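(* Let $\mathfrak{X}=\mathrm{Specf}(\mathcal{A})$ be an affine smooth formal scheme over $W(k)$ possessing local coordinates $\{x_i\}_{i=1}^n$ with coordinate derivations $\{\partial_i\}_{i=1}^n$, and let $A=\mathcal{A}/p$. The algebra $D_{A}^{(0,1)}$ is a free graded module over $D(A)$, with a basis given by the set $\{\partial^{I}(\partial^{[p]})^{J}\}$, where $I=(i_{1},\dots,i_{n})$ is a multi-index with $0\leq i_{j}\leq p-1$ for all $j$ and $J$ is any multi-index with entries $\geq0$.
   Context: $k$ is a perfect field of characteristic $p>0$, $W(k)$ its Witt vectors. $D(A)=A[f,v]/(fv-p)$, graded with $A$ in degree $0$, $\deg f=1$, $\deg v=-1$ (so $fv=0$ here). Local coordinates: $x_i\in\mathcal{A}$ and $W(k)$-linear derivations $\partial_i$ with $\partial_i(x_j)=\delta_{ij}$, the $\partial_i$ forming a free basis of the $W(k)$-linear continuous derivations of $\mathcal{A}$. Let $D_{\mathcal{A}}^{(m)}$ ($m=0,1$) be the subring of the ring of finite order continuous $W(k)$-linear differential operators on $\mathcal{A}$ generated by those of order $\le p^m$, and let $D_{\mathcal{A}}^{(0,1),i}=\{\Phi\in D_{\mathcal{A}}^{(1)}\mid p^i\Phi\in D_{\mathcal{A}}^{(0)}\}$ for $i\in\mathbb{Z}$. $D_{\mathcal{A}}^{(0,1)}=\bigoplus_iD_{\mathcal{A}}^{(0,1),i}$ is a graded $D(W(k))$-algebra, with $f$ the inclusion of the $i$th piece into the $(i+1)$st and $v$ multiplication by $p$ from the $i$th to the $(i-1)$st.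 Set $D_A^{(0,1)}=D_{\mathcal{A}}^{(0,1)}/p$; replacing $D_{\mathcal{A}}^{(m)}$ by $p$-adic completions gives the same reduction mod $p$. $\partial_i$ is regarded as an element of degree $0$ and $\partial_i^{[p]}=\partial_i^p/p!$ as an element of degree $1$. $\partial^I=\prod_j\partial_j^{i_j}$ and $(\partial^{[p]})^J=\prod_j(\partial_j^{[p]})^{j_j}$. *)

theory Defs
  imports
    "HOL-Library.Poly_Mapping"
    "HOL-Computational_Algebra.Primes"
    "HOL-Algebra.Generated_Rings"
    "HOL-Algebra.QuotRing"
    "HOL-Algebra.UnivPoly"
begin

section \<open>Perfect fields and Witt vectors\<close>

definition perfect_field :: "nat \<Rightarrow> ('k, 's) ring_scheme \<Rightarrow> bool" where
  "perfect_field p k \<longleftrightarrow>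
     field k \<and> Factorial_Ring.prime p \<and> [p] \<cdot>\<^bsub>k\<^esub> \<one>\<^bsub>k\<^esub> = \<zero>\<^bsub>k\<^esub> \<and>
     (\<forall>a\<in>carrier k. \<exists>b\<in>carrier k. b [^]\<^bsub>k\<^esub> p = a)"

text \<open>
  Integral polynomials in the variables \<open>X\<^sub>0, Y\<^sub>0, X\<^sub>1, Y\<^sub>1, \<dots>\<close>. The even-numbered variables
  are the \<open>X\<^sub>i\<close>, the odd-numbered ones the \<open>Y\<^sub>i\<close>.
\<close>

type_synonym zpoly = "(nat \<Rightarrow>\<^sub>0 nat) \<Rightarrow>\<^sub>0 int"

definition zvar :: "nat \<Rightarrow> zpoly" where
  "zvar i = Poly_Mapping.single (Poly_Mapping.single i 1) 1"

definition Xvar :: "nat \<Rightarrow> zpoly" where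
  "Xvar i = zvar (2 * i)"

definition Yvar :: "nat \<Rightarrow> zpoly" where
  "Yvar i = zvar (2 * i + 1)"

definition ghost :: "nat \<Rightarrow> (nat \<Rightarrow> 'r::comm_ring_1) \<Rightarrow> nat \<Rightarrow> 'r" where
  "ghost p a n = (\<Sum>i\<le>n. of_nat (p ^ i) * a i ^ (p ^ (n - i)))"

text \<open>
  By Witt's theorem there is exactly one sequence of integral polynomials for each of the
  following two descriptions (uniqueness is clear as the coefficients are torsion-free).
\<close>

definition witt_sum_poly :: "nat \<Rightarrow> nat \<Rightarrow> zpoly" where
  "witt_sum_poly p = (THE S. \<forall>n. ghost p S n = ghost p Xvar n + ghost p Yvar n)"

definition witt_prod_poly :: "nat \<Rightarrow> nat \<Rightarrow> zpoly" where
  "witt_prod_poly p = (THE M. \<forall>n. ghost p M n = ghost p Xvar n * ghost p Yvar n)"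

definition zpoly_eval :: "('k, 's) ring_scheme \<Rightarrow> (nat \<Rightarrow> 'k) \<Rightarrow> (nat \<Rightarrow> 'k) \<Rightarrow> zpoly \<Rightarrow> 'k" where
  "zpoly_eval k a b P =
     (\<Oplus>\<^bsub>k\<^esub>m\<in>Poly_Mapping.keys P.
        [Poly_Mapping.lookup P m] \<cdot>\<^bsub>k\<^esub>
        (\<Otimes>\<^bsub>k\<^esub>i\<in>Poly_Mapping.keys m.
           (if even i then a (i div 2) else b (i div 2)) [^]\<^bsub>k\<^esub> Poly_Mapping.lookup m i))"

definition witt_ring :: "nat \<Rightarrow> ('k, 's) ring_scheme \<Rightarrow> (nat \<Rightarrow> 'k) ring" where
  "witt_ring p k = \<lparr>
     carrier = UNIV \<rightarrow> carrier k,
     mult = (\<lambda>a b n. zpoly_eval k a b (witt_prod_poly p n)),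
     one = (\<lambda>n. if n = 0 then \<one>\<^bsub>k\<^esub> else \<zero>\<^bsub>k\<^esub>),
     zero = (\<lambda>n. \<zero>\<^bsub>k\<^esub>),
     add = (\<lambda>a b n. zpoly_eval k a b (witt_sum_poly p n))\<rparr>"


section \<open>Reduction modulo \<open>p\<close> and affine smooth formal schemes\<close>

definition int_ideal :: "('r, 's) ring_scheme \<Rightarrow> nat \<Rightarrow> 'r set" where
  "int_ideal R m = Idl\<^bsub>R\<^esub> {[m] \<cdot>\<^bsub>R\<^esub> \<one>\<^bsub>R\<^esub>}"

definition reduction :: "nat \<Rightarrow> ('r, 's) ring_scheme \<Rightarrow> 'r set ring" where
  "reduction p R = R Quot int_ideal R p"

definition reduction_map :: "nat \<Rightarrow> ('r, 's) ring_scheme \<Rightarrow> 'r \<Rightarrow> 'r set" where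
  "reduction_map p R a = int_ideal R p +>\<^bsub>R\<^esub> a"

definition p_adically_complete :: "nat \<Rightarrow> ('a, 't) ring_scheme \<Rightarrow> bool" where
  "p_adically_complete p A \<longleftrightarrow>
     (\<Inter>n. int_ideal A (p ^ n)) = {\<zero>\<^bsub>A\<^esub>} \<and>
     (\<forall>s\<in>UNIV \<rightarrow> carrier A.
        (\<forall>n. s (Suc n) \<ominus>\<^bsub>A\<^esub> s n \<in> int_ideal A (p ^ n)) \<longrightarrow>
        (\<exists>a\<in>carrier A. \<forall>n. a \<ominus>\<^bsub>A\<^esub> s n \<in> int_ideal A (p ^ n)))"

definition finite_type :: "('w, 'u) ring_scheme \<Rightarrow> ('w \<Rightarrow> 'r) \<Rightarrow> ('r, 's) ring_scheme \<Rightarrow> bool" where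
  "finite_type W \<phi> S \<longleftrightarrow>
     (\<exists>G. finite G \<and> G \<subseteq> carrier S \<and> generate_ring S (\<phi> ` carrier W \<union> G) = carrier S)"

text \<open>
  The infinitesimal lifting property of \<open>S\<close> over \<open>W/p\<close>, with test algebras \<open>B\<close> on the type
  \<open>'c\<close>. An algebra over \<open>W/p\<close> is the same thing as a \<open>W\<close>-algebra in which \<open>p = 0\<close>. For
  \<open>W = W(k)\<close> one has \<open>W/p = k\<close>, so this is formal smoothness over \<open>k\<close>.
\<close>

definition formally_smooth_mod ::
  "'c itself \<Rightarrow> nat \<Rightarrow> ('w, 'u) ring_scheme \<Rightarrow> ('w \<Rightarrow> 'r) \<Rightarrow> ('r, 's) ring_scheme \<Rightarrow> bool" where
  "formally_smooth_mod (_ :: 'c itself) p W \<phi> S \<longleftrightarrow>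
     (\<forall>(B :: 'c ring) \<psi> N u.
        cring B \<and> \<psi> \<in> ring_hom W B \<and> [p] \<cdot>\<^bsub>B\<^esub> \<one>\<^bsub>B\<^esub> = \<zero>\<^bsub>B\<^esub> \<and>
        ideal N B \<and> (\<forall>a\<in>N. \<forall>b\<in>N. a \<otimes>\<^bsub>B\<^esub> b = \<zero>\<^bsub>B\<^esub>) \<and>
        u \<in> ring_hom S (B Quot N) \<and> (\<forall>w\<in>carrier W. u (\<phi> w) = N +>\<^bsub>B\<^esub> \<psi> w) \<longrightarrow>
        (\<exists>u'\<in>ring_hom S B.
           (\<forall>w\<in>carrier W. u' (\<phi> w) = \<psi> w) \<and> (\<forall>s\<in>carrier S. N +>\<^bsub>B\<^esub> u' s = u s)))"

text \<open>
  \<open>Specf A\<close> is a smooth formal scheme over \<open>W = W(k)\<close>: \<open>A\<close> is \<open>p\<close>-adically complete and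
  separated, flat over the discrete valuation ring \<open>W\<close> (i.e. without \<open>p\<close>-torsion), and \<open>A/p\<close>
  is a smooth \<open>k\<close>-algebra (i.e. of finite type and formally smooth).

  Testing formal smoothness on the single type \<open>('a \<times> 'a) set\<close> is no restriction. As \<open>A/p\<close> is
  of finite type, every lifting problem takes place in a finitely generated \<open>k\<close>-subalgebra of
  the test algebra. Such a subalgebra is countable or of the cardinality of \<open>k\<close> and so, as \<open>A\<close>
  contains \<open>W(k)\<close> unless it is zero, has a copy on this type. If \<open>A = 0\<close> lifts always exist.
\<close>

definition affine_smooth_formal ::
  "nat \<Rightarrow> ('w, 'u) ring_scheme \<Rightarrow> ('w \<Rightarrow> 'a) \<Rightarrow> ('a, 't) ring_scheme \<Rightarrow> bool" where
  "affine_smooth_formal p W \<iota> A \<longleftrightarrow>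
     cring A \<and> \<iota> \<in> ring_hom W A \<and>
     p_adically_complete p A \<and>
     (\<forall>a\<in>carrier A. [p] \<cdot>\<^bsub>A\<^esub> a = \<zero>\<^bsub>A\<^esub> \<longrightarrow> a = \<zero>\<^bsub>A\<^esub>) \<and>
     finite_type W (\<lambda>w. reduction_map p A (\<iota> w)) (reduction p A) \<and>
     formally_smooth_mod TYPE(('a \<times> 'a) set) p W (\<lambda>w. reduction_map p A (\<iota> w)) (reduction p A)"


section \<open>Free and graded modules\<close>

definition free_basis ::
  "('r, 's) ring_scheme \<Rightarrow> ('r, 'm, 't) module_scheme \<Rightarrow> 'i set \<Rightarrow> ('i \<Rightarrow> 'm) \<Rightarrow> bool" where
  "free_basis R M K b \<longleftrightarrow>
     b \<in> K \<rightarrow> carrier M \<and>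
     (\<forall>m\<in>carrier M. \<exists>!c. c \<in> K \<rightarrow>\<^sub>E carrier R \<and> finite {i\<in>K. c i \<noteq> \<zero>\<^bsub>R\<^esub>} \<and>
        m = (\<Oplus>\<^bsub>M\<^esub>i\<in>{i\<in>K. c i \<noteq> \<zero>\<^bsub>R\<^esub>}. c i \<odot>\<^bsub>M\<^esub> b i))"

definition grading :: "('m, 't) ring_scheme \<Rightarrow> (int \<Rightarrow> 'm set) \<Rightarrow> bool" where
  "grading M H \<longleftrightarrow>
     (\<forall>i. additive_subgroup (H i) M) \<and>
     (\<forall>m\<in>carrier M. \<exists>!c. (\<forall>i. c i \<in> H i) \<and> finite {i. c i \<noteq> \<zero>\<^bsub>M\<^esub>} \<and>
        m = (\<Oplus>\<^bsub>M\<^esub>i\<in>{i. c i \<noteq> \<zero>\<^bsub>M\<^esub>}. c i))"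

definition graded_ring :: "('r, 's) ring_scheme \<Rightarrow> (int \<Rightarrow> 'r set) \<Rightarrow> bool" where
  "graded_ring R G \<longleftrightarrow>
     ring R \<and> grading R G \<and> \<one>\<^bsub>R\<^esub> \<in> G 0 \<and>
     (\<forall>i j. \<forall>r\<in>G i. \<forall>s\<in>G j. r \<otimes>\<^bsub>R\<^esub> s \<in> G (i + j))"

definition graded_module ::
  "('r, 's) ring_scheme \<Rightarrow> (int \<Rightarrow> 'r set) \<Rightarrow>
   ('r, 'm, 't) module_scheme \<Rightarrow> (int \<Rightarrow> 'm set) \<Rightarrow> bool" where
  "graded_module R G M H \<longleftrightarrow>
     graded_ring R G \<and> module R M \<and> grading M H \<and>
     (\<forall>i j. \<forall>r\<in>G i. \<forall>m\<in>H j. r \<odot>\<^bsub>M\<^esub> m \<in> H (i + j))"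

definition free_graded_module ::
  "('r, 's) ring_scheme \<Rightarrow> (int \<Rightarrow> 'r set) \<Rightarrow> ('r, 'm, 't) module_scheme \<Rightarrow> (int \<Rightarrow> 'm set) \<Rightarrow>
   'i set \<Rightarrow> ('i \<Rightarrow> 'm) \<Rightarrow> ('i \<Rightarrow> int) \<Rightarrow> bool" where
  "free_graded_module R G M H K b d \<longleftrightarrow>
     graded_module R G M H \<and> free_basis R M K b \<and> (\<forall>i\<in>K. b i \<in> H (d i))"


section \<open>Differential operators\<close>

text \<open>
  The \<open>A\<close>-module and ring of \<open>W\<close>-linear endomorphisms of \<open>A\<close> that are continuous for the
  \<open>p\<close>-adic topology. Endomorphisms are extensional functions on the carrier of \<open>A\<close>.
\<close>

definition op_alg ::
  "nat \<Rightarrow> ('w, 'u) ring_scheme \<Rightarrow> ('w \<Rightarrow> 'a) \<Rightarrow> ('a, 't) ring_scheme \<Rightarrow> ('a, 'a \<Rightarrow> 'a) module" where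
  "op_alg p W \<iota> A = \<lparr>
     carrier = {\<Phi> \<in> carrier A \<rightarrow>\<^sub>E carrier A.
       (\<forall>a\<in>carrier A. \<forall>b\<in>carrier A. \<Phi> (a \<oplus>\<^bsub>A\<^esub> b) = \<Phi> a \<oplus>\<^bsub>A\<^esub> \<Phi> b) \<and>
       (\<forall>w\<in>carrier W. \<forall>a\<in>carrier A. \<Phi> (\<iota> w \<otimes>\<^bsub>A\<^esub> a) = \<iota> w \<otimes>\<^bsub>A\<^esub> \<Phi> a) \<and>
       (\<forall>n. \<exists>m. \<Phi> ` int_ideal A (p ^ m) \<subseteq> int_ideal A (p ^ n))},
     mult = (\<lambda>\<Phi> \<Psi>. compose (carrier A) \<Phi> \<Psi>),
     one = (\<lambda>a\<in>carrier A. a),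
     zero = (\<lambda>a\<in>carrier A. \<zero>\<^bsub>A\<^esub>),
     add = (\<lambda>\<Phi> \<Psi>. \<lambda>a\<in>carrier A. \<Phi> a \<oplus>\<^bsub>A\<^esub> \<Psi> a),
     smult = (\<lambda>b \<Phi>. \<lambda>a\<in>carrier A. b \<otimes>\<^bsub>A\<^esub> \<Phi> a)\<rparr>"

definition commutator :: "('a, 't) ring_scheme \<Rightarrow> ('a \<Rightarrow> 'a) \<Rightarrow> 'a \<Rightarrow> 'a \<Rightarrow> 'a" where
  "commutator A \<Phi> b = (\<lambda>a\<in>carrier A. \<Phi> (b \<otimes>\<^bsub>A\<^esub> a) \<ominus>\<^bsub>A\<^esub> b \<otimes>\<^bsub>A\<^esub> \<Phi> a)"

primrec order_le :: "('a, 't) ring_scheme \<Rightarrow> nat \<Rightarrow> ('a \<Rightarrow> 'a) \<Rightarrow> bool" where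
  "order_le A 0 \<Phi> \<longleftrightarrow>
     (\<forall>b\<in>carrier A. commutator A \<Phi> b = (\<lambda>a\<in>carrier A. \<zero>\<^bsub>A\<^esub>))"
| "order_le A (Suc m) \<Phi> \<longleftrightarrow> (\<forall>b\<in>carrier A. order_le A m (commutator A \<Phi> b))"

definition diff_alg ::
  "nat \<Rightarrow> ('w, 'u) ring_scheme \<Rightarrow> ('w \<Rightarrow> 'a) \<Rightarrow> ('a, 't) ring_scheme \<Rightarrow> ('a, 'a \<Rightarrow> 'a) module" where
  "diff_alg p W \<iota> A =
     (op_alg p W \<iota> A)\<lparr>carrier := {\<Phi> \<in> carrier (op_alg p W \<iota> A). \<exists>m. order_le A m \<Phi>}\<rparr>"

definition der_module ::
  "nat \<Rightarrow> ('w, 'u) ring_scheme \<Rightarrow> ('w \<Rightarrow> 'a) \<Rightarrow> ('a, 't) ring_scheme \<Rightarrow> ('a, 'a \<Rightarrow> 'a) module" where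
  "der_module p W \<iota> A =
     (op_alg p W \<iota> A)\<lparr>carrier := {\<delta> \<in> carrier (op_alg p W \<iota> A).
        \<forall>a\<in>carrier A. \<forall>b\<in>carrier A. \<delta> (a \<otimes>\<^bsub>A\<^esub> b) = a \<otimes>\<^bsub>A\<^esub> \<delta> b \<oplus>\<^bsub>A\<^esub> \<delta> a \<otimes>\<^bsub>A\<^esub> b}\<rparr>"

definition local_coordinates ::
  "nat \<Rightarrow> ('w, 'u) ring_scheme \<Rightarrow> ('w \<Rightarrow> 'a) \<Rightarrow> ('a, 't) ring_scheme \<Rightarrow>
   nat \<Rightarrow> (nat \<Rightarrow> 'a) \<Rightarrow> (nat \<Rightarrow> 'a \<Rightarrow> 'a) \<Rightarrow> bool" where
  "local_coordinates p W \<iota> A n x \<delta> \<longleftrightarrow>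
     (\<forall>i<n. x i \<in> carrier A) \<and>
     (\<forall>i<n. \<forall>j<n. \<delta> i (x j) = (if i = j then \<one>\<^bsub>A\<^esub> else \<zero>\<^bsub>A\<^esub>)) \<and>
     free_basis A (der_module p W \<iota> A) {..<n} \<delta>"

definition D_level ::
  "nat \<Rightarrow> ('w, 'u) ring_scheme \<Rightarrow> ('w \<Rightarrow> 'a) \<Rightarrow> ('a, 't) ring_scheme \<Rightarrow> nat \<Rightarrow> ('a \<Rightarrow> 'a) set" where
  "D_level p W \<iota> A m =
     generate_ring (diff_alg p W \<iota> A) {\<Phi> \<in> carrier (diff_alg p W \<iota> A). order_le A (p ^ m) \<Phi>}"

text \<open>
  The condition \<open>p\<^sup>i \<Phi> \<in> D\<^sup>(\<^sup>0\<^sup>)\<close> for \<open>i \<in> \<int>\<close>. As \<open>nat\<close> truncates negative integers to \<open>0\<close>, it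
  reads \<open>p\<^sup>i \<Phi> = \<Psi>\<close> for \<open>i \<ge> 0\<close> and \<open>\<Phi> = p\<^sup>-\<^sup>i \<Psi>\<close> for \<open>i < 0\<close>, with \<open>\<Psi> \<in> D\<^sup>(\<^sup>0\<^sup>)\<close>.
\<close>

definition D01_part ::
  "nat \<Rightarrow> ('w, 'u) ring_scheme \<Rightarrow> ('w \<Rightarrow> 'a) \<Rightarrow> ('a, 't) ring_scheme \<Rightarrow> int \<Rightarrow> ('a \<Rightarrow> 'a) set" where
  "D01_part p W \<iota> A i = {\<Phi> \<in> D_level p W \<iota> A 1. \<exists>\<Psi>\<in>D_level p W \<iota> A 0.
     [(p ^ nat i)] \<cdot>\<^bsub>diff_alg p W \<iota> A\<^esub> \<Phi> = [(p ^ nat (- i))] \<cdot>\<^bsub>diff_alg p W \<iota> A\<^esub> \<Psi>}"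

definition D01 ::
  "nat \<Rightarrow> ('w, 'u) ring_scheme \<Rightarrow> ('w \<Rightarrow> 'a) \<Rightarrow> ('a, 't) ring_scheme \<Rightarrow> (int \<Rightarrow> 'a \<Rightarrow> 'a) ring" where
  "D01 p W \<iota> A = (let D = diff_alg p W \<iota> A in \<lparr>
     carrier = {F. (\<forall>i. F i \<in> D01_part p W \<iota> A i) \<and> finite {i. F i \<noteq> \<zero>\<^bsub>D\<^esub>}},
     mult = (\<lambda>F G n. \<Oplus>\<^bsub>D\<^esub>i\<in>{i. F i \<noteq> \<zero>\<^bsub>D\<^esub>}. F i \<otimes>\<^bsub>D\<^esub> G (n - i)),
     one = (\<lambda>i. if i = 0 then \<one>\<^bsub>D\<^esub> else \<zero>\<^bsub>D\<^esub>),
     zero = (\<lambda>i. \<zero>\<^bsub>D\<^esub>),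
     add = (\<lambda>F G i. F i \<oplus>\<^bsub>D\<^esub> G i)\<rparr>)"


section \<open>The ring \<open>D(R) = R[f,v]/(fv - p)\<close>\<close>

text \<open>\<open>R[f,v]\<close> is encoded as \<open>R[f][v]\<close>; the outer variable is \<open>v\<close>.\<close>

definition f_var :: "('r, 's) ring_scheme \<Rightarrow> nat \<Rightarrow> nat \<Rightarrow> 'r" where
  "f_var R = monom (UP (UP R)) (monom (UP R) \<one>\<^bsub>R\<^esub> 1) 0"

definition v_var :: "('r, 's) ring_scheme \<Rightarrow> nat \<Rightarrow> nat \<Rightarrow> 'r" where
  "v_var R = monom (UP (UP R)) \<one>\<^bsub>UP R\<^esub> 1"

definition fv_ideal :: "nat \<Rightarrow> ('r, 's) ring_scheme \<Rightarrow> (nat \<Rightarrow> nat \<Rightarrow> 'r) set" where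
  "fv_ideal p R = Idl\<^bsub>UP (UP R)\<^esub>
     {f_var R \<otimes>\<^bsub>UP (UP R)\<^esub> v_var R \<ominus>\<^bsub>UP (UP R)\<^esub> [p] \<cdot>\<^bsub>UP (UP R)\<^esub> \<one>\<^bsub>UP (UP R)\<^esub>}"

definition D_ring :: "nat \<Rightarrow> ('r, 's) ring_scheme \<Rightarrow> (nat \<Rightarrow> nat \<Rightarrow> 'r) set ring" where
  "D_ring p R = UP (UP R) Quot fv_ideal p R"

definition D_ring_part :: "nat \<Rightarrow> ('r, 's) ring_scheme \<Rightarrow> int \<Rightarrow> (nat \<Rightarrow> nat \<Rightarrow> 'r) set set" where
  "D_ring_part p R d = (\<lambda>P. fv_ideal p R +>\<^bsub>UP (UP R)\<^esub> P) `
     {P \<in> carrier (UP (UP R)).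
        \<forall>i j. coeff (UP R) (coeff (UP (UP R)) P j) i \<noteq> \<zero>\<^bsub>R\<^esub> \<longrightarrow> int i - int j = d}"


section \<open>\<open>D\<^sup>(\<^sup>0\<^sup>,\<^sup>1\<^sup>)\<close> modulo \<open>p\<close> as a module over \<open>D(A/p)\<close>\<close>

text \<open>The class modulo \<open>p\<close> of the operator \<open>\<Phi>\<close> regarded as an element of degree \<open>i\<close>.\<close>

definition D01_class ::
  "nat \<Rightarrow> ('w, 'u) ring_scheme \<Rightarrow> ('w \<Rightarrow> 'a) \<Rightarrow> ('a, 't) ring_scheme \<Rightarrow>
   int \<Rightarrow> ('a \<Rightarrow> 'a) \<Rightarrow> (int \<Rightarrow> 'a \<Rightarrow> 'a) set" where
  "D01_class p W \<iota> A i \<Phi> =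
     reduction_map p (D01 p W \<iota> A) (\<lambda>j. if j = i then \<Phi> else \<zero>\<^bsub>diff_alg p W \<iota> A\<^esub>)"

text \<open>
  The structure map from \<open>D(A/p)\<close>: it sends \<open>a\<close> to multiplication by \<open>a\<close> in degree \<open>0\<close>, \<open>f\<close> to
  the identity in degree \<open>1\<close>, and \<open>v\<close> to \<open>p\<close> in degree \<open>-1\<close>. Thus \<open>f\<close> acts by the inclusions
  of the \<open>i\<close>th piece into the \<open>(i+1)\<close>st and \<open>v\<close> by multiplication by \<open>p\<close> from the \<open>i\<close>th piece to
  the \<open>(i-1)\<close>st. As usual for maps out of quotients, \<open>the_elem\<close> picks the common value on a
  coset.
\<close>

definition D01_coeff_map ::
  "nat \<Rightarrow> ('w, 'u) ring_scheme \<Rightarrow> ('w \<Rightarrow> 'a) \<Rightarrow> ('a, 't) ring_scheme \<Rightarrow>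
   'a set \<Rightarrow> (int \<Rightarrow> 'a \<Rightarrow> 'a) set" where
  "D01_coeff_map p W \<iota> A c =
     the_elem ((\<lambda>a. D01_class p W \<iota> A 0 (a \<odot>\<^bsub>diff_alg p W \<iota> A\<^esub> \<one>\<^bsub>diff_alg p W \<iota> A\<^esub>)) ` c)"

definition D01_structure_map ::
  "nat \<Rightarrow> ('w, 'u) ring_scheme \<Rightarrow> ('w \<Rightarrow> 'a) \<Rightarrow> ('a, 't) ring_scheme \<Rightarrow>
   (nat \<Rightarrow> nat \<Rightarrow> 'a set) set \<Rightarrow> (int \<Rightarrow> 'a \<Rightarrow> 'a) set" where
  "D01_structure_map p W \<iota> A c =
     (let D = diff_alg p W \<iota> A;
          S = reduction p (D01 p W \<iota> A);
          f = D01_class p W \<iota> A 1 \<one>\<^bsub>D\<^esub>;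
          v = D01_class p W \<iota> A (-1) ([p] \<cdot>\<^bsub>D\<^esub> \<one>\<^bsub>D\<^esub>);
          R = reduction p A
      in the_elem (eval (UP R) S (eval R S (D01_coeff_map p W \<iota> A) f) v ` c))"

definition D01_mod ::
  "nat \<Rightarrow> ('w, 'u) ring_scheme \<Rightarrow> ('w \<Rightarrow> 'a) \<Rightarrow> ('a, 't) ring_scheme \<Rightarrow>
   ((nat \<Rightarrow> nat \<Rightarrow> 'a set) set, (int \<Rightarrow> 'a \<Rightarrow> 'a) set) module" where
  "D01_mod p W \<iota> A = (let S = reduction p (D01 p W \<iota> A) in
     ring.extend S (module.fields (\<lambda>c m. D01_structure_map p W \<iota> A c \<otimes>\<^bsub>S\<^esub> m)))"

definition D01_mod_part ::
  "nat \<Rightarrow> ('w, 'u) ring_scheme \<Rightarrow> ('w \<Rightarrow> 'a) \<Rightarrow> ('a, 't) ring_scheme \<Rightarrow>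
   int \<Rightarrow> (int \<Rightarrow> 'a \<Rightarrow> 'a) set set" where
  "D01_mod_part p W \<iota> A i = D01_class p W \<iota> A i ` D01_part p W \<iota> A i"

text \<open>The operator \<open>\<delta>\<^sup>p/p!\<close>; it is unique if it exists, as \<open>A\<close> has no \<open>p\<close>-torsion.\<close>

definition divided_pth_power ::
  "nat \<Rightarrow> ('w, 'u) ring_scheme \<Rightarrow> ('w \<Rightarrow> 'a) \<Rightarrow> ('a, 't) ring_scheme \<Rightarrow> ('a \<Rightarrow> 'a) \<Rightarrow> 'a \<Rightarrow> 'a" where
  "divided_pth_power p W \<iota> A \<delta> = (let D = diff_alg p W \<iota> A in
     THE \<Psi>. \<Psi> \<in> carrier D \<and> [(fact p :: nat)] \<cdot>\<^bsub>D\<^esub> \<Psi> = \<delta> [^]\<^bsub>D\<^esub> p)"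

text \<open>A product in a fixed order; below the factors commute with each other.\<close>

definition multi_power ::
  "('r, 's) ring_scheme \<Rightarrow> nat \<Rightarrow> (nat \<Rightarrow> 'r) \<Rightarrow> (nat \<Rightarrow> nat) \<Rightarrow> 'r" where
  "multi_power R n e I = foldr (\<lambda>j r. e j [^]\<^bsub>R\<^esub> I j \<otimes>\<^bsub>R\<^esub> r) [0..<n] \<one>\<^bsub>R\<^esub>"

definition D01_monomial ::
  "nat \<Rightarrow> ('w, 'u) ring_scheme \<Rightarrow> ('w \<Rightarrow> 'a) \<Rightarrow> ('a, 't) ring_scheme \<Rightarrow>
   nat \<Rightarrow> (nat \<Rightarrow> 'a \<Rightarrow> 'a) \<Rightarrow> (nat \<Rightarrow> nat) \<Rightarrow> (nat \<Rightarrow> nat) \<Rightarrow> (int \<Rightarrow> 'a \<Rightarrow> 'a) set" where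
  "D01_monomial p W \<iota> A n \<delta> I J = (let S = reduction p (D01 p W \<iota> A) in
     multi_power S n (\<lambda>j. D01_class p W \<iota> A 0 (\<delta> j)) I \<otimes>\<^bsub>S\<^esub>
     multi_power S n (\<lambda>j. D01_class p W \<iota> A 1 (divided_pth_power p W \<iota> A (\<delta> j))) J)"

end

theory Submission
  imports Defs
begin

text \<open>
  Since \<open>A/p\<close> is smooth, a derivation modulo \<open>p\<^sup>n\<close> lifts to one modulo \<open>p\<^sup>n\<^sup>+\<^sup>1\<close>, hence by
  completeness to a derivation of \<open>A\<close>. Derivations of \<open>A\<close> are combinations of the \<open>\<partial>\<^sub>i\<close>, so a
  derivation modulo \<open>p\<close> that kills the coordinates vanishes modulo \<open>p\<close>. This applies to \<open>\<partial>\<^sub>i\<^sup>p\<close>,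
  whence \<open>\<partial>\<^sub>i\<^sup>[\<^sup>p\<^sup>] = \<partial>\<^sub>i\<^sup>p/p!\<close> exists.

  Euler's identity on symbols makes \<open>m! \<Phi>\<close> a combination of the \<open>\<partial>\<^sup>L\<close> when \<open>\<Phi>\<close> has order at most
  \<open>m\<close>, and evaluation at the monomials \<open>x\<^sup>L\<close> controls the divisibility of its coefficients by \<open>p\<close>.
  It follows that \<open>D\<^sup>(\<^sup>1\<^sup>)\<close> is \<open>A\<close>-free on the \<open>e\<^sub>I\<^sub>J = \<partial>\<^sup>I (\<partial>\<^sup>[\<^sup>p\<^sup>])\<^sup>J\<close> and that \<open>D\<^sup>(\<^sup>0\<^sup>)\<close> is \<open>A\<close>-free on
  the \<open>p\<^sup>|\<^sup>J\<^sup>| e\<^sub>I\<^sub>J\<close>. So the \<open>i\<close>th piece of \<open>D\<^sup>(\<^sup>0\<^sup>,\<^sup>1\<^sup>)\<close> is \<open>A\<close>-free on the \<open>p\<^sup>h e\<^sub>I\<^sub>J\<close> with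
  \<open>h = max 0 (|J| - i)\<close>, and modulo \<open>p\<close> these basis elements are \<open>f\<^sup>i\<^sup>-\<^sup>|\<^sup>J\<^sup>| e\<^sub>I\<^sub>J\<close> for \<open>i \<ge> |J|\<close> and
  \<open>v\<^sup>|\<^sup>J\<^sup>|\<^sup>-\<^sup>i e\<^sub>I\<^sub>J\<close> for \<open>i \<le> |J|\<close>.
\<close>

text \<open>The coordinates are known only through derivations of \<open>A\<close> itself; no etale
  map to affine space is at hand. So a derivation modulo p says nothing until it is lifted to
  \<open>A\<close>, and operators are analysed by commutators with functions instead of Taylor
  expansion.

  The constants come from p! = p (p - 1)!, where (p - 1)! is a unit of \<open>A\<close>. Each
  divided power in a monomial \<open>eb (I, J)\<close> hides one factor p!, so the plain monomial
  with exponents I + pJ is \<open>eb (I, J)\<close> times |J| factors p!. Dividing by m! is harmless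
  for m < p, and order p, the last order among the generators of the larger ring, costs a single
  factor p; hence divisibility by p itself is all that has to be controlled there.

  On the other side fv = 0 in D(A/p), which is therefore free over A/p on 1 and the powers of f and
  of v. A mixed product f^i v^j, applied to a monomial, exceeds the basis element of its degree by
  p^min(i, j), so it dies modulo p as it must. Both sides become finitely supported families in A/p,
  and freeness is a comparison of coordinates.\<close>

lemma (in abelian_monoid) finsum_sub_carrier:
  assumes "H \<subseteq> carrier G" "\<zero> \<in> H" "\<And>a b. a \<in> H \<Longrightarrow> b \<in> H \<Longrightarrow> a \<oplus> b \<in> H" "f \<in> F \<rightarrow> H"
  shows "finsum (G\<lparr>carrier := H\<rparr>) f F = finsum G f F"
proof -
  interpret H: abelian_monoid "G\<lparr>carrier := H\<rparr>"
    by (rule abelian_monoidI) (use assms(1-3) in \<open>auto intro: a_assoc a_comm\<close>)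
  show ?thesis using assms(4)
  proof (induction F rule: infinite_finite_induct)
    case (insert x F)
    then have "f x \<in> carrier G" "f \<in> F \<rightarrow> carrier G" using assms(1) by auto
    with insert H.finsum_insert[of F x f] finsum_insert[of F x f] show ?case by (auto simp: Pi_def)
  qed (simp_all add: H.finsum_infinite finsum_infinite)
qed

section \<open>Integer multiples in rings and reduction modulo an integer\<close>

context ring
begin

lemma add_pow_one_mult:
  assumes "a \<in> carrier R"
  shows "[(m::nat)] \<cdot> \<one> \<otimes> a = [m] \<cdot> a" "a \<otimes> [m] \<cdot> \<one> = [m] \<cdot> a"
  using add_pow_ldistr[of \<one> a m] add_pow_rdistr[of a \<one> m] assms by simp_all

lemma add_pow_minus:
  "a \<in> carrier R \<Longrightarrow> [(m::nat)] \<cdot> (\<ominus> a) = \<ominus> ([m] \<cdot> a)"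
  using add.nat_pow_inv[of a m] by (simp add: a_inv_def add_pow_def)

lemma add_pow_distrib:
  "a \<in> carrier R \<Longrightarrow> b \<in> carrier R \<Longrightarrow> [(m::nat)] \<cdot> (a \<oplus> b) = [m] \<cdot> a \<oplus> [m] \<cdot> b"
  using add.nat_pow_distrib[of a b m] by (simp add: add_pow_def)

lemma add_pow_mult:
  "a \<in> carrier R \<Longrightarrow> [(m::nat)] \<cdot> ([(n::nat)] \<cdot> a) = [(m * n)] \<cdot> a"
  using add.nat_pow_pow[of a m n] by (simp add: add_pow_def mult.commute[of m n])

lemma add_pow_diff_distrib:
  "a \<in> carrier R \<Longrightarrow> b \<in> carrier R \<Longrightarrow> [(m::nat)] \<cdot> (a \<ominus> b) = [m] \<cdot> a \<ominus> [m] \<cdot> b"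
  by (simp add: a_minus_def add_pow_distrib add_pow_minus)

lemma add_pow_finsum:
  assumes "f \<in> F \<rightarrow> carrier R"
  shows "[(m::nat)] \<cdot> (\<Oplus>i\<in>F. f i) = (\<Oplus>i\<in>F. [m] \<cdot> f i)"
  using assms
  by (induction F rule: infinite_finite_induct) (auto simp: add_pow_distrib Pi_def)

lemma int_ideal_ideal: "ideal (int_ideal R m) R"
  unfolding int_ideal_def by (rule genideal_ideal) auto

text \<open>The multiples of \<open>m\<close> already form a two-sided ideal, since
  \<open>[m] \<cdot> a\<close> equals \<open>[m] \<cdot> \<one> \<otimes> a\<close>. Membership in
  \<open>int_ideal\<close> is read as divisibility by \<open>m\<close> from here on.\<close>

lemma int_ideal_eq: "int_ideal R m = (\<lambda>a. [m] \<cdot> a) ` carrier R"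
proof -
  let ?I = "(\<lambda>a. [m] \<cdot> a) ` carrier R"
  have "ideal ?I R"
  proof (rule idealI)
    show "ring R" by (rule ring_axioms)
    show "subgroup ?I (add_monoid R)"
    proof (rule add.subgroupI)
      show "?I \<subseteq> carrier R" "?I \<noteq> {}" by auto
      show "\<ominus> a \<in> ?I" if "a \<in> ?I" for a
        using that by (auto simp: add_pow_minus[symmetric])
      show "a \<oplus> b \<in> ?I" if "a \<in> ?I" "b \<in> ?I" for a b
        using that by (auto simp: add_pow_distrib[symmetric])
    qed
    show "x \<otimes> a \<in> ?I" if "a \<in> ?I" "x \<in> carrier R" for a x
      using that by (auto simp: add_pow_rdistr)
    show "a \<otimes> x \<in> ?I" if "a \<in> ?I" "x \<in> carrier R" for a x
      using that by (auto simp: add_pow_ldistr)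
  qed
  moreover have "[m] \<cdot> \<one> \<in> ?I" by blast
  ultimately have "int_ideal R m \<subseteq> ?I"
    unfolding int_ideal_def by (intro genideal_minimal) auto
  moreover have "?I \<subseteq> int_ideal R m"
  proof
    fix y assume "y \<in> ?I"
    then obtain a where a: "a \<in> carrier R" "y = [m] \<cdot> a" by blast
    interpret I: ideal "int_ideal R m" R by (rule int_ideal_ideal)
    have "[m] \<cdot> \<one> \<in> int_ideal R m"
      unfolding int_ideal_def by (rule genideal_self') auto
    from I.I_r_closed[OF this a(1)] show "y \<in> int_ideal R m"
      using a by (simp add: add_pow_one_mult)
  qed
  ultimately show ?thesis by blast
qed

lemma int_idealI: "a \<in> carrier R \<Longrightarrow> [m] \<cdot> a \<in> int_ideal R m"
  by (auto simp: int_ideal_eq)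

lemma reduction_ring: "ring (reduction m R)"
  unfolding reduction_def by (rule ideal.quotient_is_ring[OF int_ideal_ideal])

lemma reduction_map_hom: "reduction_map m R \<in> ring_hom R (reduction m R)"
  unfolding reduction_def reduction_map_def[abs_def]
  by (rule ideal.rcos_ring_hom[OF int_ideal_ideal])

lemma carrier_reduction: "carrier (reduction m R) = reduction_map m R ` carrier R"
  by (auto simp: reduction_def reduction_map_def FactRing_simps)

lemma coset_eq_iff:
  assumes "ideal I R" "a \<in> carrier R" "b \<in> carrier R"
  shows "I +> a = I +> b \<longleftrightarrow> a \<ominus> b \<in> I"
  using quotient_eq_iff_same_a_r_cos[OF assms] by auto

lemma mem_coset_iff:
  assumes "ideal I R" "a \<in> carrier R" "b \<in> carrier R"
  shows "b \<in> I +> a \<longleftrightarrow> b \<ominus> a \<in> I"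
proof -
  interpret I: ideal I R by fact
  show ?thesis using I.a_rcos_module_minus[OF ring_axioms assms(2,3)] .
qed

lemma reduction_map_eq_iff:
  assumes "a \<in> carrier R" "b \<in> carrier R"
  shows "reduction_map m R a = reduction_map m R b \<longleftrightarrow> a \<ominus> b \<in> int_ideal R m"
  unfolding reduction_map_def by (rule coset_eq_iff[OF int_ideal_ideal assms])

lemma reduction_map_zero_iff:
  assumes "a \<in> carrier R"
  shows "reduction_map m R a = \<zero>\<^bsub>reduction m R\<^esub> \<longleftrightarrow> a \<in> int_ideal R m"
proof -
  have "reduction_map m R \<zero> = \<zero>\<^bsub>reduction m R\<^esub>"
    using ring_hom_zero[OF reduction_map_hom ring_axioms reduction_ring] .
  with reduction_map_eq_iff[OF assms zero_closed, of m] assms show ?thesis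
    by (simp add: a_minus_def)
qed

lemma finsum_subring_carrier:
  assumes "subring H R" "f \<in> F \<rightarrow> H"
  shows "finsum (R\<lparr>carrier := H\<rparr>) f F = finsum R f F"
  using subringE[OF assms(1)] by (intro finsum_sub_carrier assms) auto

end

lemma (in cring) reduction_cring: "cring (reduction m R)"
  unfolding reduction_def by (rule ideal.quotient_is_cring[OF int_ideal_ideal is_cring])

lemma ring_hom_add_pow:
  assumes "ring R" "ring S" "h \<in> ring_hom R S" "a \<in> carrier R"
  shows "h ([(m::nat)] \<cdot>\<^bsub>R\<^esub> a) = [m] \<cdot>\<^bsub>S\<^esub> h a"
proof -
  interpret R: ring R by fact
  interpret S: ring S by fact
  have "h a \<in> carrier S" by (rule ring_hom_closed[OF assms(3,4)])
  then show ?thesis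
  proof (induction m)
    case (Suc m)
    then show ?case using assms(3,4)
      by (simp add: ring_hom_add[OF assms(3)])
  qed (simp add: ring_hom_zero[OF assms(3,1,2)])
qed

lemma (in abelian_group) minus_eq_zeroD:
  assumes "a \<in> carrier G" "b \<in> carrier G" "a \<ominus> b = \<zero>"
  shows "a = b"
  using assms minus_equality[of a "\<ominus> b"] by (simp add: a_minus_def)

section \<open>Operators and their order\<close>

locale operators = cring A for A (structure) +
  fixes p :: nat and W :: "('w, 'u) ring_scheme" and \<iota> :: "'w \<Rightarrow> 'a"
  assumes iota_hom: "\<iota> \<in> ring_hom W A"
begin

abbreviation E where "E \<equiv> op_alg p W \<iota> A"
abbreviation D where "D \<equiv> diff_alg p W \<iota> A"

definition lin_op :: "('a \<Rightarrow> 'a) \<Rightarrow> bool" where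
  "lin_op \<Phi> \<longleftrightarrow> \<Phi> \<in> carrier A \<rightarrow>\<^sub>E carrier A \<and>
     (\<forall>a\<in>carrier A. \<forall>b\<in>carrier A. \<Phi> (a \<oplus> b) = \<Phi> a \<oplus> \<Phi> b) \<and>
     (\<forall>w\<in>carrier W. \<forall>a\<in>carrier A. \<Phi> (\<iota> w \<otimes> a) = \<iota> w \<otimes> \<Phi> a)"

lemma additive_zero:
  assumes "\<Phi> \<zero> \<in> carrier A" "\<Phi> (\<zero> \<oplus> \<zero>) = \<Phi> \<zero> \<oplus> \<Phi> \<zero>"
  shows "\<Phi> \<zero> = \<zero>"
  using assms add.l_cancel_one'[of "\<Phi> \<zero>" "\<Phi> \<zero>"] by simp

lemma additive_add_pow:
  assumes "\<Phi> \<in> carrier A \<rightarrow> carrier A"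
    "\<And>a b. a \<in> carrier A \<Longrightarrow> b \<in> carrier A \<Longrightarrow> \<Phi> (a \<oplus> b) = \<Phi> a \<oplus> \<Phi> b" "a \<in> carrier A"
  shows "\<Phi> ([(m::nat)] \<cdot> a) = [m] \<cdot> \<Phi> a"
proof (induction m)
  case 0
  have "\<Phi> \<zero> = \<zero>"
    by (rule additive_zero, rule funcset_mem[OF assms(1) zero_closed], rule assms(2)[OF zero_closed zero_closed])
  then show ?case by simp
qed (use assms in simp)

text \<open>Additive maps are automatically continuous for the \<open>p\<close>-adic topology.\<close>

lemma carrier_E: "carrier E = {\<Phi>. lin_op \<Phi>}"
proof -
  have "\<exists>m. \<Phi> ` int_ideal A (p ^ m) \<subseteq> int_ideal A (p ^ n)" if "lin_op \<Phi>" for \<Phi> n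
  proof (intro exI subsetI)
    fix y assume "y \<in> \<Phi> ` int_ideal A (p ^ n)"
    then obtain a where "a \<in> carrier A" "y = \<Phi> ([(p ^ n)] \<cdot> a)" by (auto simp: int_ideal_eq)
    then show "y \<in> int_ideal A (p ^ n)"
      using additive_add_pow[of \<Phi> a "p ^ n"] that by (auto simp: lin_op_def PiE_iff int_ideal_eq)
  qed
  then show ?thesis by (auto simp: op_alg_def lin_op_def)
qed

lemma iota_closed [simp]: "w \<in> carrier W \<Longrightarrow> \<iota> w \<in> carrier A"
  by (rule ring_hom_closed[OF iota_hom])

lemma op_closed [simp]: "\<Phi> \<in> carrier E \<Longrightarrow> a \<in> carrier A \<Longrightarrow> \<Phi> a \<in> carrier A"
  by (auto simp: carrier_E lin_op_def)

lemma op_add: "\<Phi> \<in> carrier E \<Longrightarrow> a \<in> carrier A \<Longrightarrow> b \<in> carrier A \<Longrightarrow> \<Phi> (a \<oplus> b) = \<Phi> a \<oplus> \<Phi> b"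
  by (auto simp: carrier_E lin_op_def)

lemma op_lin: "\<Phi> \<in> carrier E \<Longrightarrow> w \<in> carrier W \<Longrightarrow> a \<in> carrier A \<Longrightarrow> \<Phi> (\<iota> w \<otimes> a) = \<iota> w \<otimes> \<Phi> a"
  by (auto simp: carrier_E lin_op_def)

lemma op_zero [simp]: "\<Phi> \<in> carrier E \<Longrightarrow> \<Phi> \<zero> = \<zero>"
  using additive_zero[of \<Phi>] op_add by simp

lemma op_add_pow: "\<Phi> \<in> carrier E \<Longrightarrow> a \<in> carrier A \<Longrightarrow> \<Phi> ([(m::nat)] \<cdot> a) = [m] \<cdot> \<Phi> a"
  using additive_add_pow[of \<Phi> a m] op_add by auto

lemma op_eqI:
  "\<Phi> \<in> carrier E \<Longrightarrow> \<Psi> \<in> carrier E \<Longrightarrow> (\<And>a. a \<in> carrier A \<Longrightarrow> \<Phi> a = \<Psi> a) \<Longrightarrow> \<Phi> = \<Psi>"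
  by (rule extensionalityI[of _ "carrier A"]) (unfold carrier_E lin_op_def PiE_def, blast+)

lemma opI:
  assumes "\<And>a. a \<in> carrier A \<Longrightarrow> f a \<in> carrier A"
    "\<And>a b. a \<in> carrier A \<Longrightarrow> b \<in> carrier A \<Longrightarrow> f (a \<oplus> b) = f a \<oplus> f b"
    "\<And>w a. w \<in> carrier W \<Longrightarrow> a \<in> carrier A \<Longrightarrow> f (\<iota> w \<otimes> a) = \<iota> w \<otimes> f a"
  shows "(\<lambda>a\<in>carrier A. f a) \<in> carrier E"
  using assms by (auto simp: carrier_E lin_op_def)

lemma op_mult_apply [simp]: "a \<in> carrier A \<Longrightarrow> (\<Phi> \<otimes>\<^bsub>E\<^esub> \<Psi>) a = \<Phi> (\<Psi> a)"
  by (simp add: op_alg_def compose_def)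
lemma op_add_apply [simp]: "a \<in> carrier A \<Longrightarrow> (\<Phi> \<oplus>\<^bsub>E\<^esub> \<Psi>) a = \<Phi> a \<oplus> \<Psi> a"
  by (simp add: op_alg_def)
lemma op_one_apply [simp]: "a \<in> carrier A \<Longrightarrow> \<one>\<^bsub>E\<^esub> a = a"
  by (simp add: op_alg_def)
lemma op_zero_apply [simp]: "a \<in> carrier A \<Longrightarrow> \<zero>\<^bsub>E\<^esub> a = \<zero>"
  by (simp add: op_alg_def)

lemma op_add_eq: "\<Phi> \<oplus>\<^bsub>E\<^esub> \<Psi> = (\<lambda>a\<in>carrier A. \<Phi> a \<oplus> \<Psi> a)"
  by (simp add: op_alg_def)
lemma op_mult_eq: "\<Phi> \<otimes>\<^bsub>E\<^esub> \<Psi> = (\<lambda>a\<in>carrier A. \<Phi> (\<Psi> a))"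
  by (simp add: op_alg_def compose_def)

lemma op_add_closed: "\<Phi> \<in> carrier E \<Longrightarrow> \<Psi> \<in> carrier E \<Longrightarrow> \<Phi> \<oplus>\<^bsub>E\<^esub> \<Psi> \<in> carrier E"
  unfolding op_add_eq by (rule opI) (auto simp: op_add op_lin a_ac r_distr)
lemma op_mult_closed: "\<Phi> \<in> carrier E \<Longrightarrow> \<Psi> \<in> carrier E \<Longrightarrow> \<Phi> \<otimes>\<^bsub>E\<^esub> \<Psi> \<in> carrier E"
  unfolding op_mult_eq by (rule opI) (auto simp: op_add op_lin)
lemma op_one_closed: "\<one>\<^bsub>E\<^esub> \<in> carrier E"
  using opI[of "\<lambda>a. a"] by (auto simp: op_alg_def[of p])
lemma op_zero_closed: "\<zero>\<^bsub>E\<^esub> \<in> carrier E"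
  using opI[of "\<lambda>a. \<zero>"] by (auto simp: op_alg_def[of p])

lemma E_ring: "ring E"
proof (rule ringI)
  show "abelian_group E"
  proof (rule abelian_groupI)
    fix \<Phi> assume \<Phi>: "\<Phi> \<in> carrier E"
    have "(\<lambda>a\<in>carrier A. \<ominus> \<Phi> a) \<in> carrier E"
      by (rule opI) (use \<Phi> in \<open>auto simp: op_add op_lin r_minus minus_add a_comm\<close>)
    moreover have "(\<lambda>a\<in>carrier A. \<ominus> \<Phi> a) \<oplus>\<^bsub>E\<^esub> \<Phi> = \<zero>\<^bsub>E\<^esub>"
      by (rule op_eqI) (use \<Phi> calculation in \<open>auto simp: op_add_closed op_zero_closed l_neg\<close>)
    ultimately show "\<exists>y\<in>carrier E. y \<oplus>\<^bsub>E\<^esub> \<Phi> = \<zero>\<^bsub>E\<^esub>" by blast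
  next
    fix \<Phi> \<Psi> \<Theta> assume "\<Phi> \<in> carrier E" "\<Psi> \<in> carrier E" "\<Theta> \<in> carrier E"
    then show "\<Phi> \<oplus>\<^bsub>E\<^esub> \<Psi> \<oplus>\<^bsub>E\<^esub> \<Theta> = \<Phi> \<oplus>\<^bsub>E\<^esub> (\<Psi> \<oplus>\<^bsub>E\<^esub> \<Theta>)"
      by (intro op_eqI) (auto simp: op_add_closed a_assoc)
  next
    fix \<Phi> \<Psi> assume "\<Phi> \<in> carrier E" "\<Psi> \<in> carrier E"
    then show "\<Phi> \<oplus>\<^bsub>E\<^esub> \<Psi> = \<Psi> \<oplus>\<^bsub>E\<^esub> \<Phi>"
      by (intro op_eqI) (auto simp: op_add_closed a_comm)
  next
    fix \<Phi> assume "\<Phi> \<in> carrier E"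
    then show "\<zero>\<^bsub>E\<^esub> \<oplus>\<^bsub>E\<^esub> \<Phi> = \<Phi>"
      by (intro op_eqI) (auto simp: op_add_closed op_zero_closed)
  qed (auto simp: op_add_closed op_zero_closed)
  show "Group.monoid E"
  proof (rule monoidI)
    fix \<Phi> \<Psi> \<Theta> assume "\<Phi> \<in> carrier E" "\<Psi> \<in> carrier E" "\<Theta> \<in> carrier E"
    then show "\<Phi> \<otimes>\<^bsub>E\<^esub> \<Psi> \<otimes>\<^bsub>E\<^esub> \<Theta> = \<Phi> \<otimes>\<^bsub>E\<^esub> (\<Psi> \<otimes>\<^bsub>E\<^esub> \<Theta>)"
      by (intro op_eqI) (auto simp: op_mult_closed)
  next
    fix \<Phi> assume "\<Phi> \<in> carrier E"
    then show "\<one>\<^bsub>E\<^esub> \<otimes>\<^bsub>E\<^esub> \<Phi> = \<Phi>" "\<Phi> \<otimes>\<^bsub>E\<^esub> \<one>\<^bsub>E\<^esub> = \<Phi>"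
      by (intro op_eqI; auto simp: op_mult_closed op_one_closed)+
  qed (auto simp: op_mult_closed op_one_closed)
next
  fix \<Phi> \<Psi> \<Theta> assume "\<Phi> \<in> carrier E" "\<Psi> \<in> carrier E" "\<Theta> \<in> carrier E"
  then show "(\<Phi> \<oplus>\<^bsub>E\<^esub> \<Psi>) \<otimes>\<^bsub>E\<^esub> \<Theta> = \<Phi> \<otimes>\<^bsub>E\<^esub> \<Theta> \<oplus>\<^bsub>E\<^esub> \<Psi> \<otimes>\<^bsub>E\<^esub> \<Theta>"
    "\<Theta> \<otimes>\<^bsub>E\<^esub> (\<Phi> \<oplus>\<^bsub>E\<^esub> \<Psi>) = \<Theta> \<otimes>\<^bsub>E\<^esub> \<Phi> \<oplus>\<^bsub>E\<^esub> \<Theta> \<otimes>\<^bsub>E\<^esub> \<Psi>"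
    by (intro op_eqI; auto simp: op_mult_closed op_add_closed op_add)+
qed

sublocale E: ring E by (rule E_ring)

lemma op_neg: "\<Phi> \<in> carrier E \<Longrightarrow> a \<in> carrier A \<Longrightarrow> \<Phi> (\<ominus> a) = \<ominus> \<Phi> a"
  using op_add[of \<Phi> "\<ominus> a" a] by (simp add: l_neg minus_equality[symmetric])

lemma op_neg_apply [simp]: "\<Phi> \<in> carrier E \<Longrightarrow> a \<in> carrier A \<Longrightarrow> (\<ominus>\<^bsub>E\<^esub> \<Phi>) a = \<ominus> \<Phi> a"
  using op_add_apply[of a "\<ominus>\<^bsub>E\<^esub> \<Phi>" \<Phi>] by (simp add: E.l_neg minus_equality[symmetric])

lemma op_diff_apply [simp]:
  "\<Phi> \<in> carrier E \<Longrightarrow> \<Psi> \<in> carrier E \<Longrightarrow> a \<in> carrier A \<Longrightarrow> (\<Phi> \<ominus>\<^bsub>E\<^esub> \<Psi>) a = \<Phi> a \<ominus> \<Psi> a"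
  by (simp add: a_minus_def)

lemma op_add_pow_apply [simp]:
  "a \<in> carrier A \<Longrightarrow> ([(m::nat)] \<cdot>\<^bsub>E\<^esub> \<Phi>) a = [m] \<cdot> \<Phi> a"
  by (induction m) (simp_all)

lemma op_finsum_apply:
  "\<Phi> \<in> F \<rightarrow> carrier E \<Longrightarrow> a \<in> carrier A \<Longrightarrow> (\<Oplus>\<^bsub>E\<^esub>i\<in>F. \<Phi> i) a = (\<Oplus>i\<in>F. \<Phi> i a)"
  by (induction F rule: infinite_finite_induct) (auto simp: Pi_def)

section \<open>Multiplication operators and commutators with them\<close>

definition \<mu> :: "'a \<Rightarrow> 'a \<Rightarrow> 'a" where "\<mu> b = (\<lambda>a\<in>carrier A. b \<otimes> a)"

lemma mu_apply [simp]: "a \<in> carrier A \<Longrightarrow> \<mu> b a = b \<otimes> a" by (simp add: \<mu>_def)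

lemma mu_closed [simp]: "b \<in> carrier A \<Longrightarrow> \<mu> b \<in> carrier E"
  unfolding \<mu>_def by (rule opI) (auto simp: r_distr m_lcomm)

lemma mu_add: "a \<in> carrier A \<Longrightarrow> b \<in> carrier A \<Longrightarrow> \<mu> (a \<oplus> b) = \<mu> a \<oplus>\<^bsub>E\<^esub> \<mu> b"
  by (rule op_eqI) (auto simp: l_distr)
lemma mu_mult: "a \<in> carrier A \<Longrightarrow> b \<in> carrier A \<Longrightarrow> \<mu> (a \<otimes> b) = \<mu> a \<otimes>\<^bsub>E\<^esub> \<mu> b"
  by (rule op_eqI) (auto simp: m_assoc)
lemma mu_one: "\<mu> \<one> = \<one>\<^bsub>E\<^esub>" by (rule op_eqI) auto
lemma mu_zero: "\<mu> \<zero> = \<zero>\<^bsub>E\<^esub>" by (rule op_eqI) auto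
lemma mu_neg: "a \<in> carrier A \<Longrightarrow> \<mu> (\<ominus> a) = \<ominus>\<^bsub>E\<^esub> \<mu> a"
  by (rule op_eqI) (auto simp: l_minus)
lemma mu_comm: "a \<in> carrier A \<Longrightarrow> b \<in> carrier A \<Longrightarrow> \<mu> a \<otimes>\<^bsub>E\<^esub> \<mu> b = \<mu> b \<otimes>\<^bsub>E\<^esub> \<mu> a"
  by (simp add: mu_mult[symmetric] m_comm)
lemma mu_add_pow: "a \<in> carrier A \<Longrightarrow> \<mu> ([(m::nat)] \<cdot> a) = [m] \<cdot>\<^bsub>E\<^esub> \<mu> a"
  by (rule op_eqI) (auto simp: add_pow_ldistr)
text \<open>The bracket of \<open>\<Phi>\<close> and \<open>b\<close> as an expression in the ring
  \<open>E\<close>. It replaces the pointwise \<open>commutator\<close> in the definition of order,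
  so that ring laws and the product rule in \<open>\<Phi>\<close> apply.\<close>

definition ad :: "('a \<Rightarrow> 'a) \<Rightarrow> 'a \<Rightarrow> 'a \<Rightarrow> 'a" where
  "ad \<Phi> b = \<Phi> \<otimes>\<^bsub>E\<^esub> \<mu> b \<ominus>\<^bsub>E\<^esub> \<mu> b \<otimes>\<^bsub>E\<^esub> \<Phi>"

lemma ad_closed [simp]: "\<Phi> \<in> carrier E \<Longrightarrow> b \<in> carrier A \<Longrightarrow> ad \<Phi> b \<in> carrier E"
  by (simp add: ad_def)

lemma ad_apply: "\<Phi> \<in> carrier E \<Longrightarrow> b \<in> carrier A \<Longrightarrow> a \<in> carrier A \<Longrightarrow>
    ad \<Phi> b a = \<Phi> (b \<otimes> a) \<ominus> b \<otimes> \<Phi> a"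
  by (simp add: ad_def)

lemma commutator_eq_ad: "\<Phi> \<in> carrier E \<Longrightarrow> b \<in> carrier A \<Longrightarrow> commutator A \<Phi> b = ad \<Phi> b"
proof -
  assume *: "\<Phi> \<in> carrier E" "b \<in> carrier A"
  have "ad \<Phi> b \<in> extensional (carrier A)"
    using ad_closed[OF *] unfolding carrier_E lin_op_def PiE_def by blast
  moreover have "commutator A \<Phi> b \<in> extensional (carrier A)"
    by (simp add: commutator_def)
  ultimately show ?thesis
    by (intro extensionalityI[of "commutator A \<Phi> b" "carrier A"])
      (use * in \<open>simp_all add: commutator_def ad_apply\<close>)
qed

lemma ad_add: "\<Phi> \<in> carrier E \<Longrightarrow> \<Psi> \<in> carrier E \<Longrightarrow> b \<in> carrier A \<Longrightarrow>
    ad (\<Phi> \<oplus>\<^bsub>E\<^esub> \<Psi>) b = ad \<Phi> b \<oplus>\<^bsub>E\<^esub> ad \<Psi> b"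
  using mu_closed[of b] by (simp add: ad_def a_minus_def E.l_distr E.r_distr E.minus_add E.a_ac)

lemma ad_neg: "\<Phi> \<in> carrier E \<Longrightarrow> b \<in> carrier A \<Longrightarrow> ad (\<ominus>\<^bsub>E\<^esub> \<Phi>) b = \<ominus>\<^bsub>E\<^esub> ad \<Phi> b"
  by (simp add: ad_def a_minus_def E.l_minus E.r_minus E.minus_add)

lemma ad_diff: "\<Phi> \<in> carrier E \<Longrightarrow> \<Psi> \<in> carrier E \<Longrightarrow> b \<in> carrier A \<Longrightarrow>
    ad (\<Phi> \<ominus>\<^bsub>E\<^esub> \<Psi>) b = ad \<Phi> b \<ominus>\<^bsub>E\<^esub> ad \<Psi> b"
  by (simp add: a_minus_def ad_add ad_neg)

lemma ad_zero: "b \<in> carrier A \<Longrightarrow> ad \<zero>\<^bsub>E\<^esub> b = \<zero>\<^bsub>E\<^esub>"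
  by (simp add: ad_def a_minus_def)

lemma ad_mult: "\<Phi> \<in> carrier E \<Longrightarrow> \<Psi> \<in> carrier E \<Longrightarrow> b \<in> carrier A \<Longrightarrow>
    ad (\<Phi> \<otimes>\<^bsub>E\<^esub> \<Psi>) b = \<Phi> \<otimes>\<^bsub>E\<^esub> ad \<Psi> b \<oplus>\<^bsub>E\<^esub> ad \<Phi> b \<otimes>\<^bsub>E\<^esub> \<Psi>"
  by (rule op_eqI) (auto simp: ad_apply op_add op_neg a_minus_def a_assoc r_neg1 r_neg2 l_neg r_neg)

lemma ad_mu: "a \<in> carrier A \<Longrightarrow> b \<in> carrier A \<Longrightarrow> ad (\<mu> a) b = \<zero>\<^bsub>E\<^esub>"
  by (simp add: ad_def mu_comm[of a b] E.r_neg a_minus_def)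

lemma ad_add_pow: "\<Phi> \<in> carrier E \<Longrightarrow> b \<in> carrier A \<Longrightarrow>
    ad ([(m::nat)] \<cdot>\<^bsub>E\<^esub> \<Phi>) b = [m] \<cdot>\<^bsub>E\<^esub> ad \<Phi> b"
  by (simp add: ad_def E.add_pow_ldistr E.add_pow_rdistr E.add_pow_diff_distrib)

text \<open>Multiplications by \<open>b\<close> and \<open>c\<close> commute, so the Jacobi identity
  leaves no correction term. Inductions on the order use this to interchange the bracket with a
  coordinate and the bracket with a test function.\<close>

lemma ad_swap: "\<Phi> \<in> carrier E \<Longrightarrow> b \<in> carrier A \<Longrightarrow> c \<in> carrier A \<Longrightarrow>
    ad (ad \<Phi> b) c = ad (ad \<Phi> c) b"
  by (rule op_eqI) (auto simp: ad_apply a_minus_def op_neg op_add minus_add r_distr r_minus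
       m_lcomm[of b c] a_ac)

lemma ad_finsum:
  assumes "\<Phi> \<in> F \<rightarrow> carrier E" "b \<in> carrier A"
  shows "ad (\<Oplus>\<^bsub>E\<^esub>i\<in>F. \<Phi> i) b = (\<Oplus>\<^bsub>E\<^esub>i\<in>F. ad (\<Phi> i) b)"
  using assms
  by (induction F rule: infinite_finite_induct)
    (auto simp: Pi_def ad_add ad_zero E.finsum_infinite)

text \<open>\<open>ord_lt m \<Phi>\<close>: the operator \<open>\<Phi>\<close> has order less than \<open>m\<close>, so only \<open>0\<close> has order less than \<open>0\<close>.\<close>

primrec ord_lt :: "nat \<Rightarrow> ('a \<Rightarrow> 'a) \<Rightarrow> bool" where
  "ord_lt 0 \<Phi> \<longleftrightarrow> \<Phi> = \<zero>\<^bsub>E\<^esub>"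
| "ord_lt (Suc m) \<Phi> \<longleftrightarrow> (\<forall>b\<in>carrier A. ord_lt m (ad \<Phi> b))"

lemma order_le_iff: "\<Phi> \<in> carrier E \<Longrightarrow> order_le A m \<Phi> \<longleftrightarrow> ord_lt (Suc m) \<Phi>"
proof (induction m arbitrary: \<Phi>)
  case 0
  have "(\<lambda>a\<in>carrier A. \<zero>) = \<zero>\<^bsub>E\<^esub>" by (simp add: op_alg_def)
  with 0 show ?case by (simp add: commutator_eq_ad)
next
  case (Suc m)
  then show ?case by (simp add: commutator_eq_ad)
qed

lemma ord_zero: "ord_lt m \<zero>\<^bsub>E\<^esub>"
  by (induction m) (auto simp: ad_zero)

lemma ord_Suc: "\<Phi> \<in> carrier E \<Longrightarrow> ord_lt m \<Phi> \<Longrightarrow> ord_lt (Suc m) \<Phi>"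
  by (induction m arbitrary: \<Phi>) (auto simp: ad_zero)

lemma ord_mono: "m \<le> m' \<Longrightarrow> \<Phi> \<in> carrier E \<Longrightarrow> ord_lt m \<Phi> \<Longrightarrow> ord_lt m' \<Phi>"
  by (induction m' rule: dec_induct) (auto intro: ord_Suc simp del: ord_lt.simps)

lemma ord_add: "\<Phi> \<in> carrier E \<Longrightarrow> \<Psi> \<in> carrier E \<Longrightarrow> ord_lt m \<Phi> \<Longrightarrow> ord_lt m \<Psi> \<Longrightarrow>
    ord_lt m (\<Phi> \<oplus>\<^bsub>E\<^esub> \<Psi>)"
  by (induction m arbitrary: \<Phi> \<Psi>) (auto simp: ad_add)

lemma ord_neg: "\<Phi> \<in> carrier E \<Longrightarrow> ord_lt m \<Phi> \<Longrightarrow> ord_lt m (\<ominus>\<^bsub>E\<^esub> \<Phi>)"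
  by (induction m arbitrary: \<Phi>) (auto simp: ad_neg)

text \<open>Orders at most \<open>m - 1\<close> and \<open>m' - 1\<close> add up to order at most
  \<open>m + m' - 2\<close>, that is, less than \<open>m + m' - 1\<close>; hence the bound
  \<open>Suc k\<close>. The product rule \<open>ad_mult\<close> lowers one of the two orders at each
  step, and an operator with bound \<open>0\<close> is zero.\<close>

lemma ord_mult:
  "\<Phi> \<in> carrier E \<Longrightarrow> \<Psi> \<in> carrier E \<Longrightarrow> ord_lt m \<Phi> \<Longrightarrow> ord_lt m' \<Psi> \<Longrightarrow> m + m' \<le> Suc k \<Longrightarrow>
    ord_lt k (\<Phi> \<otimes>\<^bsub>E\<^esub> \<Psi>)"
proof (induction k arbitrary: \<Phi> \<Psi> m m')
  case 0
  then have "m = 0 \<or> m' = 0" by auto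
  with 0 show ?case by auto
next
  case (Suc k)
  show ?case
  proof (cases "m = 0 \<or> m' = 0")
    case True
    with Suc have "\<Phi> \<otimes>\<^bsub>E\<^esub> \<Psi> = \<zero>\<^bsub>E\<^esub>" by auto
    then show ?thesis using ord_zero by metis
  next
    case False
    then obtain i j where ij: "m = Suc i" "m' = Suc j" by (metis not0_implies_Suc)
    show ?thesis unfolding ord_lt.simps
    proof
      fix b assume b: "b \<in> carrier A"
      have "ord_lt k (\<Phi> \<otimes>\<^bsub>E\<^esub> ad \<Psi> b)"
        by (rule Suc.IH[of _ _ m j]) (use Suc.prems b ij in auto)
      moreover have "ord_lt k (ad \<Phi> b \<otimes>\<^bsub>E\<^esub> \<Psi>)"
        by (rule Suc.IH[of _ _ i m']) (use Suc.prems b ij in auto)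
      ultimately show "ord_lt k (ad (\<Phi> \<otimes>\<^bsub>E\<^esub> \<Psi>) b)"
        using Suc.prems b by (simp add: ad_mult ord_add)
    qed
  qed
qed

lemma ord_mu: "a \<in> carrier A \<Longrightarrow> ord_lt 1 (\<mu> a)"
  by (simp add: ad_mu)

text \<open>The commutator with \<open>a\<close> vanishes; its value at \<open>\<one>\<close> says
  that \<open>\<Phi> a\<close> is \<open>a \<otimes> \<Phi> \<one>\<close>.\<close>

lemma ord_one_iff: "\<Phi> \<in> carrier E \<Longrightarrow> ord_lt 1 \<Phi> \<longleftrightarrow> \<Phi> = \<mu> (\<Phi> \<one>)"
proof
  assume \<Phi>: "\<Phi> \<in> carrier E" and o: "ord_lt 1 \<Phi>"
  show "\<Phi> = \<mu> (\<Phi> \<one>)"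
  proof (rule op_eqI)
    fix a assume a: "a \<in> carrier A"
    with o have "ad \<Phi> a = \<zero>\<^bsub>E\<^esub>" by simp
    with a ad_apply[OF \<Phi> a one_closed] have "\<Phi> a \<ominus> a \<otimes> \<Phi> \<one> = \<zero>"
      by simp
    with a \<Phi> show "\<Phi> a = \<mu> (\<Phi> \<one>) a"
      using minus_eq_zeroD[of "\<Phi> a" "a \<otimes> \<Phi> \<one>"] by (simp add: m_comm)
  qed (use \<Phi> in auto)
qed (metis ord_mu op_closed one_closed)

section \<open>The ring of differential operators\<close>

lemma carrier_D: "carrier D = {\<Phi> \<in> carrier E. \<exists>m. ord_lt m \<Phi>}"
proof -
  have "(\<exists>m. order_le A m \<Phi>) \<longleftrightarrow> (\<exists>m. ord_lt m \<Phi>)" if "\<Phi> \<in> carrier E" for \<Phi>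
    using that order_le_iff ord_Suc by blast
  then show ?thesis by (auto simp: diff_alg_def)
qed

lemma D_eq: "D = E\<lparr>carrier := carrier D\<rparr>" by (simp add: diff_alg_def)

lemma D_subring: "subring (carrier D) E"
proof (rule E.subringI)
  show "\<one>\<^bsub>E\<^esub> \<in> carrier D" using ord_mu[of \<one>] unfolding carrier_D mu_one[symmetric] by (auto simp: mu_one simp del: ord_lt.simps)
  fix \<Phi> \<Psi> assume "\<Phi> \<in> carrier D" "\<Psi> \<in> carrier D"
  then obtain m m' where *: "\<Phi> \<in> carrier E" "\<Psi> \<in> carrier E" "ord_lt m \<Phi>" "ord_lt m' \<Psi>"
    by (auto simp: carrier_D)
  show "\<Phi> \<otimes>\<^bsub>E\<^esub> \<Psi> \<in> carrier D"
    using ord_mult[OF *, of "m + m'"] * by (auto simp: carrier_D)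
  have "ord_lt (max m m') \<Phi>" "ord_lt (max m m') \<Psi>"
    using ord_mono[of m "max m m'"] ord_mono[of m' "max m m'"] * by auto
  from ord_add[OF *(1,2) this] * show "\<Phi> \<oplus>\<^bsub>E\<^esub> \<Psi> \<in> carrier D" by (auto simp: carrier_D)
qed (auto simp: carrier_D intro: ord_neg)

lemma D_ring: "ring D"
  using E.subring_is_ring[OF D_subring] D_eq by simp

sublocale D: ring D by (rule D_ring)

lemma D_sub_E [simp]: "\<Phi> \<in> carrier D \<Longrightarrow> \<Phi> \<in> carrier E" by (auto simp: carrier_D)

lemma D_simps [simp]: "mult D = mult E" "add D = add E" "one D = one E" "zero D = zero E"
  "smult D = smult E"
  by (simp_all only: diff_alg_def) simp_all

lemma D_pow [simp]: "\<Phi> [^]\<^bsub>D\<^esub> (m::nat) = \<Phi> [^]\<^bsub>E\<^esub> m"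
  by (simp add: nat_pow_def)

lemma D_add_pow [simp]: "[(m::nat)] \<cdot>\<^bsub>D\<^esub> \<Phi> = [m] \<cdot>\<^bsub>E\<^esub> \<Phi>"
  by (simp add: add_pow_def nat_pow_def)

lemma D_neg [simp]: "\<Phi> \<in> carrier D \<Longrightarrow> \<ominus>\<^bsub>D\<^esub> \<Phi> = \<ominus>\<^bsub>E\<^esub> \<Phi>"
  using E.minus_equality[of "\<ominus>\<^bsub>D\<^esub> \<Phi>" \<Phi>] D.l_neg[of \<Phi>] by auto

lemma D_finsum: "f \<in> F \<rightarrow> carrier D \<Longrightarrow> finsum D f F = finsum E f F"
  using E.finsum_subring_carrier[OF D_subring, of f F] D_eq by simp

lemma mu_D [simp]: "a \<in> carrier A \<Longrightarrow> \<mu> a \<in> carrier D"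
  unfolding carrier_D using ord_mu[of a] mu_closed[of a] by blast

lemma mu_smult: "a \<in> carrier A \<Longrightarrow> a \<odot>\<^bsub>E\<^esub> \<one>\<^bsub>E\<^esub> = \<mu> a"
  by (simp add: \<mu>_def op_alg_def cong: restrict_cong)

end

section \<open>Lifting derivations\<close>

definition dual_numbers :: "('a, 't) ring_scheme \<Rightarrow> ('a \<times> 'a) ring" where
  "dual_numbers A = \<lparr>carrier = carrier A \<times> carrier A,
     mult = (\<lambda>(a, b) (c, d). (a \<otimes>\<^bsub>A\<^esub> c, a \<otimes>\<^bsub>A\<^esub> d \<oplus>\<^bsub>A\<^esub> b \<otimes>\<^bsub>A\<^esub> c)),
     one = (\<one>\<^bsub>A\<^esub>, \<zero>\<^bsub>A\<^esub>), zero = (\<zero>\<^bsub>A\<^esub>, \<zero>\<^bsub>A\<^esub>),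
     add = (\<lambda>(a, b) (c, d). (a \<oplus>\<^bsub>A\<^esub> c, b \<oplus>\<^bsub>A\<^esub> d))\<rparr>"

lemma (in cring) dual_numbers_cring: "cring (dual_numbers R)"
proof (rule cringI)
  show "abelian_group (dual_numbers R)"
  proof (rule abelian_groupI)
    fix y assume "y \<in> carrier (dual_numbers R)"
    then show "\<exists>z\<in>carrier (dual_numbers R). z \<oplus>\<^bsub>dual_numbers R\<^esub> y = \<zero>\<^bsub>dual_numbers R\<^esub>"
      by (intro bexI[of _ "(\<ominus> fst y, \<ominus> snd y)"]) (auto simp: dual_numbers_def l_neg)
  qed (auto simp: dual_numbers_def a_ac)
  show "comm_monoid (dual_numbers R)"
    by (rule comm_monoidI) (auto simp: dual_numbers_def l_distr r_distr m_ac a_ac)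
qed (auto simp: dual_numbers_def l_distr r_distr a_ac)

section \<open>Congruences modulo powers of p in a complete ring without p-torsion\<close>

locale formal_scheme = operators A p W \<iota>
  for A (structure) and p :: nat and W :: "('w, 'u) ring_scheme" and \<iota> :: "'w \<Rightarrow> 'a" +
  assumes p_prime: "Factorial_Ring.prime p"
    and p_torsion_free: "a \<in> carrier A \<Longrightarrow> [p] \<cdot> a = \<zero> \<Longrightarrow> a = \<zero>"
    and complete: "p_adically_complete p A"
    and smooth: "formally_smooth_mod TYPE(('a \<times> 'a) set) p W
      (\<lambda>w. reduction_map p A (\<iota> w)) (reduction p A)"
begin

text \<open>Membership of both sides is part of the relation, so congruences chain without side
  conditions. In particular \<open>cg 0 a \<zero>\<close> says only that \<open>a\<close> lies in
  \<open>A\<close>, which is how unrestricted coefficients are expressed later.\<close>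

definition cg :: "nat \<Rightarrow> 'a \<Rightarrow> 'a \<Rightarrow> bool" where
  "cg n a b \<longleftrightarrow> a \<in> carrier A \<and> b \<in> carrier A \<and> (\<exists>c\<in>carrier A. a = b \<oplus> [(p ^ n)] \<cdot> c)"

lemma cg_iff: "a \<in> carrier A \<Longrightarrow> b \<in> carrier A \<Longrightarrow> cg n a b \<longleftrightarrow> a \<ominus> b \<in> int_ideal A (p ^ n)"
proof -
  assume ab: "a \<in> carrier A" "b \<in> carrier A"
  have "a = b \<oplus> c \<longleftrightarrow> a \<ominus> b = c" if "c \<in> carrier A" for c
    using ab that by (auto simp: a_minus_def a_ac r_neg1 r_neg2 r_neg a_lcomm[of b c])
  with ab show ?thesis by (auto simp: cg_def int_ideal_eq)
qed

lemma cg_refl: "a \<in> carrier A \<Longrightarrow> cg n a a"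
  unfolding cg_def by (auto intro!: bexI[of _ \<zero>])

lemma cg_sym: "cg n a b \<Longrightarrow> cg n b a"
  unfolding cg_def
proof (elim conjE bexE, intro conjI)
  fix c assume *: "c \<in> carrier A" "a = b \<oplus> [(p ^ n)] \<cdot> c" "b \<in> carrier A"
  show "\<exists>c\<in>carrier A. b = a \<oplus> [(p ^ n)] \<cdot> c"
    using * by (intro bexI[of _ "\<ominus> c"]) (auto simp: add_pow_minus a_assoc r_neg)
qed

lemma cg_trans [trans]: "cg n a b \<Longrightarrow> cg n b c \<Longrightarrow> cg n a c"
  unfolding cg_def
proof (elim conjE bexE, intro conjI)
  fix d e assume *: "d \<in> carrier A" "e \<in> carrier A" "a = b \<oplus> [(p ^ n)] \<cdot> d" "b = c \<oplus> [(p ^ n)] \<cdot> e"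
    "c \<in> carrier A"
  show "\<exists>d\<in>carrier A. a = c \<oplus> [(p ^ n)] \<cdot> d"
    using * by (intro bexI[of _ "d \<oplus> e"]) (auto simp: add_pow_distrib a_ac)
qed

lemma cg_add: "cg n a b \<Longrightarrow> cg n c d \<Longrightarrow> cg n (a \<oplus> c) (b \<oplus> d)"
  unfolding cg_def
proof (elim conjE bexE, intro conjI)
  fix e f assume *: "e \<in> carrier A" "f \<in> carrier A" "a = b \<oplus> [(p ^ n)] \<cdot> e" "c = d \<oplus> [(p ^ n)] \<cdot> f"
    "b \<in> carrier A" "d \<in> carrier A"
  show "\<exists>e\<in>carrier A. a \<oplus> c = b \<oplus> d \<oplus> [(p ^ n)] \<cdot> e"
    using * by (intro bexI[of _ "e \<oplus> f"]) (auto simp: add_pow_distrib a_ac)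
qed auto

lemma cg_mult_left: "a \<in> carrier A \<Longrightarrow> cg n b c \<Longrightarrow> cg n (a \<otimes> b) (a \<otimes> c)"
  unfolding cg_def
proof (elim conjE bexE, intro conjI)
  fix e assume *: "a \<in> carrier A" "e \<in> carrier A" "b = c \<oplus> [(p ^ n)] \<cdot> e" "c \<in> carrier A"
  show "\<exists>d\<in>carrier A. a \<otimes> b = a \<otimes> c \<oplus> [(p ^ n)] \<cdot> d"
    using * by (intro bexI[of _ "a \<otimes> e"]) (auto simp: add_pow_rdistr r_distr)
qed auto

lemma cg_mult: "cg n a b \<Longrightarrow> cg n c d \<Longrightarrow> cg n (a \<otimes> c) (b \<otimes> d)"
  using cg_mult_left[of a n c d] cg_mult_left[of d n a b] cg_trans[of n "a \<otimes> c" "a \<otimes> d" "b \<otimes> d"]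
  by (auto simp: cg_def m_comm)

lemma cg_neg: "cg n a b \<Longrightarrow> cg n (\<ominus> a) (\<ominus> b)"
  using cg_mult_left[of "\<ominus> \<one>" n a b] by (auto simp: cg_def l_minus)

lemma cg_minus: "cg n a b \<Longrightarrow> cg n c d \<Longrightarrow> cg n (a \<ominus> c) (b \<ominus> d)"
  unfolding a_minus_def by (intro cg_add cg_neg)

lemma cg_add_pow: "cg n a b \<Longrightarrow> cg n ([(m::nat)] \<cdot> a) ([m] \<cdot> b)"
proof (induction m)
  case (Suc m)
  then show ?case by (auto intro: cg_add)
qed (auto intro: cg_refl)

lemma cg_mono: "cg n a b \<Longrightarrow> m \<le> n \<Longrightarrow> cg m a b"
  unfolding cg_def
proof (elim conjE bexE, intro conjI)
  fix c assume *: "m \<le> n" "c \<in> carrier A" "a = b \<oplus> [(p ^ n)] \<cdot> c"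
  then have "p ^ n = p ^ m * p ^ (n - m)" by (simp add: power_add[symmetric])
  with * show "\<exists>c\<in>carrier A. a = b \<oplus> [(p ^ m)] \<cdot> c"
    by (intro bexI[of _ "[(p ^ (n - m))] \<cdot> c"]) (auto simp: add_pow_mult)
qed

lemma cg_zero_add_pow: "a \<in> carrier A \<Longrightarrow> cg n ([(p ^ n)] \<cdot> a) \<zero>"
  by (auto simp: cg_def)

lemma cg_all_eq: "(\<And>n. cg n a b) \<Longrightarrow> a = b"
proof -
  assume *: "\<And>n. cg n a b"
  then have ab: "a \<in> carrier A" "b \<in> carrier A" by (auto simp: cg_def)
  then have "a \<ominus> b \<in> (\<Inter>n. int_ideal A (p ^ n))" using * by (auto simp: cg_iff)
  then have "a \<ominus> b = \<zero>" using complete unfolding p_adically_complete_def by blast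
  with ab show "a = b" by (rule minus_eq_zeroD)
qed

lemma limit_exists:
  assumes "\<And>n. s n \<in> carrier A" "\<And>n. cg n (s (Suc n)) (s n)"
  shows "\<exists>a\<in>carrier A. \<forall>n. cg n a (s n)"
proof -
  have "s \<in> UNIV \<rightarrow> carrier A" "\<forall>n. s (Suc n) \<ominus> s n \<in> int_ideal A (p ^ n)"
    using assms by (auto simp: cg_iff)
  then obtain a where "a \<in> carrier A" "\<forall>n. a \<ominus> s n \<in> int_ideal A (p ^ n)"
    using complete unfolding p_adically_complete_def by blast
  then show ?thesis using assms(1) by (auto simp: cg_iff)
qed

text \<open>Bezout gives an inverse \<open>s n\<close> of \<open>m\<close> modulo
  \<open>p ^ n\<close> for every \<open>n\<close>. These inverses are compatible, and their limit in
  the complete ring inverts \<open>m\<close>.\<close>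

lemma coprime_inverse:
  assumes "coprime m p" "m \<noteq> 0"
  shows "\<exists>u\<in>carrier A. [(m::nat)] \<cdot> u = \<one>"
proof -
  have "\<exists>s t. m * s = p ^ n * t + 1" for n
    using bezout_nat[of m "p ^ n"] assms by simp
  then obtain s t where st: "\<And>n. m * s n = p ^ n * t n + 1" by metis
  have inv: "cg n ([m] \<cdot> ([s n] \<cdot> a)) a" if "a \<in> carrier A" for a n
    using that st[of n] by (auto simp: add_pow_mult cg_def add.nat_pow_mult[symmetric] a_comm intro!: bexI[of _ "[t n] \<cdot> a"])
  have step: "cg n ([s (Suc n)] \<cdot> \<one>) ([s n] \<cdot> \<one>)" for n
  proof -
    \<comment> \<open>The product of \<open>m\<close> with both approximate inverses, computed in
      two ways, shows that they agree modulo \<open>p ^ n\<close>.\<close>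
    have "cg n ([s n] \<cdot> ([m] \<cdot> ([s (Suc n)] \<cdot> \<one>))) ([s n] \<cdot> \<one>)"
      by (intro cg_add_pow cg_mono[OF inv]) auto
    moreover have "cg n ([s n] \<cdot> ([m] \<cdot> ([s (Suc n)] \<cdot> \<one>))) ([s (Suc n)] \<cdot> \<one>)"
      using inv[of "[s (Suc n)] \<cdot> \<one>" n] by (simp add: add_pow_mult mult.commute mult.left_commute)
    ultimately show ?thesis by (blast intro: cg_trans cg_sym)
  qed
  have "\<exists>u\<in>carrier A. \<forall>n. cg n u ([s n] \<cdot> \<one>)"
    by (rule limit_exists) (auto intro: step)
  then obtain u where u: "u \<in> carrier A" "\<And>n. cg n u ([s n] \<cdot> \<one>)"
    by blast
  have "[m] \<cdot> u = \<one>"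
  proof (rule cg_all_eq)
    fix n show "cg n ([m] \<cdot> u) \<one>"
      using cg_trans[OF cg_add_pow[OF u(2)] inv[OF one_closed]] .
  qed
  with u show ?thesis by blast
qed

lemma coprime_cancel:
  assumes "coprime m p" "m \<noteq> 0" "a \<in> carrier A" "cg n ([(m::nat)] \<cdot> a) \<zero>"
  shows "cg n a \<zero>"
proof -
  obtain u where u: "u \<in> carrier A" "[m] \<cdot> u = \<one>" using coprime_inverse[OF assms(1,2)] by blast
  have "cg n (u \<otimes> [m] \<cdot> a) (u \<otimes> \<zero>)" by (rule cg_mult_left[OF u(1) assms(4)])
  moreover have "u \<otimes> [m] \<cdot> a = a" 
  proof -
    have "u \<otimes> [m] \<cdot> a = [m] \<cdot> u \<otimes> a"
      unfolding add_pow_rdistr[OF u(1) assms(3)] add_pow_ldistr[OF u(1) assms(3)] ..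
    then show ?thesis unfolding u(2) l_one[OF assms(3)] .
  qed
  ultimately show ?thesis using u by simp
qed

lemma p_power_torsion_free: "a \<in> carrier A \<Longrightarrow> [(p ^ k)] \<cdot> a = \<zero> \<Longrightarrow> a = \<zero>"
proof (induction k)
  case (Suc k)
  have "[p] \<cdot> ([(p ^ k)] \<cdot> a) = \<zero>"
    unfolding add_pow_mult[OF Suc.prems(1)] using Suc.prems(2) by (simp only: power_Suc)
  then have "[(p ^ k)] \<cdot> a = \<zero>" by (rule p_torsion_free[rotated]) (use Suc.prems in simp)
  with Suc show ?case by blast
qed simp

text \<open>The power of \<open>p\<close> dividing \<open>m\<close> is cancelled by the hypothesis
  on \<open>p\<close>-torsion. The remaining factor is prime to \<open>p\<close>, so it can be
  cancelled modulo every \<open>p ^ n\<close>, and \<open>A\<close> is separated.\<close>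

lemma torsion_free: 
  assumes "m \<noteq> 0" "a \<in> carrier A" "[(m::nat)] \<cdot> a = \<zero>"
  shows "a = \<zero>"
proof -
  obtain k m' where m: "m = p ^ k * m'" "\<not> p dvd m'"
    using multiplicity_decompose'[of m p] assms(1) p_prime not_prime_unit by blast
  then have "coprime m' p" "m' \<noteq> 0"
    using prime_imp_coprime[OF p_prime, of m'] assms(1) by (auto simp: coprime_commute)
  have "[(p ^ k)] \<cdot> ([m'] \<cdot> a) = \<zero>" using assms m by (simp add: add_pow_mult)
  then have "[m'] \<cdot> a = \<zero>" using p_power_torsion_free assms(2) by simp
  then have "cg n ([m'] \<cdot> a) \<zero>" for n by (simp add: cg_refl)
  then have "cg n a \<zero>" for n using coprime_cancel \<open>coprime m' p\<close> \<open>m' \<noteq> 0\<close> assms(2) by blast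
  then show ?thesis by (rule cg_all_eq)
qed

lemma torsion_free_cancel:
  assumes "m \<noteq> 0" "a \<in> carrier A" "b \<in> carrier A" "[(m::nat)] \<cdot> a = [m] \<cdot> b"
  shows "a = b"
proof (rule minus_eq_zeroD)
  show "a \<ominus> b = \<zero>"
  proof (rule torsion_free[OF assms(1)])
    have "[m] \<cdot> (a \<ominus> b) = [m] \<cdot> b \<ominus> [m] \<cdot> b"
      unfolding add_pow_diff_distrib[OF assms(2,3)] assms(4) ..
    then show "[m] \<cdot> (a \<ominus> b) = \<zero>" using assms by (simp add: a_minus_def r_neg)
  qed (use assms in auto)
qed (use assms in auto)

lemma cg_p_cancel:
  assumes "a \<in> carrier A" "cg (m + n) ([(p ^ m)] \<cdot> a) \<zero>"
  shows "cg n a \<zero>"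
proof -
  obtain c where c: "c \<in> carrier A" "[(p ^ m)] \<cdot> a = [(p ^ (m + n))] \<cdot> c"
    using assms(2) by (auto simp: cg_def)
  then have "[(p ^ m)] \<cdot> a = [(p ^ m)] \<cdot> ([(p ^ n)] \<cdot> c)"
    by (simp only: add_pow_mult power_add)
  then have "a = [(p ^ n)] \<cdot> c"
    by (rule torsion_free_cancel[rotated 3]) (use p_prime assms(1) c(1) in auto)
  with c show ?thesis by (auto simp: cg_def)
qed

text \<open>Represents a derivation of \<open>A/p\<^sup>n\<close> by values chosen in
  \<open>A\<close>, so that no quotient ring for varying \<open>n\<close> appears. By the product
  rule, killing the image of \<open>W\<close> amounts to \<open>W\<close>-linearity.\<close>

definition der_mod :: "nat \<Rightarrow> ('a \<Rightarrow> 'a) \<Rightarrow> bool" where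
  "der_mod n d \<longleftrightarrow> (\<forall>a\<in>carrier A. d a \<in> carrier A) \<and>
     (\<forall>a\<in>carrier A. \<forall>b\<in>carrier A. cg n (d (a \<oplus> b)) (d a \<oplus> d b)) \<and>
     (\<forall>a\<in>carrier A. \<forall>b\<in>carrier A. cg n (d (a \<otimes> b)) (a \<otimes> d b \<oplus> d a \<otimes> b)) \<and>
     (\<forall>w\<in>carrier W. cg n (d (\<iota> w)) \<zero>)"

text \<open>
  The reduction of this subring of the dual numbers modulo \<open>p\<close> is a
  square-zero extension of \<open>A/p\<close> by \<open>p\<^sup>n A/p\<^sup>n\<^sup>+\<^sup>1 A\<close>, because \<open>A\<close> has no \<open>p\<close>-torsion, and a
  section of this extension is the same thing as a lift of \<open>d\<close> modulo \<open>p\<^sup>n\<^sup>+\<^sup>1\<close>.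
\<close>

definition lift_ring :: "nat \<Rightarrow> ('a \<Rightarrow> 'a) \<Rightarrow> ('a \<times> 'a) ring" where
  "lift_ring n d = (dual_numbers A)\<lparr>carrier := {(a, b). cg n b (d a) \<and> a \<in> carrier A}\<rparr>"

lemma der_mod_zero: "der_mod n d \<Longrightarrow> cg n (d \<zero>) \<zero>"
proof -
  assume d: "der_mod n d"
  then have 0: "d \<zero> \<in> carrier A" "cg n (d (\<zero> \<oplus> \<zero>)) (d \<zero> \<oplus> d \<zero>)" unfolding der_mod_def by blast+
  then have "cg n (d \<zero> \<ominus> d \<zero>) (d \<zero> \<oplus> d \<zero> \<ominus> d \<zero>)" by (intro cg_minus cg_refl) auto
  with 0 show ?thesis by (auto simp: a_minus_def r_neg a_assoc intro: cg_sym)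
qed

lemma der_mod_one: "der_mod n d \<Longrightarrow> cg n (d \<one>) \<zero>"
proof -
  assume d: "der_mod n d"
  then have 0: "d \<one> \<in> carrier A" "cg n (d (\<one> \<otimes> \<one>)) (\<one> \<otimes> d \<one> \<oplus> d \<one> \<otimes> \<one>)"
    unfolding der_mod_def by blast+
  then have "cg n (d \<one> \<ominus> d \<one>) (d \<one> \<oplus> d \<one> \<ominus> d \<one>)" by (intro cg_minus cg_refl) auto
  with 0 show ?thesis by (auto simp: a_minus_def r_neg a_assoc intro: cg_sym)
qed

lemma der_mod_neg: "der_mod n d \<Longrightarrow> a \<in> carrier A \<Longrightarrow> cg n (d (\<ominus> a)) (\<ominus> d a)"
proof -
  assume d: "der_mod n d" and a: "a \<in> carrier A"
  then have 0: "d a \<in> carrier A" "d (\<ominus> a) \<in> carrier A" "cg n (d (a \<oplus> \<ominus> a)) (d a \<oplus> d (\<ominus> a))"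
    unfolding der_mod_def using a_inv_closed by blast+
  then have "cg n (d a \<oplus> d (\<ominus> a)) \<zero>"
    using der_mod_zero[OF d] a by (metis cg_sym cg_trans r_neg)
  then have "cg n (d a \<oplus> d (\<ominus> a) \<ominus> d a) (\<zero> \<ominus> d a)" using 0 by (intro cg_minus cg_refl) auto
  with 0 show ?thesis by (simp add: a_minus_def a_ac r_neg2 r_neg1)
qed

lemma der_mod_add_pow: "der_mod n d \<Longrightarrow> a \<in> carrier A \<Longrightarrow> cg n (d ([(m::nat)] \<cdot> a)) ([m] \<cdot> d a)"
proof (induction m)
  case 0
  then show ?case using der_mod_zero by simp
next
  case (Suc m)
  then have "cg n (d ([m] \<cdot> a \<oplus> a)) (d ([m] \<cdot> a) \<oplus> d a)" "d a \<in> carrier A"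
    unfolding der_mod_def by auto
  with cg_add[OF Suc.IH[OF Suc.prems] cg_refl[of "d a" n]] show ?case by (auto intro: cg_trans)
qed

text \<open>Closure under products is the product rule for \<open>d\<close> modulo
  \<open>p ^ n\<close>, and closure under sums is its additivity.\<close>

lemma lift_ring_subring:
  assumes d: "der_mod n d"
  shows "subring (carrier (lift_ring n d)) (dual_numbers A)"
proof -
  interpret N: cring "dual_numbers A" by (rule dual_numbers_cring)
  have neg: "\<ominus>\<^bsub>dual_numbers A\<^esub> (a, b) = (\<ominus> a, \<ominus> b)" if "a \<in> carrier A" "b \<in> carrier A" for a b
    by (rule N.minus_equality) (use that in \<open>auto simp: dual_numbers_def l_neg\<close>)
  show ?thesis
  proof (rule N.subringI)
    show "carrier (lift_ring n d) \<subseteq> carrier (dual_numbers A)"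
      by (auto simp: lift_ring_def dual_numbers_def cg_def)
    show "\<one>\<^bsub>dual_numbers A\<^esub> \<in> carrier (lift_ring n d)"
      using der_mod_one[OF d] by (auto simp: lift_ring_def dual_numbers_def intro: cg_sym)
  next
    fix h assume "h \<in> carrier (lift_ring n d)"
    then obtain a b where h: "h = (a, b)" "a \<in> carrier A" "b \<in> carrier A" "cg n b (d a)"
      by (auto simp: lift_ring_def cg_def)
    then show "\<ominus>\<^bsub>dual_numbers A\<^esub> h \<in> carrier (lift_ring n d)"
      using cg_trans[OF cg_neg[OF h(4)] cg_sym[OF der_mod_neg[OF d h(2)]]]
      by (auto simp: neg lift_ring_def)
  next
    fix h h' assume "h \<in> carrier (lift_ring n d)" "h' \<in> carrier (lift_ring n d)"
    then obtain a b a' b' where h: "h = (a, b)" "a \<in> carrier A" "b \<in> carrier A" "cg n b (d a)"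
      "h' = (a', b')" "a' \<in> carrier A" "b' \<in> carrier A" "cg n b' (d a')"
      by (cases h, cases h') (auto simp: lift_ring_def cg_def intro: that)
    have "cg n (d (a \<oplus> a')) (d a \<oplus> d a')" "cg n (d (a \<otimes> a')) (a \<otimes> d a' \<oplus> d a \<otimes> a')"
      using d h unfolding der_mod_def by blast+
    moreover have "cg n (b \<oplus> b') (d a \<oplus> d a')" by (rule cg_add[OF h(4,8)])
    moreover have "cg n (a \<otimes> b' \<oplus> b \<otimes> a') (a \<otimes> d a' \<oplus> d a \<otimes> a')"
      using h by (intro cg_add cg_mult cg_refl) auto
    ultimately show "h \<otimes>\<^bsub>dual_numbers A\<^esub> h' \<in> carrier (lift_ring n d)"
      "h \<oplus>\<^bsub>dual_numbers A\<^esub> h' \<in> carrier (lift_ring n d)"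
      using h by (auto simp: dual_numbers_def lift_ring_def intro: cg_trans cg_sym)
  qed
qed

lemma lift_ring_cring: "der_mod n d \<Longrightarrow> cring (lift_ring n d)"
proof -
  assume d: "der_mod n d"
  interpret N: cring "dual_numbers A" by (rule dual_numbers_cring)
  have "subcring (carrier (lift_ring n d)) (dual_numbers A)"
    by (rule N.subcringI'[OF lift_ring_subring[OF d]])
  then have "cring ((dual_numbers A)\<lparr>carrier := carrier (lift_ring n d)\<rparr>)"
    using N.subcring_iff subcringE(1) by blast
  then show ?thesis by (simp add: lift_ring_def)
qed

text \<open>Sending \<open>a\<close> to \<open>(a, d a)\<close> becomes a ring homomorphism from
  \<open>A/p\<close> only after \<open>B\<close>, the reduction of \<open>T\<close>, is divided by
  the square-zero ideal \<open>N\<close>. Formal smoothness lifts it to \<open>B\<close>, and the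
  second components of representatives of the lift are the new values. Compatibility of the lift
  with \<open>W\<close> makes them vanish on \<open>\<iota> w\<close> modulo
  \<open>p ^ Suc n\<close>.\<close>

lemma lift_step:
  assumes d: "der_mod n d"
  shows "\<exists>d'. der_mod (Suc n) d' \<and> (\<forall>a\<in>carrier A. cg n (d' a) (d a))"
proof -
  define T where "T = lift_ring n d"
  define B where "B = reduction p T"
  define r where "r = reduction_map p T"
  interpret T: cring T unfolding T_def by (rule lift_ring_cring[OF d])
  interpret B: cring B unfolding B_def by (rule T.reduction_cring)
  have r_hom: "r \<in> ring_hom T B" unfolding r_def B_def by (rule T.reduction_map_hom)
  have T_car: "(a, b) \<in> carrier T \<longleftrightarrow> a \<in> carrier A \<and> b \<in> carrier A \<and> cg n b (d a)" for a b
    by (auto simp: T_def lift_ring_def cg_def)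
  have T_add: "(a, b) \<oplus>\<^bsub>T\<^esub> (a', b') = (a \<oplus> a', b \<oplus> b')"
    and T_mult: "(a, b) \<otimes>\<^bsub>T\<^esub> (a', b') = (a \<otimes> a', a \<otimes> b' \<oplus> b \<otimes> a')"
    and T_zero: "\<zero>\<^bsub>T\<^esub> = (\<zero>, \<zero>)" and T_one: "\<one>\<^bsub>T\<^esub> = (\<one>, \<zero>)" for a b a' b'
    by (simp_all add: T_def lift_ring_def dual_numbers_def)
  have T_neg: "\<ominus>\<^bsub>T\<^esub> (a, b) = (\<ominus> a, \<ominus> b)" if "(a, b) \<in> carrier T" for a b
  proof (rule T.minus_equality)
    have "cg n (\<ominus> b) (d (\<ominus> a))"
      using that der_mod_neg[OF d, of a] by (auto simp: T_car intro: cg_trans cg_neg cg_sym)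
    with that show "(\<ominus> a, \<ominus> b) \<in> carrier T" by (simp add: T_car)
    show "(\<ominus> a, \<ominus> b) \<oplus>\<^bsub>T\<^esub> (a, b) = \<zero>\<^bsub>T\<^esub>"
      using that by (simp add: T_car T_add T_zero l_neg)
  qed (use that in auto)
  have T_pow: "[(m::nat)] \<cdot>\<^bsub>T\<^esub> (a, b) = ([m] \<cdot> a, [m] \<cdot> b)" for m a b
    by (induction m) (simp_all add: T_add T_zero)
  have d_closed: "d a \<in> carrier A" if "a \<in> carrier A" for a using d that by (simp add: der_mod_def)
  have d_T: "(a, d a) \<in> carrier T" if "a \<in> carrier A" for a
    using that d_closed by (simp add: T_car cg_refl)
  have eps_T: "(\<zero>, b) \<in> carrier T \<longleftrightarrow> cg n b \<zero>" for b
  proof -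
    have "cg n (d \<zero>) \<zero>" by (rule der_mod_zero[OF d])
    then have "cg n b (d \<zero>) \<longleftrightarrow> cg n b \<zero>" by (blast intro: cg_trans cg_sym)
    then show ?thesis unfolding T_car by (auto simp: cg_def)
  qed
  have r_eq: "r s = r t \<longleftrightarrow> (\<exists>u\<in>carrier T. s = t \<oplus>\<^bsub>T\<^esub> [p] \<cdot>\<^bsub>T\<^esub> u)"
    if "s \<in> carrier T" "t \<in> carrier T" for s t
  proof -
    have "s = t \<oplus>\<^bsub>T\<^esub> c \<longleftrightarrow> s \<ominus>\<^bsub>T\<^esub> t = c" if "c \<in> carrier T" for c
      using that \<open>s \<in> carrier T\<close> \<open>t \<in> carrier T\<close>
      by (auto simp: a_minus_def T.a_ac T.r_neg1 T.r_neg2 T.r_neg T.a_lcomm[of t c])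
    then show ?thesis
      unfolding r_def T.reduction_map_eq_iff[OF that] T.int_ideal_eq by auto
  qed
  define N where "N = (\<lambda>b. r (\<zero>, b)) ` {b. cg n b \<zero>}"
  have N_ideal: "ideal N B"
  proof (rule idealI)
    show "subgroup N (add_monoid B)"
    proof (rule B.add.subgroupI)
      show "N \<subseteq> carrier B" using ring_hom_closed[OF r_hom] eps_T by (auto simp: N_def)
      show "N \<noteq> {}" using cg_refl[OF zero_closed] by (auto simp: N_def)
    next
      fix y assume "y \<in> N"
      then obtain b where b: "cg n b \<zero>" "y = r (\<zero>, b)" by (auto simp: N_def)
      then have "(\<zero>, b) \<in> carrier T" "b \<in> carrier A" by (auto simp: eps_T cg_def)
      moreover have "cg n (\<ominus> b) \<zero>" using cg_neg[OF b(1)] by simp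
      moreover have "\<ominus>\<^bsub>B\<^esub> r (\<zero>, b) = r (\<ominus>\<^bsub>T\<^esub> (\<zero>, b))"
        by (rule B.minus_equality) (use calculation in \<open>auto simp: ring_hom_add[OF r_hom, symmetric]
          ring_hom_closed[OF r_hom] T.l_neg ring_hom_zero[OF r_hom T.ring_axioms B.ring_axioms]\<close>)
      ultimately show "\<ominus>\<^bsub>B\<^esub> y \<in> N" using b by (auto simp: N_def T_neg)
    next
      fix y z assume "y \<in> N" "z \<in> N"
      then obtain b c where b: "cg n b \<zero>" "y = r (\<zero>, b)" "cg n c \<zero>" "z = r (\<zero>, c)" by (auto simp: N_def)
      have "y \<oplus>\<^bsub>B\<^esub> z = r ((\<zero>, b) \<oplus>\<^bsub>T\<^esub> (\<zero>, c))"
        using b by (simp add: eps_T ring_hom_add[OF r_hom])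
      moreover have "cg n (b \<oplus> c) \<zero>" using cg_add[OF b(1,3)] by simp
      ultimately show "y \<oplus>\<^bsub>B\<^esub> z \<in> N" by (auto simp: N_def T_add)
    qed
    fix y z assume "y \<in> N" "z \<in> carrier B"
    then obtain b t where b: "cg n b \<zero>" "y = r (\<zero>, b)" "t \<in> carrier T" "z = r t"
      by (auto simp: N_def B_def T.carrier_reduction r_def)
    obtain a c where t: "t = (a, c)" by (cases t)
    have "z \<otimes>\<^bsub>B\<^esub> y = r (t \<otimes>\<^bsub>T\<^esub> (\<zero>, b))"
      using b by (simp add: eps_T ring_hom_mult[OF r_hom])
    also have "t \<otimes>\<^bsub>T\<^esub> (\<zero>, b) = (\<zero>, a \<otimes> b)" using b t by (auto simp: T_mult T_car cg_def)
    finally have "z \<otimes>\<^bsub>B\<^esub> y = r (\<zero>, a \<otimes> b)" .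
    moreover have "cg n (a \<otimes> b) \<zero>" using cg_mult_left[of a n b \<zero>] b t by (auto simp: T_car)
    ultimately show "z \<otimes>\<^bsub>B\<^esub> y \<in> N" by (auto simp: N_def)
    then show "y \<otimes>\<^bsub>B\<^esub> z \<in> N" using \<open>y \<in> N\<close> \<open>z \<in> carrier B\<close> b ring_hom_closed[OF r_hom] eps_T
      by (metis B.m_comm)
  qed (rule B.ring_axioms)
  interpret N: ideal N B by (rule N_ideal)
  define U where "U t = N +>\<^bsub>B\<^esub> r t" for t
  have U_hom: "U \<in> ring_hom T (B Quot N)"
  proof -
    have "(+>\<^bsub>B\<^esub>) N \<circ> r \<in> ring_hom T (B Quot N)"
      by (rule ring_hom_trans[OF r_hom N.rcos_ring_hom])
    then show ?thesis by (simp add: U_def[abs_def] comp_def)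
  qed
  have U_eq: "U s = U t"
    if st: "s \<in> carrier T" "t \<in> carrier T" and red: "reduction_map p A (fst s) = reduction_map p A (fst t)"
    for s t
  proof -
    obtain a b a' b' where ab: "s = (a, b)" "t = (a', b')" by (cases s, cases t)
    with st have car: "a \<in> carrier A" "b \<in> carrier A" "a' \<in> carrier A" "b' \<in> carrier A"
      "cg n b (d a)" "cg n b' (d a')" by (auto simp: T_car)
    have "cg 1 a a'" using red ab car reduction_map_eq_iff[of a a' p] by (simp add: cg_iff)
    then obtain c where c: "c \<in> carrier A" "a = a' \<oplus> [p] \<cdot> c" by (auto simp: cg_def)
    \<comment> \<open>The pair \<open>(c, d c)\<close> lies in \<open>T\<close>, so \<open>p\<close>
      times it vanishes in \<open>B\<close>. What is left of the difference is
      \<open>(\<zero>, e)\<close>, and the derivation laws modulo \<open>p ^ n\<close> put its class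
      into \<open>N\<close>.\<close>
    define e where "e = b \<ominus> (b' \<oplus> [p] \<cdot> d c)"
    have e: "e \<in> carrier A" using car c d_closed by (simp add: e_def)
    have "cg n (d a) (d a' \<oplus> d ([p] \<cdot> c))" using d c car unfolding der_mod_def by auto
    also have "cg n (d a' \<oplus> d ([p] \<cdot> c)) (b' \<oplus> [p] \<cdot> d c)"
      using car c by (intro cg_add der_mod_add_pow[OF d] cg_sym[OF car(6)])
    finally have "cg n b (b' \<oplus> [p] \<cdot> d c)" by (rule cg_trans[OF car(5)])
    then have "cg n e ((b' \<oplus> [p] \<cdot> d c) \<ominus> (b' \<oplus> [p] \<cdot> d c))"
      unfolding e_def using car c d_closed by (intro cg_minus cg_refl) auto
    then have e0: "cg n e \<zero>" using car c d_closed by (simp add: a_minus_def r_neg)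
    have b_eq: "b = b' \<oplus> [p] \<cdot> d c \<oplus> e"
      using car c d_closed by (simp add: e_def a_minus_def minus_add a_ac r_neg1 r_neg2 r_neg)
    have "s = t \<oplus>\<^bsub>T\<^esub> (\<zero>, e) \<oplus>\<^bsub>T\<^esub> [p] \<cdot>\<^bsub>T\<^esub> (c, d c)"
      using car c d_closed e by (simp add: ab T_add T_pow b_eq a_ac)
    moreover have te: "t \<oplus>\<^bsub>T\<^esub> (\<zero>, e) \<in> carrier T" using st e0 by (simp add: eps_T)
    ultimately have "r s = r (t \<oplus>\<^bsub>T\<^esub> (\<zero>, e))"
      using st c d_T by (subst r_eq) auto
    also have "\<dots> = r t \<oplus>\<^bsub>B\<^esub> r (\<zero>, e)" using st e0 by (simp add: ring_hom_add[OF r_hom] eps_T)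
    finally have "r s \<ominus>\<^bsub>B\<^esub> r t = r (\<zero>, e)"
      using st e0 ring_hom_closed[OF r_hom]
      by (simp add: eps_T a_minus_def B.a_ac B.r_neg1 B.r_neg2 B.r_neg B.a_lcomm[of "r t" "r (\<zero>, e)"])
    then have "r s \<ominus>\<^bsub>B\<^esub> r t \<in> N" using e0 by (auto simp: N_def)
    then show ?thesis unfolding U_def
      by (subst B.coset_eq_iff[OF N_ideal]) (use st ring_hom_closed[OF r_hom] in auto)
  qed
  define S where "S = reduction p A"
  define q where "q = reduction_map p A"
  have q_hom: "q \<in> ring_hom A S" unfolding q_def S_def by (rule reduction_map_hom)
  \<comment> \<open>Any representative \<open>a\<close> may be chosen: by \<open>U_eq\<close> the
    class depends only on \<open>a\<close> modulo \<open>p\<close>.\<close>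
  define u where "u s = (let a = SOME a. a \<in> carrier A \<and> q a = s in U (a, d a))" for s
  have u_q: "u (q a) = U t" if t: "t \<in> carrier T" "q (fst t) = q a" "a \<in> carrier A" for a t
  proof -
    let ?b = "SOME b. b \<in> carrier A \<and> q b = q a"
    have "?b \<in> carrier A \<and> q ?b = q a" by (rule someI[of _ a]) (use that in simp)
    then have "U (?b, d ?b) = U t" using t by (intro U_eq) (auto simp: d_T q_def)
    then show ?thesis by (simp add: u_def)
  qed
  have S_car: "carrier S = q ` carrier A" by (simp add: S_def q_def carrier_reduction)
  have fst_add: "fst (s \<oplus>\<^bsub>T\<^esub> t) = fst s \<oplus> fst t" and fst_mult: "fst (s \<otimes>\<^bsub>T\<^esub> t) = fst s \<otimes> fst t" for s t
    by (cases s; cases t; simp add: T_add T_mult)+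
  have u_hom: "u \<in> ring_hom S (B Quot N)"
  proof (rule ring_hom_memI)
    fix s assume "s \<in> carrier S"
    then obtain a where a: "a \<in> carrier A" "s = q a" by (auto simp: S_car)
    then show "u s \<in> carrier (B Quot N)"
      using u_q[of "(a, d a)" a] d_T[of a] ring_hom_closed[OF U_hom] by simp
  next
    fix s t assume "s \<in> carrier S" "t \<in> carrier S"
    then obtain a b where a: "a \<in> carrier A" "s = q a" "b \<in> carrier A" "t = q b" by (auto simp: S_car)
    have us: "u s = U (a, d a)" "u t = U (b, d b)"
      using u_q[of "(a, d a)" a] u_q[of "(b, d b)" b] d_T a by simp_all
    have "u (q (a \<oplus> b)) = U ((a, d a) \<oplus>\<^bsub>T\<^esub> (b, d b))" "u (q (a \<otimes> b)) = U ((a, d a) \<otimes>\<^bsub>T\<^esub> (b, d b))"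
      using a d_T by (intro u_q; simp add: fst_add fst_mult)+
    then show "u (s \<otimes>\<^bsub>S\<^esub> t) = u s \<otimes>\<^bsub>B Quot N\<^esub> u t" "u (s \<oplus>\<^bsub>S\<^esub> t) = u s \<oplus>\<^bsub>B Quot N\<^esub> u t"
      using a d_T us by (simp_all add: ring_hom_add[OF q_hom] ring_hom_mult[OF q_hom]
          ring_hom_add[OF U_hom] ring_hom_mult[OF U_hom])
  next
    have "u (q \<one>) = U \<one>\<^bsub>T\<^esub>" by (rule u_q, rule T.one_closed, simp_all only: T_one fst_conv one_closed)
    then show "u \<one>\<^bsub>S\<^esub> = \<one>\<^bsub>B Quot N\<^esub>" by (simp add: ring_hom_one[OF q_hom] ring_hom_one[OF U_hom])
  qed
  have iota_T: "(\<iota> w, \<zero>) \<in> carrier T" if "w \<in> carrier W" for w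
    using d that by (auto simp: T_car der_mod_def intro: cg_sym)
  \<comment> \<open>The \<open>W\<close>-algebra structure of \<open>B\<close>; the pair lies in
    \<open>T\<close> because \<open>d\<close> kills \<open>\<iota> w\<close> modulo
    \<open>p ^ n\<close>.\<close>
  define \<psi> where "\<psi> w = r (\<iota> w, \<zero>)" for w
  have psi_hom: "\<psi> \<in> ring_hom W B"
  proof (rule ring_hom_memI)
    fix w v assume w: "w \<in> carrier W" "v \<in> carrier W"
    show "\<psi> w \<in> carrier B" using iota_T[OF w(1)] ring_hom_closed[OF r_hom] by (simp add: \<psi>_def)
    have "(\<iota> (w \<otimes>\<^bsub>W\<^esub> v), \<zero>) = (\<iota> w, \<zero>) \<otimes>\<^bsub>T\<^esub> (\<iota> v, \<zero>)" "(\<iota> (w \<oplus>\<^bsub>W\<^esub> v), \<zero>) = (\<iota> w, \<zero>) \<oplus>\<^bsub>T\<^esub> (\<iota> v, \<zero>)"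
      using w by (simp_all add: T_mult T_add ring_hom_mult[OF iota_hom] ring_hom_add[OF iota_hom])
    then show "\<psi> (w \<otimes>\<^bsub>W\<^esub> v) = \<psi> w \<otimes>\<^bsub>B\<^esub> \<psi> v" "\<psi> (w \<oplus>\<^bsub>W\<^esub> v) = \<psi> w \<oplus>\<^bsub>B\<^esub> \<psi> v"
      using iota_T w by (simp_all add: \<psi>_def ring_hom_mult[OF r_hom] ring_hom_add[OF r_hom])
  next
    show "\<psi> \<one>\<^bsub>W\<^esub> = \<one>\<^bsub>B\<^esub>"
      by (simp add: \<psi>_def ring_hom_one[OF iota_hom] T_one[symmetric] ring_hom_one[OF r_hom])
  qed
  have pB: "[p] \<cdot>\<^bsub>B\<^esub> \<one>\<^bsub>B\<^esub> = \<zero>\<^bsub>B\<^esub>"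
  proof -
    have "[p] \<cdot>\<^bsub>B\<^esub> \<one>\<^bsub>B\<^esub> = r ([p] \<cdot>\<^bsub>T\<^esub> \<one>\<^bsub>T\<^esub>)"
      using ring_hom_add_pow[OF T.ring_axioms B.ring_axioms r_hom T.one_closed, of p]
      by (simp add: ring_hom_one[OF r_hom])
    also have "\<dots> = \<zero>\<^bsub>B\<^esub>"
      unfolding r_def B_def by (subst T.reduction_map_zero_iff) (auto intro: T.int_idealI)
    finally show ?thesis .
  qed
  have NN: "\<forall>a\<in>N. \<forall>b\<in>N. a \<otimes>\<^bsub>B\<^esub> b = \<zero>\<^bsub>B\<^esub>"
  proof (intro ballI)
    fix y z assume "y \<in> N" "z \<in> N"
    then obtain b c where b: "cg n b \<zero>" "y = r (\<zero>, b)" "cg n c \<zero>" "z = r (\<zero>, c)" by (auto simp: N_def)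
    then have bc: "b \<in> carrier A" "c \<in> carrier A" by (auto simp: cg_def)
    have "y \<otimes>\<^bsub>B\<^esub> z = r ((\<zero>, b) \<otimes>\<^bsub>T\<^esub> (\<zero>, c))"
      using b by (simp add: eps_T ring_hom_mult[OF r_hom])
    also have "(\<zero>, b) \<otimes>\<^bsub>T\<^esub> (\<zero>, c) = \<zero>\<^bsub>T\<^esub>" using bc by (simp add: T_mult T_zero)
    finally show "y \<otimes>\<^bsub>B\<^esub> z = \<zero>\<^bsub>B\<^esub>"
      using ring_hom_zero[OF r_hom T.ring_axioms B.ring_axioms] by simp
  qed
  have u_psi: "\<forall>w\<in>carrier W. u (q (\<iota> w)) = N +>\<^bsub>B\<^esub> \<psi> w"
    using u_q iota_T by (auto simp: \<psi>_def U_def[symmetric])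
  obtain u' where u': "u' \<in> ring_hom S B" "\<forall>w\<in>carrier W. u' (q (\<iota> w)) = \<psi> w"
    "\<forall>s\<in>carrier S. N +>\<^bsub>B\<^esub> u' s = u s"
    using smooth[unfolded formally_smooth_mod_def, rule_format, of B \<psi> N u] B.cring_axioms psi_hom pB
      N_ideal NN u_hom u_psi unfolding q_def S_def by blast
  have lift_ex: "\<exists>b. (a, b) \<in> carrier T \<and> r (a, b) = u' (q a)" if a: "a \<in> carrier A" for a
  proof -
    have qa: "q a \<in> carrier S" using a by (simp add: S_car)
    have "N +>\<^bsub>B\<^esub> u' (q a) = N +>\<^bsub>B\<^esub> r (a, d a)"
      using u'(3) qa u_q[of "(a, d a)" a] d_T[OF a] a by (simp add: U_def)
    then have "u' (q a) \<ominus>\<^bsub>B\<^esub> r (a, d a) \<in> N"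
      using B.coset_eq_iff[OF N_ideal ring_hom_closed[OF u'(1) qa] ring_hom_closed[OF r_hom d_T[OF a]]] by simp
    then obtain b where b: "cg n b \<zero>" "u' (q a) \<ominus>\<^bsub>B\<^esub> r (a, d a) = r (\<zero>, b)" by (auto simp: N_def)
    have "u' (q a) = r (\<zero>, b) \<oplus>\<^bsub>B\<^esub> r (a, d a)"
      using ring_hom_closed[OF u'(1) qa] ring_hom_closed[OF r_hom d_T[OF a]]
      by (simp add: b(2)[symmetric] a_minus_def B.a_assoc B.l_neg)
    also have "\<dots> = r (a, b \<oplus> d a)"
      using b d_T[OF a] a by (subst ring_hom_add[OF r_hom, symmetric]) (auto simp: eps_T T_add)
    finally show ?thesis
      using b d_T[OF a] a T.a_closed[of "(\<zero>, b)" "(a, d a)"] by (intro exI[of _ "b \<oplus> d a"]) (auto simp: T_add eps_T)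
  qed
  define d' where "d' a = (SOME b. (a, b) \<in> carrier T \<and> r (a, b) = u' (q a))" for a
  have d': "(a, d' a) \<in> carrier T" "r (a, d' a) = u' (q a)" if "a \<in> carrier A" for a
    using someI_ex[OF lift_ex[OF that]] by (auto simp: d'_def)
  \<comment> \<open>Equal classes differ by \<open>p\<close> times some \<open>(c, e)\<close> with
    \<open>[p] \<cdot> c = \<zero>\<close>, so \<open>c\<close> is zero by torsion-freeness and
    \<open>p ^ n\<close> divides \<open>e\<close>. The additional factor \<open>p\<close> in front
    of \<open>e\<close> is the gain from \<open>n\<close> to \<open>Suc n\<close>.\<close>
  have uniq: "cg (Suc n) b b'" if bT: "(a, b) \<in> carrier T" "(a, b') \<in> carrier T" "r (a, b) = r (a, b')" for a b b'
  proof -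
    obtain c e where ce: "(c, e) \<in> carrier T" "(a, b) = (a, b') \<oplus>\<^bsub>T\<^esub> [p] \<cdot>\<^bsub>T\<^esub> (c, e)"
      using r_eq[OF bT(1,2)] bT(3) by auto
    then have car: "a \<in> carrier A" "c \<in> carrier A" "e \<in> carrier A" "b' \<in> carrier A" "b \<in> carrier A"
      using bT(1,2) ce(1) unfolding T_car by blast+
    from ce have eq: "a = a \<oplus> [p] \<cdot> c" "b = b' \<oplus> [p] \<cdot> e" by (auto simp: T_pow T_add)
    then have "[p] \<cdot> c = \<zero>" using car add.l_cancel_one'[of a "[p] \<cdot> c"] by blast
    then have "c = \<zero>" using p_torsion_free car by simp
    then have "cg n e \<zero>" using ce eps_T by simp
    then obtain g where "g \<in> carrier A" "e = [(p ^ n)] \<cdot> g" by (auto simp: cg_def)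
    then show ?thesis using car eq by (auto simp: cg_def add_pow_mult intro!: bexI[of _ g])
  qed
  have "der_mod (Suc n) d'"
    unfolding der_mod_def
  proof (intro conjI ballI)
    fix a b assume ab: "a \<in> carrier A" "b \<in> carrier A"
    note * = d'[OF ab(1)] d'[OF ab(2)]
    have q: "q a \<in> carrier S" "q b \<in> carrier S" using ab by (auto simp: S_car)
    have "r (a \<oplus> b, d' (a \<oplus> b)) = r ((a, d' a) \<oplus>\<^bsub>T\<^esub> (b, d' b))"
      using * ab q d'(2)[of "a \<oplus> b"]
      by (simp only: ring_hom_add[OF r_hom] ring_hom_add[OF u'(1)] ring_hom_add[OF q_hom] add.m_closed)
    then show "cg (Suc n) (d' (a \<oplus> b)) (d' a \<oplus> d' b)"
      using *(1,3) ab T.a_closed[OF *(1,3)] d'(1)[of "a \<oplus> b"] by (intro uniq[of "a \<oplus> b"]) (auto simp: T_add)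
    have "r (a \<otimes> b, d' (a \<otimes> b)) = r ((a, d' a) \<otimes>\<^bsub>T\<^esub> (b, d' b))"
      using * ab q d'(2)[of "a \<otimes> b"]
      by (simp only: ring_hom_mult[OF r_hom] ring_hom_mult[OF u'(1)] ring_hom_mult[OF q_hom] m_closed)
    then show "cg (Suc n) (d' (a \<otimes> b)) (a \<otimes> d' b \<oplus> d' a \<otimes> b)"
      using *(1,3) ab T.m_closed[OF *(1,3)] d'(1)[of "a \<otimes> b"] by (intro uniq[of "a \<otimes> b"]) (auto simp: T_mult)
  next
    fix w assume w: "w \<in> carrier W"
    show "cg (Suc n) (d' (\<iota> w)) \<zero>"
      using u'(2) w d'[of "\<iota> w"] iota_T[OF w] by (intro uniq[of "\<iota> w"]) (auto simp: \<psi>_def)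
  qed (use d'(1) in \<open>auto simp: T_car\<close>)
  moreover have "cg n (d' a) (d a)" if "a \<in> carrier A" for a using d'(1)[OF that] by (simp add: T_car)
  ultimately show ?thesis by blast
qed

text \<open>Infinitely many lifting steps give values that converge \<open>p\<close>-adically. The
  limit satisfies the derivation laws modulo every \<open>p ^ k\<close>, hence exactly.\<close>

lemma derivation_lift:
  assumes d: "der_mod 1 d"
  shows "\<exists>\<Delta>\<in>carrier (der_module p W \<iota> A). \<forall>a\<in>carrier A. cg 1 (\<Delta> a) (d a)"
proof -
  \<comment> \<open>\<open>f k\<close> is a derivation modulo \<open>p ^ Suc k\<close>; the shift
    lets the sequence start with \<open>d\<close> itself at \<open>k = 0\<close>.\<close>
  have "\<exists>f. \<forall>k. der_mod (Suc k) (f k) \<and> (k = 0 \<longrightarrow> f k = d) \<and> (\<forall>a\<in>carrier A. cg (Suc k) (f (Suc k) a) (f k a))"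
    by (rule dependent_nat_choice[where P = "\<lambda>k g. der_mod (Suc k) g \<and> (k = 0 \<longrightarrow> g = d)" and
        Q = "\<lambda>k g h. \<forall>a\<in>carrier A. cg (Suc k) (h a) (g a)", simplified conj_assoc])
      (use d lift_step in auto)
  then obtain f where f: "\<And>k. der_mod (Suc k) (f k)" "f 0 = d"
    "\<And>k a. a \<in> carrier A \<Longrightarrow> cg (Suc k) (f (Suc k) a) (f k a)" by metis
  have f_closed: "f k a \<in> carrier A" if "a \<in> carrier A" for k a
    using f(1)[of k] that by (simp add: der_mod_def)
  have "\<exists>b\<in>carrier A. \<forall>k. cg k b (f k a)" if "a \<in> carrier A" for a
    by (rule limit_exists) (use that f_closed cg_mono[OF f(3)] in auto)
  then obtain g where g: "\<And>a. a \<in> carrier A \<Longrightarrow> g a \<in> carrier A" "\<And>a k. a \<in> carrier A \<Longrightarrow> cg k (g a) (f k a)"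
    by metis
  have f': "der_mod k (f k)" for k
    using f(1)[of k] cg_mono[of "Suc k" _ _ k] unfolding der_mod_def by auto
  have add: "g (a \<oplus> b) = g a \<oplus> g b" if "a \<in> carrier A" "b \<in> carrier A" for a b
  proof (rule cg_all_eq)
    fix k
    have "cg k (g (a \<oplus> b)) (f k (a \<oplus> b))" using that by (simp add: g)
    also have "cg k (f k (a \<oplus> b)) (f k a \<oplus> f k b)" using f'[of k] that by (simp add: der_mod_def)
    also have "cg k (f k a \<oplus> f k b) (g a \<oplus> g b)" using that by (intro cg_add cg_sym[OF g(2)])
    finally show "cg k (g (a \<oplus> b)) (g a \<oplus> g b)" .
  qed
  have mult: "g (a \<otimes> b) = a \<otimes> g b \<oplus> g a \<otimes> b" if "a \<in> carrier A" "b \<in> carrier A" for a b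
  proof (rule cg_all_eq)
    fix k
    have "cg k (g (a \<otimes> b)) (f k (a \<otimes> b))" using that by (simp add: g)
    also have "cg k (f k (a \<otimes> b)) (a \<otimes> f k b \<oplus> f k a \<otimes> b)" using f'[of k] that by (simp add: der_mod_def)
    also have "cg k (a \<otimes> f k b \<oplus> f k a \<otimes> b) (a \<otimes> g b \<oplus> g a \<otimes> b)"
      using that by (intro cg_add cg_mult cg_refl cg_sym[OF g(2)])
    finally show "cg k (g (a \<otimes> b)) (a \<otimes> g b \<oplus> g a \<otimes> b)" .
  qed
  have iota: "g (\<iota> w) = \<zero>" if "w \<in> carrier W" for w
  proof (rule cg_all_eq)
    fix k show "cg k (g (\<iota> w)) \<zero>"
      using f'[of k] that g(2)[of "\<iota> w" k] by (auto simp: der_mod_def intro: cg_trans)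
  qed
  define \<Delta> where "\<Delta> = (\<lambda>a\<in>carrier A. g a)"
  have "\<Delta> \<in> carrier E" unfolding \<Delta>_def
    by (rule opI) (auto simp: g add mult iota)
  then have "\<Delta> \<in> carrier (der_module p W \<iota> A)"
    by (auto simp: der_module_def \<Delta>_def mult)
  moreover have "cg 1 (\<Delta> a) (d a)" if "a \<in> carrier A" for a
  proof -
    have "cg 1 (g a) (f 1 a)" by (rule g(2)[OF that])
    also have "cg 1 (f 1 a) (f 0 a)" using f(3)[OF that, of 0] by simp
    finally show ?thesis using that f(2) by (simp add: \<Delta>_def)
  qed
  ultimately show ?thesis by blast
qed

end

section \<open>Finite sums, differences and ordered products\<close>

context abelian_monoid
begin

lemma finsum_single:
  assumes "finite F" "i \<in> F" "\<And>j. j \<in> F \<Longrightarrow> j \<noteq> i \<Longrightarrow> f j = \<zero>" "f i \<in> carrier G"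
  shows "finsum G f F = f i"
proof -
  have "finsum G f F = finsum G f (insert i (F - {i}))" using assms(2) by (simp add: insert_absorb)
  also have "\<dots> = f i \<oplus> finsum G f (F - {i})"
    using assms by (subst finsum_insert) (auto simp: Pi_def)
  also have "finsum G f (F - {i}) = \<zero>" using assms by (intro add.finprod_one_eqI) auto
  finally show ?thesis using assms by simp
qed

lemma finsum_mono_neutral:
  assumes "finite F" "H \<subseteq> F" "\<And>i. i \<in> F - H \<Longrightarrow> f i = \<zero>" "\<And>i. i \<in> H \<Longrightarrow> f i \<in> carrier G"
  shows "finsum G f F = finsum G f H"
proof -
  have "f \<in> F \<rightarrow> carrier G" using assms by (metis DiffI Pi_I zero_closed)
  with assms show ?thesis
    by (intro add.finprod_mono_neutral_cong_left[symmetric]) auto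
qed

lemma finsum_neutral: "(\<And>i. i \<in> F \<Longrightarrow> f i = \<zero>) \<Longrightarrow> finsum G f F = \<zero>"
  by (rule add.finprod_one_eqI)

end

context abelian_group
begin

lemma minus_cancel_left: "a \<in> carrier G \<Longrightarrow> b \<in> carrier G \<Longrightarrow> (a \<oplus> b) \<ominus> a = b"
  by (simp add: a_minus_def a_comm[of a b] a_assoc r_neg)

lemma minus_add_cancel: "a \<in> carrier G \<Longrightarrow> b \<in> carrier G \<Longrightarrow> (a \<ominus> b) \<oplus> b = a"
  by (simp add: a_minus_def a_assoc l_neg)

lemma minus_self: "a \<in> carrier G \<Longrightarrow> a \<ominus> a = \<zero>"
  by (simp add: a_minus_def r_neg)

lemma add_diff_add: 
  "a \<in> carrier G \<Longrightarrow> b \<in> carrier G \<Longrightarrow> c \<in> carrier G \<Longrightarrow> d \<in> carrier G \<Longrightarrow>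
    (a \<oplus> b) \<ominus> (c \<oplus> d) = (a \<ominus> c) \<oplus> (b \<ominus> d)"
  by (simp add: a_minus_def minus_add a_ac)

text \<open>In the commutator of two derivations, \<open>b\<close> and \<open>c\<close> are the
  mixed terms that occur in both compositions and cancel.\<close>

lemma minus_cancel_cross:
  assumes "a \<in> carrier G" "b \<in> carrier G" "c \<in> carrier G" "d \<in> carrier G" "e \<in> carrier G" "f \<in> carrier G"
  shows "((a \<oplus> b) \<oplus> (c \<oplus> d)) \<ominus> ((e \<oplus> c) \<oplus> (b \<oplus> f)) = (a \<ominus> e) \<oplus> (d \<ominus> f)"
proof -
  have "((a \<oplus> b) \<oplus> (c \<oplus> d)) \<ominus> ((e \<oplus> c) \<oplus> (b \<oplus> f)) =
    ((a \<oplus> d) \<oplus> (b \<oplus> c)) \<ominus> ((e \<oplus> f) \<oplus> (b \<oplus> c))" using assms by (simp add: a_ac)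
  also have "\<dots> = ((a \<oplus> d) \<ominus> (e \<oplus> f)) \<oplus> ((b \<oplus> c) \<ominus> (b \<oplus> c))"
    using assms by (subst add_diff_add) auto
  also have "\<dots> = (a \<ominus> e) \<oplus> (d \<ominus> f)"
    using assms by (simp add: minus_self add_diff_add)
  finally show ?thesis .
qed

end

context monoid
begin

text \<open>Agrees with \<open>multi_power\<close> on \<open>[0..<n]\<close>; arbitrary lists of
  indices make induction over the factors possible.\<close>

abbreviation list_power :: "(nat \<Rightarrow> 'a) \<Rightarrow> (nat \<Rightarrow> nat) \<Rightarrow> nat list \<Rightarrow> 'a" where
  "list_power e I js \<equiv> foldr (\<lambda>j r. e j [^] I j \<otimes> r) js \<one>"

lemma list_power_closed [intro]:
  "(\<And>j. j \<in> set js \<Longrightarrow> e j \<in> carrier G) \<Longrightarrow> list_power e I js \<in> carrier G"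
  by (induction js) auto

lemma list_power_cong:
  "(\<And>j. j \<in> set js \<Longrightarrow> I j = I' j) \<Longrightarrow> list_power e I js = list_power e I' js"
  by (induction js) auto

lemma pow_comm:
  "x \<in> carrier G \<Longrightarrow> y \<in> carrier G \<Longrightarrow> x \<otimes> y = y \<otimes> x \<Longrightarrow> x [^] (k::nat) \<otimes> y = y \<otimes> x [^] k"
proof (induction k)
  case (Suc k)
  then show ?case by (metis m_assoc nat_pow_Suc nat_pow_closed)
qed simp

lemma list_power_comm:
  assumes "y \<in> carrier G" "\<And>j. j \<in> set js \<Longrightarrow> e j \<in> carrier G" "\<And>j. j \<in> set js \<Longrightarrow> e j \<otimes> y = y \<otimes> e j"
  shows "list_power e I js \<otimes> y = y \<otimes> list_power e I js"
  using assms
proof (induction js)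
  case (Cons j js)
  have c: "list_power e I js \<in> carrier G" using Cons.prems by auto
  have "e j [^] I j \<otimes> list_power e I js \<otimes> y = e j [^] I j \<otimes> (y \<otimes> list_power e I js)"
    using Cons c by (simp add: m_assoc)
  also have "\<dots> = (y \<otimes> e j [^] I j) \<otimes> list_power e I js"
    using Cons.prems c pow_comm[of "e j" y "I j"] by (simp add: m_assoc[symmetric])
  finally show ?case using Cons.prems c by (simp add: m_assoc)
qed simp

lemma list_power_Suc:
  assumes "j \<in> set js" "distinct js" "\<And>i. i \<in> set js \<Longrightarrow> e i \<in> carrier G"
    "\<And>i. i \<in> set js \<Longrightarrow> e i \<otimes> e j = e j \<otimes> e i"
  shows "list_power e (I(j := Suc (I j))) js = e j \<otimes> list_power e I js"
  using assms
proof (induction js)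
  case (Cons a js)
  have c: "list_power e I js \<in> carrier G" "e a \<in> carrier G" "e j \<in> carrier G" using Cons.prems by auto
  show ?case
  proof (cases "a = j")
    case True
    then have "list_power e (I(j := Suc (I j))) js = list_power e I js"
      using Cons.prems by (intro list_power_cong) auto
    then show ?thesis using True c pow_comm[of "e j" "e j" "I j"] by (simp add: m_assoc[symmetric])
  next
    case False
    then have "list_power e (I(j := Suc (I j))) js = e j \<otimes> list_power e I js"
      using Cons by auto
    moreover have "e a [^] I a \<otimes> e j = e j \<otimes> e a [^] I a" using Cons.prems c by (intro pow_comm) auto
    ultimately show ?thesis using False c by (simp add: m_assoc[symmetric])
  qed
qed simp

end

lemma multi_power_eq: "multi_power R n e I = monoid.list_power R e I [0..<n]"
  by (simp add: multi_power_def)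

section \<open>Division of operators by integers, derivations and the Leibniz rule\<close>

context formal_scheme
begin

lemma E_cancel:
  assumes "m \<noteq> 0" "\<Phi> \<in> carrier E" "\<Psi> \<in> carrier E" "[(m::nat)] \<cdot>\<^bsub>E\<^esub> \<Phi> = [m] \<cdot>\<^bsub>E\<^esub> \<Psi>"
  shows "\<Phi> = \<Psi>"
proof (rule op_eqI[OF assms(2,3)])
  fix a assume a: "a \<in> carrier A"
  have "[m] \<cdot> \<Phi> a = [m] \<cdot> \<Psi> a" using arg_cong[OF assms(4), of "\<lambda>f. f a"] a by simp
  then show "\<Phi> a = \<Psi> a" by (rule torsion_free_cancel[rotated 3]) (use assms a in auto)
qed

lemma E_torsion_free:
  assumes "m \<noteq> 0" "\<Phi> \<in> carrier E" "[(m::nat)] \<cdot>\<^bsub>E\<^esub> \<Phi> = \<zero>\<^bsub>E\<^esub>"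
  shows "\<Phi> = \<zero>\<^bsub>E\<^esub>"
  by (rule E_cancel[OF assms(1,2)]) (use assms(3) in simp_all)

text \<open>Brackets are compatible with multiples and \<open>E\<close> has no torsion, so dividing
  an operator by an integer does not raise its order.\<close>

lemma ord_add_pow_cancel:
  "m \<noteq> 0 \<Longrightarrow> \<Phi> \<in> carrier E \<Longrightarrow> ord_lt k ([(m::nat)] \<cdot>\<^bsub>E\<^esub> \<Phi>) \<Longrightarrow> ord_lt k \<Phi>"
  by (induction k arbitrary: \<Phi>) (auto simp: ad_add_pow intro: E_torsion_free)

text \<open>Quotients by \<open>m\<close> are unique in the absence of torsion, so the pointwise
  quotient inherits additivity and \<open>W\<close>-linearity.\<close>

lemma op_divide:
  assumes "m \<noteq> 0" "\<Phi> \<in> carrier E" "\<And>a. a \<in> carrier A \<Longrightarrow> \<exists>b\<in>carrier A. \<Phi> a = [(m::nat)] \<cdot> b"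
  shows "\<exists>\<Psi>\<in>carrier E. [m] \<cdot>\<^bsub>E\<^esub> \<Psi> = \<Phi>"
proof -
  obtain g where g: "\<And>a. a \<in> carrier A \<Longrightarrow> g a \<in> carrier A" "\<And>a. a \<in> carrier A \<Longrightarrow> \<Phi> a = [m] \<cdot> g a"
    using assms(3) by metis
  have "(\<lambda>a\<in>carrier A. g a) \<in> carrier E"
  proof (rule opI)
    fix a b assume ab: "a \<in> carrier A" "b \<in> carrier A"
    have "[m] \<cdot> g (a \<oplus> b) = [m] \<cdot> (g a \<oplus> g b)"
      using ab g op_add[OF assms(2) ab] by (simp only: add_pow_distrib add.m_closed)
    then show "g (a \<oplus> b) = g a \<oplus> g b" by (rule torsion_free_cancel[rotated 3]) (use ab g assms in auto)
  next
    fix w a assume ab: "w \<in> carrier W" "a \<in> carrier A"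
    have "[m] \<cdot> g (\<iota> w \<otimes> a) = [m] \<cdot> (\<iota> w \<otimes> g a)"
      using ab g op_lin[OF assms(2) ab] by (simp only: add_pow_rdistr m_closed iota_closed)
    then show "g (\<iota> w \<otimes> a) = \<iota> w \<otimes> g a" by (rule torsion_free_cancel[rotated 3]) (use ab g assms in auto)
  qed (rule g)
  moreover have "[m] \<cdot>\<^bsub>E\<^esub> (\<lambda>a\<in>carrier A. g a) = \<Phi>"
    by (rule op_eqI) (use calculation assms(2) g in auto)
  ultimately show ?thesis by blast
qed

definition Der :: "('a \<Rightarrow> 'a) set" where
  "Der = {\<Delta> \<in> carrier E. \<forall>a\<in>carrier A. \<forall>b\<in>carrier A. \<Delta> (a \<otimes> b) = a \<otimes> \<Delta> b \<oplus> \<Delta> a \<otimes> b}"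

lemma Der_eq: "carrier (der_module p W \<iota> A) = Der"
  by (simp add: der_module_def Der_def)

lemma Der_E [simp]: "\<Delta> \<in> Der \<Longrightarrow> \<Delta> \<in> carrier E" by (simp add: Der_def)

lemma Der_mult: "\<Delta> \<in> Der \<Longrightarrow> a \<in> carrier A \<Longrightarrow> b \<in> carrier A \<Longrightarrow> \<Delta> (a \<otimes> b) = a \<otimes> \<Delta> b \<oplus> \<Delta> a \<otimes> b"
  unfolding Der_def by blast

lemma DerI: "\<Delta> \<in> carrier E \<Longrightarrow>
    (\<And>a b. a \<in> carrier A \<Longrightarrow> b \<in> carrier A \<Longrightarrow> \<Delta> (a \<otimes> b) = a \<otimes> \<Delta> b \<oplus> \<Delta> a \<otimes> b) \<Longrightarrow> \<Delta> \<in> Der"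
  unfolding Der_def by blast

lemma Der_one: "\<Delta> \<in> Der \<Longrightarrow> \<Delta> \<one> = \<zero>"
proof -
  assume \<Delta>: "\<Delta> \<in> Der"
  then have c: "\<Delta> \<one> \<in> carrier A" by simp
  have "\<Delta> (\<one> \<otimes> \<one>) = \<one> \<otimes> \<Delta> \<one> \<oplus> \<Delta> \<one> \<otimes> \<one>" by (rule Der_mult[OF \<Delta>]) auto
  then have "\<Delta> \<one> = \<Delta> \<one> \<oplus> \<Delta> \<one>" unfolding l_one[OF c] r_one[OF c] l_one[OF one_closed] .
  then show ?thesis using add.l_cancel_one'[OF c c] by blast
qed

lemma Der_ad: "\<Delta> \<in> Der \<Longrightarrow> b \<in> carrier A \<Longrightarrow> ad \<Delta> b = \<mu> (\<Delta> b)"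
  by (rule op_eqI) (simp_all add: ad_apply Der_mult minus_cancel_left)

lemma Der_commutator:
  assumes "\<Delta> \<in> Der" "\<Delta>' \<in> Der"
  shows "\<Delta> \<otimes>\<^bsub>E\<^esub> \<Delta>' \<ominus>\<^bsub>E\<^esub> \<Delta>' \<otimes>\<^bsub>E\<^esub> \<Delta> \<in> Der"
proof -
  have "\<Delta> (\<Delta>' (a \<otimes> b)) \<ominus> \<Delta>' (\<Delta> (a \<otimes> b)) =
    a \<otimes> (\<Delta> (\<Delta>' b) \<ominus> \<Delta>' (\<Delta> b)) \<oplus> (\<Delta> (\<Delta>' a) \<ominus> \<Delta>' (\<Delta> a)) \<otimes> b"
    if ab: "a \<in> carrier A" "b \<in> carrier A" for a b
  proof -
    have *: "\<Delta> (\<Delta>' (a \<otimes> b)) = (a \<otimes> \<Delta> (\<Delta>' b) \<oplus> \<Delta> a \<otimes> \<Delta>' b) \<oplus> (\<Delta>' a \<otimes> \<Delta> b \<oplus> \<Delta> (\<Delta>' a) \<otimes> b)"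
      "\<Delta>' (\<Delta> (a \<otimes> b)) = (a \<otimes> \<Delta>' (\<Delta> b) \<oplus> \<Delta>' a \<otimes> \<Delta> b) \<oplus> (\<Delta> a \<otimes> \<Delta>' b \<oplus> \<Delta>' (\<Delta> a) \<otimes> b)"
      using assms ab by (simp_all add: Der_mult op_add)
    have cl: "\<Delta> a \<in> carrier A" "\<Delta> b \<in> carrier A" "\<Delta>' a \<in> carrier A" "\<Delta>' b \<in> carrier A"
      "\<Delta> (\<Delta>' a) \<in> carrier A" "\<Delta> (\<Delta>' b) \<in> carrier A" "\<Delta>' (\<Delta> a) \<in> carrier A" "\<Delta>' (\<Delta> b) \<in> carrier A"
      using assms ab by auto
    show ?thesis unfolding * using cl ab
      by (subst minus_cancel_cross) (simp_all add: a_minus_def l_distr r_distr l_minus r_minus)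
  qed
  then show ?thesis using assms by (intro DerI) auto
qed

lemma smult_eq: "c \<in> carrier A \<Longrightarrow> \<Phi> \<in> carrier E \<Longrightarrow> c \<odot>\<^bsub>E\<^esub> \<Phi> = \<mu> c \<otimes>\<^bsub>E\<^esub> \<Phi>"
proof -
  assume *: "c \<in> carrier A" "\<Phi> \<in> carrier E"
  have "c \<odot>\<^bsub>E\<^esub> \<Phi> = (\<lambda>a\<in>carrier A. c \<otimes> \<Phi> a)" by (simp add: op_alg_def)
  moreover have "\<mu> c \<otimes>\<^bsub>E\<^esub> \<Phi> = (\<lambda>a\<in>carrier A. \<mu> c (\<Phi> a))" by (rule op_mult_eq)
  ultimately show ?thesis using * by (auto intro: restrict_ext)
qed

lemma Leibniz:
  assumes \<Delta>: "\<Delta> \<in> Der" and ab: "a \<in> carrier A" "b \<in> carrier A"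
  shows "(\<Delta> [^]\<^bsub>E\<^esub> m) (a \<otimes> b) =
    (\<Oplus>k\<in>{..m}. [(m choose k)] \<cdot> ((\<Delta> [^]\<^bsub>E\<^esub> k) a \<otimes> (\<Delta> [^]\<^bsub>E\<^esub> (m - k)) b))"
proof (induction m)
  case 0
  then show ?case using ab by simp
next
  case (Suc m)
  define u v where "u k = (\<Delta> [^]\<^bsub>E\<^esub> k) a" and "v k = (\<Delta> [^]\<^bsub>E\<^esub> k) b" for k :: nat
  have cl: "u k \<in> carrier A" "v k \<in> carrier A" for k using \<Delta> ab by (auto simp: u_def v_def)
  have step: "\<Delta> (u k) = u (Suc k)" "\<Delta> (v k) = v (Suc k)" for k
    using \<Delta> ab E.nat_pow_Suc2[of \<Delta> k] by (auto simp: u_def v_def simp del: E.nat_pow_Suc)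
  have sum: "\<Delta> (\<Oplus>k\<in>F. f k) = (\<Oplus>k\<in>F. \<Delta> (f k))" if "f \<in> F \<rightarrow> carrier A" for F :: "nat set" and f
    using that by (induction F rule: infinite_finite_induct) (use \<Delta> in \<open>auto simp: op_add Pi_def\<close>)
  have "(\<Delta> [^]\<^bsub>E\<^esub> Suc m) (a \<otimes> b) = \<Delta> ((\<Delta> [^]\<^bsub>E\<^esub> m) (a \<otimes> b))"
    using \<Delta> ab E.nat_pow_Suc2[of \<Delta> m] by (simp del: E.nat_pow_Suc)
  also have "\<dots> = \<Delta> (\<Oplus>k\<in>{..m}. [(m choose k)] \<cdot> (u k \<otimes> v (m - k)))"
    unfolding Suc.IH u_def v_def ..
  also have "\<dots> = (\<Oplus>k\<in>{..m}. \<Delta> ([(m choose k)] \<cdot> (u k \<otimes> v (m - k))))"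
    by (rule sum) (auto simp: cl)
  also have "\<dots> = (\<Oplus>k\<in>{..m}. [(m choose k)] \<cdot> (u (Suc k) \<otimes> v (m - k)) \<oplus> [(m choose k)] \<cdot> (u k \<otimes> v (Suc m - k)))"
    using \<Delta> by (intro finsum_cong') (auto simp: op_add_pow cl Der_mult step add_pow_distrib Suc_diff_le a_comm)
  also have "\<dots> = (\<Oplus>k\<in>{..m}. [(m choose k)] \<cdot> (u (Suc k) \<otimes> v (m - k))) \<oplus>
      (\<Oplus>k\<in>{..m}. [(m choose k)] \<cdot> (u k \<otimes> v (Suc m - k)))"
    by (rule finsum_addf) (auto simp: cl)
  \<comment> \<open>The added summand \<open>k = Suc m\<close> has binomial coefficient 0. With it
    the sum can be shifted by one and combined with the first sum by Pascal's rule.\<close>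
  also have "(\<Oplus>k\<in>{..m}. [(m choose k)] \<cdot> (u k \<otimes> v (Suc m - k))) =
      (\<Oplus>k\<in>{..Suc m}. [(m choose k)] \<cdot> (u k \<otimes> v (Suc m - k)))"
    by (subst finsum_Suc) (auto simp: cl binomial_eq_0)
  also have "\<dots> = (\<Oplus>k\<in>{..m}. [(m choose Suc k)] \<cdot> (u (Suc k) \<otimes> v (m - k))) \<oplus> u 0 \<otimes> v (Suc m)"
    by (subst finsum_Suc2) (auto simp: cl)
  also have "(\<Oplus>k\<in>{..m}. [(m choose k)] \<cdot> (u (Suc k) \<otimes> v (m - k))) \<oplus> \<dots> =
      ((\<Oplus>k\<in>{..m}. [(m choose k)] \<cdot> (u (Suc k) \<otimes> v (m - k))) \<oplus>
      (\<Oplus>k\<in>{..m}. [(m choose Suc k)] \<cdot> (u (Suc k) \<otimes> v (m - k)))) \<oplus> u 0 \<otimes> v (Suc m)"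
    by (rule a_assoc[symmetric]) (auto simp: cl intro!: finsum_closed)
  also have "(\<Oplus>k\<in>{..m}. [(m choose k)] \<cdot> (u (Suc k) \<otimes> v (m - k))) \<oplus>
      (\<Oplus>k\<in>{..m}. [(m choose Suc k)] \<cdot> (u (Suc k) \<otimes> v (m - k))) =
      (\<Oplus>k\<in>{..m}. [(m choose k)] \<cdot> (u (Suc k) \<otimes> v (m - k)) \<oplus> [(m choose Suc k)] \<cdot> (u (Suc k) \<otimes> v (m - k)))"
    by (rule finsum_addf[symmetric]) (auto simp: cl)
  also have "\<dots> = (\<Oplus>k\<in>{..m}. [(Suc m choose Suc k)] \<cdot> (u (Suc k) \<otimes> v (Suc m - Suc k)))"
    by (intro finsum_cong') (auto simp: cl add.nat_pow_mult)
  also have "\<dots> \<oplus> u 0 \<otimes> v (Suc m) = (\<Oplus>k\<in>{..Suc m}. [(Suc m choose k)] \<cdot> (u k \<otimes> v (Suc m - k)))"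
    by (rule sym, subst finsum_Suc2) (auto simp: cl)
  finally show ?case unfolding u_def v_def .
qed

lemma cg_finsum:
  assumes "\<And>i. i \<in> F \<Longrightarrow> cg m (f i) (g i)"
  shows "cg m (\<Oplus>i\<in>F. f i) (\<Oplus>i\<in>F. g i)"
  using assms
proof (induction F rule: infinite_finite_induct)
  case (insert i F)
  then have "f \<in> insert i F \<rightarrow> carrier A" "g \<in> insert i F \<rightarrow> carrier A" by (auto simp: cg_def)
  with insert show ?case by (auto simp: Pi_def intro: cg_add)
qed (auto simp: finsum_infinite intro: cg_refl)

lemma p_gt_1: "p > 1" by (rule prime_gt_1_nat[OF p_prime])

text \<open>By Leibniz all mixed terms carry a binomial coefficient divisible by \<open>p\<close>,
  so modulo \<open>p\<close> only the two outer terms survive.\<close>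

lemma Der_pow_p:
  assumes \<Delta>: "\<Delta> \<in> Der"
  shows "der_mod 1 (\<Delta> [^]\<^bsub>E\<^esub> p)"
  unfolding der_mod_def
proof (intro conjI ballI)
  let ?P = "\<Delta> [^]\<^bsub>E\<^esub> p"
  have P: "?P \<in> carrier E" using \<Delta> by simp
  fix a b assume ab: "a \<in> carrier A" "b \<in> carrier A"
  show "cg 1 (?P (a \<oplus> b)) (?P a \<oplus> ?P b)" using ab P by (simp add: op_add cg_refl)
  define t where "t k = [(p choose k)] \<cdot> ((\<Delta> [^]\<^bsub>E\<^esub> k) a \<otimes> (\<Delta> [^]\<^bsub>E\<^esub> (p - k)) b)" for k
  define s where "s k = (if k = 0 then a \<otimes> ?P b else if k = p then ?P a \<otimes> b else \<zero>)" for k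
  have s_closed: "s k \<in> carrier A" for k using ab P by (simp add: s_def)
  have "?P (a \<otimes> b) = (\<Oplus>k\<in>{..p}. t k)" unfolding t_def by (rule Leibniz[OF \<Delta> ab])
  also have "cg 1 \<dots> (\<Oplus>k\<in>{..p}. s k)"
  proof (rule cg_finsum)
    fix k assume k: "k \<in> {..p}"
    show "cg 1 (t k) (s k)"
    proof (cases "k = 0 \<or> k = p")
      case True
      then show ?thesis using ab P p_gt_1 by (auto simp: t_def s_def cg_refl)
    next
      case False
      then have "p dvd (p choose k)" using k p_prime by (intro dvd_choose_prime) auto
      then obtain c where "p choose k = p * c" by (elim dvdE)
      then have "t k = [p] \<cdot> ([c] \<cdot> ((\<Delta> [^]\<^bsub>E\<^esub> k) a \<otimes> (\<Delta> [^]\<^bsub>E\<^esub> (p - k)) b))"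
        using ab \<Delta> by (simp add: t_def add_pow_mult)
      then show ?thesis using False cg_zero_add_pow[of _ 1] ab \<Delta> by (simp add: s_def)
    qed
  qed
  also have "(\<Oplus>k\<in>{..p}. s k) = (\<Oplus>k\<in>{0, p}. s k)"
    by (rule finsum_mono_neutral) (auto simp: s_def ab P)
  also have "\<dots> = a \<otimes> ?P b \<oplus> ?P a \<otimes> b"
    using p_gt_1 ab P by (simp add: s_def)
  finally show "cg 1 (?P (a \<otimes> b)) (a \<otimes> ?P b \<oplus> ?P a \<otimes> b)" .
next
  fix w assume w: "w \<in> carrier W"
  have "(\<Delta> [^]\<^bsub>E\<^esub> p) (\<iota> w) = (\<Delta> [^]\<^bsub>E\<^esub> p) (\<iota> w \<otimes> \<one>)" using w by simp
  also have "\<dots> = \<iota> w \<otimes> (\<Delta> [^]\<^bsub>E\<^esub> p) \<one>" using w \<Delta> by (intro op_lin) auto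
  also have "(\<Delta> [^]\<^bsub>E\<^esub> p) \<one> = (\<Delta> [^]\<^bsub>E\<^esub> (p - 1)) (\<Delta> \<one>)"
    using p_gt_1 E.nat_pow_Suc[of \<Delta> "p - 1"] by simp
  also have "\<dots> = \<zero>" using \<Delta> by (simp add: Der_one)
  finally show "cg 1 ((\<Delta> [^]\<^bsub>E\<^esub> p) (\<iota> w)) \<zero>" using w by (simp add: cg_refl)
qed (use \<Delta> in auto)

lemma ord_Der: "\<Delta> \<in> Der \<Longrightarrow> ord_lt 2 \<Delta>"
  by (simp add: numeral_2_eq_2 Der_ad ad_mu)

lemma ord_pow: "\<Delta> \<in> Der \<Longrightarrow> ord_lt (Suc m) (\<Delta> [^]\<^bsub>E\<^esub> m)"
proof (induction m)
  case 0
  then show ?case using ord_mu[of \<one>] by (simp add: mu_one)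
next
  case (Suc m)
  show ?case unfolding E.nat_pow_Suc
    by (rule ord_mult[of _ _ "Suc m" 2]) (use Suc ord_Der in \<open>auto simp del: ord_lt.simps\<close>)
qed

end

section \<open>Divided powers of coordinate derivations\<close>

locale formal_coords = formal_scheme A p W \<iota>
  for A (structure) and p :: nat and W :: "('w, 'u) ring_scheme" and \<iota> :: "'w \<Rightarrow> 'a" +
  fixes n :: nat and x :: "nat \<Rightarrow> 'a" and \<delta> :: "nat \<Rightarrow> 'a \<Rightarrow> 'a"
  assumes coords: "local_coordinates p W \<iota> A n x \<delta>"
begin

lemma x_closed [simp]: "i < n \<Longrightarrow> x i \<in> carrier A"
  using coords unfolding local_coordinates_def by blast

lemma delta_x: "i < n \<Longrightarrow> j < n \<Longrightarrow> \<delta> i (x j) = (if i = j then \<one> else \<zero>)"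
  using coords unfolding local_coordinates_def by blast

lemma delta_Der: "i < n \<Longrightarrow> \<delta> i \<in> Der"
  using coords unfolding local_coordinates_def free_basis_def Der_eq by blast

lemma delta_E [simp]: "i < n \<Longrightarrow> \<delta> i \<in> carrier E"
  using delta_Der by simp

text \<open>The basis property gives some expansion; evaluation at \<open>x j\<close> identifies the
  coefficient, as the \<open>\<delta> i\<close> are dual to the coordinates.\<close>

lemma Der_expand:
  assumes \<Delta>: "\<Delta> \<in> Der" and a: "a \<in> carrier A"
  shows "\<Delta> a = (\<Oplus>i\<in>{..<n}. \<Delta> (x i) \<otimes> \<delta> i a)"
proof -
  let ?M = "der_module p W \<iota> A"
  from coords \<Delta> obtain c where c: "c \<in> {..<n} \<rightarrow>\<^sub>E carrier A"
    "\<Delta> = (\<Oplus>\<^bsub>?M\<^esub>i\<in>{i\<in>{..<n}. c i \<noteq> \<zero>}. c i \<odot>\<^bsub>?M\<^esub> \<delta> i)"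
    unfolding local_coordinates_def free_basis_def Der_eq by blast
  let ?F = "{i\<in>{..<n}. c i \<noteq> \<zero>}"
  have M: "?M = E\<lparr>carrier := Der\<rparr>" unfolding der_module_def Der_def ..
  have c_closed [simp]: "c i \<in> carrier A" if "i < n" for i using c(1) that by auto
  have trm: "c i \<odot>\<^bsub>?M\<^esub> \<delta> i = \<mu> (c i) \<otimes>\<^bsub>E\<^esub> \<delta> i" "\<mu> (c i) \<otimes>\<^bsub>E\<^esub> \<delta> i \<in> Der" if "i < n" for i
  proof -
    show "c i \<odot>\<^bsub>?M\<^esub> \<delta> i = \<mu> (c i) \<otimes>\<^bsub>E\<^esub> \<delta> i" using that by (simp add: M smult_eq)
    show "\<mu> (c i) \<otimes>\<^bsub>E\<^esub> \<delta> i \<in> Der"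
      using that by (intro DerI) (auto simp: Der_mult[OF delta_Der] r_distr m_ac)
  qed
  have Der_add: "a \<oplus>\<^bsub>E\<^esub> b \<in> Der" if "a \<in> Der" "b \<in> Der" for a b
  proof -
    have "(a \<oplus>\<^bsub>E\<^esub> b) (s \<otimes> t) = s \<otimes> (a \<oplus>\<^bsub>E\<^esub> b) t \<oplus> (a \<oplus>\<^bsub>E\<^esub> b) s \<otimes> t"
      if st: "s \<in> carrier A" "t \<in> carrier A" for s t
      using \<open>a \<in> Der\<close> \<open>b \<in> Der\<close> st by (simp add: Der_mult l_distr r_distr a_ac)
    then show ?thesis using that by (intro DerI) auto
  qed
  have Der_zero: "\<zero>\<^bsub>E\<^esub> \<in> Der" by (intro DerI) auto
  interpret M: abelian_monoid ?M
    unfolding M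
    by (rule abelian_monoidI) (use Der_add Der_zero in \<open>auto intro: E.a_assoc E.a_comm\<close>)
  have "\<Delta> = finsum ?M (\<lambda>i. \<mu> (c i) \<otimes>\<^bsub>E\<^esub> \<delta> i) ?F"
    unfolding c(2) by (rule M.finsum_cong') (use trm in \<open>auto simp: Der_eq\<close>)
  also have "\<dots> = finsum E (\<lambda>i. \<mu> (c i) \<otimes>\<^bsub>E\<^esub> \<delta> i) ?F"
    unfolding M by (rule E.finsum_sub_carrier) (use Der_add Der_zero trm in auto)
  finally have \<Delta>_eq: "\<Delta> = (\<Oplus>\<^bsub>E\<^esub>i\<in>?F. \<mu> (c i) \<otimes>\<^bsub>E\<^esub> \<delta> i)" .
  have exp: "\<Delta> b = (\<Oplus>i\<in>{..<n}. c i \<otimes> \<delta> i b)" if b: "b \<in> carrier A" for b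
  proof -
    have "\<Delta> b = (\<Oplus>i\<in>?F. (\<mu> (c i) \<otimes>\<^bsub>E\<^esub> \<delta> i) b)"
      unfolding \<Delta>_eq by (rule op_finsum_apply) (use b in auto)
    also have "\<dots> = (\<Oplus>i\<in>?F. c i \<otimes> \<delta> i b)" using b by (intro finsum_cong') auto
    also have "\<dots> = (\<Oplus>i\<in>{..<n}. c i \<otimes> \<delta> i b)"
      using b by (intro finsum_mono_neutral[symmetric]) auto
    finally show ?thesis .
  qed
  have "\<Delta> (x j) = c j" if "j < n" for j
  proof -
    have "\<Delta> (x j) = (\<Oplus>i\<in>{..<n}. c i \<otimes> \<delta> i (x j))" using that by (intro exp) auto
    also have "\<dots> = c j \<otimes> \<delta> j (x j)" using that by (intro finsum_single) (auto simp: delta_x)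
    finally show ?thesis using that by (simp add: delta_x)
  qed
  then show ?thesis unfolding exp[OF a] using a by (intro finsum_cong') auto
qed

lemma Der_eq_zero:
  assumes "\<Delta> \<in> Der" "\<And>i. i < n \<Longrightarrow> \<Delta> (x i) = \<zero>"
  shows "\<Delta> = \<zero>\<^bsub>E\<^esub>"
proof (rule op_eqI)
  fix a assume a: "a \<in> carrier A"
  have "\<Delta> a = (\<Oplus>i\<in>{..<n}. \<zero>)"
    unfolding Der_expand[OF assms(1) a] using a by (intro finsum_cong') (auto simp: assms(2))
  with a show "\<Delta> a = \<zero>\<^bsub>E\<^esub> a" by simp
qed (use assms in auto)

lemma delta_const: "i < n \<Longrightarrow> j < n \<Longrightarrow> k < n \<Longrightarrow> \<delta> i (\<delta> j (x k)) = \<zero>"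
  using Der_one[OF delta_Der] by (auto simp: delta_x)

text \<open>The commutator is a derivation, and it kills every coordinate because
  \<open>\<delta> j (x k)\<close> is 0 or 1.\<close>

lemma delta_comm:
  assumes "i < n" "j < n"
  shows "\<delta> i \<otimes>\<^bsub>E\<^esub> \<delta> j = \<delta> j \<otimes>\<^bsub>E\<^esub> \<delta> i"
proof -
  have "\<delta> i \<otimes>\<^bsub>E\<^esub> \<delta> j \<ominus>\<^bsub>E\<^esub> \<delta> j \<otimes>\<^bsub>E\<^esub> \<delta> i = \<zero>\<^bsub>E\<^esub>"
    by (rule Der_eq_zero[OF Der_commutator]) (use assms delta_Der in \<open>auto simp: delta_const minus_self\<close>)
  then show ?thesis by (rule E.minus_eq_zeroD[rotated 2]) (use assms in auto)
qed

lemma delta_pow_p: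
  assumes i: "i < n" and a: "a \<in> carrier A"
  shows "cg 1 ((\<delta> i [^]\<^bsub>E\<^esub> p) a) \<zero>"
proof -
  let ?P = "\<delta> i [^]\<^bsub>E\<^esub> p"
  obtain \<Delta> where \<Delta>: "\<Delta> \<in> Der" "\<And>a. a \<in> carrier A \<Longrightarrow> cg 1 (\<Delta> a) (?P a)"
    using derivation_lift[OF Der_pow_p[OF delta_Der[OF i]]] by (auto simp: Der_eq)
  have P_x: "?P (x j) = \<zero>" if "j < n" for j
  proof -
    \<comment> \<open>Since \<open>p\<close> is at least 2, two factors can be split off: the first
      turns \<open>x j\<close> into 0 or 1, and the second kills that.\<close>
    define q where "q = p - 2"
    have "Suc (Suc q) = p" using p_gt_1 by (simp add: q_def)
    then have "?P = \<delta> i [^]\<^bsub>E\<^esub> Suc (Suc q)" by presburger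
    then have "?P (x j) = (\<delta> i [^]\<^bsub>E\<^esub> q) (\<delta> i (\<delta> i (x j)))" using that i by simp
    then show ?thesis using that i by (simp add: delta_const)
  qed
  have "cg 1 (?P a) (\<Delta> a)" by (rule cg_sym[OF \<Delta>(2)[OF a]])
  also have "\<Delta> a = (\<Oplus>j\<in>{..<n}. \<Delta> (x j) \<otimes> \<delta> j a)" by (rule Der_expand[OF \<Delta>(1) a])
  also have "cg 1 \<dots> (\<Oplus>j\<in>{..<n}. \<zero>)"
  proof (rule cg_finsum)
    fix j assume "j \<in> {..<n}"
    then have "cg 1 (\<Delta> (x j)) \<zero>" "\<delta> j a \<in> carrier A" using \<Delta>(2)[of "x j"] P_x a by auto
    from cg_mult_left[OF this(2,1)] show "cg 1 (\<Delta> (x j) \<otimes> \<delta> j a) \<zero>"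
      using \<open>j \<in> {..<n}\<close> \<Delta>(1) \<open>\<delta> j a \<in> carrier A\<close> by (simp add: m_comm[of "\<delta> j a"])
  qed
  finally show ?thesis by simp
qed

lemma coprime_fact: "k < p \<Longrightarrow> coprime (fact k :: nat) p"
  using prime_dvd_fact_iff[OF p_prime, of k] prime_imp_coprime[OF p_prime, of "fact k"]
  by (auto simp: coprime_commute)

text \<open>All values of the \<open>p\<close>th power of \<open>\<delta> i\<close> are divisible by
  \<open>p\<close>, and (p - 1)! is a unit, so they are divisible by p!. The quotient has finite
  order because its multiple has.\<close>

lemma divided_power_exists:
  assumes i: "i < n"
  shows "\<exists>!\<Psi>. \<Psi> \<in> carrier D \<and> [(fact p :: nat)] \<cdot>\<^bsub>D\<^esub> \<Psi> = \<delta> i [^]\<^bsub>D\<^esub> p"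
proof -
  have fact_p: "(fact p :: nat) = p * fact (p - 1)" using p_gt_1 by (simp add: fact_reduce)
  obtain u where u: "u \<in> carrier A" "[(fact (p - 1) :: nat)] \<cdot> u = \<one>"
    using coprime_inverse[OF coprime_fact[of "p - 1"]] p_gt_1 by auto
  have "\<exists>\<Psi>\<in>carrier E. [(fact p :: nat)] \<cdot>\<^bsub>E\<^esub> \<Psi> = \<delta> i [^]\<^bsub>E\<^esub> p"
  proof (rule op_divide)
    fix a assume a: "a \<in> carrier A"
    obtain c where c: "c \<in> carrier A" "(\<delta> i [^]\<^bsub>E\<^esub> p) a = [p] \<cdot> c"
      using delta_pow_p[OF i a] by (auto simp: cg_def)
    have "[(fact p :: nat)] \<cdot> (u \<otimes> c) = [p] \<cdot> ([(fact (p - 1) :: nat)] \<cdot> (u \<otimes> c))"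
      unfolding fact_p by (rule add_pow_mult[symmetric]) (use u c in simp)
    also have "[(fact (p - 1) :: nat)] \<cdot> (u \<otimes> c) = c"
      unfolding add_pow_ldistr[OF u(1) c(1), symmetric] u(2) by (rule l_one[OF c(1)])
    finally have "(\<delta> i [^]\<^bsub>E\<^esub> p) a = [(fact p :: nat)] \<cdot> (u \<otimes> c)" using c(2) by simp
    then show "\<exists>b\<in>carrier A. (\<delta> i [^]\<^bsub>E\<^esub> p) a = [(fact p :: nat)] \<cdot> b"
      by (rule bexI) (use u c in simp)
  qed (use i in auto)
  then obtain \<Psi> where \<Psi>: "\<Psi> \<in> carrier E" "[(fact p :: nat)] \<cdot>\<^bsub>E\<^esub> \<Psi> = \<delta> i [^]\<^bsub>E\<^esub> p" by blast
  have "ord_lt (Suc p) \<Psi>"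
    by (rule ord_add_pow_cancel[of "fact p"]) (use \<Psi> ord_pow[OF delta_Der[OF i], of p] in \<open>simp_all del: ord_lt.simps\<close>)
  with \<Psi> have "\<Psi> \<in> carrier D" unfolding carrier_D by blast
  moreover have "\<Psi>' = \<Psi>" if "\<Psi>' \<in> carrier D" "[(fact p :: nat)] \<cdot>\<^bsub>D\<^esub> \<Psi>' = \<delta> i [^]\<^bsub>D\<^esub> p" for \<Psi>'
    by (rule E_cancel[of "fact p"]) (use that \<Psi> in simp_all)
  moreover have "[(fact p :: nat)] \<cdot>\<^bsub>D\<^esub> \<Psi> = \<delta> i [^]\<^bsub>D\<^esub> p"
    unfolding D_add_pow D_pow by (rule \<Psi>(2))
  ultimately show ?thesis by blast
qed

definition dp :: "nat \<Rightarrow> 'a \<Rightarrow> 'a" where "dp i = divided_pth_power p W \<iota> A (\<delta> i)"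

lemma dp_closed [simp]: "i < n \<Longrightarrow> dp i \<in> carrier E"
  and dp_fact: "i < n \<Longrightarrow> [(fact p :: nat)] \<cdot>\<^bsub>E\<^esub> dp i = \<delta> i [^]\<^bsub>E\<^esub> p"
  using theI'[OF divided_power_exists[of i]]
  by (simp_all add: dp_def divided_pth_power_def Let_def)

lemma ord_dp: "i < n \<Longrightarrow> ord_lt (Suc p) (dp i)"
  by (rule ord_add_pow_cancel[of "fact p"])
    (use dp_fact[of i] ord_pow[OF delta_Der, of i p] in \<open>simp_all del: ord_lt.simps\<close>)

text \<open>After multiplication by p! the claim concerns a power of \<open>\<delta> i\<close>;
  without torsion the factor cancels again.\<close>

lemma dp_comm:
  assumes "i < n" "\<Phi> \<in> carrier E" "\<delta> i \<otimes>\<^bsub>E\<^esub> \<Phi> = \<Phi> \<otimes>\<^bsub>E\<^esub> \<delta> i"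
  shows "dp i \<otimes>\<^bsub>E\<^esub> \<Phi> = \<Phi> \<otimes>\<^bsub>E\<^esub> dp i"
proof -
  have "[(fact p :: nat)] \<cdot>\<^bsub>E\<^esub> (dp i \<otimes>\<^bsub>E\<^esub> \<Phi>) = \<delta> i [^]\<^bsub>E\<^esub> p \<otimes>\<^bsub>E\<^esub> \<Phi>"
    using assms by (simp add: E.add_pow_ldistr[symmetric] dp_fact)
  also have "\<dots> = \<Phi> \<otimes>\<^bsub>E\<^esub> \<delta> i [^]\<^bsub>E\<^esub> p" using assms by (intro E.pow_comm) auto
  also have "\<dots> = [(fact p :: nat)] \<cdot>\<^bsub>E\<^esub> (\<Phi> \<otimes>\<^bsub>E\<^esub> dp i)"
    using assms by (simp add: E.add_pow_rdistr[symmetric] dp_fact)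
  finally show ?thesis by (rule E_cancel[rotated 3]) (use assms in auto)
qed

lemma dp_delta_comm: "i < n \<Longrightarrow> j < n \<Longrightarrow> dp i \<otimes>\<^bsub>E\<^esub> \<delta> j = \<delta> j \<otimes>\<^bsub>E\<^esub> dp i"
  by (rule dp_comm) (auto simp: delta_comm)

lemma dp_dp_comm: "i < n \<Longrightarrow> j < n \<Longrightarrow> dp i \<otimes>\<^bsub>E\<^esub> dp j = dp j \<otimes>\<^bsub>E\<^esub> dp i"
  by (rule dp_comm) (auto simp: dp_delta_comm)

text \<open>On symbols, the next lemma is the chain rule \<open>{\<sigma>, b} = \<Sum>\<^sub>j {\<sigma>, x\<^sub>j} \<partial>\<^sub>j b\<close>.\<close>

lemma ord_chain_rule:
  assumes "\<Phi> \<in> carrier E" "ord_lt (Suc (Suc k)) \<Phi>" "b \<in> carrier A"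
  shows "ord_lt k (ad \<Phi> b \<ominus>\<^bsub>E\<^esub> (\<Oplus>\<^bsub>E\<^esub>j\<in>{..<n}. ad \<Phi> (x j) \<otimes>\<^bsub>E\<^esub> \<mu> (\<delta> j b)))"
  using assms
proof (induction k arbitrary: \<Phi>)
  case 0
  note \<Phi> = 0(1) and b = 0(3)
  \<comment> \<open>An operator of order at most 1 becomes a derivation once multiplication by its
    value at \<open>\<one>\<close> is subtracted. Brackets do not see that correction, and the
    derivation has an expansion in the \<open>\<delta> j\<close>.\<close>
  define \<Delta> where "\<Delta> = \<Phi> \<ominus>\<^bsub>E\<^esub> \<mu> (\<Phi> \<one>)"
  have \<Delta>_E: "\<Delta> \<in> carrier E" using \<Phi> by (simp add: \<Delta>_def)
  have ad_eq: "ad \<Phi> c = \<mu> (\<Delta> c)" if c: "c \<in> carrier A" for c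
  proof -
    have "ord_lt 1 (ad \<Phi> c)" using 0(2) c by simp
    then have "ad \<Phi> c = \<mu> (ad \<Phi> c \<one>)" by (rule iffD1[OF ord_one_iff[OF ad_closed[OF \<Phi> c]]])
    also have "ad \<Phi> c \<one> = \<Delta> c" using \<Phi> c by (simp add: \<Delta>_def ad_apply m_comm)
    finally show ?thesis .
  qed
  have "\<Delta> (a \<otimes> c) = a \<otimes> \<Delta> c \<oplus> \<Delta> a \<otimes> c" if ac: "a \<in> carrier A" "c \<in> carrier A" for a c
  proof -
    have "ad \<Phi> a c = \<Delta> a \<otimes> c" using ad_eq ac by simp
    then have "\<Phi> (a \<otimes> c) \<ominus> a \<otimes> \<Phi> c = \<Delta> a \<otimes> c" using \<Phi> ac by (simp add: ad_apply)
    then have *: "\<Phi> (a \<otimes> c) = \<Delta> a \<otimes> c \<oplus> a \<otimes> \<Phi> c"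
      using \<Phi> ac minus_add_cancel[of "\<Phi> (a \<otimes> c)" "a \<otimes> \<Phi> c"] by simp
    have "\<Delta> (a \<otimes> c) = \<Phi> (a \<otimes> c) \<ominus> \<Phi> \<one> \<otimes> (a \<otimes> c)" using \<Phi> ac by (simp add: \<Delta>_def)
    also have "\<dots> = \<Delta> a \<otimes> c \<oplus> (a \<otimes> \<Phi> c \<ominus> \<Phi> \<one> \<otimes> (a \<otimes> c))"
      unfolding * using \<Phi> ac \<Delta>_E by (simp add: a_minus_def a_assoc)
    also have "a \<otimes> \<Phi> c \<ominus> \<Phi> \<one> \<otimes> (a \<otimes> c) = a \<otimes> \<Delta> c"
      using \<Phi> ac by (simp add: \<Delta>_def a_minus_def r_distr r_minus m_lcomm)
    finally show ?thesis using \<Delta>_E ac by (simp add: a_comm)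
  qed
  then have \<Delta>: "\<Delta> \<in> Der" using \<Delta>_E by (intro DerI) auto
  have "ad \<Phi> b = (\<Oplus>\<^bsub>E\<^esub>j\<in>{..<n}. ad \<Phi> (x j) \<otimes>\<^bsub>E\<^esub> \<mu> (\<delta> j b))"
  proof (rule op_eqI)
    fix a assume a: "a \<in> carrier A"
    have "ad \<Phi> b a = (\<Oplus>i\<in>{..<n}. \<Delta> (x i) \<otimes> \<delta> i b) \<otimes> a"
      using ad_eq a b Der_expand[OF \<Delta> b] by simp
    also have "\<dots> = (\<Oplus>i\<in>{..<n}. \<Delta> (x i) \<otimes> \<delta> i b \<otimes> a)"
      by (rule finsum_ldistr) (use a b \<Delta>_E in auto)
    also have "\<dots> = (\<Oplus>i\<in>{..<n}. (ad \<Phi> (x i) \<otimes>\<^bsub>E\<^esub> \<mu> (\<delta> i b)) a)"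
      using a b \<Delta>_E by (intro finsum_cong') (auto simp: ad_eq m_assoc)
    also have "\<dots> = (\<Oplus>\<^bsub>E\<^esub>i\<in>{..<n}. ad \<Phi> (x i) \<otimes>\<^bsub>E\<^esub> \<mu> (\<delta> i b)) a"
      by (rule op_finsum_apply[symmetric]) (use a b \<Phi> in auto)
    finally show "ad \<Phi> b a = (\<Oplus>\<^bsub>E\<^esub>j\<in>{..<n}. ad \<Phi> (x j) \<otimes>\<^bsub>E\<^esub> \<mu> (\<delta> j b)) a" .
  qed (use \<Phi> b in \<open>auto intro!: E.finsum_closed\<close>)
  then show ?case using \<Phi> b by (simp add: E.minus_self)
next
  case (Suc k)
  note \<Phi> = Suc.prems(1) and b = Suc.prems(3)
  show ?case unfolding ord_lt.simps
  proof
    fix c assume c: "c \<in> carrier A"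
    have "ad (ad \<Phi> b \<ominus>\<^bsub>E\<^esub> (\<Oplus>\<^bsub>E\<^esub>j\<in>{..<n}. ad \<Phi> (x j) \<otimes>\<^bsub>E\<^esub> \<mu> (\<delta> j b))) c =
      ad (ad \<Phi> b) c \<ominus>\<^bsub>E\<^esub> ad (\<Oplus>\<^bsub>E\<^esub>j\<in>{..<n}. ad \<Phi> (x j) \<otimes>\<^bsub>E\<^esub> \<mu> (\<delta> j b)) c"
      by (rule ad_diff) (use \<Phi> b c in \<open>auto intro!: E.finsum_closed\<close>)
    also have "ad (\<Oplus>\<^bsub>E\<^esub>j\<in>{..<n}. ad \<Phi> (x j) \<otimes>\<^bsub>E\<^esub> \<mu> (\<delta> j b)) c =
      (\<Oplus>\<^bsub>E\<^esub>j\<in>{..<n}. ad (ad \<Phi> (x j) \<otimes>\<^bsub>E\<^esub> \<mu> (\<delta> j b)) c)"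
      by (rule ad_finsum) (use \<Phi> b c in auto)
    also have "\<dots> = (\<Oplus>\<^bsub>E\<^esub>j\<in>{..<n}. ad (ad \<Phi> c) (x j) \<otimes>\<^bsub>E\<^esub> \<mu> (\<delta> j b))"
      by (rule E.finsum_cong') (use \<Phi> b c in \<open>auto simp: ad_mult ad_mu ad_swap[of \<Phi> _ c]\<close>)
    also have "ad (ad \<Phi> b) c = ad (ad \<Phi> c) b" using \<Phi> b c by (rule ad_swap)
    finally show "ord_lt k (ad (ad \<Phi> b \<ominus>\<^bsub>E\<^esub> (\<Oplus>\<^bsub>E\<^esub>j\<in>{..<n}. ad \<Phi> (x j) \<otimes>\<^bsub>E\<^esub> \<mu> (\<delta> j b))) c)"
      using Suc.IH[of "ad \<Phi> c"] Suc.prems c by simp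
  qed
qed

text \<open>On symbols, the next lemma is Euler's identity \<open>m \<sigma> = \<Sum>\<^sub>j {\<sigma>, x\<^sub>j} \<xi>\<^sub>j\<close> in degree \<open>m\<close>.\<close>

lemma ord_Euler:
  assumes "\<Phi> \<in> carrier E" "ord_lt (Suc m) \<Phi>"
  shows "ord_lt m ([m] \<cdot>\<^bsub>E\<^esub> \<Phi> \<ominus>\<^bsub>E\<^esub> (\<Oplus>\<^bsub>E\<^esub>j\<in>{..<n}. ad \<Phi> (x j) \<otimes>\<^bsub>E\<^esub> \<delta> j))"
  using assms
proof (induction m arbitrary: \<Phi>)
  case 0
  then have "(\<Oplus>\<^bsub>E\<^esub>j\<in>{..<n}. ad \<Phi> (x j) \<otimes>\<^bsub>E\<^esub> \<delta> j) = \<zero>\<^bsub>E\<^esub>"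
    by (intro E.finsum_neutral) auto
  then show ?case by (simp add: a_minus_def)
next
  case (Suc m)
  note \<Phi> = Suc.prems(1)
  show ?case unfolding ord_lt.simps
  proof
    fix b assume b: "b \<in> carrier A"
    define S1 where "S1 = (\<Oplus>\<^bsub>E\<^esub>j\<in>{..<n}. ad (ad \<Phi> b) (x j) \<otimes>\<^bsub>E\<^esub> \<delta> j)"
    define S2 where "S2 = (\<Oplus>\<^bsub>E\<^esub>j\<in>{..<n}. ad \<Phi> (x j) \<otimes>\<^bsub>E\<^esub> \<mu> (\<delta> j b))"
    have S: "S1 \<in> carrier E" "S2 \<in> carrier E" using \<Phi> b by (auto simp: S1_def S2_def intro!: E.finsum_closed)
    have "ad (\<Oplus>\<^bsub>E\<^esub>j\<in>{..<n}. ad \<Phi> (x j) \<otimes>\<^bsub>E\<^esub> \<delta> j) b = (\<Oplus>\<^bsub>E\<^esub>j\<in>{..<n}. ad (ad \<Phi> (x j) \<otimes>\<^bsub>E\<^esub> \<delta> j) b)"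
      by (rule ad_finsum) (use \<Phi> b in auto)
    also have "\<dots> = (\<Oplus>\<^bsub>E\<^esub>j\<in>{..<n}. ad (ad \<Phi> b) (x j) \<otimes>\<^bsub>E\<^esub> \<delta> j \<oplus>\<^bsub>E\<^esub> ad \<Phi> (x j) \<otimes>\<^bsub>E\<^esub> \<mu> (\<delta> j b))"
      by (rule E.finsum_cong')
        (use \<Phi> b in \<open>auto simp: ad_mult Der_ad[OF delta_Der] ad_swap[of \<Phi> _ b] E.a_comm\<close>)
    also have "\<dots> = S1 \<oplus>\<^bsub>E\<^esub> S2"
      unfolding S1_def S2_def by (rule E.finsum_addf) (use \<Phi> b in auto)
    finally have sum: "ad (\<Oplus>\<^bsub>E\<^esub>j\<in>{..<n}. ad \<Phi> (x j) \<otimes>\<^bsub>E\<^esub> \<delta> j) b = S1 \<oplus>\<^bsub>E\<^esub> S2" .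
    have "ad ([Suc m] \<cdot>\<^bsub>E\<^esub> \<Phi> \<ominus>\<^bsub>E\<^esub> (\<Oplus>\<^bsub>E\<^esub>j\<in>{..<n}. ad \<Phi> (x j) \<otimes>\<^bsub>E\<^esub> \<delta> j)) b =
      [Suc m] \<cdot>\<^bsub>E\<^esub> ad \<Phi> b \<ominus>\<^bsub>E\<^esub> (S1 \<oplus>\<^bsub>E\<^esub> S2)"
      unfolding sum[symmetric] ad_add_pow[OF \<Phi> b, symmetric]
      by (rule ad_diff) (use \<Phi> b in \<open>auto intro!: E.finsum_closed\<close>)
    \<comment> \<open>Of the \<open>Suc m\<close> copies of the bracket, \<open>m\<close> form
      Euler's expression for \<open>ad \<Phi> b\<close>, and the last one is compared with
      \<open>S2\<close> by the chain rule.\<close>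
    also have "\<dots> = ([m] \<cdot>\<^bsub>E\<^esub> ad \<Phi> b \<ominus>\<^bsub>E\<^esub> S1) \<oplus>\<^bsub>E\<^esub> (ad \<Phi> b \<ominus>\<^bsub>E\<^esub> S2)"
      using \<Phi> b S by (simp add: E.add_diff_add)
    finally show "ord_lt m (ad ([Suc m] \<cdot>\<^bsub>E\<^esub> \<Phi> \<ominus>\<^bsub>E\<^esub> (\<Oplus>\<^bsub>E\<^esub>j\<in>{..<n}. ad \<Phi> (x j) \<otimes>\<^bsub>E\<^esub> \<delta> j)) b)"
      using Suc.IH[of "ad \<Phi> b"] ord_chain_rule[OF \<Phi> Suc.prems(2) b] \<Phi> b S Suc.prems(2)
      by (simp add: S1_def[symmetric] S2_def[symmetric] ord_add)
  qed
qed

end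

context monoid
begin

lemma list_power_add_pow:
  assumes "j \<in> set js" "distinct js" "\<And>i. i \<in> set js \<Longrightarrow> e i \<in> carrier G"
    "\<And>i. i \<in> set js \<Longrightarrow> e i \<otimes> e j = e j \<otimes> e i"
  shows "list_power e (I(j := I j + k)) js = e j [^] (k::nat) \<otimes> list_power e I js"
proof (induction k)
  case 0
  show ?case using assms(3) by (auto intro!: list_power_closed[THEN l_one[symmetric]])
next
  case (Suc k)
  have c: "e j \<in> carrier G" "list_power e I js \<in> carrier G" using assms by auto
  have "list_power e (I(j := I j + Suc k)) js = e j \<otimes> list_power e (I(j := I j + k)) js"
    using list_power_Suc[of j js e "I(j := I j + k)"] assms by simp
  also have "\<dots> = (e j \<otimes> e j [^] k) \<otimes> list_power e I js"
    unfolding Suc using c by (simp add: m_assoc)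
  also have "e j \<otimes> e j [^] k = e j [^] Suc k" using c pow_comm[of "e j" "e j" k] by simp
  finally show ?case .
qed

lemma list_power_mem:
  assumes "\<one> \<in> H" "\<And>a b. a \<in> H \<Longrightarrow> b \<in> H \<Longrightarrow> a \<otimes> b \<in> H" "\<And>j. j \<in> set js \<Longrightarrow> e j \<in> H"
  shows "list_power e I js \<in> H"
proof -
  have "e j [^] (k::nat) \<in> H" if "j \<in> set js" for j k
    using that assms by (induction k) auto
  with assms show ?thesis by (induction js) auto
qed

lemma list_power_zero: "list_power e (\<lambda>j. 0) js = \<one>"
  by (induction js) auto

end

text \<open>The recursion for falling factorials: \<open>fact m * (l choose m)\<close> is l (l - 1)
  ... (l - m + 1). Written with binomials it also covers \<open>l \<le> m\<close>, where both sides
  vanish.\<close>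

lemma fact_binomial_Suc: "fact (Suc m) * (l choose Suc m) = fact m * (l choose m) * (l - m :: nat)"
proof -
  have "Suc m * (l choose Suc m) = (l - m) * (l choose m)"
    using binomial_absorption[of m l] binomial_absorb_comp[of l m] by simp
  then have "fact m * (Suc m * (l choose Suc m)) = fact m * ((l - m) * (l choose m))" by (rule arg_cong)
  then show ?thesis by (simp only: fact_Suc of_nat_id mult_ac)
qed

section \<open>Action of differential monomials on coordinate monomials\<close>

context formal_coords
begin

abbreviation xm :: "(nat \<Rightarrow> nat) \<Rightarrow> 'a" where "xm L \<equiv> list_power x L [0..<n]"
abbreviation mpow :: "(nat \<Rightarrow> 'a \<Rightarrow> 'a) \<Rightarrow> (nat \<Rightarrow> nat) \<Rightarrow> 'a \<Rightarrow> 'a" where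
  "mpow e I \<equiv> E.list_power e I [0..<n]"

lemma xm_closed [simp]: "xm L \<in> carrier A" by auto

lemma mpow_delta_closed [simp]: "mpow \<delta> I \<in> carrier E" by auto
lemma mpow_dp_closed [simp]: "mpow dp J \<in> carrier E" by auto

lemma delta_x_pow:
  assumes "i < n" "j < n"
  shows "\<delta> j (x i [^] (k::nat)) = (if i = j then [k] \<cdot> (x i [^] (k - 1)) else \<zero>)"
proof (induction k)
  case 0
  then show ?case using assms Der_one[OF delta_Der] by simp
next
  case (Suc k)
  have "\<delta> j (x i [^] Suc k) = x i [^] k \<otimes> \<delta> j (x i) \<oplus> \<delta> j (x i [^] k) \<otimes> x i"
    using assms by (simp add: Der_mult[OF delta_Der])
  then show ?case using assms Suc
    by (cases k) (auto simp: delta_x add_pow_ldistr l_distr a_comm)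
qed

lemma delta_list_power_x:
  assumes "j < n" "set js \<subseteq> {..<n}" "distinct js"
  shows "\<delta> j (list_power x L js) =
    (if j \<in> set js then [(L j)] \<cdot> list_power x (L(j := L j - 1)) js else \<zero>)"
  using assms(2,3)
proof (induction js)
  case Nil
  then show ?case using Der_one[OF delta_Der[OF assms(1)]] by simp
next
  case (Cons i js)
  have c: "list_power x L' js \<in> carrier A" for L'
    by (rule list_power_closed) (use Cons.prems in auto)
  have "\<delta> j (list_power x L (i # js)) =
     x i [^] L i \<otimes> \<delta> j (list_power x L js) \<oplus> \<delta> j (x i [^] L i) \<otimes> list_power x L js"
    using Cons.prems c by (simp add: Der_mult[OF delta_Der[OF assms(1)]])
  also have "\<dots> = (if j \<in> set (i # js) then [(L j)] \<cdot> list_power x (L(j := L j - 1)) (i # js) else \<zero>)"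
  proof (cases "i = j")
    case True
    have "list_power x (L(j := L j - 1)) js = list_power x L js"
      using Cons.prems True by (intro list_power_cong) auto
    then show ?thesis using True Cons c assms(1) by (auto simp: delta_x_pow add_pow_ldistr)
  next
    case False
    then show ?thesis using Cons c assms(1) by (auto simp: delta_x_pow add_pow_rdistr)
  qed
  finally show ?case .
qed

lemma delta_xm: "j < n \<Longrightarrow> \<delta> j (xm L) = [(L j)] \<cdot> xm (L(j := L j - 1))"
  by (subst delta_list_power_x) auto

lemma delta_pow_xm:
  "j < n \<Longrightarrow> (\<delta> j [^]\<^bsub>E\<^esub> m) (xm L) = [(fact m * (L j choose m))] \<cdot> xm (L(j := L j - m))"
proof (induction m)
  case (Suc m)
  have "(\<delta> j [^]\<^bsub>E\<^esub> Suc m) (xm L) = \<delta> j ((\<delta> j [^]\<^bsub>E\<^esub> m) (xm L))"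
    using Suc.prems E.nat_pow_Suc2[of "\<delta> j" m] by (simp del: E.nat_pow_Suc)
  also have "\<dots> = [(fact m * (L j choose m))] \<cdot> ([(L j - m)] \<cdot> xm (L(j := L j - Suc m)))"
  proof -
    have "\<delta> j (xm (L(j := L j - m))) = [(L j - m)] \<cdot> xm (L(j := L j - Suc m))"
      using delta_xm[OF Suc.prems, of "L(j := L j - m)"]
      by (simp only: fun_upd_same fun_upd_upd diff_diff_left Suc_eq_plus1[symmetric])
    then show ?thesis unfolding Suc.IH[OF Suc.prems] using Suc.prems by (simp only: op_add_pow delta_E xm_closed)
  qed
  also have "\<dots> = [(fact m * (L j choose m) * (L j - m))] \<cdot> xm (L(j := L j - Suc m))"
    by (rule add_pow_mult) simp
  finally show ?case unfolding fact_binomial_Suc .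
qed simp

lemma list_power_delta_xm:
  assumes "set js \<subseteq> {..<n}" "distinct js"
  shows "(E.list_power \<delta> L' js) (xm L) =
    [(\<Prod>j\<in>set js. fact (L' j) * (L j choose L' j))] \<cdot> xm (\<lambda>j. if j \<in> set js then L j - L' j else L j)"
  using assms
proof (induction js)
  case (Cons i js)
  let ?g = "\<lambda>js. \<Prod>j\<in>set js. fact (L' j) * (L j choose L' j)"
  let ?L = "\<lambda>j. if j \<in> set js then L j - L' j else L j"
  have i: "i < n" "i \<notin> set js" using Cons.prems by auto
  have "(E.list_power \<delta> L' (i # js)) (xm L) = (\<delta> i [^]\<^bsub>E\<^esub> L' i) ([(?g js)] \<cdot> xm ?L)"
    using Cons by simp
  also have "\<dots> = [(?g js)] \<cdot> ([(fact (L' i) * (L i choose L' i))] \<cdot> xm (?L(i := L i - L' i)))"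
    using i by (simp add: op_add_pow delta_pow_xm)
  also have "\<dots> = [(?g js * (fact (L' i) * (L i choose L' i)))] \<cdot> xm (?L(i := L i - L' i))"
    by (rule add_pow_mult) simp
  also have "?g js * (fact (L' i) * (L i choose L' i)) = ?g (i # js)" using i by (simp add: mult.commute)
  also have "?L(i := L i - L' i) = (\<lambda>j. if j \<in> set (i # js) then L j - L' j else L j)" by auto
  finally show ?case .
qed simp

text \<open>Truncated subtraction in the exponent does no harm: where \<open>L' j\<close> exceeds
  \<open>L j\<close>, the binomial factor is zero.\<close>

lemma mpow_delta_xm:
  "(mpow \<delta> L') (xm L) = [(\<Prod>j<n. fact (L' j) * (L j choose L' j))] \<cdot> xm (\<lambda>j. L j - L' j)"
proof -
  have "xm (\<lambda>j. if j \<in> set [0..<n] then L j - L' j else L j) = xm (\<lambda>j. L j - L' j)"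
    by (rule list_power_cong) simp
  moreover have "set [0..<n] = {..<n}" by auto
  ultimately show ?thesis using list_power_delta_xm[of "[0..<n]" L' L] by simp
qed

text \<open>Evaluate at \<open>x\<^sup>L\<close> and induct on the total degree of \<open>L\<close>.\<close>

lemma delta_coeff_congruence:
  fixes l :: "'i \<Rightarrow> nat \<Rightarrow> nat"
  assumes F: "finite F" "\<And>K K'. K \<in> F \<Longrightarrow> K' \<in> F \<Longrightarrow> (\<And>j. j < n \<Longrightarrow> l K j = l K' j) \<Longrightarrow> K = K'"
    and c: "\<And>K. K \<in> F \<Longrightarrow> c K \<in> carrier A"
    and sum: "\<And>a. a \<in> carrier A \<Longrightarrow> cg k (\<Oplus>K\<in>F. c K \<otimes> (mpow \<delta> (l K)) a) \<zero>"
    and "K \<in> F"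
  shows "cg k ([(\<Prod>j<n. fact (l K j) :: nat)] \<cdot> c K) \<zero>"
  using \<open>K \<in> F\<close>
proof (induction "\<Sum>j<n. l K j" arbitrary: K rule: less_induct)
  case less
  let ?L = "l K"
  have t_closed: "c K' \<otimes> (mpow \<delta> (l K')) (xm ?L) \<in> carrier A" if "K' \<in> F" for K'
    using c that by auto
  have eq: "c K' \<otimes> (mpow \<delta> (l K')) (xm ?L) =
     [(\<Prod>j<n. ?L j choose l K' j)] \<cdot> ([(\<Prod>j<n. fact (l K' j) :: nat)] \<cdot> c K') \<otimes> xm (\<lambda>j. ?L j - l K' j)"
    if "K' \<in> F" for K'
    using c[OF that] by (simp add: mpow_delta_xm add_pow_rdistr add_pow_ldistr add_pow_mult prod.distrib mult.commute)
  \<comment> \<open>If \<open>l K'\<close> is not componentwise below \<open>l K\<close>, a binomial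
    factor vanishes. Otherwise its total degree is smaller, distinct indices having distinct
    exponents, and the induction hypothesis applies to the factorials times \<open>c K'\<close>,
    which is how \<open>eq\<close> groups the term.\<close>
  have small: "cg k (c K' \<otimes> (mpow \<delta> (l K')) (xm ?L)) \<zero>" if K': "K' \<in> F" "K' \<noteq> K" for K'
  proof (cases "\<exists>j<n. ?L j < l K' j")
    case True
    then obtain j where j: "j < n" "?L j < l K' j" by blast
    then have z: "(\<Prod>j<n. ?L j choose l K' j) = 0" by (intro prod_zero) (auto simp: binomial_eq_0)
    show ?thesis unfolding eq[OF K'(1)] z using c[OF K'(1)] by (simp add: cg_refl)
  next
    case False
    then have le: "l K' j \<le> ?L j" if "j < n" for j using that by force
    obtain j where "j < n" "l K' j \<noteq> ?L j" using F(2)[of K' K] K' less.prems by blast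
    then have "(\<Sum>j<n. l K' j) < (\<Sum>j<n. ?L j)"
      using le by (intro sum_strict_mono_ex1) (auto intro!: bexI[of _ j] simp: le_neq_implies_less)
    then have "cg k ([(\<Prod>j<n. fact (l K' j) :: nat)] \<cdot> c K') \<zero>" using less.hyps K' by blast
    from cg_mult[OF cg_add_pow[OF this] cg_refl[OF xm_closed]]
    show ?thesis unfolding eq[OF K'(1)] by (simp add: )
  qed
  have "cg k (\<Oplus>K'\<in>F. if K' = K then c K' \<otimes> (mpow \<delta> (l K')) (xm ?L) else \<zero>)
             (\<Oplus>K'\<in>F. c K' \<otimes> (mpow \<delta> (l K')) (xm ?L))"
    using small t_closed by (intro cg_finsum) (auto intro: cg_refl cg_sym)
  also have "(\<Oplus>K'\<in>F. if K' = K then c K' \<otimes> (mpow \<delta> (l K')) (xm ?L) else \<zero>) = c K \<otimes> (mpow \<delta> ?L) (xm ?L)"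
    using F(1) less.prems t_closed by (subst finsum_single[of _ K]) auto
  also have "cg k (\<Oplus>K'\<in>F. c K' \<otimes> (mpow \<delta> (l K')) (xm ?L)) \<zero>" by (rule sum) simp
  finally have "cg k (c K \<otimes> (mpow \<delta> ?L) (xm ?L)) \<zero>" .
  moreover have "xm (\<lambda>j. ?L j - ?L j) = \<one>" unfolding diff_self_eq_0 by (rule list_power_zero)
  ultimately show ?case
    using c[OF less.prems] unfolding mpow_delta_xm by (simp add: add_pow_rdistr)
qed

section \<open>The monomials in derivations and divided powers\<close>

definition M :: "((nat \<Rightarrow> nat) \<times> (nat \<Rightarrow> nat)) set" where
  "M = ({..<n} \<rightarrow>\<^sub>E {0..p - 1}) \<times> ({..<n} \<rightarrow>\<^sub>E (UNIV :: nat set))"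

definition eb :: "(nat \<Rightarrow> nat) \<times> (nat \<Rightarrow> nat) \<Rightarrow> 'a \<Rightarrow> 'a" where
  "eb K = mpow \<delta> (fst K) \<otimes>\<^bsub>E\<^esub> mpow dp (snd K)"

definition wt :: "(nat \<Rightarrow> nat) \<times> (nat \<Rightarrow> nat) \<Rightarrow> nat" where
  "wt K = (\<Sum>j<n. snd K j)"

text \<open>The exponent of the plain derivations hidden in \<open>eb K\<close>: by
  \<open>eb_fact\<close>, a power of p! turns \<open>eb K\<close> into
  \<open>mpow \<delta> (\<theta> K)\<close>.\<close>

definition \<theta> :: "(nat \<Rightarrow> nat) \<times> (nat \<Rightarrow> nat) \<Rightarrow> nat \<Rightarrow> nat" where
  "\<theta> K j = fst K j + p * snd K j"

definition sz :: "(nat \<Rightarrow> nat) \<times> (nat \<Rightarrow> nat) \<Rightarrow> nat" where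
  "sz K = (\<Sum>j<n. \<theta> K j)"

lemma eb_closed [simp]: "eb K \<in> carrier E" by (simp add: eb_def)

lemma M_fst: "K \<in> M \<Longrightarrow> j < n \<Longrightarrow> fst K j \<le> p - 1"
proof -
  assume "K \<in> M" "j < n"
  then have "fst K \<in> {..<n} \<rightarrow>\<^sub>E {0..p - 1}" "j \<in> {..<n}"
    unfolding M_def mem_Times_iff by simp_all
  then have "fst K j \<in> {0..p - 1}" by (rule PiE_mem)
  then show ?thesis by simp
qed

text \<open>In base \<open>p\<close>, \<open>fst K j\<close> is the last digit of
  \<open>\<theta> K j\<close>, and \<open>snd K j\<close> is the remaining quotient. Extensionality
  fixes the values outside \<open>{..<n}\<close>.\<close>

lemma theta_inj:
  assumes "K \<in> M" "K' \<in> M" "\<And>j. j < n \<Longrightarrow> \<theta> K j = \<theta> K' j"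
  shows "K = K'"
proof -
  have *: "fst K j = fst K' j \<and> snd K j = snd K' j" if j: "j < n" for j
  proof -
    have lt: "fst K j < p" "fst K' j < p"
      using M_fst[OF assms(1) j] M_fst[OF assms(2) j] p_gt_1 by auto
    have "\<theta> K j mod p = fst K j" "\<theta> K j div p = snd K j" "\<theta> K' j mod p = fst K' j" "\<theta> K' j div p = snd K' j"
      using lt p_gt_1 by (simp_all add: \<theta>_def)
    then show ?thesis using assms(3)[OF j] by metis
  qed
  have in_M: "fst K \<in> {..<n} \<rightarrow>\<^sub>E {0..p - 1}" "fst K' \<in> {..<n} \<rightarrow>\<^sub>E {0..p - 1}"
    "snd K \<in> {..<n} \<rightarrow>\<^sub>E UNIV" "snd K' \<in> {..<n} \<rightarrow>\<^sub>E UNIV"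
    using assms(1,2) unfolding M_def mem_Times_iff by simp_all
  have "fst K = fst K'" by (rule PiE_ext[OF in_M(1,2)]) (use * in simp)
  moreover have "snd K = snd K'" by (rule PiE_ext[OF in_M(3,4)]) (use * in simp)
  ultimately show ?thesis by (simp add: prod_eq_iff)
qed

lemma mpow_dp_comm:
  "\<Phi> \<in> carrier E \<Longrightarrow> (\<And>j. j < n \<Longrightarrow> dp j \<otimes>\<^bsub>E\<^esub> \<Phi> = \<Phi> \<otimes>\<^bsub>E\<^esub> dp j) \<Longrightarrow> mpow dp J \<otimes>\<^bsub>E\<^esub> \<Phi> = \<Phi> \<otimes>\<^bsub>E\<^esub> mpow dp J"
  by (rule E.list_power_comm) auto

lemma mpow_delta_comm:
  "\<Phi> \<in> carrier E \<Longrightarrow> (\<And>j. j < n \<Longrightarrow> \<delta> j \<otimes>\<^bsub>E\<^esub> \<Phi> = \<Phi> \<otimes>\<^bsub>E\<^esub> \<delta> j) \<Longrightarrow> mpow \<delta> J \<otimes>\<^bsub>E\<^esub> \<Phi> = \<Phi> \<otimes>\<^bsub>E\<^esub> mpow \<delta> J"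
  by (rule E.list_power_comm) auto

lemma mpow_delta_add_pow:
  "j < n \<Longrightarrow> mpow \<delta> (I(j := I j + k)) = \<delta> j [^]\<^bsub>E\<^esub> k \<otimes>\<^bsub>E\<^esub> mpow \<delta> I"
  by (rule E.list_power_add_pow) (auto simp: delta_comm)

lemma mpow_dp_add_pow:
  "j < n \<Longrightarrow> mpow dp (I(j := I j + k)) = dp j [^]\<^bsub>E\<^esub> k \<otimes>\<^bsub>E\<^esub> mpow dp I"
  by (rule E.list_power_add_pow) (auto simp: dp_dp_comm)

lemma eb_delta_comm: "j < n \<Longrightarrow> eb K \<otimes>\<^bsub>E\<^esub> \<delta> j = \<delta> j \<otimes>\<^bsub>E\<^esub> eb K"
  using mpow_dp_comm[of "\<delta> j" "snd K"] mpow_delta_comm[of "\<delta> j" "fst K"]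
  by (simp add: eb_def E.m_assoc dp_delta_comm delta_comm) (simp add: E.m_assoc[symmetric])

lemma dp_eb:
  assumes j: "j < n"
  shows "dp j \<otimes>\<^bsub>E\<^esub> eb K = eb (fst K, (snd K)(j := Suc (snd K j)))"
proof -
  have "dp j \<otimes>\<^bsub>E\<^esub> eb K = (dp j \<otimes>\<^bsub>E\<^esub> mpow \<delta> (fst K)) \<otimes>\<^bsub>E\<^esub> mpow dp (snd K)"
    using j by (simp add: eb_def E.m_assoc)
  also have "dp j \<otimes>\<^bsub>E\<^esub> mpow \<delta> (fst K) = mpow \<delta> (fst K) \<otimes>\<^bsub>E\<^esub> dp j"
    using j by (intro mpow_delta_comm[symmetric]) (auto simp: dp_delta_comm)
  also have "\<dots> \<otimes>\<^bsub>E\<^esub> mpow dp (snd K) = mpow \<delta> (fst K) \<otimes>\<^bsub>E\<^esub> mpow dp ((snd K)(j := Suc (snd K j)))"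
    using j mpow_dp_add_pow[OF j, of "snd K" 1] by (simp add: E.m_assoc)
  finally show ?thesis by (simp add: eb_def)
qed

lemma sum_upd: "j < n \<Longrightarrow> (\<Sum>i<n. (g(j := v)) i) + g j = (\<Sum>i<n. g i) + (v :: nat)"
  by (subst (1 2) sum.remove[of _ j]) auto

text \<open>Here \<open>e = 1\<close> stands for the carry \<open>\<partial>\<^sub>j\<^sup>p = p! \<partial>\<^sub>j\<^sup>[\<^sup>p\<^sup>]\<close>.\<close>

lemma delta_eb:
  assumes j: "j < n" and K: "K \<in> M"
  shows "\<exists>K'\<in>M. \<exists>e\<le>1. \<delta> j \<otimes>\<^bsub>E\<^esub> eb K = [(fact p ^ e :: nat)] \<cdot>\<^bsub>E\<^esub> eb K' \<and>
     wt K' = wt K + e \<and> sz K' = Suc (sz K)"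
proof -
  obtain I J where IJ: "K = (I, J)" by (cases K)
  have IM: "I \<in> {..<n} \<rightarrow>\<^sub>E {0..p - 1}" "J \<in> {..<n} \<rightarrow>\<^sub>E UNIV" using K by (auto simp: M_def IJ)
  have le: "I j \<le> p - 1" using M_fst[OF K j] by (simp add: IJ)
  have step: "\<delta> j \<otimes>\<^bsub>E\<^esub> eb K = mpow \<delta> (I(j := Suc (I j))) \<otimes>\<^bsub>E\<^esub> mpow dp J"
    using j mpow_delta_add_pow[OF j, of I 1] by (simp add: eb_def IJ E.m_assoc)
  show ?thesis
  proof (cases "I j < p - 1")
    case True
    let ?K = "(I(j := Suc (I j)), J)"
    have "?K \<in> M" using IM True j by (auto simp: M_def PiE_iff extensional_def)
    moreover have "\<delta> j \<otimes>\<^bsub>E\<^esub> eb K = [(fact p ^ 0 :: nat)] \<cdot>\<^bsub>E\<^esub> eb ?K"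
      using step by (simp add: eb_def)
    moreover have "sz ?K = Suc (sz K)"
    proof -
      have "\<theta> ?K = (\<theta> K)(j := Suc (\<theta> K j))" by (auto simp: \<theta>_def IJ)
      then show ?thesis using sum_upd[OF j, of "\<theta> K" "Suc (\<theta> K j)"] unfolding sz_def by simp
    qed
    moreover have "wt ?K = wt K + 0" by (simp add: wt_def IJ)
    ultimately show ?thesis by (intro bexI[of _ ?K] exI[of _ 0]) auto
  next
    case False
    then have Ij: "Suc (I j) = p" using le p_gt_1 by auto
    let ?K = "(I(j := 0), J(j := Suc (J j)))"
    have "?K \<in> M" using IM j by (auto simp: M_def PiE_iff extensional_def)
    moreover have "\<delta> j \<otimes>\<^bsub>E\<^esub> eb K = [(fact p ^ 1 :: nat)] \<cdot>\<^bsub>E\<^esub> eb ?K"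
    proof -
      have "mpow \<delta> (I(j := Suc (I j))) = \<delta> j [^]\<^bsub>E\<^esub> p \<otimes>\<^bsub>E\<^esub> mpow \<delta> (I(j := 0))"
        using mpow_delta_add_pow[OF j, of "I(j := 0)" p] Ij by simp
      also have "\<dots> = [(fact p :: nat)] \<cdot>\<^bsub>E\<^esub> (dp j \<otimes>\<^bsub>E\<^esub> mpow \<delta> (I(j := 0)))"
        using j by (simp add: dp_fact[symmetric] E.add_pow_ldistr)
      finally have "\<delta> j \<otimes>\<^bsub>E\<^esub> eb K = [(fact p :: nat)] \<cdot>\<^bsub>E\<^esub> (dp j \<otimes>\<^bsub>E\<^esub> eb (I(j := 0), J))"
        unfolding step using j by (simp add: E.add_pow_ldistr eb_def E.m_assoc)
      then show ?thesis using dp_eb[OF j, of "(I(j := 0), J)"] by simp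
    qed
    moreover have "sz ?K = Suc (sz K)"
    proof -
      have "\<theta> ?K = (\<theta> K)(j := Suc (\<theta> K j))" 
        by (rule ext, simp add: \<theta>_def IJ) (use Ij in simp)
      then show ?thesis using sum_upd[OF j, of "\<theta> K" "Suc (\<theta> K j)"] unfolding sz_def by simp
    qed
    moreover have "wt ?K = wt K + 1"
      using sum_upd[OF j, of J "Suc (J j)"] unfolding wt_def IJ by simp
    ultimately show ?thesis by (intro bexI[of _ ?K] exI[of _ 1]) auto
  qed
qed

definition K0 :: "(nat \<Rightarrow> nat) \<times> (nat \<Rightarrow> nat)" where
  "K0 = (\<lambda>j\<in>{..<n}. 0, \<lambda>j\<in>{..<n}. 0)"

lemma K0: "K0 \<in> M" "eb K0 = \<one>\<^bsub>E\<^esub>" "wt K0 = 0" "sz K0 = 0"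
proof -
  have "mpow e (\<lambda>j\<in>{..<n}. 0) = \<one>\<^bsub>E\<^esub>" for e
    using E.list_power_cong[of "[0..<n]" "\<lambda>j\<in>{..<n}. 0" "\<lambda>j. 0" e]
    unfolding E.list_power_zero by simp
  then show "eb K0 = \<one>\<^bsub>E\<^esub>" by (simp add: eb_def K0_def)
  show "K0 \<in> M" by (auto simp: K0_def M_def)
qed (simp_all add: wt_def sz_def \<theta>_def K0_def)

text \<open>Each \<open>dp j\<close> absorbs one p!, which makes \<open>wt K\<close> factors in
  total. Moving the power of \<open>dp i\<close> past the remaining \<open>\<delta>\<close> joins
  the two ordered products factor by factor, so the induction runs over lists.\<close>

lemma eb_fact:
  "K \<in> M \<Longrightarrow> [(fact p ^ wt K :: nat)] \<cdot>\<^bsub>E\<^esub> eb K = mpow \<delta> (\<theta> K)"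
proof -
  have *: "[(fact p ^ (\<Sum>j\<in>set js. J j) :: nat)] \<cdot>\<^bsub>E\<^esub>
     (E.list_power \<delta> I js \<otimes>\<^bsub>E\<^esub> E.list_power dp J js) = E.list_power \<delta> (\<lambda>j. I j + p * J j) js"
    if "set js \<subseteq> {..<n}" "distinct js" for I J js
    using that
  proof (induction js)
    case (Cons i js)
    let ?d = "E.list_power \<delta> I js" and ?q = "E.list_power dp J js"
    let ?N = "fact p ^ (\<Sum>j\<in>set js. J j) :: nat"
    have c: "?d \<in> carrier E" "?q \<in> carrier E" "i < n" using Cons.prems by (auto intro!: E.list_power_closed)
    have pw: "[(fact p ^ k :: nat)] \<cdot>\<^bsub>E\<^esub> (dp i [^]\<^bsub>E\<^esub> k) = \<delta> i [^]\<^bsub>E\<^esub> (p * k)" for k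
    proof (induction k)
      case (Suc k)
      have "[(fact p ^ Suc k :: nat)] \<cdot>\<^bsub>E\<^esub> (dp i [^]\<^bsub>E\<^esub> Suc k) =
        [(fact p ^ k :: nat)] \<cdot>\<^bsub>E\<^esub> (dp i [^]\<^bsub>E\<^esub> k) \<otimes>\<^bsub>E\<^esub> [(fact p :: nat)] \<cdot>\<^bsub>E\<^esub> dp i"
        using c by (simp add: E.add_pow_ldistr E.add_pow_rdistr E.add_pow_mult mult.commute)
      also have "\<dots> = \<delta> i [^]\<^bsub>E\<^esub> (p * k) \<otimes>\<^bsub>E\<^esub> \<delta> i [^]\<^bsub>E\<^esub> p"
        unfolding Suc using c by (simp add: dp_fact)
      also have "\<dots> = \<delta> i [^]\<^bsub>E\<^esub> (p * Suc k)" using c by (simp add: E.nat_pow_mult add.commute)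
      finally show ?case .
    qed simp
    have comm: "?d \<otimes>\<^bsub>E\<^esub> dp i [^]\<^bsub>E\<^esub> J i = dp i [^]\<^bsub>E\<^esub> J i \<otimes>\<^bsub>E\<^esub> ?d"
      using c Cons.prems
      by (intro E.list_power_comm) (auto intro!: E.pow_comm[symmetric] simp: dp_delta_comm)
    have "(E.list_power \<delta> I (i # js) \<otimes>\<^bsub>E\<^esub> E.list_power dp J (i # js)) =
        \<delta> i [^]\<^bsub>E\<^esub> I i \<otimes>\<^bsub>E\<^esub> ((?d \<otimes>\<^bsub>E\<^esub> dp i [^]\<^bsub>E\<^esub> J i) \<otimes>\<^bsub>E\<^esub> ?q)"
      using c by (simp add: E.m_assoc)
    also have "\<dots> = \<delta> i [^]\<^bsub>E\<^esub> I i \<otimes>\<^bsub>E\<^esub> dp i [^]\<^bsub>E\<^esub> J i \<otimes>\<^bsub>E\<^esub> (?d \<otimes>\<^bsub>E\<^esub> ?q)"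
      unfolding comm using c by (simp add: E.m_assoc)
    finally have eq: "(E.list_power \<delta> I (i # js) \<otimes>\<^bsub>E\<^esub> E.list_power dp J (i # js)) =
        \<delta> i [^]\<^bsub>E\<^esub> I i \<otimes>\<^bsub>E\<^esub> dp i [^]\<^bsub>E\<^esub> J i \<otimes>\<^bsub>E\<^esub> (?d \<otimes>\<^bsub>E\<^esub> ?q)" .
    have N: "fact p ^ (\<Sum>j\<in>set (i # js). J j) = fact p ^ J i * ?N"
      using Cons.prems by (simp add: power_add)
    have "[(fact p ^ (\<Sum>j\<in>set (i # js). J j) :: nat)] \<cdot>\<^bsub>E\<^esub>
       (\<delta> i [^]\<^bsub>E\<^esub> I i \<otimes>\<^bsub>E\<^esub> dp i [^]\<^bsub>E\<^esub> J i \<otimes>\<^bsub>E\<^esub> (?d \<otimes>\<^bsub>E\<^esub> ?q)) =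
       \<delta> i [^]\<^bsub>E\<^esub> I i \<otimes>\<^bsub>E\<^esub> [(fact p ^ J i :: nat)] \<cdot>\<^bsub>E\<^esub> (dp i [^]\<^bsub>E\<^esub> J i) \<otimes>\<^bsub>E\<^esub> [?N] \<cdot>\<^bsub>E\<^esub> (?d \<otimes>\<^bsub>E\<^esub> ?q)"
      unfolding N using c by (simp add: E.add_pow_ldistr E.add_pow_rdistr E.add_pow_mult mult.commute)
    also have "\<dots> = \<delta> i [^]\<^bsub>E\<^esub> (I i + p * J i) \<otimes>\<^bsub>E\<^esub> E.list_power \<delta> (\<lambda>j. I j + p * J j) js"
      unfolding pw using c Cons by (simp add: E.nat_pow_mult)
    finally show ?case unfolding eq by simp
  qed simp
  have s: "set [0..<n] = {..<n}" by auto
  show ?thesis using *[of "[0..<n]" "snd K" "fst K"] unfolding s by (simp add: eb_def wt_def \<theta>_def[abs_def])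
qed

end

section \<open>Bases over \<open>A\<close>\<close>

context formal_coords
begin

type_synonym idx = "(nat \<Rightarrow> nat) \<times> (nat \<Rightarrow> nat)"

text \<open>Families are total and vanish outside \<open>M\<close>, so they can be added, scaled and
  compared as functions.\<close>

definition FS :: "(idx \<Rightarrow> 'a) set" where
  "FS = {c. (\<forall>K. c K \<in> carrier A) \<and> finite {K. c K \<noteq> \<zero>} \<and> {K. c K \<noteq> \<zero>} \<subseteq> M}"

definition lc :: "(idx \<Rightarrow> 'a) \<Rightarrow> 'a \<Rightarrow> 'a" where
  "lc c = (\<Oplus>\<^bsub>E\<^esub>K\<in>{K. c K \<noteq> \<zero>}. \<mu> (c K) \<otimes>\<^bsub>E\<^esub> eb K)"

lemma FS_closed: "c \<in> FS \<Longrightarrow> c K \<in> carrier A" unfolding FS_def by blast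
lemma FS_supp: "c \<in> FS \<Longrightarrow> c K \<noteq> \<zero> \<Longrightarrow> K \<in> M" unfolding FS_def by blast
lemma FS_finite: "c \<in> FS \<Longrightarrow> finite {K. c K \<noteq> \<zero>}" by (simp add: FS_def)
lemma FS_outside: "c \<in> FS \<Longrightarrow> K \<notin> M \<Longrightarrow> c K = \<zero>" by (auto simp: FS_def)

lemma FSI: "(\<And>K. c K \<in> carrier A) \<Longrightarrow> finite F \<Longrightarrow> (\<And>K. K \<notin> F \<Longrightarrow> c K = \<zero>) \<Longrightarrow> F \<subseteq> M \<Longrightarrow> c \<in> FS"
proof -
  assume *: "\<And>K. c K \<in> carrier A" "finite F" "\<And>K. K \<notin> F \<Longrightarrow> c K = \<zero>" "F \<subseteq> M"
  then have "{K. c K \<noteq> \<zero>} \<subseteq> F" by blast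
  with * show ?thesis by (auto simp: FS_def intro: finite_subset)
qed

lemma lc_eq: "c \<in> FS \<Longrightarrow> finite F \<Longrightarrow> {K. c K \<noteq> \<zero>} \<subseteq> F \<Longrightarrow> lc c = (\<Oplus>\<^bsub>E\<^esub>K\<in>F. \<mu> (c K) \<otimes>\<^bsub>E\<^esub> eb K)"
  unfolding lc_def
  by (rule E.finsum_mono_neutral[symmetric]) (auto simp: FS_closed mu_zero)

lemma lc_closed [simp]: "c \<in> FS \<Longrightarrow> lc c \<in> carrier E"
  unfolding lc_def by (rule E.finsum_closed) (auto simp: FS_closed)

lemma FS_zero: "(\<lambda>K. \<zero>) \<in> FS" by (simp add: FS_def)
lemma lc_zero: "lc (\<lambda>K. \<zero>) = \<zero>\<^bsub>E\<^esub>" by (simp add: lc_def)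

lemma FS_add: "c \<in> FS \<Longrightarrow> d \<in> FS \<Longrightarrow> (\<lambda>K. c K \<oplus> d K) \<in> FS"
  by (rule FSI[of _ "{K. c K \<noteq> \<zero>} \<union> {K. d K \<noteq> \<zero>}"]) (auto simp: FS_closed FS_finite dest: FS_supp)

lemma lc_add: "c \<in> FS \<Longrightarrow> d \<in> FS \<Longrightarrow> lc (\<lambda>K. c K \<oplus> d K) = lc c \<oplus>\<^bsub>E\<^esub> lc d"
proof -
  assume *: "c \<in> FS" "d \<in> FS"
  let ?F = "{K. c K \<noteq> \<zero>} \<union> {K. d K \<noteq> \<zero>}"
  have F: "finite ?F" using * by (simp add: FS_finite)
  have "lc (\<lambda>K. c K \<oplus> d K) = (\<Oplus>\<^bsub>E\<^esub>K\<in>?F. \<mu> (c K \<oplus> d K) \<otimes>\<^bsub>E\<^esub> eb K)"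
    using * F by (intro lc_eq FS_add) auto
  also have "\<dots> = (\<Oplus>\<^bsub>E\<^esub>K\<in>?F. \<mu> (c K) \<otimes>\<^bsub>E\<^esub> eb K \<oplus>\<^bsub>E\<^esub> \<mu> (d K) \<otimes>\<^bsub>E\<^esub> eb K)"
    by (rule E.finsum_cong') (use * in \<open>auto simp: FS_closed mu_add E.l_distr\<close>)
  also have "\<dots> = (\<Oplus>\<^bsub>E\<^esub>K\<in>?F. \<mu> (c K) \<otimes>\<^bsub>E\<^esub> eb K) \<oplus>\<^bsub>E\<^esub> (\<Oplus>\<^bsub>E\<^esub>K\<in>?F. \<mu> (d K) \<otimes>\<^bsub>E\<^esub> eb K)"
    by (rule E.finsum_addf) (use * in \<open>auto simp: FS_closed\<close>)
  also have "(\<Oplus>\<^bsub>E\<^esub>K\<in>?F. \<mu> (c K) \<otimes>\<^bsub>E\<^esub> eb K) = lc c" using * F by (intro lc_eq[symmetric]) auto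
  also have "(\<Oplus>\<^bsub>E\<^esub>K\<in>?F. \<mu> (d K) \<otimes>\<^bsub>E\<^esub> eb K) = lc d" using * F by (intro lc_eq[symmetric]) auto
  finally show ?thesis .
qed

lemma FS_mult: "c \<in> FS \<Longrightarrow> a \<in> carrier A \<Longrightarrow> (\<lambda>K. a \<otimes> c K) \<in> FS"
  by (rule FSI[of _ "{K. c K \<noteq> \<zero>}"]) (auto simp: FS_closed FS_finite dest: FS_supp)

lemma lc_mult: "c \<in> FS \<Longrightarrow> a \<in> carrier A \<Longrightarrow> lc (\<lambda>K. a \<otimes> c K) = \<mu> a \<otimes>\<^bsub>E\<^esub> lc c"
proof -
  assume *: "c \<in> FS" "a \<in> carrier A"
  let ?F = "{K. c K \<noteq> \<zero>}"
  have "lc (\<lambda>K. a \<otimes> c K) = (\<Oplus>\<^bsub>E\<^esub>K\<in>?F. \<mu> (a \<otimes> c K) \<otimes>\<^bsub>E\<^esub> eb K)"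
    using * by (intro lc_eq FS_mult) (auto simp: FS_finite)
  also have "\<dots> = (\<Oplus>\<^bsub>E\<^esub>K\<in>?F. \<mu> a \<otimes>\<^bsub>E\<^esub> (\<mu> (c K) \<otimes>\<^bsub>E\<^esub> eb K))"
    by (rule E.finsum_cong') (use * in \<open>auto simp: FS_closed mu_mult E.m_assoc\<close>)
  also have "\<dots> = \<mu> a \<otimes>\<^bsub>E\<^esub> lc c"
    unfolding lc_def by (rule E.finsum_rdistr[symmetric]) (use * in \<open>auto simp: FS_closed FS_finite\<close>)
  finally show ?thesis .
qed

lemma FS_single: "K \<in> M \<Longrightarrow> a \<in> carrier A \<Longrightarrow> (\<lambda>L. if L = K then a else \<zero>) \<in> FS"
  by (rule FSI[of _ "{K}"]) auto

lemma lc_single: "K \<in> M \<Longrightarrow> a \<in> carrier A \<Longrightarrow> lc (\<lambda>L. if L = K then a else \<zero>) = \<mu> a \<otimes>\<^bsub>E\<^esub> eb K"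
  by (subst lc_eq[OF FS_single, of K a "{K}"]) auto

text \<open>The function \<open>g\<close> prescribes how often \<open>p\<close> divides each
  coefficient, and \<open>T\<close> which indices occur. With \<open>g = wt\<close> this describes
  the smaller ring of level 0, with \<open>g\<close> constantly 0 the ring of level 1, and with
  \<open>hi i\<close> the piece of degree \<open>i\<close>.\<close>

definition span :: "(idx \<Rightarrow> nat) \<Rightarrow> idx set \<Rightarrow> ('a \<Rightarrow> 'a) set" where
  "span g T = lc ` {c \<in> FS. (\<forall>K. cg (g K) (c K) \<zero>) \<and> {K. c K \<noteq> \<zero>} \<subseteq> T}"

lemma span_E: "\<Phi> \<in> span g T \<Longrightarrow> \<Phi> \<in> carrier E" by (auto simp: span_def)

lemma spanI: "c \<in> FS \<Longrightarrow> (\<And>K. cg (g K) (c K) \<zero>) \<Longrightarrow> {K. c K \<noteq> \<zero>} \<subseteq> T \<Longrightarrow> lc c \<in> span g T"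
  by (auto simp: span_def)

lemma span_zero: "\<zero>\<^bsub>E\<^esub> \<in> span g T"
  using spanI[OF FS_zero, of g T] by (simp add: lc_zero cg_refl)

lemma span_add: "\<Phi> \<in> span g T \<Longrightarrow> \<Psi> \<in> span g T \<Longrightarrow> \<Phi> \<oplus>\<^bsub>E\<^esub> \<Psi> \<in> span g T"
proof -
  assume "\<Phi> \<in> span g T" "\<Psi> \<in> span g T"
  then obtain c d where *: "c \<in> FS" "\<And>K. cg (g K) (c K) \<zero>" "{K. c K \<noteq> \<zero>} \<subseteq> T" "\<Phi> = lc c"
    "d \<in> FS" "\<And>K. cg (g K) (d K) \<zero>" "{K. d K \<noteq> \<zero>} \<subseteq> T" "\<Psi> = lc d" by (auto simp: span_def)
  have "lc (\<lambda>K. c K \<oplus> d K) \<in> span g T"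
  proof (rule spanI)
    show "cg (g K) (c K \<oplus> d K) \<zero>" for K using cg_add[OF *(2,6)[of K]] by simp
    have "c K \<oplus> d K = \<zero>" if "K \<notin> T" for K
    proof -
      have "c K = \<zero>" "d K = \<zero>" using that *(3,7) by blast+
      then show ?thesis by simp
    qed
    then show "{K. c K \<oplus> d K \<noteq> \<zero>} \<subseteq> T" by blast
  qed (use * FS_add in auto)
  then show ?thesis using * by (simp add: lc_add)
qed

lemma span_mult: "\<Phi> \<in> span g T \<Longrightarrow> a \<in> carrier A \<Longrightarrow> \<mu> a \<otimes>\<^bsub>E\<^esub> \<Phi> \<in> span g T"
proof -
  assume "\<Phi> \<in> span g T" and a: "a \<in> carrier A"
  then obtain c where *: "c \<in> FS" "\<And>K. cg (g K) (c K) \<zero>" "{K. c K \<noteq> \<zero>} \<subseteq> T" "\<Phi> = lc c"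
    by (auto simp: span_def)
  have "lc (\<lambda>K. a \<otimes> c K) \<in> span g T"
  proof (rule spanI)
    show "cg (g K) (a \<otimes> c K) \<zero>" for K using cg_mult_left[OF a *(2)[of K]] a by simp
    show "{K. a \<otimes> c K \<noteq> \<zero>} \<subseteq> T" using *(3) a by auto
  qed (use * a FS_mult in auto)
  then show ?thesis using * a by (simp add: lc_mult)
qed

lemma span_neg: "\<Phi> \<in> span g T \<Longrightarrow> \<ominus>\<^bsub>E\<^esub> \<Phi> \<in> span g T"
  using span_mult[of \<Phi> g T "\<ominus> \<one>"] span_E[of \<Phi> g T] by (simp add: mu_neg mu_one E.l_minus)

lemma span_single: "K \<in> T \<Longrightarrow> K \<in> M \<Longrightarrow> cg (g K) a \<zero> \<Longrightarrow> \<mu> a \<otimes>\<^bsub>E\<^esub> eb K \<in> span g T"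
proof -
  assume *: "K \<in> T" "K \<in> M" "cg (g K) a \<zero>"
  then have a: "a \<in> carrier A" by (simp add: cg_def)
  have "lc (\<lambda>L. if L = K then a else \<zero>) \<in> span g T"
    by (rule spanI) (use * a FS_single cg_refl in auto)
  then show ?thesis using * a by (simp add: lc_single)
qed

lemma span_finsum: "(\<And>i. i \<in> F \<Longrightarrow> f i \<in> span g T) \<Longrightarrow> (\<Oplus>\<^bsub>E\<^esub>i\<in>F. f i) \<in> span g T"
proof (induction F rule: infinite_finite_induct)
  case (insert i F)
  then have "f \<in> F \<rightarrow> carrier E" "f i \<in> carrier E" using span_E by blast+
  with insert show ?case by (simp add: span_add)
qed (auto simp: span_zero E.finsum_infinite)

lemma span_induct:
  assumes "\<Phi> \<in> span g T" "\<zero>\<^bsub>E\<^esub> \<in> Y" "\<And>\<Phi> \<Psi>. \<Phi> \<in> Y \<Longrightarrow> \<Psi> \<in> Y \<Longrightarrow> \<Phi> \<oplus>\<^bsub>E\<^esub> \<Psi> \<in> Y"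
    "\<And>K a. K \<in> T \<Longrightarrow> K \<in> M \<Longrightarrow> cg (g K) a \<zero> \<Longrightarrow> \<mu> a \<otimes>\<^bsub>E\<^esub> eb K \<in> Y"
  shows "\<Phi> \<in> Y"
proof -
  obtain c where *: "c \<in> FS" "\<And>K. cg (g K) (c K) \<zero>" "{K. c K \<noteq> \<zero>} \<subseteq> T" "\<Phi> = lc c"
    using assms(1) by (auto simp: span_def)
  have "(\<Oplus>\<^bsub>E\<^esub>K\<in>F. \<mu> (c K) \<otimes>\<^bsub>E\<^esub> eb K) \<in> Y" if "F \<subseteq> {K. c K \<noteq> \<zero>}" for F
    using that
  proof (induction F rule: infinite_finite_induct)
    case (insert K F)
    have "K \<in> T" "K \<in> M" using insert.prems *(1,3) by (auto simp: FS_def)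
    then have "\<mu> (c K) \<otimes>\<^bsub>E\<^esub> eb K \<in> Y" using assms(4) *(2) by blast
    moreover have "(\<Oplus>\<^bsub>E\<^esub>K\<in>insert K F. \<mu> (c K) \<otimes>\<^bsub>E\<^esub> eb K) = \<mu> (c K) \<otimes>\<^bsub>E\<^esub> eb K \<oplus>\<^bsub>E\<^esub> (\<Oplus>\<^bsub>E\<^esub>K\<in>F. \<mu> (c K) \<otimes>\<^bsub>E\<^esub> eb K)"
      using insert.hyps *(1) by (intro E.finsum_insert) (auto simp: FS_closed)
    ultimately show ?case using insert assms(3) by simp
  qed (use assms(2) in \<open>auto simp: E.finsum_infinite\<close>)
  then show ?thesis unfolding *(4) lc_def by blast
qed

lemma eb_span: "K \<in> T \<Longrightarrow> K \<in> M \<Longrightarrow> [(p ^ g K)] \<cdot>\<^bsub>E\<^esub> eb K \<in> span g T"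
  using span_single[of K T g "[(p ^ g K)] \<cdot> \<one>"] cg_zero_add_pow[OF one_closed]
  by (simp add: mu_add_pow mu_one E.add_pow_ldistr)

lemma fact_p_eq: "(fact p :: nat) = p * fact (p - 1)" using p_gt_1 by (simp add: fact_reduce)

lemma fact_unit: "m < p \<Longrightarrow> \<exists>u\<in>carrier A. [(fact m :: nat)] \<cdot> u = \<one>"
  by (rule coprime_inverse[OF coprime_fact]) auto

text \<open>For \<open>e = 1\<close> the factor p! supplies one more power of \<open>p\<close>. The
  exponent \<open>e\<close> is the carry from \<open>delta_eb\<close>.\<close>

lemma cg_fact: "cg k a \<zero> \<Longrightarrow> e \<le> 1 \<Longrightarrow> cg (k + e) ([(fact p ^ e :: nat)] \<cdot> a) \<zero>"
proof -
  assume a: "cg k a \<zero>" and e: "e \<le> 1"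
  then obtain b where b: "b \<in> carrier A" "a = [(p ^ k)] \<cdot> b" by (auto simp: cg_def)
  show ?thesis
  proof (cases "e = 0")
    case False
    then have "e = 1" using e by simp
    have "[(fact p :: nat)] \<cdot> a = [(p ^ Suc k)] \<cdot> ([(fact (p - 1) :: nat)] \<cdot> b)"
      unfolding b(2) fact_p_eq using b(1) by (simp only: add_pow_mult power_Suc mult_ac)
    then show ?thesis using b(1) \<open>e = 1\<close> cg_zero_add_pow[of _ "Suc k"] by simp
  next
    case True
    moreover have "a \<in> carrier A" using a by (simp add: cg_def)
    ultimately show ?thesis using a by simp
  qed
qed

text \<open>
  \<open>stab g T\<close> collects the operators that preserve the span under multiplication from the left. It
  is a subring, so it suffices to look at generators.
\<close>

definition stab :: "(idx \<Rightarrow> nat) \<Rightarrow> idx set \<Rightarrow> ('a \<Rightarrow> 'a) set" where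
  "stab g T = {\<Phi> \<in> carrier E. \<forall>\<Psi>\<in>span g T. \<Phi> \<otimes>\<^bsub>E\<^esub> \<Psi> \<in> span g T}"

lemma stab_one: "\<one>\<^bsub>E\<^esub> \<in> stab g T" by (auto simp: stab_def span_E)
lemma stab_zero: "\<zero>\<^bsub>E\<^esub> \<in> stab g T" by (auto simp: stab_def span_E span_zero)
lemma stab_neg: "\<Phi> \<in> stab g T \<Longrightarrow> \<ominus>\<^bsub>E\<^esub> \<Phi> \<in> stab g T"
  by (auto simp: stab_def span_E E.l_minus span_neg)
lemma stab_add: "\<Phi> \<in> stab g T \<Longrightarrow> \<Psi> \<in> stab g T \<Longrightarrow> \<Phi> \<oplus>\<^bsub>E\<^esub> \<Psi> \<in> stab g T"
  by (auto simp: stab_def span_E E.l_distr span_add)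
lemma stab_mult: "\<Phi> \<in> stab g T \<Longrightarrow> \<Psi> \<in> stab g T \<Longrightarrow> \<Phi> \<otimes>\<^bsub>E\<^esub> \<Psi> \<in> stab g T"
  by (auto simp: stab_def span_E E.m_assoc)
lemma stab_mu: "a \<in> carrier A \<Longrightarrow> \<mu> a \<in> stab g T"
  by (auto simp: stab_def span_mult)

lemma stabI:
  assumes "\<Phi> \<in> carrier E"
    "\<And>K a. K \<in> T \<Longrightarrow> K \<in> M \<Longrightarrow> cg (g K) a \<zero> \<Longrightarrow> \<Phi> \<otimes>\<^bsub>E\<^esub> (\<mu> a \<otimes>\<^bsub>E\<^esub> eb K) \<in> span g T"
  shows "\<Phi> \<in> stab g T"
proof -
  have "\<Phi> \<otimes>\<^bsub>E\<^esub> \<Psi> \<in> span g T" if "\<Psi> \<in> span g T" for \<Psi>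
  proof -
    have "\<Psi> \<in> {\<Psi> \<in> carrier E. \<Phi> \<otimes>\<^bsub>E\<^esub> \<Psi> \<in> span g T}"
    proof (rule span_induct[OF that])
      fix K a assume *: "K \<in> T" "K \<in> M" "cg (g K) a \<zero>"
      then have "a \<in> carrier A" by (simp add: cg_def)
      then show "\<mu> a \<otimes>\<^bsub>E\<^esub> eb K \<in> {\<Psi> \<in> carrier E. \<Phi> \<otimes>\<^bsub>E\<^esub> \<Psi> \<in> span g T}" using assms(2)[OF *] by simp
    qed (use assms(1) in \<open>auto simp: span_zero E.r_distr span_add\<close>)
    then show ?thesis by simp
  qed
  with assms(1) show ?thesis by (simp add: stab_def)
qed

lemma mu_commute_ad: "\<Phi> \<in> carrier E \<Longrightarrow> a \<in> carrier A \<Longrightarrow> \<Phi> \<otimes>\<^bsub>E\<^esub> \<mu> a = ad \<Phi> a \<oplus>\<^bsub>E\<^esub> \<mu> a \<otimes>\<^bsub>E\<^esub> \<Phi>"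
  by (simp add: ad_def E.minus_add_cancel)

text \<open>When a carry raises the weight, \<open>delta_eb\<close> supplies a factor p!, which pays
  for the additional power of \<open>p\<close> demanded at the new index. \<open>N = 1\<close>
  serves level 0 and \<open>N = 0\<close> serves level 1.\<close>

lemma delta_stab:
  assumes j: "j < n" and g: "\<And>K. g K = N * wt K" "N \<le> 1"
  shows "\<delta> j \<in> stab g M"
proof (rule stabI)
  fix K a assume K: "K \<in> M" and a0: "cg (g K) a \<zero>"
  then have a: "a \<in> carrier A" by (simp add: cg_def)
  obtain K' e where e: "K' \<in> M" "e \<le> 1" "\<delta> j \<otimes>\<^bsub>E\<^esub> eb K = [(fact p ^ e :: nat)] \<cdot>\<^bsub>E\<^esub> eb K'" "wt K' = wt K + e"
    using delta_eb[OF j K] by blast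
  have "\<delta> j \<otimes>\<^bsub>E\<^esub> (\<mu> a \<otimes>\<^bsub>E\<^esub> eb K) = (\<mu> (\<delta> j a) \<oplus>\<^bsub>E\<^esub> \<mu> a \<otimes>\<^bsub>E\<^esub> \<delta> j) \<otimes>\<^bsub>E\<^esub> eb K"
    using a j mu_commute_ad[of "\<delta> j" a] by (simp add: E.m_assoc[symmetric] Der_ad[OF delta_Der])
  also have "\<dots> = \<mu> (\<delta> j a) \<otimes>\<^bsub>E\<^esub> eb K \<oplus>\<^bsub>E\<^esub> \<mu> ([(fact p ^ e :: nat)] \<cdot> a) \<otimes>\<^bsub>E\<^esub> eb K'"
    using a j e(3) by (simp add: E.l_distr E.m_assoc mu_add_pow E.add_pow_ldistr E.add_pow_rdistr)
  also have "\<dots> \<in> span g M"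
  proof (intro span_add span_single K e(1))
    obtain b where b: "b \<in> carrier A" "a = [(p ^ g K)] \<cdot> b" using a0 by (auto simp: cg_def)
    then have "\<delta> j a = [(p ^ g K)] \<cdot> \<delta> j b" using j by (simp add: op_add_pow)
    then show "cg (g K) (\<delta> j a) \<zero>" using b j cg_zero_add_pow[of "\<delta> j b"] by simp
    have "g K' \<le> g K + e" using g e(4) by (simp add: algebra_simps)
    then show "cg (g K') ([(fact p ^ e :: nat)] \<cdot> a) \<zero>"
      using cg_fact[OF a0 e(2)] cg_mono by blast
  qed
  finally show "\<delta> j \<otimes>\<^bsub>E\<^esub> (\<mu> a \<otimes>\<^bsub>E\<^esub> eb K) \<in> span g M" .
qed (use j in auto)

text \<open>These are the combinations of the \<open>mpow \<delta> (\<theta> K)\<close> of total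
  degree at most \<open>m\<close>, because that operator is \<open>eb K\<close> times
  \<open>wt K\<close> factors p!, and (p - 1)! is a unit.\<close>

definition Y :: "nat \<Rightarrow> ('a \<Rightarrow> 'a) set" where "Y m = span wt {K \<in> M. sz K \<le> m}"

text \<open>Euler's identity has \<open>\<delta> j\<close> on the right. Since \<open>eb K\<close>
  commutes with \<open>\<delta> j\<close>, right multiplication leaves the coefficients on the left
  undifferentiated and raises the size by one.\<close>

lemma Y_delta:
  assumes "\<Phi> \<in> Y m" "j < n"
  shows "\<Phi> \<otimes>\<^bsub>E\<^esub> \<delta> j \<in> Y (Suc m)"
proof -
  have "\<Phi> \<in> {\<Psi> \<in> carrier E. \<Psi> \<otimes>\<^bsub>E\<^esub> \<delta> j \<in> Y (Suc m)}"
  proof (rule span_induct[OF assms(1)[unfolded Y_def]])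
    fix K a assume K: "K \<in> {K \<in> M. sz K \<le> m}" and a0: "cg (wt K) a \<zero>"
    then have a: "a \<in> carrier A" by (simp add: cg_def)
    obtain K' e where e: "K' \<in> M" "e \<le> 1" "\<delta> j \<otimes>\<^bsub>E\<^esub> eb K = [(fact p ^ e :: nat)] \<cdot>\<^bsub>E\<^esub> eb K'"
      "wt K' = wt K + e" "sz K' = Suc (sz K)"
      using delta_eb[OF assms(2)] K by blast
    have "(\<mu> a \<otimes>\<^bsub>E\<^esub> eb K) \<otimes>\<^bsub>E\<^esub> \<delta> j = \<mu> ([(fact p ^ e :: nat)] \<cdot> a) \<otimes>\<^bsub>E\<^esub> eb K'"
      using a assms(2) e(3) by (simp add: E.m_assoc eb_delta_comm mu_add_pow E.add_pow_ldistr E.add_pow_rdistr)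
    also have "\<dots> \<in> Y (Suc m)"
      unfolding Y_def by (rule span_single) (use e K cg_fact[OF a0 e(2)] in auto)
    finally show "\<mu> a \<otimes>\<^bsub>E\<^esub> eb K \<in> {\<Psi> \<in> carrier E. \<Psi> \<otimes>\<^bsub>E\<^esub> \<delta> j \<in> Y (Suc m)}" using a by simp
  qed (use assms(2) in \<open>auto simp: Y_def span_zero E.l_distr span_add\<close>)
  then show ?thesis by simp
qed

lemma span_mono: "T \<subseteq> T' \<Longrightarrow> (\<And>K. g' K \<le> g K) \<Longrightarrow> span g T \<subseteq> span g' T'"
  unfolding span_def by (intro image_mono Collect_mono) (use cg_mono in blast)

lemma Y_mono: "m \<le> m' \<Longrightarrow> Y m \<subseteq> Y m'"
  unfolding Y_def by (rule span_mono) auto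

text \<open>Euler's identity writes \<open>Suc m\<close> times \<open>\<Phi>\<close> as an operator
  of smaller order plus brackets with coordinates followed by \<open>\<delta> j\<close>. The
  induction hypothesis handles \<open>fact m\<close> times that operator and \<open>fact m\<close>
  times the brackets, and the two factors multiply to \<open>fact (Suc m)\<close>.\<close>

lemma order_Y:
  assumes "\<Phi> \<in> carrier E" "ord_lt (Suc m) \<Phi>"
  shows "[(fact m :: nat)] \<cdot>\<^bsub>E\<^esub> \<Phi> \<in> Y m"
  using assms
proof (induction m arbitrary: \<Phi>)
  case 0
  then have "\<Phi> = \<mu> (\<Phi> \<one>)" using ord_one_iff[OF 0(1)] by (simp del: ord_lt.simps)
  moreover have "\<mu> (\<Phi> \<one>) \<otimes>\<^bsub>E\<^esub> eb K0 \<in> Y 0"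
    unfolding Y_def by (rule span_single) (use K0 0 in \<open>auto simp: cg_def\<close>)
  ultimately show ?case using 0 K0 by simp
next
  case (Suc m)
  note \<Phi> = Suc.prems(1)
  let ?S = "\<Oplus>\<^bsub>E\<^esub>j\<in>{..<n}. ad \<Phi> (x j) \<otimes>\<^bsub>E\<^esub> \<delta> j"
  let ?T = "[Suc m] \<cdot>\<^bsub>E\<^esub> \<Phi> \<ominus>\<^bsub>E\<^esub> ?S"
  let ?f = "fact m :: nat"
  have S: "?S \<in> carrier E" using \<Phi> by (intro E.finsum_closed) auto
  have T: "?T \<in> carrier E" using \<Phi> S by simp
  have "[?f] \<cdot>\<^bsub>E\<^esub> ?T \<in> Y m" by (rule Suc.IH[OF T ord_Euler[OF Suc.prems]])
  then have 1: "[?f] \<cdot>\<^bsub>E\<^esub> ?T \<in> Y (Suc m)" using Y_mono[of m "Suc m"] by auto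
  have "[?f] \<cdot>\<^bsub>E\<^esub> ?S = (\<Oplus>\<^bsub>E\<^esub>j\<in>{..<n}. [?f] \<cdot>\<^bsub>E\<^esub> (ad \<Phi> (x j) \<otimes>\<^bsub>E\<^esub> \<delta> j))"
    by (rule E.add_pow_finsum) (use \<Phi> in auto)
  also have "\<dots> = (\<Oplus>\<^bsub>E\<^esub>j\<in>{..<n}. [?f] \<cdot>\<^bsub>E\<^esub> ad \<Phi> (x j) \<otimes>\<^bsub>E\<^esub> \<delta> j)"
    by (rule E.finsum_cong') (use \<Phi> in \<open>auto simp: E.add_pow_ldistr\<close>)
  also have "\<dots> \<in> Y (Suc m)"
    unfolding Y_def
  proof (rule span_finsum, fold Y_def)
    fix j assume "j \<in> {..<n}"
    then show "[?f] \<cdot>\<^bsub>E\<^esub> ad \<Phi> (x j) \<otimes>\<^bsub>E\<^esub> \<delta> j \<in> Y (Suc m)"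
      using Suc.IH[of "ad \<Phi> (x j)"] Suc.prems by (intro Y_delta) auto
  qed
  finally have 2: "[?f] \<cdot>\<^bsub>E\<^esub> ?S \<in> Y (Suc m)" .
  have "[(fact (Suc m) :: nat)] \<cdot>\<^bsub>E\<^esub> \<Phi> = [?f] \<cdot>\<^bsub>E\<^esub> ([Suc m] \<cdot>\<^bsub>E\<^esub> \<Phi>)"
    unfolding E.add_pow_mult[OF \<Phi>] by (simp only: fact_Suc of_nat_id mult.commute)
  also have "[Suc m] \<cdot>\<^bsub>E\<^esub> \<Phi> = ?T \<oplus>\<^bsub>E\<^esub> ?S" using \<Phi> S by (simp only: E.minus_add_cancel E.add.nat_pow_closed)
  also have "[?f] \<cdot>\<^bsub>E\<^esub> \<dots> = [?f] \<cdot>\<^bsub>E\<^esub> ?T \<oplus>\<^bsub>E\<^esub> [?f] \<cdot>\<^bsub>E\<^esub> ?S" by (rule E.add_pow_distrib[OF T S])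
  also have "\<dots> \<in> Y (Suc m)" using 1 2 unfolding Y_def by (rule span_add)
  finally show ?case .
qed

text \<open>For \<open>m < p\<close> the factor \<open>fact m\<close> of \<open>order_Y\<close> is a
  unit of \<open>A\<close>.\<close>

lemma order_lt_p_Y:
  assumes "\<Phi> \<in> carrier E" "ord_lt (Suc m) \<Phi>" "m < p"
  shows "\<Phi> \<in> Y m"
proof -
  obtain u where u: "u \<in> carrier A" "[(fact m :: nat)] \<cdot> u = \<one>" using fact_unit[OF assms(3)] by blast
  have "\<mu> u \<otimes>\<^bsub>E\<^esub> [(fact m :: nat)] \<cdot>\<^bsub>E\<^esub> \<Phi> = \<mu> ([(fact m :: nat)] \<cdot> u) \<otimes>\<^bsub>E\<^esub> \<Phi>"
    using u(1) assms(1) by (simp only: mu_add_pow E.add_pow_ldistr E.add_pow_rdistr mu_closed)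
  also have "\<dots> = \<Phi>" unfolding u(2) using assms(1) by (simp add: mu_one)
  finally show ?thesis
    using span_mult[OF order_Y[OF assms(1,2), unfolded Y_def] u(1)] by (simp add: Y_def)
qed

lemma sz_ge: "p * wt K \<le> sz K"
  by (simp add: sz_def wt_def \<theta>_def sum.distrib sum_distrib_left)

lemma eb_mem:
  assumes "\<one>\<^bsub>E\<^esub> \<in> H" "\<And>a b. a \<in> H \<Longrightarrow> b \<in> H \<Longrightarrow> a \<otimes>\<^bsub>E\<^esub> b \<in> H" "\<And>j. j < n \<Longrightarrow> \<delta> j \<in> H"
    "\<And>j. j < n \<Longrightarrow> dp j \<in> H"
  shows "eb K \<in> H"
  unfolding eb_def by (intro assms(2) E.list_power_mem) (use assms in auto)

text \<open>Below size \<open>p\<close> there is no room for a divided power, since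
  \<open>p * wt K \<le> sz K\<close>. Such an operator is built from plain derivations and
  multiplications alone.\<close>

lemma Y_lt_p_mem:
  assumes "\<Phi> \<in> Y m" "m < p" "\<zero>\<^bsub>E\<^esub> \<in> H" "\<one>\<^bsub>E\<^esub> \<in> H" "\<And>a b. a \<in> H \<Longrightarrow> b \<in> H \<Longrightarrow> a \<otimes>\<^bsub>E\<^esub> b \<in> H"
    "\<And>a b. a \<in> H \<Longrightarrow> b \<in> H \<Longrightarrow> a \<oplus>\<^bsub>E\<^esub> b \<in> H" "\<And>j. j < n \<Longrightarrow> \<delta> j \<in> H" "\<And>a. a \<in> carrier A \<Longrightarrow> \<mu> a \<in> H"
  shows "\<Phi> \<in> H"
proof (rule span_induct[OF assms(1)[unfolded Y_def]])
  fix K a assume K: "K \<in> {K \<in> M. sz K \<le> m}" and a0: "cg (wt K) a \<zero>"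
  then have a: "a \<in> carrier A" by (simp add: cg_def)
  have "wt K = 0"
  proof (rule ccontr)
    assume "wt K \<noteq> 0"
    then have "p * 1 \<le> p * wt K" by (intro mult_le_mono2) simp
    with sz_ge[of K] K assms(2) show False by simp
  qed
  then have "eb K = mpow \<delta> (\<theta> K)" using eb_fact[of K] K by simp
  then have "eb K \<in> H" using E.list_power_mem[of H "[0..<n]" \<delta> "\<theta> K"] assms(4,5,7) by simp
  then show "\<mu> a \<otimes>\<^bsub>E\<^esub> eb K \<in> H" using assms(5,8) a by blast
qed (use assms in auto)

section \<open>Linear independence of the monomials over A\<close>

lemma lc_apply:
  assumes "c \<in> FS" "a \<in> carrier A"
  shows "lc c a = (\<Oplus>K\<in>{K. c K \<noteq> \<zero>}. c K \<otimes> eb K a)"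
proof -
  have "lc c a = (\<Oplus>K\<in>{K. c K \<noteq> \<zero>}. (\<mu> (c K) \<otimes>\<^bsub>E\<^esub> eb K) a)"
    unfolding lc_def by (rule op_finsum_apply) (use assms in \<open>auto simp: FS_closed\<close>)
  also have "\<dots> = (\<Oplus>K\<in>{K. c K \<noteq> \<zero>}. c K \<otimes> eb K a)"
    by (rule finsum_cong') (use assms in \<open>auto simp: FS_closed\<close>)
  finally show ?thesis .
qed

text \<open>Multiplication by \<open>N\<close> factors p! turns every \<open>eb L\<close> into a
  plain monomial and its coefficient into \<open>d L\<close>. Evaluation at coordinate monomials
  shows that a factorial multiple of \<open>d K\<close> vanishes modulo every \<open>p ^ k\<close>;
  hence \<open>d K\<close> and \<open>c K\<close> vanish.\<close>

lemma lc_eq_zero: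
  assumes c: "c \<in> FS" and "lc c = \<zero>\<^bsub>E\<^esub>"
  shows "c K = \<zero>"
proof (rule ccontr)
  assume "c K \<noteq> \<zero>"
  let ?F = "{K. c K \<noteq> \<zero>}"
  define N where "N = (\<Sum>K\<in>?F. wt K)"
  have N: "wt L \<le> N" if "L \<in> ?F" for L
    unfolding N_def by (rule member_le_sum) (use that c in \<open>auto simp: FS_finite\<close>)
  define d where "d L = [(fact p ^ (N - wt L) :: nat)] \<cdot> c L" for L
  have d_closed: "d L \<in> carrier A" for L using c by (simp add: d_def FS_closed)
  have "(\<Oplus>L\<in>?F. d L \<otimes> (mpow \<delta> (\<theta> L)) a) = \<zero>" if a: "a \<in> carrier A" for a
  proof -
    have "(\<Oplus>L\<in>?F. d L \<otimes> (mpow \<delta> (\<theta> L)) a) = (\<Oplus>L\<in>?F. [(fact p ^ N :: nat)] \<cdot> (c L \<otimes> eb L a))"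
    proof (rule finsum_cong')
      fix L assume L: "L \<in> ?F"
      then have "L \<in> M" using c FS_supp by blast
      then have "d L \<otimes> (mpow \<delta> (\<theta> L)) a = d L \<otimes> [(fact p ^ wt L :: nat)] \<cdot> eb L a"
        using a by (simp add: eb_fact[symmetric])
      also have "\<dots> = [(fact p ^ (N - wt L) * fact p ^ wt L :: nat)] \<cdot> (c L \<otimes> eb L a)"
        unfolding d_def using a FS_closed[OF c, of L]
        by (simp only: add_pow_ldistr add_pow_rdistr add_pow_mult op_closed eb_closed add.nat_pow_closed m_closed mult.commute)
      also have "fact p ^ (N - wt L) * fact p ^ wt L = (fact p ^ N :: nat)"
        using N[OF L] by (simp add: power_add[symmetric])
      finally show "d L \<otimes> (mpow \<delta> (\<theta> L)) a = [(fact p ^ N :: nat)] \<cdot> (c L \<otimes> eb L a)" .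
    qed (use a c in \<open>auto simp: FS_closed\<close>)
    also have "\<dots> = [(fact p ^ N :: nat)] \<cdot> lc c a"
      unfolding lc_apply[OF c a] by (rule add_pow_finsum[symmetric]) (use a c in \<open>auto simp: FS_closed\<close>)
    finally show ?thesis using assms(2) a by simp
  qed
  then have "cg k (\<Oplus>L\<in>?F. d L \<otimes> (mpow \<delta> (\<theta> L)) a) \<zero>" if "a \<in> carrier A" for k a
    using that by (simp add: cg_refl)
  then have "cg k ([(\<Prod>j<n. fact (\<theta> K j) :: nat)] \<cdot> d K) \<zero>" for k
  proof (rule delta_coeff_congruence[of ?F \<theta> d k K, rotated 3])
    show "K1 = K2" if "K1 \<in> ?F" "K2 \<in> ?F" "\<And>j. j < n \<Longrightarrow> \<theta> K1 j = \<theta> K2 j" for K1 K2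
      by (rule theta_inj[OF _ _ that(3)]) (use that FS_supp[OF c] in blast)+
  qed (use FS_finite[OF c] d_closed \<open>c K \<noteq> \<zero>\<close> in simp_all)
  then have "[(\<Prod>j<n. fact (\<theta> K j) :: nat)] \<cdot> d K = \<zero>" by (rule cg_all_eq)
  then have "d K = \<zero>" by (rule torsion_free[rotated 2]) (use d_closed in auto)
  then have "c K = \<zero>" unfolding d_def by (rule torsion_free[rotated 2]) (use c in \<open>auto simp: FS_closed\<close>)
  with \<open>c K \<noteq> \<zero>\<close> show False ..
qed

lemma lc_inj:
  assumes "c \<in> FS" "d \<in> FS" "lc c = lc d"
  shows "c = d"
proof
  fix K
  let ?m = "\<lambda>K. \<ominus> \<one> \<otimes> d K"
  have m: "?m \<in> FS" using assms(2) by (rule FS_mult) simp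
  have "lc (\<lambda>K. c K \<oplus> ?m K) = lc c \<oplus>\<^bsub>E\<^esub> \<mu> (\<ominus> \<one>) \<otimes>\<^bsub>E\<^esub> lc d"
    using assms(1,2) m by (simp add: lc_add lc_mult)
  also have "\<dots> = \<zero>\<^bsub>E\<^esub>" using assms by (simp add: mu_neg mu_one E.l_minus E.r_neg)
  finally have "c K \<oplus> ?m K = \<zero>" using lc_eq_zero[OF FS_add[OF assms(1) m]] by blast
  then show "c K = d K"
    using assms(1,2) minus_eq_zeroD[of "c K" "d K"] by (simp add: FS_closed l_minus a_minus_def)
qed

text \<open>\<open>Q\<close> and \<open>P\<close> are the candidates for the rings of level 1 and
  level 0; \<open>D_level_one\<close> and \<open>D_level_zero\<close> confirm this.\<close>

abbreviation Q where "Q \<equiv> span (\<lambda>K. 0) M"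
abbreviation P where "P \<equiv> span wt M"

text \<open>
  By Euler's identity \<open>p! \<Phi>\<close> is a combination of the \<open>\<partial>\<^sup>L\<close> with \<open>|L| \<le> p\<close>, and its values are
  divisible by \<open>p\<close>. So its coefficients are divisible by \<open>p\<close> as well, except for those of the
  \<open>\<partial>\<^sub>j\<^sup>p\<close>.
\<close>

lemma order_le_p_span:
  assumes \<Phi>: "\<Phi> \<in> carrier E" "ord_lt (Suc p) \<Phi>"
  shows "\<Phi> \<in> span (\<lambda>K. 0) {K \<in> M. sz K \<le> p}"
proof -
  obtain c where c: "c \<in> FS" "\<And>K. cg (wt K) (c K) \<zero>" "{K. c K \<noteq> \<zero>} \<subseteq> {K \<in> M. sz K \<le> p}"
    "[(fact p :: nat)] \<cdot>\<^bsub>E\<^esub> \<Phi> = lc c"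
    using order_Y[OF \<Phi>] unfolding Y_def span_def by blast
  let ?F = "{K. c K \<noteq> \<zero>}"
  let ?G = "{K \<in> ?F. wt K = 0}"
  have cc [simp]: "c K \<in> carrier A" for K using c(1) by (rule FS_closed)
  have F: "finite ?F" "?F \<subseteq> M" using FS_finite[OF c(1)] c(3) by auto
  \<comment> \<open>Indices of positive weight have coefficients divisible by \<open>p\<close> from
    the start, so modulo \<open>p\<close> the sum runs over weight 0. There every
    \<open>\<theta> K j\<close> is below \<open>p\<close>, and the factorials are prime to
    \<open>p\<close>.\<close>
  have dvd: "cg 1 (c K) \<zero>" for K
  proof (cases "c K = \<zero> \<or> wt K \<noteq> 0")
    case True
    then show ?thesis
    proof
      assume "wt K \<noteq> 0"
      then show ?thesis by (intro cg_mono[OF c(2)[of K]]) simp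
    qed (simp add: cg_refl)
  next
    case False
    then have K: "K \<in> ?G" by simp
    have 1: "cg 1 ([(\<Prod>j<n. fact (\<theta> K j) :: nat)] \<cdot> c K) \<zero>"
    proof (rule delta_coeff_congruence[of ?G \<theta> c 1 K])
      fix a assume a: "a \<in> carrier A"
      have "(\<Oplus>L\<in>?G. c L \<otimes> (mpow \<delta> (\<theta> L)) a) = (\<Oplus>L\<in>?G. c L \<otimes> eb L a)"
        by (rule finsum_cong') (use a F in \<open>auto simp: eb_fact[symmetric]\<close>)
      also have "\<dots> = (\<Oplus>L\<in>?F. if wt L = 0 then c L \<otimes> eb L a else \<zero>)"
        by (subst finsum_mono_neutral[of ?F ?G]) (use a F in \<open>auto intro!: finsum_cong'\<close>)
      also have "cg 1 \<dots> (\<Oplus>L\<in>?F. c L \<otimes> eb L a)"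
      proof (rule cg_finsum)
        fix L assume "L \<in> ?F"
        show "cg 1 (if wt L = 0 then c L \<otimes> eb L a else \<zero>) (c L \<otimes> eb L a)"
        proof (cases "wt L = 0")
          case False
          then have "cg 1 (c L) \<zero>" using cg_mono[OF c(2)[of L], of 1] by simp
          from cg_mult[OF this cg_refl[of "eb L a"]] show ?thesis using False a by (auto intro: cg_sym)
        qed (use a in \<open>simp add: cg_refl\<close>)
      qed
      also have "(\<Oplus>L\<in>?F. c L \<otimes> eb L a) = [(fact p :: nat)] \<cdot> \<Phi> a"
        unfolding lc_apply[OF c(1) a, symmetric] c(4)[symmetric] using a by simp
      also have "cg 1 \<dots> \<zero>"
        using cg_fact[of 0 "\<Phi> a" 1] \<Phi>(1) a by (simp add: cg_def[of 0])
      finally show "cg 1 (\<Oplus>L\<in>?G. c L \<otimes> (mpow \<delta> (\<theta> L)) a) \<zero>" .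
      next
      show "K1 = K2" if "K1 \<in> ?G" "K2 \<in> ?G" "\<And>j. j < n \<Longrightarrow> \<theta> K1 j = \<theta> K2 j" for K1 K2
        by (rule theta_inj[OF _ _ that(3)]) (use that F in blast)+
    qed (use F K in simp_all)
    have 2: "coprime (\<Prod>j<n. fact (\<theta> K j) :: nat) p"
    proof (rule prod_coprime_left)
      fix j assume "j \<in> {..<n}"
      then have "snd K j = 0" "fst K j \<le> p - 1" using K M_fst[of K j] F by (auto simp: wt_def)
      then show "coprime (fact (\<theta> K j) :: nat) p"
        using p_gt_1 by (intro coprime_fact) (auto simp: \<theta>_def)
    qed
    show ?thesis by (rule coprime_cancel[OF 2 _ cc 1]) simp
  qed
  \<comment> \<open>The coefficients are divisible by \<open>p\<close> and (p - 1)! is invertible,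
    so the whole factor p! can be removed from them.\<close>
  obtain u where u: "u \<in> carrier A" "[(fact (p - 1) :: nat)] \<cdot> u = \<one>"
    using fact_unit[of "p - 1"] p_gt_1 by auto
  have "\<exists>d\<in>carrier A. c K = [(fact p :: nat)] \<cdot> d" for K
  proof -
    obtain b where b: "b \<in> carrier A" "c K = [p] \<cdot> b" using dvd[of K] by (auto simp: cg_def)
    have "[(fact p :: nat)] \<cdot> (u \<otimes> b) = [p] \<cdot> ([(fact (p - 1) :: nat)] \<cdot> u \<otimes> b)"
      unfolding fact_p_eq using u(1) b(1) by (simp only: add_pow_mult add_pow_ldistr m_closed)
    then have "c K = [(fact p :: nat)] \<cdot> (u \<otimes> b)" unfolding u(2) using b by simp
    then show ?thesis using u b by blast
  qed
  then obtain d where d: "\<And>K. d K \<in> carrier A" "\<And>K. c K = [(fact p :: nat)] \<cdot> d K" by metis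
  have d0: "d K = \<zero>" if "c K = \<zero>" for K
    by (rule torsion_free[of "fact p"]) (use d that in auto)
  have dFS: "d \<in> FS" by (rule FSI[of d ?F]) (use d(1) d0 F in auto)
  have "[(fact p :: nat)] \<cdot>\<^bsub>E\<^esub> lc d = \<mu> ([(fact p :: nat)] \<cdot> \<one>) \<otimes>\<^bsub>E\<^esub> lc d"
    using dFS by (simp add: mu_add_pow mu_one E.add_pow_ldistr)
  also have "\<dots> = lc (\<lambda>K. [(fact p :: nat)] \<cdot> \<one> \<otimes> d K)" using dFS by (intro lc_mult[symmetric]) auto
  also have "(\<lambda>K. [(fact p :: nat)] \<cdot> \<one> \<otimes> d K) = c" using d by (simp add: add_pow_ldistr fun_eq_iff)
  finally have "[(fact p :: nat)] \<cdot>\<^bsub>E\<^esub> \<Phi> = [(fact p :: nat)] \<cdot>\<^bsub>E\<^esub> lc d" unfolding c(4) by (rule sym)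
  then have "\<Phi> = lc d" by (rule E_cancel[OF fact_nonzero \<Phi>(1) lc_closed[OF dFS]])
  also have "lc d \<in> span (\<lambda>K. 0) {K \<in> M. sz K \<le> p}"
  proof (rule spanI[OF dFS])
    show "cg 0 (d K) \<zero>" for K using d(1) by (simp add: cg_def)
    show "{K. d K \<noteq> \<zero>} \<subseteq> {K \<in> M. sz K \<le> p}" using d0 c(3) by blast
  qed
  finally show ?thesis .
qed

section \<open>Identification of the rings of level 0 and level 1\<close>

lemma D_level_eq: "D_level p W \<iota> A m = generate_ring D {\<Phi> \<in> carrier E. ord_lt (Suc (p ^ m)) \<Phi>}"
proof -
  have "{\<Phi> \<in> carrier D. order_le A (p ^ m) \<Phi>} = {\<Phi> \<in> carrier E. ord_lt (Suc (p ^ m)) \<Phi>}"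
    using order_le_iff unfolding carrier_D by blast
  then show ?thesis by (simp add: D_level_def)
qed

lemma gen_subset: "{\<Phi> \<in> carrier E. ord_lt m \<Phi>} \<subseteq> carrier D" unfolding carrier_D by blast

text \<open>All generators preserve the span, hence so does the ring they generate; applied to the
  identity, this puts each of its elements into the span.\<close>

lemma generate_subset_stab:
  assumes "{\<Phi> \<in> carrier E. ord_lt m \<Phi>} \<subseteq> stab g T" "\<one>\<^bsub>E\<^esub> \<in> span g T"
  shows "generate_ring D {\<Phi> \<in> carrier E. ord_lt m \<Phi>} \<subseteq> span g T"
proof
  fix \<Phi> assume \<Phi>: "\<Phi> \<in> generate_ring D {\<Phi> \<in> carrier E. ord_lt m \<Phi>}"
  have "\<Phi> \<in> stab g T" using \<Phi>
  proof induction
    case (a_inv h)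
    have "h \<in> carrier D" by (rule D.generate_ring_in_carrier[OF gen_subset a_inv(1)])
    with a_inv show ?case by (simp add: stab_neg)
  qed (use assms in \<open>auto simp: stab_one stab_add stab_mult\<close>)
  then have "\<Phi> \<otimes>\<^bsub>E\<^esub> \<one>\<^bsub>E\<^esub> \<in> span g T" using assms(2) unfolding stab_def by blast
  moreover have "\<Phi> \<in> carrier E" using D.generate_ring_in_carrier[OF gen_subset \<Phi>] by simp
  ultimately show "\<Phi> \<in> span g T" by simp
qed

lemma one_span: "K0 \<in> T \<Longrightarrow> g K0 = 0 \<Longrightarrow> \<one>\<^bsub>E\<^esub> \<in> span g T"
  using eb_span[of K0 T g] K0 by simp

lemma D_level_subring: "subring (D_level p W \<iota> A m) D"
  unfolding D_level_eq by (rule D.generate_ring_is_subring[OF gen_subset])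

lemma mem_D_level: "\<Phi> \<in> carrier E \<Longrightarrow> ord_lt (Suc (p ^ m)) \<Phi> \<Longrightarrow> \<Phi> \<in> D_level p W \<iota> A m"
  unfolding D_level_eq by (rule generate_ring.incl) blast

text \<open>Operators of order at most 1 lie in \<open>Y 1\<close>, and 1 is below \<open>p\<close>,
  so they come from multiplications and plain derivations, which preserve \<open>P\<close>.
  Conversely, \<open>p ^ wt K\<close> times \<open>eb K\<close> is, up to a unit, the plain monomial
  with exponent \<open>\<theta> K\<close>.\<close>

lemma D_level_zero: "D_level p W \<iota> A 0 = P"
proof
  have "{\<Phi> \<in> carrier E. ord_lt (Suc (p ^ 0)) \<Phi>} \<subseteq> stab wt M"
  proof
    fix \<Phi> assume "\<Phi> \<in> {\<Phi> \<in> carrier E. ord_lt (Suc (p ^ 0)) \<Phi>}"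
    then have "\<Phi> \<in> Y 1" using p_gt_1 by (intro order_lt_p_Y) auto
    then show "\<Phi> \<in> stab wt M"
      by (rule Y_lt_p_mem)
        (use p_gt_1 in \<open>auto simp: stab_zero stab_one stab_mult stab_add stab_mu delta_stab[of _ _ 1]\<close>)
  qed
  then show "D_level p W \<iota> A 0 \<subseteq> P"
    unfolding D_level_eq by (rule generate_subset_stab) (auto intro: one_span K0)
  show "P \<subseteq> D_level p W \<iota> A 0"
  proof
    fix \<Phi> assume \<Phi>: "\<Phi> \<in> P"
    let ?L = "D_level p W \<iota> A 0"
    have L: "\<one>\<^bsub>E\<^esub> \<in> ?L" "\<zero>\<^bsub>E\<^esub> \<in> ?L" "\<And>a b. a \<in> ?L \<Longrightarrow> b \<in> ?L \<Longrightarrow> a \<otimes>\<^bsub>E\<^esub> b \<in> ?L"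
      "\<And>a b. a \<in> ?L \<Longrightarrow> b \<in> ?L \<Longrightarrow> a \<oplus>\<^bsub>E\<^esub> b \<in> ?L"
      using subringE[OF D_level_subring[of 0]] by auto
    have mu_L: "\<mu> a \<in> ?L" if "a \<in> carrier A" for a
      by (rule mem_D_level) (use that ord_mono[OF _ _ ord_mu[of a], of 2] in \<open>auto simp: numeral_2_eq_2\<close>)
    have del_L: "\<delta> j \<in> ?L" if "j < n" for j
      by (rule mem_D_level) (use that ord_Der[OF delta_Der[of j]] in \<open>auto simp: numeral_2_eq_2\<close>)
    obtain u where u: "u \<in> carrier A" "[(fact (p - 1) :: nat)] \<cdot> u = \<one>"
      using fact_unit[of "p - 1"] p_gt_1 by auto
    show "\<Phi> \<in> ?L"
    proof (rule span_induct[OF \<Phi>])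
      fix K a assume K: "K \<in> M" "cg (wt K) a \<zero>"
      then obtain b where b: "b \<in> carrier A" "a = [(p ^ wt K)] \<cdot> b" by (auto simp: cg_def)
      have up: "[(fact (p - 1) ^ k :: nat)] \<cdot> (u [^] k) = \<one>" for k
      proof (induction k)
        case (Suc k)
        have "[(fact (p - 1) ^ Suc k :: nat)] \<cdot> (u [^] Suc k) =
          [(fact (p - 1) ^ k :: nat)] \<cdot> (u [^] k) \<otimes> [(fact (p - 1) :: nat)] \<cdot> u"
          using u(1) by (simp add: add_pow_ldistr add_pow_rdistr add_pow_mult mult.commute)
        then show ?case unfolding Suc u(2) by simp
      qed simp
      \<comment> \<open>The element \<open>u [^] wt K \<otimes> b\<close> trades the factor
        \<open>p ^ wt K\<close> of \<open>a\<close> for \<open>fact p ^ wt K\<close>, which is what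
        \<open>eb_fact\<close> absorbs.\<close>
      have "[(fact p ^ wt K :: nat)] \<cdot> (u [^] wt K \<otimes> b) =
        [(p ^ wt K)] \<cdot> ([(fact (p - 1) ^ wt K :: nat)] \<cdot> (u [^] wt K) \<otimes> b)"
        unfolding fact_p_eq power_mult_distrib using u(1) b(1)
        by (simp only: add_pow_mult add_pow_ldistr m_closed nat_pow_closed)
      then have "[(fact p ^ wt K :: nat)] \<cdot> (u [^] wt K \<otimes> b) = a" unfolding up using b by simp
      then have "\<mu> a \<otimes>\<^bsub>E\<^esub> eb K = \<mu> (u [^] wt K \<otimes> b) \<otimes>\<^bsub>E\<^esub> [(fact p ^ wt K :: nat)] \<cdot>\<^bsub>E\<^esub> eb K"
        using u(1) b(1) by (auto simp: mu_add_pow E.add_pow_ldistr E.add_pow_rdistr)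
      also have "\<dots> \<in> ?L"
        unfolding eb_fact[OF K(1)] using u(1) b(1)
        by (intro L(3) mu_L E.list_power_mem) (auto intro: L del_L)
      finally show "\<mu> a \<otimes>\<^bsub>E\<^esub> eb K \<in> ?L" .
    qed (use L in auto)
  qed
qed

text \<open>The new case is \<open>dp j\<close>. Moving it past a multiplication leaves a bracket of
  order below \<open>p\<close>, and operators of that order already preserve \<open>Q\<close>. All
  generators, of order up to \<open>p\<close>, are then covered by
  \<open>order_le_p_span\<close>.\<close>

lemma D_level_one: "D_level p W \<iota> A 1 = Q"
proof
  let ?S = "stab (\<lambda>K. 0) M"
  have lt_p: "\<Phi> \<in> ?S" if "\<Phi> \<in> carrier E" "ord_lt p \<Phi>" for \<Phi>
  proof -
    have "\<Phi> \<in> Y (p - 1)" by (rule order_lt_p_Y) (use that p_gt_1 in \<open>auto simp del: ord_lt.simps\<close>)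
    then show ?thesis
      by (rule Y_lt_p_mem)
        (use p_gt_1 in \<open>auto simp: stab_zero stab_one stab_mult stab_add stab_mu delta_stab[of _ _ 0]\<close>)
  qed
  have dp_S: "dp j \<in> ?S" if j: "j < n" for j
  proof (rule stabI)
    fix K a assume K: "K \<in> M" "cg 0 a \<zero>"
    then have a: "a \<in> carrier A" by (simp add: cg_def)
    let ?K = "(fst K, (snd K)(j := Suc (snd K j)))"
    have "fst K \<in> {..<n} \<rightarrow>\<^sub>E {0..p - 1}" "snd K \<in> {..<n} \<rightarrow>\<^sub>E UNIV"
      using K(1) unfolding M_def mem_Times_iff by simp_all
    moreover from this(2) have "(snd K)(j := Suc (snd K j)) \<in> {..<n} \<rightarrow>\<^sub>E UNIV"
      using j by (auto simp: PiE_iff extensional_def)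
    ultimately have KM: "?K \<in> M" unfolding M_def by blast
    have "ord_lt p (ad (dp j) a)" using ord_dp[OF j] a by simp
    then have "ad (dp j) a \<in> ?S" using lt_p j a by simp
    moreover have "eb K \<in> Q" using eb_span[of K M "\<lambda>K. 0"] K by simp
    ultimately have 1: "ad (dp j) a \<otimes>\<^bsub>E\<^esub> eb K \<in> Q" by (simp add: stab_def)
    have 2: "\<mu> a \<otimes>\<^bsub>E\<^esub> eb ?K \<in> Q" by (rule span_single) (use KM K in auto)
    have "dp j \<otimes>\<^bsub>E\<^esub> (\<mu> a \<otimes>\<^bsub>E\<^esub> eb K) = (ad (dp j) a \<oplus>\<^bsub>E\<^esub> \<mu> a \<otimes>\<^bsub>E\<^esub> dp j) \<otimes>\<^bsub>E\<^esub> eb K"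
      using a j mu_commute_ad[of "dp j" a] by (simp add: E.m_assoc[symmetric])
    also have "\<dots> = ad (dp j) a \<otimes>\<^bsub>E\<^esub> eb K \<oplus>\<^bsub>E\<^esub> \<mu> a \<otimes>\<^bsub>E\<^esub> eb ?K"
      using a j by (simp add: E.l_distr E.m_assoc dp_eb)
    finally show "dp j \<otimes>\<^bsub>E\<^esub> (\<mu> a \<otimes>\<^bsub>E\<^esub> eb K) \<in> Q" using span_add[OF 1 2] by simp
  qed (use j in auto)
  have eb_S: "eb K \<in> ?S" for K
    by (rule eb_mem) (auto simp: stab_one stab_mult dp_S delta_stab[of _ _ 0])
  have "{\<Phi> \<in> carrier E. ord_lt (Suc (p ^ 1)) \<Phi>} \<subseteq> ?S"
  proof
    fix \<Phi> assume "\<Phi> \<in> {\<Phi> \<in> carrier E. ord_lt (Suc (p ^ 1)) \<Phi>}"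
    then have "\<Phi> \<in> span (\<lambda>K. 0) {K \<in> M. sz K \<le> p}" by (intro order_le_p_span) (auto simp del: ord_lt.simps)
    then show "\<Phi> \<in> ?S"
      by (rule span_induct) (auto simp: cg_def intro: stab_zero stab_add stab_mult stab_mu eb_S)
  qed
  then show "D_level p W \<iota> A 1 \<subseteq> Q"
    unfolding D_level_eq by (rule generate_subset_stab) (auto intro: one_span K0)
  show "Q \<subseteq> D_level p W \<iota> A 1"
  proof
    fix \<Phi> assume \<Phi>: "\<Phi> \<in> Q"
    let ?L = "D_level p W \<iota> A 1"
    have L: "\<one>\<^bsub>E\<^esub> \<in> ?L" "\<zero>\<^bsub>E\<^esub> \<in> ?L" "\<And>a b. a \<in> ?L \<Longrightarrow> b \<in> ?L \<Longrightarrow> a \<otimes>\<^bsub>E\<^esub> b \<in> ?L"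
      "\<And>a b. a \<in> ?L \<Longrightarrow> b \<in> ?L \<Longrightarrow> a \<oplus>\<^bsub>E\<^esub> b \<in> ?L"
      using subringE[OF D_level_subring[of 1]] by auto
    have mu_L: "\<mu> a \<in> ?L" if "a \<in> carrier A" for a
      by (rule mem_D_level) (use that ord_mono[OF _ _ ord_mu[of a], of "Suc (p ^ 1)"] in \<open>auto simp del: ord_lt.simps\<close>)
    have del_L: "\<delta> j \<in> ?L" if "j < n" for j
      by (rule mem_D_level)
        (use that p_gt_1 ord_mono[OF _ _ ord_Der[OF delta_Der[of j]], of "Suc (p ^ 1)"] in \<open>auto simp del: ord_lt.simps\<close>)
    have dp_L: "dp j \<in> ?L" if "j < n" for j
      by (rule mem_D_level) (use that ord_dp[of j] in \<open>auto simp del: ord_lt.simps\<close>)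
    show "\<Phi> \<in> ?L"
    proof (rule span_induct[OF \<Phi>])
      fix K a assume "K \<in> M" "cg 0 a \<zero>"
      then have a: "a \<in> carrier A" by (simp add: cg_def)
      have "eb K \<in> ?L" by (rule eb_mem) (use L del_L dp_L in auto)
      then show "\<mu> a \<otimes>\<^bsub>E\<^esub> eb K \<in> ?L" using mu_L[OF a] L(3) by blast
    qed (use L in auto)
  qed
qed

end

context abelian_monoid
begin

lemma finsum_swap:
  assumes "finite B" "\<And>i j. i \<in> B \<Longrightarrow> j \<in> C \<Longrightarrow> f i j \<in> carrier G"
  shows "(\<Oplus>i\<in>B. \<Oplus>j\<in>C. f i j) = (\<Oplus>j\<in>C. \<Oplus>i\<in>B. f i j)"
  using assms
proof (induction B rule: finite_induct)
  case empty
  show ?case by simp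
next
  case (insert b B)
  have cl: "(\<lambda>i. \<Oplus>j\<in>C. f i j) \<in> B \<rightarrow> carrier G" "(\<Oplus>j\<in>C. f b j) \<in> carrier G"
    "(\<lambda>j. \<Oplus>i\<in>B. f i j) \<in> C \<rightarrow> carrier G" "f b \<in> C \<rightarrow> carrier G"
    using insert.prems by (auto intro!: finsum_closed)
  have "(\<Oplus>i\<in>insert b B. \<Oplus>j\<in>C. f i j) = (\<Oplus>j\<in>C. f b j) \<oplus> (\<Oplus>j\<in>C. \<Oplus>i\<in>B. f i j)"
    using insert cl by simp
  also have "\<dots> = (\<Oplus>j\<in>C. f b j \<oplus> (\<Oplus>i\<in>B. f i j))"
    using cl by (intro finsum_addf[symmetric]) auto
  also have "\<dots> = (\<Oplus>j\<in>C. \<Oplus>i\<in>insert b B. f i j)"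
  proof (rule finsum_cong')
    fix j assume "j \<in> C"
    then show "f b j \<oplus> (\<Oplus>i\<in>B. f i j) = (\<Oplus>i\<in>insert b B. f i j)"
      using insert by (intro finsum_insert[symmetric]) auto
  next
    show "(\<lambda>j. \<Oplus>i\<in>insert b B. f i j) \<in> C \<rightarrow> carrier G"
      using insert.prems by (auto intro!: finsum_closed)
  qed simp
  finally show ?case .
qed

end

section \<open>The graded ring of a family of additive subgroups\<close>

text \<open>The construction of \<open>D01\<close> for an arbitrary ring and family of subsets, so
  that the ring axioms are checked without differential operators. An element of the ring may occur
  in several degrees; the index keeps these copies apart.\<close>

definition rees_ring :: "('r, 's) ring_scheme \<Rightarrow> (int \<Rightarrow> 'r set) \<Rightarrow> (int \<Rightarrow> 'r) ring" where
  "rees_ring R H = \<lparr>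
     carrier = {F. (\<forall>i. F i \<in> H i) \<and> finite {i. F i \<noteq> \<zero>\<^bsub>R\<^esub>}},
     mult = (\<lambda>F G n. \<Oplus>\<^bsub>R\<^esub>i\<in>{i. F i \<noteq> \<zero>\<^bsub>R\<^esub>}. F i \<otimes>\<^bsub>R\<^esub> G (n - i)),
     one = (\<lambda>i. if i = 0 then \<one>\<^bsub>R\<^esub> else \<zero>\<^bsub>R\<^esub>),
     zero = (\<lambda>i. \<zero>\<^bsub>R\<^esub>),
     add = (\<lambda>F G i. F i \<oplus>\<^bsub>R\<^esub> G i)\<rparr>"

locale graded_pieces = ring R for R (structure) +
  fixes H :: "int \<Rightarrow> 'a set"
  assumes H_sub: "H i \<subseteq> carrier R" and H_zero: "\<zero> \<in> H i"
    and H_add: "a \<in> H i \<Longrightarrow> b \<in> H i \<Longrightarrow> a \<oplus> b \<in> H i"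
    and H_neg: "a \<in> H i \<Longrightarrow> \<ominus> a \<in> H i"
    and H_one: "\<one> \<in> H 0"
    and H_mult: "a \<in> H i \<Longrightarrow> b \<in> H j \<Longrightarrow> a \<otimes> b \<in> H (i + j)"
begin

abbreviation S where "S \<equiv> rees_ring R H"

lemma rees_mem: "F \<in> carrier S \<longleftrightarrow> (\<forall>i. F i \<in> H i) \<and> finite {i. F i \<noteq> \<zero>}"
  by (simp add: rees_ring_def)

lemma rees_closed [simp]: "F \<in> carrier S \<Longrightarrow> F i \<in> carrier R"
  using H_sub by (auto simp: rees_mem)

lemma rees_add: "(F \<oplus>\<^bsub>S\<^esub> G) i = F i \<oplus> G i" by (simp add: rees_ring_def)
lemma rees_zero: "\<zero>\<^bsub>S\<^esub> i = \<zero>" by (simp add: rees_ring_def)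
lemma rees_one: "\<one>\<^bsub>S\<^esub> i = (if i = 0 then \<one> else \<zero>)" by (simp add: rees_ring_def)

lemma rees_mult:
  assumes "F \<in> carrier S" "G \<in> carrier S" "finite X" "{i. F i \<noteq> \<zero>} \<subseteq> X"
  shows "(F \<otimes>\<^bsub>S\<^esub> G) n = (\<Oplus>i\<in>X. F i \<otimes> G (n - i))"
proof -
  have "(F \<otimes>\<^bsub>S\<^esub> G) n = (\<Oplus>i\<in>{i. F i \<noteq> \<zero>}. F i \<otimes> G (n - i))" by (simp add: rees_ring_def)
  also have "\<dots> = (\<Oplus>i\<in>X. F i \<otimes> G (n - i))"
    using assms by (intro finsum_mono_neutral[symmetric]) auto
  finally show ?thesis .
qed

lemma H_finsum: "f \<in> X \<rightarrow> H i \<Longrightarrow> finsum R f X \<in> H i"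
proof (induction X rule: infinite_finite_induct)
  case (insert x X)
  then have "f \<in> X \<rightarrow> carrier R" "f x \<in> carrier R" using H_sub by blast+
  with insert show ?case by (simp add: H_add)
qed (auto simp: H_zero finsum_infinite)

lemma rees_mult_supp:
  assumes "F \<in> carrier S" "G \<in> carrier S" "(F \<otimes>\<^bsub>S\<^esub> G) n \<noteq> \<zero>"
  shows "n \<in> (\<lambda>(i, j). i + j) ` ({i. F i \<noteq> \<zero>} \<times> {i. G i \<noteq> \<zero>})"
proof (rule ccontr)
  assume *: "n \<notin> (\<lambda>(i, j). i + j) ` ({i. F i \<noteq> \<zero>} \<times> {i. G i \<noteq> \<zero>})"
  have "G (n - i) = \<zero>" if "F i \<noteq> \<zero>" for i
  proof (rule ccontr)
    assume "G (n - i) \<noteq> \<zero>"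
    with that have "(i, n - i) \<in> {i. F i \<noteq> \<zero>} \<times> {i. G i \<noteq> \<zero>}" by simp
    from imageI[OF this, of "\<lambda>(i, j). i + j"] * show False by simp
  qed
  then have "(F \<otimes>\<^bsub>S\<^esub> G) n = \<zero>"
    using assms(1,2) by (subst rees_mult[of F G "{i. F i \<noteq> \<zero>}"]) (auto simp: rees_mem intro!: finsum_neutral)
  with assms(3) show False by simp
qed

lemma rees_mult_closed:
  assumes "F \<in> carrier S" "G \<in> carrier S"
  shows "F \<otimes>\<^bsub>S\<^esub> G \<in> carrier S"
proof -
  have FG: "finite {i. F i \<noteq> \<zero>}" "finite {i. G i \<noteq> \<zero>}" "\<And>i. F i \<in> H i" "\<And>i. G i \<in> H i"
    using assms by (auto simp: rees_mem)
  have "(F \<otimes>\<^bsub>S\<^esub> G) n \<in> H n" for n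
  proof -
    have "F i \<otimes> G (n - i) \<in> H n" for i using H_mult[OF FG(3)[of i] FG(4)[of "n - i"]] by simp
    then show ?thesis using assms FG by (subst rees_mult[of F G "{i. F i \<noteq> \<zero>}"]) (auto intro!: H_finsum)
  qed
  moreover have "finite {n. (F \<otimes>\<^bsub>S\<^esub> G) n \<noteq> \<zero>}"
    by (rule finite_subset[of _ "(\<lambda>(i, j). i + j) ` ({i. F i \<noteq> \<zero>} \<times> {i. G i \<noteq> \<zero>})"])
      (use rees_mult_supp[OF assms] FG in auto)
  ultimately show ?thesis unfolding rees_mem by blast
qed

lemma rees_mult_assoc:
  assumes "F \<in> carrier S" "G \<in> carrier S" "K \<in> carrier S"
  shows "F \<otimes>\<^bsub>S\<^esub> G \<otimes>\<^bsub>S\<^esub> K = F \<otimes>\<^bsub>S\<^esub> (G \<otimes>\<^bsub>S\<^esub> K)"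
proof
  fix n
  let ?F = "{i. F i \<noteq> \<zero>}" and ?G = "{i. G i \<noteq> \<zero>}"
  \<comment> \<open>A finite set that contains the support of the product of \<open>F\<close> and
    \<open>G\<close> and does not depend on the inner index, so that the double sum can be
    interchanged.\<close>
  let ?X = "(\<lambda>(i, j). i + j) ` (?F \<times> ?G)"
  have fin: "finite ?F" "finite ?G" "finite ?X" using assms by (auto simp: rees_mem)
  have X: "{i. (F \<otimes>\<^bsub>S\<^esub> G) i \<noteq> \<zero>} \<subseteq> ?X" using rees_mult_supp[OF assms(1,2)] by blast
  have "(F \<otimes>\<^bsub>S\<^esub> G \<otimes>\<^bsub>S\<^esub> K) n = (\<Oplus>i\<in>?X. (F \<otimes>\<^bsub>S\<^esub> G) i \<otimes> K (n - i))"
    by (rule rees_mult[OF rees_mult_closed[OF assms(1,2)] assms(3) fin(3) X])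
  also have "\<dots> = (\<Oplus>i\<in>?X. \<Oplus>j\<in>?F. F j \<otimes> G (i - j) \<otimes> K (n - i))"
  proof (rule finsum_cong')
    fix i assume "i \<in> ?X"
    have "(F \<otimes>\<^bsub>S\<^esub> G) i = (\<Oplus>j\<in>?F. F j \<otimes> G (i - j))" by (rule rees_mult[OF assms(1,2) fin(1)]) simp
    also have "\<dots> \<otimes> K (n - i) = (\<Oplus>j\<in>?F. F j \<otimes> G (i - j) \<otimes> K (n - i))"
      using assms fin by (intro finsum_ldistr) auto
    finally show "(F \<otimes>\<^bsub>S\<^esub> G) i \<otimes> K (n - i) = (\<Oplus>j\<in>?F. F j \<otimes> G (i - j) \<otimes> K (n - i))" .
  qed (use assms in \<open>auto intro!: finsum_closed\<close>)
  also have "\<dots> = (\<Oplus>j\<in>?F. \<Oplus>i\<in>?X. F j \<otimes> G (i - j) \<otimes> K (n - i))"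
    by (rule finsum_swap) (use assms fin in auto)
  also have "\<dots> = (\<Oplus>j\<in>?F. F j \<otimes> (G \<otimes>\<^bsub>S\<^esub> K) (n - j))"
  proof (rule finsum_cong')
    fix j assume j: "j \<in> ?F"
    \<comment> \<open>The support of \<open>G\<close> shifted by \<open>j\<close>; outside
      \<open>?T\<close> the factor \<open>G (i - j)\<close> vanishes, so the range may be enlarged
      to \<open>?X\<close>.\<close>
    let ?T = "(\<lambda>l. l + j) ` ?G"
    have "(G \<otimes>\<^bsub>S\<^esub> K) (n - j) = (\<Oplus>l\<in>?G. G l \<otimes> K (n - j - l))"
      by (rule rees_mult[OF assms(2,3) fin(2)]) simp
    also have "\<dots> = (\<Oplus>l\<in>?G. G (l + j - j) \<otimes> K (n - (l + j)))"
      using assms by (intro finsum_cong') (auto simp: algebra_simps)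
    also have "\<dots> = (\<Oplus>i\<in>?T. G (i - j) \<otimes> K (n - i))"
      using assms by (subst finsum_reindex) (auto simp: inj_on_def)
    also have "\<dots> = (\<Oplus>i\<in>?X. G (i - j) \<otimes> K (n - i))"
    proof (rule finsum_mono_neutral[symmetric])
      show "?T \<subseteq> ?X"
      proof
        fix i assume "i \<in> ?T"
        then obtain l where "i = l + j" "l \<in> ?G" by blast
        then have "(j, l) \<in> ?F \<times> ?G" "i = (\<lambda>(i, j). i + j) (j, l)" using j by auto
        then show "i \<in> ?X" by (rule rev_image_eqI)
      qed
      fix i assume "i \<in> ?X - ?T"
      then have "G (i - j) = \<zero>" by (metis (mono_tags, lifting) DiffD2 diff_add_cancel image_iff mem_Collect_eq)
      then show "G (i - j) \<otimes> K (n - i) = \<zero>" using assms by simp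
    qed (use fin assms in auto)
    finally have "F j \<otimes> (G \<otimes>\<^bsub>S\<^esub> K) (n - j) = F j \<otimes> (\<Oplus>i\<in>?X. G (i - j) \<otimes> K (n - i))" by simp
    also have "\<dots> = (\<Oplus>i\<in>?X. F j \<otimes> (G (i - j) \<otimes> K (n - i)))"
      using fin assms by (intro finsum_rdistr) auto
    also have "\<dots> = (\<Oplus>i\<in>?X. F j \<otimes> G (i - j) \<otimes> K (n - i))"
      using fin assms by (intro finsum_cong') (auto simp: m_assoc)
    finally show "(\<Oplus>i\<in>?X. F j \<otimes> G (i - j) \<otimes> K (n - i)) = F j \<otimes> (G \<otimes>\<^bsub>S\<^esub> K) (n - j)" by simp
  qed (use assms rees_mult_closed in auto)
  also have "\<dots> = (F \<otimes>\<^bsub>S\<^esub> (G \<otimes>\<^bsub>S\<^esub> K)) n"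
    by (rule rees_mult[symmetric, OF assms(1) rees_mult_closed[OF assms(2,3)] fin(1)]) simp
  finally show "(F \<otimes>\<^bsub>S\<^esub> G \<otimes>\<^bsub>S\<^esub> K) n = (F \<otimes>\<^bsub>S\<^esub> (G \<otimes>\<^bsub>S\<^esub> K)) n" .
qed

lemma rees_add_closed:
  assumes "F \<in> carrier S" "G \<in> carrier S"
  shows "F \<oplus>\<^bsub>S\<^esub> G \<in> carrier S"
proof -
  have "{i. (F \<oplus>\<^bsub>S\<^esub> G) i \<noteq> \<zero>} \<subseteq> {i. F i \<noteq> \<zero>} \<union> {i. G i \<noteq> \<zero>}"
    using assms by (auto simp: rees_add)
  then have "finite {i. (F \<oplus>\<^bsub>S\<^esub> G) i \<noteq> \<zero>}"
    by (rule finite_subset) (use assms in \<open>simp add: rees_mem\<close>)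
  then show ?thesis using assms H_add by (auto simp: rees_mem rees_add)
qed

lemma rees_zero_closed: "\<zero>\<^bsub>S\<^esub> \<in> carrier S"
  by (simp add: rees_mem rees_zero H_zero)

lemma rees_one_closed: "\<one>\<^bsub>S\<^esub> \<in> carrier S"
  by (auto simp: rees_mem rees_one H_zero H_one intro: finite_subset[of _ "{0}"])

lemma rees_is_ring: "ring S"
proof (rule ringI)
  show "abelian_group S"
  proof (rule abelian_groupI)
    fix F assume F: "F \<in> carrier S"
    have "(\<lambda>i. \<ominus> F i) \<in> carrier S"
    proof -
      have "{i. \<ominus> F i \<noteq> \<zero>} \<subseteq> {i. F i \<noteq> \<zero>}" by auto
      then have "finite {i. \<ominus> F i \<noteq> \<zero>}" by (rule finite_subset) (use F in \<open>simp add: rees_mem\<close>)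
      then show ?thesis using F H_neg by (auto simp: rees_mem)
    qed
    moreover have "(\<lambda>i. \<ominus> F i) \<oplus>\<^bsub>S\<^esub> F = \<zero>\<^bsub>S\<^esub>"
      using F by (intro ext) (simp add: rees_add rees_zero l_neg)
    ultimately show "\<exists>G\<in>carrier S. G \<oplus>\<^bsub>S\<^esub> F = \<zero>\<^bsub>S\<^esub>" by blast
  next
    fix F G K assume "F \<in> carrier S" "G \<in> carrier S" "K \<in> carrier S"
    then show "F \<oplus>\<^bsub>S\<^esub> G \<oplus>\<^bsub>S\<^esub> K = F \<oplus>\<^bsub>S\<^esub> (G \<oplus>\<^bsub>S\<^esub> K)" by (intro ext) (simp add: rees_add a_assoc)
  next
    fix F G assume "F \<in> carrier S" "G \<in> carrier S"
    then show "F \<oplus>\<^bsub>S\<^esub> G = G \<oplus>\<^bsub>S\<^esub> F" by (intro ext) (simp add: rees_add a_comm)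
  next
    fix F assume "F \<in> carrier S"
    then show "\<zero>\<^bsub>S\<^esub> \<oplus>\<^bsub>S\<^esub> F = F" by (intro ext) (simp add: rees_add rees_zero)
  qed (auto simp: rees_add_closed rees_zero_closed)
  show "Group.monoid S"
  proof (rule monoidI)
    fix F assume F: "F \<in> carrier S"
    show "\<one>\<^bsub>S\<^esub> \<otimes>\<^bsub>S\<^esub> F = F"
    proof
      fix n
      have "(\<one>\<^bsub>S\<^esub> \<otimes>\<^bsub>S\<^esub> F) n = (\<Oplus>i\<in>{0}. \<one>\<^bsub>S\<^esub> i \<otimes> F (n - i))"
        by (rule rees_mult[OF rees_one_closed F]) (auto simp: rees_one split: if_splits)
      with F show "(\<one>\<^bsub>S\<^esub> \<otimes>\<^bsub>S\<^esub> F) n = F n" by (simp add: rees_one)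
    qed
    show "F \<otimes>\<^bsub>S\<^esub> \<one>\<^bsub>S\<^esub> = F"
    proof
      fix n
      let ?X = "insert n {i. F i \<noteq> \<zero>}"
      have X: "finite ?X" using F by (simp add: rees_mem)
      have "(F \<otimes>\<^bsub>S\<^esub> \<one>\<^bsub>S\<^esub>) n = (\<Oplus>i\<in>?X. F i \<otimes> \<one>\<^bsub>S\<^esub> (n - i))"
        by (rule rees_mult[OF F rees_one_closed X]) auto
      also have "\<dots> = F n \<otimes> \<one>\<^bsub>S\<^esub> (n - n)"
        by (rule finsum_single[OF X]) (use F in \<open>auto simp: rees_one\<close>)
      finally show "(F \<otimes>\<^bsub>S\<^esub> \<one>\<^bsub>S\<^esub>) n = F n" using F by (simp add: rees_one)
    qed
  qed (auto simp: rees_mult_closed rees_one_closed rees_mult_assoc)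
next
  fix F G K assume *: "F \<in> carrier S" "G \<in> carrier S" "K \<in> carrier S"
  show "(F \<oplus>\<^bsub>S\<^esub> G) \<otimes>\<^bsub>S\<^esub> K = F \<otimes>\<^bsub>S\<^esub> K \<oplus>\<^bsub>S\<^esub> G \<otimes>\<^bsub>S\<^esub> K"
  proof
    fix n
    let ?X = "{i. F i \<noteq> \<zero>} \<union> {i. G i \<noteq> \<zero>}"
    have X: "finite ?X" using * by (simp add: rees_mem)
    have "((F \<oplus>\<^bsub>S\<^esub> G) \<otimes>\<^bsub>S\<^esub> K) n = (\<Oplus>i\<in>?X. (F \<oplus>\<^bsub>S\<^esub> G) i \<otimes> K (n - i))"
      by (rule rees_mult[OF rees_add_closed[OF *(1,2)] *(3) X]) (use * in \<open>auto simp: rees_add\<close>)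
    also have "\<dots> = (\<Oplus>i\<in>?X. F i \<otimes> K (n - i) \<oplus> G i \<otimes> K (n - i))"
      using * by (intro finsum_cong') (auto simp: rees_add l_distr)
    also have "\<dots> = (\<Oplus>i\<in>?X. F i \<otimes> K (n - i)) \<oplus> (\<Oplus>i\<in>?X. G i \<otimes> K (n - i))"
      using * by (intro finsum_addf) auto
    also have "(\<Oplus>i\<in>?X. F i \<otimes> K (n - i)) = (F \<otimes>\<^bsub>S\<^esub> K) n"
      by (rule rees_mult[symmetric, OF *(1,3) X]) blast
    also have "(\<Oplus>i\<in>?X. G i \<otimes> K (n - i)) = (G \<otimes>\<^bsub>S\<^esub> K) n"
      by (rule rees_mult[symmetric, OF *(2,3) X]) blast
    finally show "((F \<oplus>\<^bsub>S\<^esub> G) \<otimes>\<^bsub>S\<^esub> K) n = (F \<otimes>\<^bsub>S\<^esub> K \<oplus>\<^bsub>S\<^esub> G \<otimes>\<^bsub>S\<^esub> K) n"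
      unfolding rees_add[of "F \<otimes>\<^bsub>S\<^esub> K" "G \<otimes>\<^bsub>S\<^esub> K" n] .
  qed
  show "K \<otimes>\<^bsub>S\<^esub> (F \<oplus>\<^bsub>S\<^esub> G) = K \<otimes>\<^bsub>S\<^esub> F \<oplus>\<^bsub>S\<^esub> K \<otimes>\<^bsub>S\<^esub> G"
  proof
    fix n
    let ?X = "{i. K i \<noteq> \<zero>}"
    have X: "finite ?X" using * by (simp add: rees_mem)
    have "(K \<otimes>\<^bsub>S\<^esub> (F \<oplus>\<^bsub>S\<^esub> G)) n = (\<Oplus>i\<in>?X. K i \<otimes> (F \<oplus>\<^bsub>S\<^esub> G) (n - i))"
      by (rule rees_mult[OF *(3) rees_add_closed[OF *(1,2)] X]) simp
    also have "\<dots> = (\<Oplus>i\<in>?X. K i \<otimes> F (n - i) \<oplus> K i \<otimes> G (n - i))"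
      using * by (intro finsum_cong') (auto simp: rees_add r_distr)
    also have "\<dots> = (\<Oplus>i\<in>?X. K i \<otimes> F (n - i)) \<oplus> (\<Oplus>i\<in>?X. K i \<otimes> G (n - i))"
      using * by (intro finsum_addf) auto
    also have "(\<Oplus>i\<in>?X. K i \<otimes> F (n - i)) = (K \<otimes>\<^bsub>S\<^esub> F) n"
      by (rule rees_mult[symmetric, OF *(3,1) X]) simp
    also have "(\<Oplus>i\<in>?X. K i \<otimes> G (n - i)) = (K \<otimes>\<^bsub>S\<^esub> G) n"
      by (rule rees_mult[symmetric, OF *(3,2) X]) simp
    finally show "(K \<otimes>\<^bsub>S\<^esub> (F \<oplus>\<^bsub>S\<^esub> G)) n = (K \<otimes>\<^bsub>S\<^esub> F \<oplus>\<^bsub>S\<^esub> K \<otimes>\<^bsub>S\<^esub> G) n"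
      unfolding rees_add[of "K \<otimes>\<^bsub>S\<^esub> F" "K \<otimes>\<^bsub>S\<^esub> G" n] .
  qed
qed

sublocale S: ring S by (rule rees_is_ring)

definition sg :: "int \<Rightarrow> 'a \<Rightarrow> int \<Rightarrow> 'a" where "sg i a = (\<lambda>j. if j = i then a else \<zero>)"

lemma sg_closed [simp]: "a \<in> H i \<Longrightarrow> sg i a \<in> carrier S"
  by (auto simp: rees_mem sg_def H_zero intro: finite_subset[of _ "{i}"])

lemma sg_add: "a \<in> carrier R \<Longrightarrow> b \<in> carrier R \<Longrightarrow> sg i (a \<oplus> b) = sg i a \<oplus>\<^bsub>S\<^esub> sg i b"
  by (rule ext) (simp add: sg_def rees_add)

lemma sg_zero: "sg i \<zero> = \<zero>\<^bsub>S\<^esub>"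
  by (rule ext) (simp add: sg_def rees_zero)

lemma sg_one: "sg 0 \<one> = \<one>\<^bsub>S\<^esub>"
  by (rule ext) (simp add: sg_def rees_one)

lemma sg_mult:
  assumes "a \<in> H i" "b \<in> H j"
  shows "sg i a \<otimes>\<^bsub>S\<^esub> sg j b = sg (i + j) (a \<otimes> b)"
proof
  fix n
  have ab: "a \<in> carrier R" "b \<in> carrier R" using assms H_sub by auto
  have "(sg i a \<otimes>\<^bsub>S\<^esub> sg j b) n = (\<Oplus>l\<in>{i}. sg i a l \<otimes> sg j b (n - l))"
    by (rule rees_mult[OF sg_closed[OF assms(1)] sg_closed[OF assms(2)]]) (auto simp: sg_def split: if_splits)
  also have "\<dots> = a \<otimes> sg j b (n - i)" using ab by (simp add: sg_def)
  finally show "(sg i a \<otimes>\<^bsub>S\<^esub> sg j b) n = sg (i + j) (a \<otimes> b) n" using ab by (auto simp: sg_def)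
qed

lemma rees_add_pow: "([(m::nat)] \<cdot>\<^bsub>S\<^esub> F) i = [m] \<cdot> F i"
  by (induction m) (simp_all add: rees_add rees_zero)

lemma rees_neg: "F \<in> carrier S \<Longrightarrow> (\<ominus>\<^bsub>S\<^esub> F) i = \<ominus> F i"
  using rees_add[of "\<ominus>\<^bsub>S\<^esub> F" F i] by (simp add: S.l_neg rees_zero minus_equality[symmetric])

lemma rees_finsum: "f \<in> X \<rightarrow> carrier S \<Longrightarrow> (\<Oplus>\<^bsub>S\<^esub>k\<in>X. f k) i = (\<Oplus>k\<in>X. f k i)"
  by (induction X rule: infinite_finite_induct)
    (auto simp: Pi_def rees_zero rees_add S.finsum_infinite finsum_infinite)

lemma rees_decompose:
  assumes F: "F \<in> carrier S"
  shows "F = (\<Oplus>\<^bsub>S\<^esub>i\<in>{i. F i \<noteq> \<zero>}. sg i (F i))"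
proof
  fix j
  have FH: "F i \<in> H i" for i using F by (simp add: rees_mem)
  have fin: "finite {i. F i \<noteq> \<zero>}" using F by (simp add: rees_mem)
  have "(\<Oplus>\<^bsub>S\<^esub>i\<in>{i. F i \<noteq> \<zero>}. sg i (F i)) j = (\<Oplus>i\<in>{i. F i \<noteq> \<zero>}. sg i (F i) j)"
    by (rule rees_finsum) (use FH in auto)
  also have "\<dots> = F j"
  proof (cases "F j = \<zero>")
    case True
    then show ?thesis by (auto simp: sg_def intro: finsum_neutral)
  next
    case False
    then show ?thesis using F fin by (subst finsum_single[of _ j]) (auto simp: sg_def)
  qed
  finally show "F j = (\<Oplus>\<^bsub>S\<^esub>i\<in>{i. F i \<noteq> \<zero>}. sg i (F i)) j" by simp
qed

end

section \<open>The homogeneous pieces and their coordinates over A\<close>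

context formal_coords
begin

abbreviation Dp where "Dp \<equiv> D01_part p W \<iota> A"
abbreviation B1 where "B1 \<equiv> D01 p W \<iota> A"

lemma D01_eq: "B1 = rees_ring D Dp"
  by (simp add: D01_def rees_ring_def Let_def)

lemma p_pow_nz: "(p ^ k :: nat) \<noteq> 0" using p_gt_1 by simp

text \<open>A common factor \<open>p ^ t\<close> on both sides cancels, so any natural numbers with
  difference \<open>i\<close> may replace the truncated exponents \<open>nat i\<close> and
  \<open>nat (- i)\<close>. Exponents then simply add up in products.\<close>

lemma part_iff:
  assumes "int a - int b = i"
  shows "\<Phi> \<in> Dp i \<longleftrightarrow> \<Phi> \<in> Q \<and> (\<exists>\<Psi>\<in>P. [(p ^ a)] \<cdot>\<^bsub>E\<^esub> \<Phi> = [(p ^ b)] \<cdot>\<^bsub>E\<^esub> \<Psi>)"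
proof -
  obtain t where t: "a = t + nat i" "b = t + nat (- i)"
  proof (rule that[of "min a b"])
    have "nat i = a - b" "nat (- i) = b - a" using assms by (auto simp: nat_minus_as_int)
    then show "a = min a b + nat i" "b = min a b + nat (- i)" by auto
  qed
  have eqv: "[(p ^ a)] \<cdot>\<^bsub>E\<^esub> \<Phi> = [(p ^ b)] \<cdot>\<^bsub>E\<^esub> \<Psi> \<longleftrightarrow> [(p ^ nat i)] \<cdot>\<^bsub>E\<^esub> \<Phi> = [(p ^ nat (- i))] \<cdot>\<^bsub>E\<^esub> \<Psi>"
    if "\<Phi> \<in> carrier E" "\<Psi> \<in> carrier E" for \<Psi>
  proof -
    have pw: "[(p ^ a)] \<cdot>\<^bsub>E\<^esub> \<Phi> = [(p ^ t)] \<cdot>\<^bsub>E\<^esub> ([(p ^ nat i)] \<cdot>\<^bsub>E\<^esub> \<Phi>)"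
      "[(p ^ b)] \<cdot>\<^bsub>E\<^esub> \<Psi> = [(p ^ t)] \<cdot>\<^bsub>E\<^esub> ([(p ^ nat (- i))] \<cdot>\<^bsub>E\<^esub> \<Psi>)"
      unfolding t power_add using that by (simp_all only: E.add_pow_mult)
    show ?thesis unfolding pw
    proof (rule iffI)
      assume "[(p ^ t)] \<cdot>\<^bsub>E\<^esub> ([(p ^ nat i)] \<cdot>\<^bsub>E\<^esub> \<Phi>) = [(p ^ t)] \<cdot>\<^bsub>E\<^esub> ([(p ^ nat (- i))] \<cdot>\<^bsub>E\<^esub> \<Psi>)"
      then show "[(p ^ nat i)] \<cdot>\<^bsub>E\<^esub> \<Phi> = [(p ^ nat (- i))] \<cdot>\<^bsub>E\<^esub> \<Psi>"
        by (rule E_cancel[OF p_pow_nz, rotated 2]) (use that in auto)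
    qed simp
  qed
  then show ?thesis
    unfolding D01_part_def D_level_one D_level_zero D_add_pow mem_Collect_eq
    by (intro conj_cong refl bex_cong) (use eqv[OF span_E span_E, symmetric] in blast)
qed

lemma part_Q: "\<Phi> \<in> Dp i \<Longrightarrow> \<Phi> \<in> Q" unfolding D01_part_def D_level_one by blast
lemma part_E [simp]: "\<Phi> \<in> Dp i \<Longrightarrow> \<Phi> \<in> carrier E" using part_Q span_E by blast
lemma part_D: "\<Phi> \<in> Dp i \<Longrightarrow> \<Phi> \<in> carrier D"
  using part_Q D_level_one subringE(1)[OF D_level_subring[of 1]] by blast

lemma level_mult: "\<Phi> \<in> D_level p W \<iota> A m \<Longrightarrow> \<Psi> \<in> D_level p W \<iota> A m \<Longrightarrow> \<Phi> \<otimes>\<^bsub>E\<^esub> \<Psi> \<in> D_level p W \<iota> A m"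
  using subringE(6)[OF D_level_subring[of m]] by simp

lemma P_mult: "\<Phi> \<in> P \<Longrightarrow> \<Psi> \<in> P \<Longrightarrow> \<Phi> \<otimes>\<^bsub>E\<^esub> \<Psi> \<in> P"
  using level_mult[of \<Phi> 0 \<Psi>] by (simp add: D_level_zero)

lemma Q_mult: "\<Phi> \<in> Q \<Longrightarrow> \<Psi> \<in> Q \<Longrightarrow> \<Phi> \<otimes>\<^bsub>E\<^esub> \<Psi> \<in> Q"
  using level_mult[of \<Phi> 1 \<Psi>] by (simp add: D_level_one[unfolded One_nat_def])

text \<open>With each degree written as a difference of natural numbers, the defining equations of
  two pieces can be multiplied; the exponents of \<open>p\<close> and the degrees add.\<close>

lemma pieces: "graded_pieces D Dp"
proof unfold_locales
  fix i
  obtain a b where ab: "int a - int b = i" using int_diff_cases by metis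
  note iff = part_iff[OF ab]
  show "Dp i \<subseteq> carrier D" using part_D by blast
  show "\<zero>\<^bsub>D\<^esub> \<in> Dp i" unfolding iff by (auto simp: span_zero intro!: bexI[of _ "\<zero>\<^bsub>E\<^esub>"])
  fix \<Phi> assume \<Phi>: "\<Phi> \<in> Dp i"
  then obtain \<Phi>' where \<Phi>': "\<Phi> \<in> Q" "\<Phi>' \<in> P" "[(p ^ a)] \<cdot>\<^bsub>E\<^esub> \<Phi> = [(p ^ b)] \<cdot>\<^bsub>E\<^esub> \<Phi>'" unfolding iff by blast
  then have "\<Phi>' \<in> carrier E" "\<Phi> \<in> carrier E" using span_E by blast+
  then have "[(p ^ a)] \<cdot>\<^bsub>E\<^esub> (\<ominus>\<^bsub>E\<^esub> \<Phi>) = [(p ^ b)] \<cdot>\<^bsub>E\<^esub> (\<ominus>\<^bsub>E\<^esub> \<Phi>')"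
    using \<Phi>' by (simp add: E.add_pow_minus)
  then have "\<ominus>\<^bsub>E\<^esub> \<Phi> \<in> Dp i" unfolding iff using \<Phi>' span_neg by blast
  then show "\<ominus>\<^bsub>D\<^esub> \<Phi> \<in> Dp i" using part_D[OF \<Phi>] by simp
  fix j \<Psi> assume \<Psi>: "\<Psi> \<in> Dp j"
  obtain c d where cd: "int c - int d = j" using int_diff_cases by metis
  obtain \<Psi>' where \<Psi>': "\<Psi> \<in> Q" "\<Psi>' \<in> P" "[(p ^ c)] \<cdot>\<^bsub>E\<^esub> \<Psi> = [(p ^ d)] \<cdot>\<^bsub>E\<^esub> \<Psi>'"
    using \<Psi> unfolding part_iff[OF cd] by blast
  have E: "\<Phi> \<in> carrier E" "\<Phi>' \<in> carrier E" "\<Psi> \<in> carrier E" "\<Psi>' \<in> carrier E"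
    using \<Phi>' \<Psi>' span_E by blast+
  have "int (a + c) - int (b + d) = i + j" using ab cd by simp
  note iff' = part_iff[OF this]
  have "[(p ^ (a + c))] \<cdot>\<^bsub>E\<^esub> (\<Phi> \<otimes>\<^bsub>E\<^esub> \<Psi>) = [(p ^ a)] \<cdot>\<^bsub>E\<^esub> \<Phi> \<otimes>\<^bsub>E\<^esub> [(p ^ c)] \<cdot>\<^bsub>E\<^esub> \<Psi>"
    using E by (simp add: E.add_pow_ldistr E.add_pow_rdistr E.add_pow_mult power_add mult.commute)
  also have "\<dots> = [(p ^ (b + d))] \<cdot>\<^bsub>E\<^esub> (\<Phi>' \<otimes>\<^bsub>E\<^esub> \<Psi>')"
    unfolding \<Phi>'(3) \<Psi>'(3) using E by (simp add: E.add_pow_ldistr E.add_pow_rdistr E.add_pow_mult power_add mult.commute)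
  finally show "\<Phi> \<otimes>\<^bsub>D\<^esub> \<Psi> \<in> Dp (i + j)"
    unfolding iff' D_simps using P_mult[OF \<Phi>'(2) \<Psi>'(2)] Q_mult[OF \<Phi>'(1) \<Psi>'(1)] by blast
next
  fix i \<Phi> \<Psi> assume "\<Phi> \<in> Dp i" "\<Psi> \<in> Dp i"
  obtain a b where ab: "int a - int b = i" using int_diff_cases by metis
  note iff = part_iff[OF ab]
  obtain \<Phi>' \<Psi>' where *: "\<Phi> \<in> Q" "\<Phi>' \<in> P" "[(p ^ a)] \<cdot>\<^bsub>E\<^esub> \<Phi> = [(p ^ b)] \<cdot>\<^bsub>E\<^esub> \<Phi>'"
    "\<Psi> \<in> Q" "\<Psi>' \<in> P" "[(p ^ a)] \<cdot>\<^bsub>E\<^esub> \<Psi> = [(p ^ b)] \<cdot>\<^bsub>E\<^esub> \<Psi>'"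
    using \<open>\<Phi> \<in> Dp i\<close> \<open>\<Psi> \<in> Dp i\<close> unfolding iff by blast
  then have E: "\<Phi> \<in> carrier E" "\<Phi>' \<in> carrier E" "\<Psi> \<in> carrier E" "\<Psi>' \<in> carrier E"
    using span_E by blast+
  have "[(p ^ a)] \<cdot>\<^bsub>E\<^esub> (\<Phi> \<oplus>\<^bsub>E\<^esub> \<Psi>) = [(p ^ b)] \<cdot>\<^bsub>E\<^esub> (\<Phi>' \<oplus>\<^bsub>E\<^esub> \<Psi>')"
    using E * by (simp add: E.add_pow_distrib)
  then show "\<Phi> \<oplus>\<^bsub>D\<^esub> \<Psi> \<in> Dp i"
    unfolding iff D_simps using span_add[OF *(1,4)] span_add[OF *(2,5)] by blast
next
  have "\<one>\<^bsub>E\<^esub> \<in> P" "\<one>\<^bsub>E\<^esub> \<in> Q" by (rule one_span; simp add: K0)+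
  moreover have "int 0 - int 0 = 0" by simp
  note part_iff[OF this]
  ultimately show "\<one>\<^bsub>D\<^esub> \<in> Dp 0" unfolding D_simps by blast
qed

sublocale B: graded_pieces D Dp rewrites "rees_ring D Dp = B1"
  by (rule pieces) (simp add: D01_eq)

definition hi :: "int \<Rightarrow> idx \<Rightarrow> nat" where "hi i K = nat (int (wt K) - i)"

text \<open>Coefficients are unique by \<open>lc_inj\<close>, so the defining equation of a piece
  holds for each of them separately, with \<open>p ^ wt K\<close> dividing the coefficient on the
  side of \<open>P\<close>. Cancelling the common power of \<open>p\<close> leaves divisibility by
  \<open>p ^ hi i K\<close>.\<close>

lemma part_eq_span: "Dp i = span (hi i) M"
proof (intro equalityI subsetI)
  fix \<Phi> assume "\<Phi> \<in> Dp i"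
  moreover have i: "int (nat i) - int (nat (- i)) = i" by simp
  ultimately obtain \<Psi> where \<Psi>: "\<Phi> \<in> Q" "\<Psi> \<in> P" "[(p ^ nat i)] \<cdot>\<^bsub>E\<^esub> \<Phi> = [(p ^ nat (- i))] \<cdot>\<^bsub>E\<^esub> \<Psi>"
    unfolding part_iff[OF i] by blast
  obtain c where c: "c \<in> FS" "\<Phi> = lc c" using \<Psi>(1) by (auto simp: span_def)
  obtain d where d: "d \<in> FS" "\<Psi> = lc d" "\<And>K. cg (wt K) (d K) \<zero>" using \<Psi>(2) by (auto simp: span_def)
  have scale: "[(k::nat)] \<cdot>\<^bsub>E\<^esub> lc e = lc (\<lambda>K. [k] \<cdot> e K)" "(\<lambda>K. [k] \<cdot> e K) \<in> FS" if "e \<in> FS" for k e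
  proof -
    have eq: "(\<lambda>K. [k] \<cdot> e K) = (\<lambda>K. [k] \<cdot> \<one> \<otimes> e K)"
      using FS_closed[OF that] by (simp add: add_pow_ldistr)
    show "(\<lambda>K. [k] \<cdot> e K) \<in> FS" unfolding eq by (rule FS_mult[OF that]) simp
    show "[k] \<cdot>\<^bsub>E\<^esub> lc e = lc (\<lambda>K. [k] \<cdot> e K)"
      unfolding eq using that by (subst lc_mult) (auto simp: mu_add_pow mu_one E.add_pow_ldistr)
  qed
  have "(\<lambda>K. [(p ^ nat i)] \<cdot> c K) = (\<lambda>K. [(p ^ nat (- i))] \<cdot> d K)"
    by (rule lc_inj) (use \<Psi>(3) c d scale in auto)
  then have cd: "[(p ^ nat i)] \<cdot> c K = [(p ^ nat (- i))] \<cdot> d K" for K by metis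
  show "\<Phi> \<in> span (hi i) M"
    unfolding c(2)
  proof (rule spanI[OF c(1)])
    fix K
    have cK: "c K \<in> carrier A" using c by (simp add: FS_closed)
    obtain b where b: "b \<in> carrier A" "d K = [(p ^ wt K)] \<cdot> b" using d(3)[of K] by (auto simp: cg_def)
    have "[(p ^ nat i)] \<cdot> c K = [(p ^ (nat (- i) + wt K))] \<cdot> b"
      unfolding cd b(2) power_add by (rule add_pow_mult[OF b(1)])
    then have *: "cg (nat (- i) + wt K) ([(p ^ nat i)] \<cdot> c K) \<zero>" using cg_zero_add_pow[OF b(1)] by simp
    \<comment> \<open>For positive \<open>hi i K\<close> the exponents \<open>nat i + hi i K\<close>
      and \<open>nat (- i) + wt K\<close> coincide; for \<open>hi i K = 0\<close> nothing about
      divisibility remains to be shown.\<close>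
    have "cg (nat i + hi i K) ([(p ^ nat i)] \<cdot> c K) \<zero> \<or> hi i K = 0"
      using cg_mono[OF *, of "nat i + hi i K"] by (cases "hi i K = 0") (auto simp: hi_def)
    then show "cg (hi i K) (c K) \<zero>"
      using cg_p_cancel[OF cK] cK by (auto simp: cg_def[of 0])
  qed (use c in \<open>auto dest: FS_supp\<close>)
next
  fix \<Phi> assume \<Phi>: "\<Phi> \<in> span (hi i) M"
  show "\<Phi> \<in> Dp i"
  proof (rule span_induct[OF \<Phi>])
    fix K a assume K: "K \<in> M" "cg (hi i K) a \<zero>"
    then obtain b where b: "b \<in> carrier A" "a = [(p ^ hi i K)] \<cdot> b" by (auto simp: cg_def)
    have i: "int (nat i) - int (nat (- i)) = i" by simp
    have le: "nat (- i) + wt K \<le> nat i + hi i K" by (auto simp: hi_def)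
    \<comment> \<open>The surplus power of \<open>p\<close>, positive only when \<open>i\<close>
      exceeds \<open>wt K\<close>.\<close>
    define t where "t = nat i + hi i K - (nat (- i) + wt K)"
    have t: "nat i + hi i K = nat (- i) + (wt K + t)" using le by (simp add: t_def)
    have "[(p ^ nat i)] \<cdot>\<^bsub>E\<^esub> (\<mu> a \<otimes>\<^bsub>E\<^esub> eb K) = \<mu> ([(p ^ (nat i + hi i K))] \<cdot> b) \<otimes>\<^bsub>E\<^esub> eb K"
      unfolding b(2) power_add using b(1) by (simp add: mu_add_pow E.add_pow_ldistr E.add_pow_mult)
    also have "\<dots> = [(p ^ nat (- i))] \<cdot>\<^bsub>E\<^esub> (\<mu> ([(p ^ (wt K + t))] \<cdot> b) \<otimes>\<^bsub>E\<^esub> eb K)"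
      unfolding t power_add[of p "nat (- i)"] using b(1) by (simp add: mu_add_pow E.add_pow_ldistr E.add_pow_mult)
    finally have eq: "[(p ^ nat i)] \<cdot>\<^bsub>E\<^esub> (\<mu> a \<otimes>\<^bsub>E\<^esub> eb K) =
      [(p ^ nat (- i))] \<cdot>\<^bsub>E\<^esub> (\<mu> ([(p ^ (wt K + t))] \<cdot> b) \<otimes>\<^bsub>E\<^esub> eb K)" .
    have "\<mu> ([(p ^ (wt K + t))] \<cdot> b) \<otimes>\<^bsub>E\<^esub> eb K \<in> P"
      by (rule span_single[OF K(1,1)]) (use cg_mono[OF cg_zero_add_pow[OF b(1), of "wt K + t"], of "wt K"] in simp)
    moreover have "\<mu> a \<otimes>\<^bsub>E\<^esub> eb K \<in> Q" by (rule span_single[OF K(1,1)]) (use b in \<open>simp add: cg_def\<close>)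
    ultimately show "\<mu> a \<otimes>\<^bsub>E\<^esub> eb K \<in> Dp i" unfolding part_iff[OF i] using eq by blast
  qed (use B.H_zero B.H_add in auto)
qed

definition co :: "('a \<Rightarrow> 'a) \<Rightarrow> idx \<Rightarrow> 'a" where "co \<Phi> = (THE c. c \<in> FS \<and> lc c = \<Phi>)"

lemma co_lc: "c \<in> FS \<Longrightarrow> co (lc c) = c"
  unfolding co_def by (rule the_equality) (auto intro: lc_inj)

lemma part_co:
  assumes "\<Phi> \<in> Dp i"
  shows "co \<Phi> \<in> FS" "lc (co \<Phi>) = \<Phi>" "cg (hi i K) (co \<Phi> K) \<zero>"
proof -
  obtain c where "c \<in> FS" "\<Phi> = lc c" "\<And>K. cg (hi i K) (c K) \<zero>"
    using assms unfolding part_eq_span by (auto simp: span_def)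
  then show "co \<Phi> \<in> FS" "lc (co \<Phi>) = \<Phi>" "cg (hi i K) (co \<Phi> K) \<zero>" by (simp_all add: co_lc)
qed

lemma co_add: "\<Phi> \<in> Dp i \<Longrightarrow> \<Psi> \<in> Dp i \<Longrightarrow> co (\<Phi> \<oplus>\<^bsub>E\<^esub> \<Psi>) = (\<lambda>K. co \<Phi> K \<oplus> co \<Psi> K)"
  using co_lc[OF FS_add[of "co \<Phi>" "co \<Psi>"]] part_co[of \<Phi> i] part_co[of \<Psi> i] by (simp add: lc_add)

lemma co_zero: "co \<zero>\<^bsub>E\<^esub> = (\<lambda>K. \<zero>)"
  using co_lc[OF FS_zero] by (simp add: lc_zero)

definition quo :: "nat \<Rightarrow> 'a \<Rightarrow> 'a" where "quo m a = (THE b. b \<in> carrier A \<and> [(p ^ m)] \<cdot> b = a)"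

lemma quo_eq: "b \<in> carrier A \<Longrightarrow> quo m ([(p ^ m)] \<cdot> b) = b"
  unfolding quo_def by (rule the_equality) (auto intro: torsion_free_cancel[OF p_pow_nz])

lemma quo: "cg m a \<zero> \<Longrightarrow> quo m a \<in> carrier A" "cg m a \<zero> \<Longrightarrow> [(p ^ m)] \<cdot> quo m a = a"
  using quo_eq by (auto simp: cg_def)

text \<open>The coordinates of \<open>F\<close> in the \<open>A\<close>-basis \<open>p\<^sup>h e\<^sub>K\<close> of the \<open>i\<close>th pieces, where \<open>h = max 0 (wt K - i)\<close>.\<close>

definition lamA :: "(int \<Rightarrow> 'a \<Rightarrow> 'a) \<Rightarrow> idx \<times> int \<Rightarrow> 'a" where
  "lamA F t = quo (hi (snd t) (fst t)) (co (F (snd t)) (fst t))"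

lemma B1_part: "F \<in> carrier B1 \<Longrightarrow> F i \<in> Dp i" using B.rees_mem by blast

lemma lamA_closed [simp]: "F \<in> carrier B1 \<Longrightarrow> lamA F t \<in> carrier A"
  unfolding lamA_def by (rule quo(1)[OF part_co(3)[OF B1_part]])

lemma lamA_pow: "F \<in> carrier B1 \<Longrightarrow> [(p ^ hi i K)] \<cdot> lamA F (K, i) = co (F i) K"
  unfolding lamA_def fst_conv snd_conv by (rule quo(2)[OF part_co(3)[OF B1_part]])

lemma lamA_eqI:
  "b \<in> carrier A \<Longrightarrow> co (F i) K = [(p ^ hi i K)] \<cdot> b \<Longrightarrow> lamA F (K, i) = b"
  unfolding lamA_def by (simp add: quo_eq)

lemma lamA_add: "F \<in> carrier B1 \<Longrightarrow> G \<in> carrier B1 \<Longrightarrow> lamA (F \<oplus>\<^bsub>B1\<^esub> G) t = lamA F t \<oplus> lamA G t"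
proof -
  assume FG: "F \<in> carrier B1" "G \<in> carrier B1"
  obtain K i where t: "t = (K, i)" by (cases t)
  have "co ((F \<oplus>\<^bsub>B1\<^esub> G) i) K = [(p ^ hi i K)] \<cdot> (lamA F (K, i) \<oplus> lamA G (K, i))"
    using FG co_add[OF B1_part[OF FG(1)] B1_part[OF FG(2)], of i]
    by (simp add: B.rees_add add_pow_distrib lamA_pow)
  then show ?thesis unfolding t using FG by (intro lamA_eqI) auto
qed

lemma lamA_neg:
  assumes F: "F \<in> carrier B1"
  shows "lamA (\<ominus>\<^bsub>B1\<^esub> F) t = \<ominus> lamA F t"
proof -
  have "lamA \<zero>\<^bsub>B1\<^esub> t = \<zero>"
    unfolding lamA_def B.rees_zero D_simps co_zero using quo_eq[of \<zero>] by simp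
  then have "lamA (\<ominus>\<^bsub>B1\<^esub> F) t \<oplus> lamA F t = \<zero>"
    using lamA_add[of "\<ominus>\<^bsub>B1\<^esub> F" F t] F by (simp add: B.S.l_neg)
  then show ?thesis using minus_equality[of "lamA (\<ominus>\<^bsub>B1\<^esub> F) t" "lamA F t"] F by simp
qed

lemma lamA_add_pow: "F \<in> carrier B1 \<Longrightarrow> lamA ([(m::nat)] \<cdot>\<^bsub>B1\<^esub> F) t = [m] \<cdot> lamA F t"
proof (induction m)
  case 0
  show ?case unfolding lamA_def using quo_eq[of \<zero>] by (simp add: B.rees_zero co_zero)
qed (simp add: lamA_add)

text \<open>Coordinates refer to the basis of each piece, so dividing them by \<open>p\<close>
  yields an operator in the same piece. Divisibility by \<open>p\<close> in \<open>E\<close> alone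
  would not give this.\<close>

lemma lamA_dvd:
  assumes F: "F \<in> carrier B1" and dvd: "\<And>t. cg 1 (lamA F t) \<zero>"
  shows "\<exists>G\<in>carrier B1. F = [p] \<cdot>\<^bsub>B1\<^esub> G"
proof -
  have "\<exists>b\<in>carrier A. lamA F t = [p] \<cdot> b" for t using dvd[of t] by (auto simp: cg_def)
  then obtain b where b: "\<And>t. b t \<in> carrier A" "\<And>t. lamA F t = [p] \<cdot> b t" by metis
  define c where "c i K = [(p ^ hi i K)] \<cdot> b (K, i)" for i K
  have co: "co (F i) K = [p] \<cdot> c i K" for i K
    unfolding lamA_pow[OF F, symmetric] b(2) c_def using b(1) by (simp add: add_pow_mult mult.commute)
  have c_closed: "c i K \<in> carrier A" for i K using b(1) by (simp add: c_def)
  have c0: "c i K = \<zero>" if "co (F i) K = \<zero>" for i K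
    by (rule p_torsion_free) (use that co c_closed in auto)
  have cFS: "c i \<in> FS" for i
  proof (rule FSI[of _ "{K. co (F i) K \<noteq> \<zero>}"])
    have "co (F i) \<in> FS" by (rule part_co(1)[OF B1_part[OF F]])
    then show "finite {K. co (F i) K \<noteq> \<zero>}" "{K. co (F i) K \<noteq> \<zero>} \<subseteq> M"
      by (auto simp: FS_finite dest: FS_supp)
  qed (use c_closed c0 in auto)
  define G where "G i = lc (c i)" for i
  have G0: "G i = \<zero>\<^bsub>E\<^esub>" if "F i = \<zero>\<^bsub>E\<^esub>" for i
  proof -
    have "c i = (\<lambda>K. \<zero>)" using c0[of i] that by (simp add: co_zero fun_eq_iff)
    then show ?thesis by (simp add: G_def lc_zero)
  qed
  have "G i \<in> Dp i" for i
    unfolding part_eq_span G_def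
  proof (rule spanI[OF cFS])
    show "cg (hi i K) (c i K) \<zero>" for K unfolding c_def by (rule cg_zero_add_pow[OF b(1)])
    show "{K. c i K \<noteq> \<zero>} \<subseteq> M" using FS_supp[OF cFS] by blast
  qed
  moreover have "finite {i. G i \<noteq> \<zero>\<^bsub>D\<^esub>}"
    by (rule finite_subset[of _ "{i. F i \<noteq> \<zero>\<^bsub>D\<^esub>}"]) (use G0 F B.rees_mem in auto)
  ultimately have "G \<in> carrier B1" unfolding B.rees_mem by blast
  moreover have "F = [p] \<cdot>\<^bsub>B1\<^esub> G"
  proof
    fix i
    have "F i = lc (co (F i))" by (rule part_co(2)[OF B1_part[OF F], symmetric])
    also have "co (F i) = (\<lambda>K. [p] \<cdot> \<one> \<otimes> c i K)" using co c_closed by (simp add: add_pow_ldistr fun_eq_iff)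
    also have "lc \<dots> = [p] \<cdot>\<^bsub>E\<^esub> G i"
      using cFS[of i] by (simp add: lc_mult G_def mu_add_pow mu_one E.add_pow_ldistr)
    finally show "F i = ([p] \<cdot>\<^bsub>B1\<^esub> G) i" by (simp add: B.rees_add_pow)
  qed
  ultimately show ?thesis by blast
qed

end

text \<open>Coordinates that are additive, faithful and finitely supported, each with its own
  degree, determine the homogeneous components. This serves both for D(A/p) and for the reduced ring
  of operators.\<close>

lemma grading_by_coordinates:
  fixes \<kappa> :: "'m \<Rightarrow> 't \<Rightarrow> 'r" and deg :: "'t \<Rightarrow> int"
  assumes "ring N" "ring R"
    and closed: "\<And>m t. m \<in> carrier N \<Longrightarrow> \<kappa> m t \<in> carrier R"
    and add: "\<And>m m' t. m \<in> carrier N \<Longrightarrow> m' \<in> carrier N \<Longrightarrow> \<kappa> (m \<oplus>\<^bsub>N\<^esub> m') t = \<kappa> m t \<oplus>\<^bsub>R\<^esub> \<kappa> m' t"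
    and inj: "\<And>m m'. m \<in> carrier N \<Longrightarrow> m' \<in> carrier N \<Longrightarrow> (\<And>t. \<kappa> m t = \<kappa> m' t) \<Longrightarrow> m = m'"
    and fin: "\<And>m. m \<in> carrier N \<Longrightarrow> finite {t. \<kappa> m t \<noteq> \<zero>\<^bsub>R\<^esub>}"
    and H: "\<And>d. H d = {m \<in> carrier N. \<forall>t. deg t \<noteq> d \<longrightarrow> \<kappa> m t = \<zero>\<^bsub>R\<^esub>}"
    and comp: "\<And>m d. m \<in> carrier N \<Longrightarrow> \<exists>m'\<in>H d. \<forall>t. deg t = d \<longrightarrow> \<kappa> m' t = \<kappa> m t"
  shows "grading N H"
proof -
  interpret N: ring N by fact
  interpret R: ring R by fact
  have zero: "\<kappa> \<zero>\<^bsub>N\<^esub> t = \<zero>\<^bsub>R\<^esub>" for t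
    using add[of "\<zero>\<^bsub>N\<^esub>" "\<zero>\<^bsub>N\<^esub>" t] closed[of "\<zero>\<^bsub>N\<^esub>" t] R.add.l_cancel_one'[of "\<kappa> \<zero>\<^bsub>N\<^esub> t" "\<kappa> \<zero>\<^bsub>N\<^esub> t"] by simp
  have neg: "\<kappa> (\<ominus>\<^bsub>N\<^esub> m) t = \<ominus>\<^bsub>R\<^esub> \<kappa> m t" if "m \<in> carrier N" for m t
    using add[of "\<ominus>\<^bsub>N\<^esub> m" m t] that zero closed R.minus_equality[of "\<kappa> (\<ominus>\<^bsub>N\<^esub> m) t" "\<kappa> m t"]
    by (simp add: N.l_neg)
  have sum: "\<kappa> (finsum N c F) t = (\<Oplus>\<^bsub>R\<^esub>d\<in>F. \<kappa> (c d) t)" if "c \<in> F \<rightarrow> carrier N" for c F t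
    using that by (induction F rule: infinite_finite_induct)
      (auto simp: zero add closed Pi_def N.finsum_infinite R.finsum_infinite)
  \<comment> \<open>In a sum of homogeneous elements, coordinate \<open>t\<close> comes from the
    summand of degree \<open>deg t\<close> alone, so the components can be recovered from the
    sum.\<close>
  have sum_deg: "\<kappa> (\<Oplus>\<^bsub>N\<^esub>d\<in>{d. c d \<noteq> \<zero>\<^bsub>N\<^esub>}. c d) t = \<kappa> (c (deg t)) t"
    if c: "\<And>d. c d \<in> H d" "finite {d. c d \<noteq> \<zero>\<^bsub>N\<^esub>}" for c t
  proof -
    have cN: "c d \<in> carrier N" for d using c(1)[of d] H by simp
    have "\<kappa> (\<Oplus>\<^bsub>N\<^esub>d\<in>{d. c d \<noteq> \<zero>\<^bsub>N\<^esub>}. c d) t = (\<Oplus>\<^bsub>R\<^esub>d\<in>{d. c d \<noteq> \<zero>\<^bsub>N\<^esub>}. \<kappa> (c d) t)"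
      by (rule sum) (use cN in auto)
    also have "\<dots> = (\<Oplus>\<^bsub>R\<^esub>d\<in>insert (deg t) {d. c d \<noteq> \<zero>\<^bsub>N\<^esub>}. \<kappa> (c d) t)"
      by (rule R.finsum_mono_neutral[symmetric]) (use c cN closed zero in auto)
    also have "\<dots> = \<kappa> (c (deg t)) t"
    proof (rule R.finsum_single)
      fix d assume "d \<noteq> deg t"
      then show "\<kappa> (c d) t = \<zero>\<^bsub>R\<^esub>" using c(1)[of d] by (simp add: H)
    qed (use c cN closed in auto)
    finally show ?thesis .
  qed
  have "additive_subgroup (H d) N" for d
  proof (rule additive_subgroupI, rule N.add.subgroupI)
    show "H d \<subseteq> carrier N" by (auto simp: H)
    show "H d \<noteq> {}" using zero by (auto simp: H)
    fix a assume a: "a \<in> H d"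
    then show "\<ominus>\<^bsub>N\<^esub> a \<in> H d" by (auto simp: H neg)
    fix b assume "b \<in> H d"
    with a show "a \<oplus>\<^bsub>N\<^esub> b \<in> H d" by (auto simp: H add)
  qed
  moreover have "\<exists>!c. (\<forall>d. c d \<in> H d) \<and> finite {d. c d \<noteq> \<zero>\<^bsub>N\<^esub>} \<and>
      m = (\<Oplus>\<^bsub>N\<^esub>d\<in>{d. c d \<noteq> \<zero>\<^bsub>N\<^esub>}. c d)" if m: "m \<in> carrier N" for m
  proof -
    have "\<forall>d. \<exists>m'. m' \<in> H d \<and> (\<forall>t. deg t = d \<longrightarrow> \<kappa> m' t = \<kappa> m t)" using comp[OF m] by blast
    then obtain c where c: "\<And>d. c d \<in> H d" "\<And>d t. deg t = d \<Longrightarrow> \<kappa> (c d) t = \<kappa> m t" by metis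
    have cN: "c d \<in> carrier N" for d using c(1)[of d] H by simp
    have "d \<in> deg ` {t. \<kappa> m t \<noteq> \<zero>\<^bsub>R\<^esub>}" if d: "c d \<noteq> \<zero>\<^bsub>N\<^esub>" for d
    proof -
      obtain t where t: "\<kappa> (c d) t \<noteq> \<zero>\<^bsub>R\<^esub>" using inj[OF cN N.zero_closed, of d] zero d by metis
      then have "deg t = d" using c(1)[of d] by (auto simp: H)
      then show ?thesis using t c(2)[of t d] by auto
    qed
    then have fc: "finite {d. c d \<noteq> \<zero>\<^bsub>N\<^esub>}"
      by (intro finite_subset[OF _ finite_imageI[OF fin[OF m]]]) blast
    have "m = (\<Oplus>\<^bsub>N\<^esub>d\<in>{d. c d \<noteq> \<zero>\<^bsub>N\<^esub>}. c d)"
      by (rule inj[OF m]) (use cN c sum_deg[OF c(1) fc] in auto)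
    moreover have "c' = c" if c': "\<And>d. c' d \<in> H d" "finite {d. c' d \<noteq> \<zero>\<^bsub>N\<^esub>}"
      "m = (\<Oplus>\<^bsub>N\<^esub>d\<in>{d. c' d \<noteq> \<zero>\<^bsub>N\<^esub>}. c' d)" for c'
    proof
      fix d
      show "c' d = c d"
      proof (rule inj)
        show "c' d \<in> carrier N" using c'(1)[of d] H by simp
        fix t show "\<kappa> (c' d) t = \<kappa> (c d) t"
        proof (cases "deg t = d")
          case True
          then show ?thesis using sum_deg[OF c'(1,2), of t] c'(3) c(2)[of t d] by simp
        next
          case False
          then show ?thesis using c(1)[of d] c'(1)[of d] by (simp add: H)
        qed
      qed (rule cN)
    qed
    ultimately show ?thesis using c(1) fc by (intro ex1I[of _ c]) auto
  qed
  ultimately show ?thesis by (simp add: grading_def)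
qed

lemma (in UP_ring) coeff_monom_one_mult:
  assumes "c \<in> carrier R" "q \<in> carrier P"
  shows "coeff P (monom P c 1 \<otimes>\<^bsub>P\<^esub> q) k = (if k = 0 then \<zero> else c \<otimes> coeff P q (k - 1))"
proof (cases k)
  case 0
  then show ?thesis using assms by (simp del: One_nat_def)
next
  case (Suc m)
  have "coeff P (monom P c 1 \<otimes>\<^bsub>P\<^esub> q) k = (\<Oplus>i\<in>{..k}. coeff P (monom P c 1) i \<otimes> coeff P q (k - i))"
    using assms by simp
  also have "\<dots> = coeff P (monom P c 1) 1 \<otimes> coeff P q (k - 1)"
    by (rule R.finsum_single) (use assms Suc in auto)
  finally show ?thesis using assms Suc by simp
qed

lemma up_mem: "f \<in> carrier (UP R) \<longleftrightarrow> (\<forall>n. f n \<in> carrier R) \<and> (\<exists>n. \<forall>m>n. f m = \<zero>\<^bsub>R\<^esub>)"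
  by (auto simp: UP_def up_def bound_def)

lemma coeff_up: "f \<in> carrier (UP R) \<Longrightarrow> coeff (UP R) f n = f n"
  by (simp add: UP_def)

section \<open>The ring \<open>R[f, v]/(fv - p)\<close>\<close>

locale fv_quotient = cring R for R (structure) +
  fixes p :: nat
  assumes p_zero: "[p] \<cdot> \<one> = \<zero>"
begin

abbreviation U where "U \<equiv> UP R"
abbreviation V where "V \<equiv> UP (UP R)"
abbreviation DR where "DR \<equiv> D_ring p R"
abbreviation I where "I \<equiv> fv_ideal p R"

sublocale U: UP_cring R U by unfold_locales simp
sublocale V: UP_cring U V by unfold_locales simp

definition g where "g = monom V (monom U \<one> 1) 1"

lemma g_closed: "g \<in> carrier V" by (simp add: g_def del: One_nat_def)

text \<open>Since \<open>p\<close> is zero in \<open>R\<close>, the generator fv - p is the monomial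
  fv.\<close>

lemma generator_eq: "f_var R \<otimes>\<^bsub>V\<^esub> v_var R \<ominus>\<^bsub>V\<^esub> [p] \<cdot>\<^bsub>V\<^esub> \<one>\<^bsub>V\<^esub> = g"
proof -
  have "[p] \<cdot>\<^bsub>U\<^esub> \<one>\<^bsub>U\<^esub> = monom U ([p] \<cdot> \<one>) 0"
    using ring_hom_add_pow[OF ring_axioms U.UP_ring U.const_ring_hom one_closed, of p] by simp
  then have u: "[p] \<cdot>\<^bsub>U\<^esub> \<one>\<^bsub>U\<^esub> = \<zero>\<^bsub>U\<^esub>" by (simp add: p_zero)
  have "[p] \<cdot>\<^bsub>V\<^esub> \<one>\<^bsub>V\<^esub> = monom V ([p] \<cdot>\<^bsub>U\<^esub> \<one>\<^bsub>U\<^esub>) 0"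
    using ring_hom_add_pow[OF U.UP_ring V.UP_ring V.const_ring_hom U.UP_one_closed, of p] by simp
  then have v: "[p] \<cdot>\<^bsub>V\<^esub> \<one>\<^bsub>V\<^esub> = \<zero>\<^bsub>V\<^esub>" by (simp add: u)
  have "f_var R \<otimes>\<^bsub>V\<^esub> v_var R = monom V (monom U \<one> 1 \<otimes>\<^bsub>U\<^esub> \<one>\<^bsub>U\<^esub>) (0 + 1)"
    unfolding f_var_def v_var_def by (rule V.monom_mult[symmetric]) simp_all
  then have "f_var R \<otimes>\<^bsub>V\<^esub> v_var R = g" by (simp add: g_def)
  then show ?thesis using g_closed by (simp add: v a_minus_def)
qed

lemma coeff_g_mult:
  assumes "Q \<in> carrier V"
  shows "coeff U (coeff V (g \<otimes>\<^bsub>V\<^esub> Q) j) i =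
    (if i = 0 \<or> j = 0 then \<zero> else coeff U (coeff V Q (j - 1)) (i - 1))"
proof -
  have m: "monom U \<one> 1 \<in> carrier U" by (rule U.monom_closed) simp
  have q: "coeff V Q (j - 1) \<in> carrier U" using assms by (rule V.coeff_closed)
  show ?thesis unfolding g_def V.coeff_monom_one_mult[OF m assms]
    using U.coeff_monom_one_mult[OF one_closed q, of i] U.coeff_closed[OF q] by auto
qed

text \<open>The coefficient of f^d for \<open>d \<ge> 0\<close> and of v^(-d) for
  \<open>d \<le> 0\<close>. These pure powers are the monomials not divisible by fv, so they index a
  basis of the quotient.\<close>

definition pc :: "(nat \<Rightarrow> nat \<Rightarrow> 'a) \<Rightarrow> int \<Rightarrow> 'a" where
  "pc P d = coeff U (coeff V P (nat (- d))) (nat d)"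

lemma pc_closed: "P \<in> carrier V \<Longrightarrow> pc P d \<in> carrier R"
  by (simp add: pc_def)

lemma pc_add: "P \<in> carrier V \<Longrightarrow> Q \<in> carrier V \<Longrightarrow> pc (P \<oplus>\<^bsub>V\<^esub> Q) d = pc P d \<oplus> pc Q d"
  by (simp add: pc_def)

lemma pc_diff: "P \<in> carrier V \<Longrightarrow> Q \<in> carrier V \<Longrightarrow> pc (P \<ominus>\<^bsub>V\<^esub> Q) d = pc P d \<ominus> pc Q d"
  by (simp add: pc_def a_minus_def)

text \<open>A polynomial without pure powers of f or v, the constant term included, has only
  monomials divisible by fv; lowering both exponents by one gives the cofactor
  \<open>Q\<close>.\<close>

lemma I_eq: "I = {P \<in> carrier V. \<forall>d. pc P d = \<zero>}"
proof -
  have "I = PIdl\<^bsub>V\<^esub> g" unfolding fv_ideal_def generator_eq by (rule V.P.cgenideal_eq_genideal[symmetric, OF g_closed])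
  also have "\<dots> = {Q \<otimes>\<^bsub>V\<^esub> g | Q. Q \<in> carrier V}" by (simp add: cgenideal_def)
  also have "\<dots> = {P \<in> carrier V. \<forall>d. pc P d = \<zero>}"
  proof (intro equalityI subsetI)
    fix P assume "P \<in> {Q \<otimes>\<^bsub>V\<^esub> g | Q. Q \<in> carrier V}"
    then obtain Q where Q: "Q \<in> carrier V" "P = g \<otimes>\<^bsub>V\<^esub> Q" using V.P.m_comm g_closed by blast
    then show "P \<in> {P \<in> carrier V. \<forall>d. pc P d = \<zero>}" 
      using g_closed coeff_g_mult[OF Q(1)] by (auto simp: pc_def simp del: V.coeff_mult)
  next
    fix P assume "P \<in> {P \<in> carrier V. \<forall>d. pc P d = \<zero>}"
    then have P: "P \<in> carrier V" "\<And>d. pc P d = \<zero>" by auto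
    have P0: "coeff U (coeff V P j) i = \<zero>" if "i = 0 \<or> j = 0" for i j
      using P(2)[of "int i - int j"] that by (auto simp: pc_def)
    define Q where "Q j i = P (Suc j) (Suc i)" for j i
    have PU: "P j \<in> carrier U" for j using P(1) by (auto simp: up_mem[of P])
    have "Q j \<in> carrier U" for j using PU[of "Suc j"] unfolding up_mem Q_def by (meson Suc_lessD less_Suc_eq_le Suc_less_eq less_SucI)
    moreover have "\<exists>m. \<forall>j>m. Q j = \<zero>\<^bsub>U\<^esub>"
    proof -
      obtain m where m: "\<And>j. j > m \<Longrightarrow> P j = \<zero>\<^bsub>U\<^esub>" using P(1) unfolding up_mem[of P] by blast
      have "Q j = \<zero>\<^bsub>U\<^esub>" if "j > m" for j using m[of "Suc j"] that by (simp add: Q_def fun_eq_iff UP_def)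
      then show ?thesis by blast
    qed
    ultimately have Q: "Q \<in> carrier V" unfolding up_mem[of Q] by blast
    have "P = g \<otimes>\<^bsub>V\<^esub> Q"
    proof (rule V.up_eqI[OF U.up_eqI])
      fix j i
      show "coeff U (coeff V P j) i = coeff U (coeff V (g \<otimes>\<^bsub>V\<^esub> Q) j) i"
        unfolding coeff_g_mult[OF Q] using P0
        by (cases i; cases j) (auto simp: coeff_up P(1) Q PU Q_def \<open>\<And>j. Q j \<in> carrier U\<close>)
    qed (use P(1) Q g_closed in auto)
    then show "P \<in> {Q \<otimes>\<^bsub>V\<^esub> g | Q. Q \<in> carrier V}" using Q g_closed V.P.m_comm by blast
  qed
  finally show ?thesis .
qed

lemma I_ideal: "ideal I V"
  unfolding fv_ideal_def by (rule V.P.genideal_ideal) (unfold generator_eq, use g_closed in auto)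

lemma DR_cring: "cring DR"
  unfolding D_ring_def by (rule ideal.quotient_is_cring[OF I_ideal V.UP_cring])

sublocale DR: cring DR by (rule DR_cring)

abbreviation cl where "cl P \<equiv> I +>\<^bsub>V\<^esub> P"

lemma cl_hom: "cl \<in> ring_hom V DR"
  unfolding D_ring_def by (rule ideal.rcos_ring_hom[OF I_ideal])

lemma carrier_DR: "carrier DR = cl ` carrier V"
  by (auto simp: D_ring_def FactRing_simps)

lemma cl_eq_iff: "P \<in> carrier V \<Longrightarrow> Q \<in> carrier V \<Longrightarrow> cl P = cl Q \<longleftrightarrow> (\<forall>d. pc P d = pc Q d)"
proof -
  assume PQ: "P \<in> carrier V" "Q \<in> carrier V"
  have "a \<ominus> b = \<zero> \<longleftrightarrow> a = b" if "a \<in> carrier R" "b \<in> carrier R" for a b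
    using that minus_eq_zeroD minus_self by blast
  then show ?thesis using V.P.coset_eq_iff[OF I_ideal PQ] PQ by (simp add: I_eq pc_diff pc_closed)
qed

definition kap :: "(nat \<Rightarrow> nat \<Rightarrow> 'a) set \<Rightarrow> int \<Rightarrow> 'a" where
  "kap X = pc (SOME P. P \<in> carrier V \<and> cl P = X)"

lemma kap_cl: "P \<in> carrier V \<Longrightarrow> kap (cl P) = pc P"
proof -
  assume P: "P \<in> carrier V"
  let ?Q = "SOME Q. Q \<in> carrier V \<and> cl Q = cl P"
  have "?Q \<in> carrier V \<and> cl ?Q = cl P" by (rule someI[of _ P]) (use P in simp)
  then show ?thesis using cl_eq_iff[of ?Q P] P by (simp add: kap_def fun_eq_iff)
qed

lemma kap_closed: "X \<in> carrier DR \<Longrightarrow> kap X d \<in> carrier R"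
  by (auto simp: carrier_DR kap_cl pc_closed)

lemma kap_add: "X \<in> carrier DR \<Longrightarrow> Y \<in> carrier DR \<Longrightarrow> kap (X \<oplus>\<^bsub>DR\<^esub> Y) d = kap X d \<oplus> kap Y d"
  by (auto simp: carrier_DR kap_cl pc_add ring_hom_add[OF cl_hom, symmetric])

lemma kap_inj: "X \<in> carrier DR \<Longrightarrow> Y \<in> carrier DR \<Longrightarrow> (\<And>d. kap X d = kap Y d) \<Longrightarrow> X = Y"
proof -
  assume "X \<in> carrier DR" "Y \<in> carrier DR" and eq: "\<And>d. kap X d = kap Y d"
  then obtain P Q where PQ: "P \<in> carrier V" "X = cl P" "Q \<in> carrier V" "Y = cl Q" by (auto simp: carrier_DR)
  then have "pc P d = pc Q d" for d using eq[of d] by (simp only: kap_cl)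
  then show ?thesis using cl_eq_iff[OF PQ(1,3)] PQ by blast
qed

lemma kap_zero: "kap \<zero>\<^bsub>DR\<^esub> d = \<zero>"
  using kap_add[of "\<zero>\<^bsub>DR\<^esub>" "\<zero>\<^bsub>DR\<^esub>" d] kap_closed[of "\<zero>\<^bsub>DR\<^esub>" d] add.l_cancel_one'[of "kap \<zero>\<^bsub>DR\<^esub> d" "kap \<zero>\<^bsub>DR\<^esub> d"]
  by simp

text \<open>The normal form of a class, free of mixed monomials. It inverts \<open>pc\<close>, and
  for a homogeneous class it is itself homogeneous.\<close>

definition pure :: "(int \<Rightarrow> 'a) \<Rightarrow> nat \<Rightarrow> nat \<Rightarrow> 'a" where
  "pure h j i = (if i = 0 \<or> j = 0 then h (int i - int j) else \<zero>)"

lemma pure_closed: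
  assumes "\<And>d. h d \<in> carrier R" "finite {d. h d \<noteq> \<zero>}"
  shows "pure h \<in> carrier V" "pure h j \<in> carrier U"
proof -
  \<comment> \<open>Inserting 0 keeps the maximum defined when \<open>h\<close> vanishes
    identically.\<close>
  define m where "m = Max (insert 0 ((\<lambda>d. nat \<bar>d\<bar>) ` {d. h d \<noteq> \<zero>}))"
  have m: "h d = \<zero>" if "nat \<bar>d\<bar> > m" for d
  proof (rule ccontr)
    assume "h d \<noteq> \<zero>"
    then have "nat \<bar>d\<bar> \<le> m" unfolding m_def using assms(2) by (intro Max_ge) auto
    with that show False by simp
  qed
  have U: "pure h j \<in> carrier U" for j
    unfolding up_mem using assms(1) by (auto simp: pure_def intro!: exI[of _ "m + j"] m)
  then show "pure h j \<in> carrier U" .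
  have "pure h j = \<zero>\<^bsub>U\<^esub>" if "j > m" for j
    using that by (auto simp: pure_def UP_def fun_eq_iff intro!: m)
  with U show "pure h \<in> carrier V" unfolding up_mem[of "pure h"] by blast
qed

lemma coeff_pure:
  assumes "\<And>d. h d \<in> carrier R" "finite {d. h d \<noteq> \<zero>}"
  shows "coeff U (coeff V (pure h) j) i = pure h j i"
  using pure_closed[OF assms] by (simp add: coeff_up)

lemma pc_pure:
  assumes "\<And>d. h d \<in> carrier R" "finite {d. h d \<noteq> \<zero>}"
  shows "pc (pure h) d = h d"
  unfolding pc_def coeff_pure[OF assms] by (auto simp: pure_def)

lemma kap_surj:
  assumes "\<And>d. h d \<in> carrier R" "finite {d. h d \<noteq> \<zero>}"
  shows "\<exists>X\<in>carrier DR. kap X = h"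
  by (rule bexI[of _ "cl (pure h)"])
    (use pure_closed[OF assms] pc_pure[OF assms] in \<open>auto simp: carrier_DR kap_cl\<close>)

lemma pc_finite: "P \<in> carrier V \<Longrightarrow> finite {d. pc P d \<noteq> \<zero>}"
proof -
  assume P: "P \<in> carrier V"
  then have PU: "P j \<in> carrier U" for j by (auto simp: up_mem[of P])
  obtain m where m: "\<And>j. j > m \<Longrightarrow> P j = \<zero>\<^bsub>U\<^esub>" using P unfolding up_mem[of P] by blast
  obtain k where k: "\<And>i. i > k \<Longrightarrow> P 0 i = \<zero>" using PU[of 0] unfolding up_mem by blast
  have "pc P d = \<zero>" if "d \<notin> {- int m..int k}" for d
  proof (cases "d \<ge> 0")
    case True
    then show ?thesis using that k[of "nat d"] P PU by (simp add: pc_def coeff_up)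
  next
    case False
    then have "P (nat (- d)) = \<zero>\<^bsub>U\<^esub>" using that by (intro m) auto
    then show ?thesis using P by (simp add: pc_def coeff_up[of P])
  qed
  then have "{d. pc P d \<noteq> \<zero>} \<subseteq> {- int m..int k}" by blast
  then show ?thesis by (rule finite_subset) simp
qed

lemma kap_finite: "X \<in> carrier DR \<Longrightarrow> finite {d. kap X d \<noteq> \<zero>}"
  by (auto simp: carrier_DR kap_cl pc_finite)

definition homog :: "int \<Rightarrow> (nat \<Rightarrow> nat \<Rightarrow> 'a) set" where
  "homog d = {P \<in> carrier V. \<forall>i j. coeff U (coeff V P j) i \<noteq> \<zero> \<longrightarrow> int i - int j = d}"

lemma DR_part: "D_ring_part p R d = cl ` homog d"
  by (simp add: D_ring_part_def homog_def)

lemma DR_part_eq: "D_ring_part p R d = {X \<in> carrier DR. \<forall>t. t \<noteq> d \<longrightarrow> kap X t = \<zero>}"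
proof (intro equalityI subsetI)
  fix X assume "X \<in> D_ring_part p R d"
  then obtain P where P: "P \<in> homog d" "X = cl P" by (auto simp: DR_part)
  then have "P \<in> carrier V" by (simp add: homog_def)
  moreover have "pc P t = \<zero>" if "t \<noteq> d" for t
  proof (rule ccontr)
    assume "pc P t \<noteq> \<zero>"
    then have "int (nat t) - int (nat (- t)) = d" using P(1) unfolding homog_def pc_def by blast
    with that show False by (auto split: if_splits)
  qed
  ultimately show "X \<in> {X \<in> carrier DR. \<forall>t. t \<noteq> d \<longrightarrow> kap X t = \<zero>}"
    using P by (auto simp: kap_cl carrier_DR)
next
  fix X assume X: "X \<in> {X \<in> carrier DR. \<forall>t. t \<noteq> d \<longrightarrow> kap X t = \<zero>}"
  have h: "\<And>t. kap X t \<in> carrier R" "finite {t. kap X t \<noteq> \<zero>}" using X kap_closed kap_finite by auto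
  have "pure (kap X) \<in> homog d"
    unfolding homog_def mem_Collect_eq coeff_pure[OF h]
    using pure_closed[OF h] X by (auto simp: pure_def split: if_splits)
  moreover have "X = cl (pure (kap X))"
    by (rule kap_inj) (use X pure_closed[OF h] pc_pure[OF h] in \<open>auto simp: kap_cl carrier_DR\<close>)
  ultimately show "X \<in> D_ring_part p R d" by (auto simp: DR_part)
qed

lemma DR_grading: "grading DR (D_ring_part p R)"
proof (rule grading_by_coordinates[of DR R kap "D_ring_part p R" "\<lambda>d. d"])
  fix X d assume X: "X \<in> carrier DR"
  define h where "h t = (if t = d then kap X t else \<zero>)" for t
  have "\<And>t. h t \<in> carrier R" "finite {t. h t \<noteq> \<zero>}"
    using kap_closed[OF X] finite_subset[OF _ kap_finite[OF X], of "{t. h t \<noteq> \<zero>}"] by (auto simp: h_def)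
  then obtain Y where "Y \<in> carrier DR" "kap Y = h" using kap_surj by blast
  then show "\<exists>m'\<in>D_ring_part p R d. \<forall>t. t = d \<longrightarrow> kap m' t = kap X t"
    by (intro bexI[of _ Y]) (auto simp: DR_part_eq h_def)
next
  fix X Y assume "X \<in> carrier DR" "Y \<in> carrier DR" "\<And>t. kap X t = kap Y t"
  then show "X = Y" by (rule kap_inj)
qed (auto simp: kap_closed kap_add kap_finite DR_part_eq intro: DR.ring_axioms ring_axioms)

lemma homog_mult:
  assumes "P \<in> homog d" "Q \<in> homog e"
  shows "P \<otimes>\<^bsub>V\<^esub> Q \<in> homog (d + e)"
proof -
  have PQ: "P \<in> carrier V" "Q \<in> carrier V" using assms by (auto simp: homog_def)
  have "coeff U (coeff V (P \<otimes>\<^bsub>V\<^esub> Q) j) i = \<zero>" if ne: "int i - int j \<noteq> d + e" for i j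
  proof -
    have "coeff U (coeff V (P \<otimes>\<^bsub>V\<^esub> Q) j) i =
      coeff U (\<Oplus>\<^bsub>U\<^esub>b\<in>{..j}. coeff V P b \<otimes>\<^bsub>U\<^esub> coeff V Q (j - b)) i"
      using PQ by simp
    also have "\<dots> = (\<Oplus>b\<in>{..j}. coeff U (coeff V P b \<otimes>\<^bsub>U\<^esub> coeff V Q (j - b)) i)"
      using PQ by (intro U.coeff_finsum) auto
    also have "\<dots> = \<zero>"
    proof (rule finsum_neutral)
      fix b assume b: "b \<in> {..j}"
      have "coeff U (coeff V P b \<otimes>\<^bsub>U\<^esub> coeff V Q (j - b)) i =
        (\<Oplus>a\<in>{..i}. coeff U (coeff V P b) a \<otimes> coeff U (coeff V Q (j - b)) (i - a))"
        using PQ by (intro U.coeff_mult) auto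
      also have "\<dots> = \<zero>"
      proof (rule finsum_neutral)
        fix a assume a: "a \<in> {..i}"
        have "int a - int b \<noteq> d \<or> int (i - a) - int (j - b) \<noteq> e" using a b ne by auto
        then have "coeff U (coeff V P b) a = \<zero> \<or> coeff U (coeff V Q (j - b)) (i - a) = \<zero>"
          using assms unfolding homog_def by blast
        then show "coeff U (coeff V P b) a \<otimes> coeff U (coeff V Q (j - b)) (i - a) = \<zero>"
          using PQ by auto
      qed
      finally show "coeff U (coeff V P b \<otimes>\<^bsub>U\<^esub> coeff V Q (j - b)) i = \<zero>" .
    qed
    finally show ?thesis .
  qed
  then show ?thesis unfolding homog_def mem_Collect_eq using PQ V.UP_mult_closed by blast
qed

lemma DR_graded: "graded_ring DR (D_ring_part p R)"
  unfolding graded_ring_def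
proof (intro conjI allI ballI)
  have "\<one>\<^bsub>V\<^esub> \<in> homog 0" by (auto simp: homog_def)
  then show "\<one>\<^bsub>DR\<^esub> \<in> D_ring_part p R 0" unfolding DR_part ring_hom_one[OF cl_hom, symmetric] by (rule imageI)
  fix i j X Y assume "X \<in> D_ring_part p R i" "Y \<in> D_ring_part p R j"
  then obtain P Q where PQ: "P \<in> homog i" "X = cl P" "Q \<in> homog j" "Y = cl Q" by (auto simp: DR_part)
  then have "X \<otimes>\<^bsub>DR\<^esub> Y = cl (P \<otimes>\<^bsub>V\<^esub> Q)" by (simp add: ring_hom_mult[OF cl_hom] homog_def)
  then show "X \<otimes>\<^bsub>DR\<^esub> Y \<in> D_ring_part p R (i + j)" unfolding DR_part using homog_mult[OF PQ(1,3)] by blast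
qed (auto intro: DR_grading DR.ring_axioms)

end

lemma (in ring) finsum_commute:
  assumes "finite F" "f \<in> F \<rightarrow> carrier R" "y \<in> carrier R" "\<And>k. k \<in> F \<Longrightarrow> f k \<otimes> y = y \<otimes> f k"
  shows "finsum R f F \<otimes> y = y \<otimes> finsum R f F"
proof -
  have "finsum R f F \<otimes> y = (\<Oplus>k\<in>F. f k \<otimes> y)" using assms by (intro finsum_ldistr) auto
  also have "\<dots> = (\<Oplus>k\<in>F. y \<otimes> f k)" using assms by (intro finsum_cong') auto
  also have "\<dots> = y \<otimes> finsum R f F" using assms by (intro finsum_rdistr[symmetric]) auto
  finally show ?thesis .
qed

text \<open>The universal property asks for a commutative target, while the structure map is
  evaluated in the whole ring. Powers and finite sums of elements of a subring are the same in
  both.\<close>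

lemma eval_subring_eq:
  assumes "ring S" "subring C S" "\<And>r. r \<in> carrier R \<Longrightarrow> h r \<in> C" "s \<in> C" "ring R"
  shows "eval R (S\<lparr>carrier := C\<rparr>) h s = eval R S h s"
proof
  fix q
  interpret S: ring S by fact
  interpret C: ring "S\<lparr>carrier := C\<rparr>" by (rule S.subring_is_ring[OF assms(2)])
  have pw: "s [^]\<^bsub>S\<lparr>carrier := C\<rparr>\<^esub> (i::nat) = s [^]\<^bsub>S\<^esub> i" for i by (simp add: nat_pow_def)
  have pwC: "s [^]\<^bsub>S\<^esub> (i::nat) \<in> C" for i
    using C.nat_pow_closed[of s i] assms(4) unfolding pw by simp
  show "eval R (S\<lparr>carrier := C\<rparr>) h s q = eval R S h s q"
  proof (cases "q \<in> carrier (UP R)")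
    case True
    then have "coeff (UP R) q i \<in> carrier R" for i by (auto simp: UP_def)
    then have "(\<lambda>i. h (coeff (UP R) q i) \<otimes>\<^bsub>S\<^esub> s [^]\<^bsub>S\<^esub> i) \<in> {..deg R q} \<rightarrow> C"
      using assms(3) pwC subringE(6)[OF assms(2)] by blast
    from S.finsum_subring_carrier[OF assms(2) this] True show ?thesis by (simp add: eval_def pw)
  qed (simp add: eval_def)
qed

section \<open>Reduction modulo p: coordinates and homogeneous parts\<close>

context formal_coords
begin

abbreviation Rb where "Rb \<equiv> reduction p A"
abbreviation red where "red \<equiv> reduction_map p A"
abbreviation SS where "SS \<equiv> reduction p B1"
abbreviation q where "q \<equiv> reduction_map p B1"
abbreviation cls where "cls \<equiv> D01_class p W \<iota> A"

lemma red_hom: "red \<in> ring_hom A Rb" by (rule reduction_map_hom)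
lemma Rb_cring: "cring Rb" by (rule reduction_cring)
sublocale Rb: cring Rb by (rule Rb_cring)
sublocale SS: ring SS by (rule B.S.reduction_ring)
lemma q_hom: "q \<in> ring_hom B1 SS" by (rule B.S.reduction_map_hom)

lemma Rb_p: "[p] \<cdot>\<^bsub>Rb\<^esub> \<one>\<^bsub>Rb\<^esub> = \<zero>\<^bsub>Rb\<^esub>"
proof -
  have "[p] \<cdot>\<^bsub>Rb\<^esub> \<one>\<^bsub>Rb\<^esub> = red ([p] \<cdot> \<one>)"
    using ring_hom_add_pow[OF ring_axioms Rb.ring_axioms red_hom one_closed, of p]
    by (simp add: ring_hom_one[OF red_hom])
  also have "\<dots> = \<zero>\<^bsub>Rb\<^esub>" by (subst reduction_map_zero_iff) (auto intro: int_idealI)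
  finally show ?thesis .
qed

sublocale fv: fv_quotient Rb p by unfold_locales (rule Rb_p)

lemma red_closed [simp]: "a \<in> carrier A \<Longrightarrow> red a \<in> carrier Rb" by (rule ring_hom_closed[OF red_hom])

lemma red_eq_iff: "a \<in> carrier A \<Longrightarrow> b \<in> carrier A \<Longrightarrow> red a = red b \<longleftrightarrow> cg 1 a b"
  by (simp add: reduction_map_eq_iff cg_iff)

lemma red_zero: "red \<zero> = \<zero>\<^bsub>Rb\<^esub>"
  by (rule ring_hom_zero[OF red_hom ring_axioms Rb.ring_axioms])

lemma q_eq_iff:
  assumes "F \<in> carrier B1" "G \<in> carrier B1"
  shows "q F = q G \<longleftrightarrow> (\<exists>H\<in>carrier B1. F = G \<oplus>\<^bsub>B1\<^esub> [p] \<cdot>\<^bsub>B1\<^esub> H)"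
proof -
  have "F = G \<oplus>\<^bsub>B1\<^esub> c \<longleftrightarrow> F \<ominus>\<^bsub>B1\<^esub> G = c" if "c \<in> carrier B1" for c
    using that assms B.S.minus_add_cancel[of F G] B.S.minus_cancel_left[of G c] B.S.a_comm[of c G] by auto
  then show ?thesis
    unfolding B.S.reduction_map_eq_iff[OF assms] B.S.int_ideal_eq by auto
qed

text \<open>\<open>lamA_dvd\<close> turns a difference whose coordinates are all divisible by
  \<open>p\<close> into a multiple of \<open>p\<close> in \<open>B1\<close>; the other direction is
  additivity of the coordinates.\<close>

lemma q_eq_lam:
  assumes "F \<in> carrier B1" "G \<in> carrier B1"
  shows "q F = q G \<longleftrightarrow> (\<forall>t. red (lamA F t) = red (lamA G t))"
proof
  assume "q F = q G"
  then obtain H where H: "H \<in> carrier B1" "F = G \<oplus>\<^bsub>B1\<^esub> [p] \<cdot>\<^bsub>B1\<^esub> H" unfolding q_eq_iff[OF assms] by blast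
  have "cg 1 (lamA F t) (lamA G t)" for t
    unfolding H(2) using H(1) assms by (auto simp: cg_def lamA_add lamA_add_pow)
  then show "\<forall>t. red (lamA F t) = red (lamA G t)" using assms by (simp add: red_eq_iff)
next
  assume eq: "\<forall>t. red (lamA F t) = red (lamA G t)"
  have "cg 1 (lamA (F \<ominus>\<^bsub>B1\<^esub> G) t) \<zero>" for t
  proof -
    have "cg 1 (lamA F t) (lamA G t)" 
      using eq[THEN spec, of t] assms by (simp only: red_eq_iff lamA_closed)
    then have "cg 1 (lamA F t \<ominus> lamA G t) (lamA G t \<ominus> lamA G t)" by (rule cg_minus) (use assms in \<open>simp add: cg_refl\<close>)
    then show ?thesis using assms by (simp add: a_minus_def[of B1] lamA_add lamA_neg minus_self a_minus_def[of A, symmetric])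
  qed
  then obtain H where H: "H \<in> carrier B1" "F \<ominus>\<^bsub>B1\<^esub> G = [p] \<cdot>\<^bsub>B1\<^esub> H"
    using lamA_dvd[of "F \<ominus>\<^bsub>B1\<^esub> G"] assms by auto
  have "F = G \<oplus>\<^bsub>B1\<^esub> [p] \<cdot>\<^bsub>B1\<^esub> H"
    unfolding H(2)[symmetric] using assms B.S.minus_add_cancel[of F G] by (simp add: B.S.a_comm)
  then show "q F = q G" unfolding q_eq_iff[OF assms] using H(1) by blast
qed

lemma carrier_SS: "carrier SS = q ` carrier B1" by (rule B.S.carrier_reduction)

text \<open>The choice of a representative is harmless by \<open>q_eq_lam\<close>.\<close>

definition lam :: "(int \<Rightarrow> 'a \<Rightarrow> 'a) set \<Rightarrow> idx \<times> int \<Rightarrow> 'a set" where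
  "lam X t = red (lamA (SOME F. F \<in> carrier B1 \<and> q F = X) t)"

lemma lam_q: "F \<in> carrier B1 \<Longrightarrow> lam (q F) t = red (lamA F t)"
proof -
  assume F: "F \<in> carrier B1"
  let ?G = "SOME G. G \<in> carrier B1 \<and> q G = q F"
  have "?G \<in> carrier B1 \<and> q ?G = q F" by (rule someI[of _ F]) (use F in simp)
  then have "\<forall>t. red (lamA ?G t) = red (lamA F t)" using q_eq_lam[of ?G F] F by blast
  then show ?thesis unfolding lam_def by blast
qed

lemma lam_closed: "X \<in> carrier SS \<Longrightarrow> lam X t \<in> carrier Rb"
  by (auto simp: carrier_SS lam_q)

lemma lam_add: "X \<in> carrier SS \<Longrightarrow> Z \<in> carrier SS \<Longrightarrow> lam (X \<oplus>\<^bsub>SS\<^esub> Z) t = lam X t \<oplus>\<^bsub>Rb\<^esub> lam Z t"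
  by (auto simp: carrier_SS lam_q lamA_add ring_hom_add[OF q_hom, symmetric] ring_hom_add[OF red_hom])

lemma lam_inj:
  assumes "X \<in> carrier SS" "Z \<in> carrier SS" "\<And>t. lam X t = lam Z t"
  shows "X = Z"
proof -
  obtain F G where FG: "F \<in> carrier B1" "X = q F" "G \<in> carrier B1" "Z = q G"
    using assms(1,2) by (auto simp: carrier_SS)
  then have "red (lamA F t) = red (lamA G t)" for t using assms(3)[of t] by (simp add: lam_q)
  then show ?thesis using q_eq_lam[OF FG(1,3)] FG by blast
qed

lemma lam_zero: "lam \<zero>\<^bsub>SS\<^esub> t = \<zero>\<^bsub>Rb\<^esub>"
  using lam_add[of "\<zero>\<^bsub>SS\<^esub>" "\<zero>\<^bsub>SS\<^esub>" t] lam_closed[of "\<zero>\<^bsub>SS\<^esub>" t]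
    Rb.add.l_cancel_one'[of "lam \<zero>\<^bsub>SS\<^esub> t" "lam \<zero>\<^bsub>SS\<^esub> t"] by simp

lemma lam_finsum: "f \<in> F \<rightarrow> carrier SS \<Longrightarrow> lam (finsum SS f F) t = (\<Oplus>\<^bsub>Rb\<^esub>k\<in>F. lam (f k) t)"
  by (induction F rule: infinite_finite_induct)
    (auto simp: lam_zero lam_add lam_closed Pi_def SS.finsum_infinite Rb.finsum_infinite)

lemma lamA_zero_if: "F \<in> carrier B1 \<Longrightarrow> co (F i) K = \<zero> \<Longrightarrow> lamA F (K, i) = \<zero>"
  by (rule lamA_eqI) auto

lemma lam_outside: "X \<in> carrier SS \<Longrightarrow> K \<notin> M \<Longrightarrow> lam X (K, i) = \<zero>\<^bsub>Rb\<^esub>"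
proof -
  assume "X \<in> carrier SS" and K: "K \<notin> M"
  then obtain F where F: "F \<in> carrier B1" "X = q F" by (auto simp: carrier_SS)
  have "co (F i) K = \<zero>" using part_co(1)[OF B1_part[OF F(1)]] K by (rule FS_outside)
  then show ?thesis using F by (simp add: lam_q lamA_zero_if red_zero)
qed

lemma lam_finite: "X \<in> carrier SS \<Longrightarrow> finite {t. lam X t \<noteq> \<zero>\<^bsub>Rb\<^esub>}"
proof -
  assume "X \<in> carrier SS"
  then obtain F where F: "F \<in> carrier B1" "X = q F" by (auto simp: carrier_SS)
  let ?T = "\<Union>i\<in>{i. F i \<noteq> \<zero>\<^bsub>E\<^esub>}. (\<lambda>K. (K, i)) ` {K. co (F i) K \<noteq> \<zero>}"
  have "finite ?T"
  proof (rule finite_UN_I)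
    show "finite {i. F i \<noteq> \<zero>\<^bsub>E\<^esub>}" using F(1) B.rees_mem[of F] by simp
    show "finite ((\<lambda>K. (K, i)) ` {K. co (F i) K \<noteq> \<zero>})" for i
      by (intro finite_imageI FS_finite part_co(1)[OF B1_part[OF F(1)]])
  qed
  moreover have "{t. lam X t \<noteq> \<zero>\<^bsub>Rb\<^esub>} \<subseteq> ?T"
  proof
    fix t assume t: "t \<in> {t. lam X t \<noteq> \<zero>\<^bsub>Rb\<^esub>}"
    obtain K i where Ki: "t = (K, i)" by (cases t)
    have "co (F i) K \<noteq> \<zero>" using t F lamA_zero_if[OF F(1), of i K] by (auto simp: lam_q red_zero Ki)
    moreover then have "F i \<noteq> \<zero>\<^bsub>E\<^esub>" by (auto simp: co_zero)
    ultimately show "t \<in> ?T" unfolding Ki by blast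
  qed
  ultimately show ?thesis by (rule finite_subset[rotated])
qed

lemma cls_q: "cls i \<Phi> = q (B.sg i \<Phi>)"
  by (simp add: D01_class_def B.sg_def)

lemma cls_closed [simp]: "\<Phi> \<in> Dp i \<Longrightarrow> cls i \<Phi> \<in> carrier SS"
  unfolding cls_q by (rule ring_hom_closed[OF q_hom B.sg_closed])

lemma cls_mult: "\<Phi> \<in> Dp i \<Longrightarrow> \<Psi> \<in> Dp j \<Longrightarrow> cls i \<Phi> \<otimes>\<^bsub>SS\<^esub> cls j \<Psi> = cls (i + j) (\<Phi> \<otimes>\<^bsub>E\<^esub> \<Psi>)"
  unfolding cls_q using B.sg_mult[of \<Phi> i \<Psi> j] ring_hom_mult[OF q_hom B.sg_closed B.sg_closed, of \<Phi> i \<Psi> j] by simp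

lemma cls_add: "\<Phi> \<in> Dp i \<Longrightarrow> \<Psi> \<in> Dp i \<Longrightarrow> cls i (\<Phi> \<oplus>\<^bsub>E\<^esub> \<Psi>) = cls i \<Phi> \<oplus>\<^bsub>SS\<^esub> cls i \<Psi>"
  unfolding cls_q using B.sg_add[OF part_D part_D, of \<Phi> i \<Psi> i i]
    ring_hom_add[OF q_hom B.sg_closed B.sg_closed, of \<Phi> i \<Psi> i] by simp

lemma cls_one: "cls 0 \<one>\<^bsub>E\<^esub> = \<one>\<^bsub>SS\<^esub>"
  unfolding cls_q using B.sg_one ring_hom_one[OF q_hom] by simp

lemma cls_zero: "cls i \<zero>\<^bsub>E\<^esub> = \<zero>\<^bsub>SS\<^esub>"
  unfolding cls_q using B.sg_zero[of i] ring_hom_zero[OF q_hom B.S.ring_axioms SS.ring_axioms] by simp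

lemma part_mult: "\<Phi> \<in> Dp i \<Longrightarrow> \<Psi> \<in> Dp j \<Longrightarrow> \<Phi> \<otimes>\<^bsub>E\<^esub> \<Psi> \<in> Dp (i + j)"
  using B.H_mult[of \<Phi> i \<Psi> j] by simp

lemma part_one: "\<one>\<^bsub>E\<^esub> \<in> Dp 0" using B.H_one by simp

lemma cls_pow: "\<Phi> \<in> Dp i \<Longrightarrow> cls i \<Phi> [^]\<^bsub>SS\<^esub> (m::nat) = cls (int m * i) (\<Phi> [^]\<^bsub>E\<^esub> m) \<and> \<Phi> [^]\<^bsub>E\<^esub> m \<in> Dp (int m * i)"
proof (induction m)
  case 0
  then show ?case by (simp add: cls_one part_one)
next
  case (Suc m)
  then show ?case
    using cls_mult[of "\<Phi> [^]\<^bsub>E\<^esub> m" "int m * i" \<Phi> i] part_mult[of "\<Phi> [^]\<^bsub>E\<^esub> m" "int m * i" \<Phi> i]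
    by (simp add: algebra_simps)
qed

lemma mem_part: "K \<in> M \<Longrightarrow> cg (hi i K) a \<zero> \<Longrightarrow> \<mu> a \<otimes>\<^bsub>E\<^esub> eb K \<in> Dp i"
  unfolding part_eq_span by (rule span_single)

lemma eb_part: "K \<in> M \<Longrightarrow> eb K \<in> Dp (int (wt K))"
  using mem_part[of K "int (wt K)" \<one>] by (simp add: hi_def cg_def mu_one)

lemma mu_part: "cg (nat (- i)) a \<zero> \<Longrightarrow> \<mu> a \<in> Dp i"
  using mem_part[of K0 i a] K0 by (simp add: hi_def cg_def)

text \<open>The operator \<open>p ^ hi i K\<close> times \<open>eb K\<close> is the basis element of
  degree \<open>i\<close> with index \<open>K\<close>, so the coordinate is \<open>b\<close> and not
  its multiple.\<close>

lemma lam_cls: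
  assumes K: "K \<in> M" and b: "b \<in> carrier A"
  shows "lam (cls i (\<mu> ([(p ^ hi i K)] \<cdot> b) \<otimes>\<^bsub>E\<^esub> eb K)) t = (if t = (K, i) then red b else \<zero>\<^bsub>Rb\<^esub>)"
proof -
  let ?a = "[(p ^ hi i K)] \<cdot> b"
  let ?\<Phi> = "\<mu> ?a \<otimes>\<^bsub>E\<^esub> eb K"
  have \<Phi>: "?\<Phi> \<in> Dp i" by (rule mem_part[OF K cg_zero_add_pow[OF b]])
  have co: "co ?\<Phi> = (\<lambda>L. if L = K then ?a else \<zero>)"
    using co_lc[OF FS_single[OF K, of ?a]] lc_single[OF K, of ?a] b by simp
  obtain L j where t: "t = (L, j)" by (cases t)
  have "lamA (B.sg i ?\<Phi>) t = (if t = (K, i) then b else \<zero>)"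
  proof (cases "t = (K, i)")
    case True
    show ?thesis unfolding True using b by (simp, intro lamA_eqI) (simp_all add: B.sg_def co)
  next
    case False
    then have "co (B.sg i ?\<Phi> j) L = \<zero>" unfolding t by (auto simp: B.sg_def co co_zero)
    then have z: "lamA (B.sg i ?\<Phi>) t = \<zero>" unfolding t by (rule lamA_zero_if[OF B.sg_closed[OF \<Phi>]])
    show ?thesis unfolding z using False by simp
  qed
  then show ?thesis unfolding cls_q lam_q[OF B.sg_closed[OF \<Phi>]] by (simp add: red_zero)
qed

abbreviation SP where "SP \<equiv> D01_mod_part p W \<iota> A"

lemma SP_eq: "SP i = {X \<in> carrier SS. \<forall>t. snd t \<noteq> i \<longrightarrow> lam X t = \<zero>\<^bsub>Rb\<^esub>}"
proof (intro equalityI subsetI)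
  fix X assume "X \<in> SP i"
  then obtain \<Phi> where \<Phi>: "\<Phi> \<in> Dp i" "X = cls i \<Phi>" by (auto simp: D01_mod_part_def)
  have "lam X (K, j) = \<zero>\<^bsub>Rb\<^esub>" if "j \<noteq> i" for K j
  proof -
    have "co (B.sg i \<Phi> j) K = \<zero>" using that by (simp add: B.sg_def co_zero)
    then show ?thesis using \<Phi> lamA_zero_if[OF B.sg_closed[OF \<Phi>(1)], of j K] by (simp add: cls_q lam_q red_zero)
  qed
  then show "X \<in> {X \<in> carrier SS. \<forall>t. snd t \<noteq> i \<longrightarrow> lam X t = \<zero>\<^bsub>Rb\<^esub>}" using \<Phi> by auto
next
  fix X assume X: "X \<in> {X \<in> carrier SS. \<forall>t. snd t \<noteq> i \<longrightarrow> lam X t = \<zero>\<^bsub>Rb\<^esub>}"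
  then obtain F where F: "F \<in> carrier B1" "X = q F" by (auto simp: carrier_SS)
  have Fi: "F i \<in> Dp i" by (rule B1_part[OF F(1)])
  \<comment> \<open>Replacing \<open>F\<close> by its component of degree \<open>i\<close> changes
    only coordinates that vanish modulo \<open>p\<close>.\<close>
  have "X = cls i (F i)"
  proof (rule lam_inj)
    fix t :: "idx \<times> int"
    obtain K j where t: "t = (K, j)" by (cases t)
    show "lam X t = lam (cls i (F i)) t"
    proof (cases "j = i")
      case True
      have "lamA (B.sg i (F i)) (K, i) = lamA F (K, i)" by (simp add: lamA_def B.sg_def)
      then show ?thesis using True t F Fi by (simp add: cls_q lam_q)
    next
      case False
      then have "co (B.sg i (F i) j) K = \<zero>" by (simp add: B.sg_def co_zero)
      then have "lam (cls i (F i)) t = \<zero>\<^bsub>Rb\<^esub>"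
        using lamA_zero_if[OF B.sg_closed[OF Fi], of j K] Fi by (simp add: t cls_q lam_q red_zero)
      moreover have "\<forall>t. snd t \<noteq> i \<longrightarrow> lam X t = \<zero>\<^bsub>Rb\<^esub>" using X by blast
      from this[THEN spec, of t] have "lam X t = \<zero>\<^bsub>Rb\<^esub>" using False t by simp
      ultimately show ?thesis by simp
    qed
  qed (use X Fi in auto)
  then show "X \<in> SP i" using Fi by (auto simp: D01_mod_part_def)
qed

lemma SP_component:
  assumes "X \<in> carrier SS"
  shows "\<exists>Z\<in>SP i. \<forall>t. snd t = i \<longrightarrow> lam Z t = lam X t"
proof -
  obtain F where F: "F \<in> carrier B1" "X = q F" using assms by (auto simp: carrier_SS)
  have Fi: "F i \<in> Dp i" by (rule B1_part[OF F(1)])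
  have "lamA (B.sg i (F i)) (K, i) = lamA F (K, i)" for K by (simp add: lamA_def B.sg_def)
  then have "\<forall>t. snd t = i \<longrightarrow> lam (cls i (F i)) t = lam X t"
    using F Fi by (auto simp: cls_q lam_q)
  moreover have "cls i (F i) \<in> SP i" using Fi by (auto simp: D01_mod_part_def)
  ultimately show ?thesis by blast
qed

section \<open>The structure map from polynomials in f and v\<close>

abbreviation NN where "NN \<equiv> D01_mod p W \<iota> A"

lemma NN_simps [simp]: "carrier NN = carrier SS" "mult NN = mult SS" "one NN = one SS"
  "zero NN = zero SS" "add NN = add SS"
  "c \<odot>\<^bsub>NN\<^esub> m = D01_structure_map p W \<iota> A c \<otimes>\<^bsub>SS\<^esub> m"
  by (simp_all add: D01_mod_def Let_def ring.defs module.defs)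

lemma NN_ring: "ring NN"
proof (rule ringI)
  show "abelian_group NN"
  proof (rule abelian_groupI)
    fix X assume "X \<in> carrier NN"
    then show "\<exists>Z\<in>carrier NN. Z \<oplus>\<^bsub>NN\<^esub> X = \<zero>\<^bsub>NN\<^esub>"
      by (intro bexI[of _ "\<ominus>\<^bsub>SS\<^esub> X"]) (auto simp: SS.l_neg)
  qed (auto simp: SS.a_ac)
  show "Group.monoid NN"
    by (rule monoidI) (auto simp: SS.m_assoc)
qed (auto simp: SS.l_distr SS.r_distr)

sublocale NN: ring NN by (rule NN_ring)

lemma NN_finsum: "finsum NN f F = finsum SS f F"
  unfolding finsum_def finprod_def by simp

lemma NN_grading: "grading NN SP"
proof (rule grading_by_coordinates[of NN Rb lam SP snd])
  fix X Z assume "X \<in> carrier NN" "Z \<in> carrier NN" "\<And>t. lam X t = lam Z t"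
  then show "X = Z" using lam_inj[of X Z] by simp
next
  show "SP d = {m \<in> carrier NN. \<forall>t. snd t \<noteq> d \<longrightarrow> lam m t = \<zero>\<^bsub>Rb\<^esub>}" for d
    unfolding SP_eq by simp
next
  fix X d assume "X \<in> carrier NN"
  then show "\<exists>Z\<in>SP d. \<forall>t. snd t = d \<longrightarrow> lam Z t = lam X t" using SP_component[of X d] by simp
qed (auto simp: lam_closed lam_add lam_finite intro: NN_ring Rb.ring_axioms)

abbreviation h where "h \<equiv> D01_coeff_map p W \<iota> A"

text \<open>Changing \<open>a\<close> by a multiple of \<open>p\<close> changes the operator in
  degree 0 by \<open>p\<close> times a multiplication, which is invisible after reduction; so
  \<open>the_elem\<close> is applied to a singleton.\<close>

lemma h_red:
  assumes a: "a \<in> carrier A"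
  shows "h (red a) = cls 0 (\<mu> a)"
  unfolding D01_coeff_map_def
proof (rule the_elem_image_unique)
  interpret I: ideal "int_ideal A p" A by (rule int_ideal_ideal)
  show "red a \<noteq> {}" using I.a_rcos_self[OF a] by (auto simp: reduction_map_def)
  fix b assume b: "b \<in> red a"
  have bA: "b \<in> carrier A"
    using b a a_r_coset_subset_G[OF I.a_subset a] by (auto simp: reduction_map_def)
  then have "b \<ominus> a \<in> int_ideal A p" using mem_coset_iff[OF int_ideal_ideal a bA] b by (simp add: reduction_map_def)
  then have "cg 1 b a" using a bA by (simp add: cg_iff)
  then obtain c where c: "c \<in> carrier A" "b = a \<oplus> [p] \<cdot> c" by (auto simp: cg_def)
  have mu0: "\<mu> d \<in> Dp 0" if "d \<in> carrier A" for d using that by (intro mu_part) (simp add: cg_def)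
  have "B.sg 0 (\<mu> b) = B.sg 0 (\<mu> a) \<oplus>\<^bsub>B1\<^esub> [p] \<cdot>\<^bsub>B1\<^esub> B.sg 0 (\<mu> c)"
    using a c by (intro ext) (simp add: B.rees_add B.rees_add_pow B.sg_def mu_add mu_add_pow)
  then have "cls 0 (\<mu> b) = cls 0 (\<mu> a)"
    unfolding cls_q using mu0 a bA c(1) by (subst q_eq_iff) auto
  then show "cls 0 (b \<odot>\<^bsub>D\<^esub> \<one>\<^bsub>D\<^esub>) = cls 0 (\<mu> a)" using bA by (simp add: mu_smult)
qed

lemma mu_part0: "a \<in> carrier A \<Longrightarrow> \<mu> a \<in> Dp 0"
  by (rule mu_part) (simp add: cg_def)

lemma h_hom: "h \<in> ring_hom Rb SS"
proof (rule ring_hom_memI)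
  fix s t assume "s \<in> carrier Rb" "t \<in> carrier Rb"
  then obtain a b where ab: "a \<in> carrier A" "s = red a" "b \<in> carrier A" "t = red b"
    by (auto simp: carrier_reduction)
  show "h s \<in> carrier SS" using ab by (simp add: h_red mu_part0)
  show "h (s \<otimes>\<^bsub>Rb\<^esub> t) = h s \<otimes>\<^bsub>SS\<^esub> h t" "h (s \<oplus>\<^bsub>Rb\<^esub> t) = h s \<oplus>\<^bsub>SS\<^esub> h t"
    using ab by (simp_all add: ring_hom_mult[OF red_hom, symmetric] ring_hom_add[OF red_hom, symmetric]
      h_red mu_mult mu_add cls_mult cls_add mu_part0)
next
  show "h \<one>\<^bsub>Rb\<^esub> = \<one>\<^bsub>SS\<^esub>"
    by (simp add: ring_hom_one[OF red_hom, symmetric] h_red mu_one cls_one)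
qed

definition fS where "fS = cls 1 \<one>\<^bsub>D\<^esub>"
definition vS where "vS = cls (-1) ([p] \<cdot>\<^bsub>D\<^esub> \<one>\<^bsub>D\<^esub>)"

lemma one_part1: "\<one>\<^bsub>E\<^esub> \<in> Dp 1" using mu_part[of 1 \<one>] by (simp add: cg_def mu_one)

lemma p_part: "[p] \<cdot>\<^bsub>E\<^esub> \<one>\<^bsub>E\<^esub> \<in> Dp (-1)"
  using mu_part[of "-1" "[p] \<cdot> \<one>"] cg_zero_add_pow[OF one_closed, of 1] by (simp add: mu_add_pow mu_one)

lemma fS_pow: "fS [^]\<^bsub>SS\<^esub> (i::nat) = cls (int i) \<one>\<^bsub>E\<^esub>" "\<one>\<^bsub>E\<^esub> \<in> Dp (int i)"
  using cls_pow[OF one_part1, of i] by (simp_all add: fS_def)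

lemma vS_pow: "vS [^]\<^bsub>SS\<^esub> (j::nat) = cls (- int j) ([(p ^ j)] \<cdot>\<^bsub>E\<^esub> \<one>\<^bsub>E\<^esub>)"
  "[(p ^ j)] \<cdot>\<^bsub>E\<^esub> \<one>\<^bsub>E\<^esub> \<in> Dp (- int j)"
proof -
  have "([p] \<cdot>\<^bsub>E\<^esub> \<one>\<^bsub>E\<^esub>) [^]\<^bsub>E\<^esub> j = [(p ^ j)] \<cdot>\<^bsub>E\<^esub> \<one>\<^bsub>E\<^esub>"
    by (induction j) (simp_all add: E.add_pow_ldistr E.add_pow_rdistr E.add_pow_mult mult.commute)
  then show "vS [^]\<^bsub>SS\<^esub> j = cls (- int j) ([(p ^ j)] \<cdot>\<^bsub>E\<^esub> \<one>\<^bsub>E\<^esub>)" "[(p ^ j)] \<cdot>\<^bsub>E\<^esub> \<one>\<^bsub>E\<^esub> \<in> Dp (- int j)"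
    using cls_pow[OF p_part, of j] by (simp_all add: vS_def)
qed

lemma fS_closed: "fS \<in> carrier SS" and vS_closed: "vS \<in> carrier SS"
  using one_part1 p_part by (simp_all add: fS_def vS_def)

text \<open>
  The image of \<open>D(A/p)\<close> lies in the commutative subring \<open>scal\<close> of families of multiplication
  operators; the universal property of polynomial rings needs a commutative target.
\<close>

definition scal :: "(int \<Rightarrow> 'a \<Rightarrow> 'a) set set" where
  "scal = q ` {F \<in> carrier B1. \<forall>i. F i \<in> \<mu> ` carrier A}"

lemma mu_image_finsum: "f \<in> X \<rightarrow> \<mu> ` carrier A \<Longrightarrow> finsum E f X \<in> \<mu> ` carrier A"
proof (induction X rule: infinite_finite_induct)
  case (insert x X)
  then obtain a b where "a \<in> carrier A" "f x = \<mu> a" "b \<in> carrier A" "finsum E f X = \<mu> b" by blast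
  moreover have "\<mu> ` carrier A \<subseteq> carrier E" by auto
  then have "f \<in> X \<rightarrow> carrier E" "f x \<in> carrier E" using insert.prems by blast+
  ultimately have "finsum E f (insert x X) = \<mu> (a \<oplus> b)" using insert.hyps by (simp add: mu_add)
  then show ?case using \<open>a \<in> carrier A\<close> \<open>b \<in> carrier A\<close> by blast
qed (use mu_zero in \<open>auto simp: E.finsum_infinite intro: rev_image_eqI[OF zero_closed]\<close>)

lemma scal_subring: "subring scal SS"
proof -
  let ?C = "{F \<in> carrier B1. \<forall>i. F i \<in> \<mu> ` carrier A}"
  interpret qh: ring_hom_ring B1 SS q
    by (rule ring_hom_ringI2[OF B.S.ring_axioms SS.ring_axioms q_hom])
  have "subring ?C B1"
  proof (rule B.S.subringI)
    have "\<one>\<^bsub>E\<^esub> \<in> \<mu> ` carrier A" "\<zero>\<^bsub>E\<^esub> \<in> \<mu> ` carrier A"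
      using mu_one mu_zero by (metis image_eqI one_closed zero_closed)+
    then show "\<one>\<^bsub>B1\<^esub> \<in> ?C" by (auto simp: B.rees_one)
  next
    fix F assume F: "F \<in> ?C"
    show "\<ominus>\<^bsub>B1\<^esub> F \<in> ?C"
    proof (intro CollectI conjI allI)
      fix i
      obtain a where "a \<in> carrier A" "F i = \<mu> a" using F by blast
      then have "(\<ominus>\<^bsub>B1\<^esub> F) i = \<mu> (\<ominus> a)" using F by (simp add: B.rees_neg mu_neg)
      then show "(\<ominus>\<^bsub>B1\<^esub> F) i \<in> \<mu> ` carrier A" using \<open>a \<in> carrier A\<close> by blast
    qed (use F in simp)
  next
    fix F G assume FG: "F \<in> ?C" "G \<in> ?C"
    have comp: "\<exists>a b. a \<in> carrier A \<and> b \<in> carrier A \<and> F i = \<mu> a \<and> G j = \<mu> b" for i j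
      using FG by blast
    show "F \<oplus>\<^bsub>B1\<^esub> G \<in> ?C"
    proof (intro CollectI conjI allI)
      fix i
      obtain a b where "a \<in> carrier A" "b \<in> carrier A" "F i = \<mu> a" "G i = \<mu> b" using comp by blast
      then have "(F \<oplus>\<^bsub>B1\<^esub> G) i = \<mu> (a \<oplus> b)" by (simp add: B.rees_add mu_add)
      then show "(F \<oplus>\<^bsub>B1\<^esub> G) i \<in> \<mu> ` carrier A" using \<open>a \<in> carrier A\<close> \<open>b \<in> carrier A\<close> by blast
    qed (use FG in simp)
    show "F \<otimes>\<^bsub>B1\<^esub> G \<in> ?C"
    proof (intro CollectI conjI allI)
      fix k
      have F: "F \<in> carrier B1" "G \<in> carrier B1" using FG by auto
      have fin: "finite {i. F i \<noteq> \<zero>\<^bsub>D\<^esub>}" using F(1) B.rees_mem by blast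
      have im: "F i \<otimes>\<^bsub>E\<^esub> G (k - i) \<in> \<mu> ` carrier A" for i
      proof -
        obtain a b where "a \<in> carrier A" "b \<in> carrier A" "F i = \<mu> a" "G (k - i) = \<mu> b" using comp by blast
        then have "F i \<otimes>\<^bsub>E\<^esub> G (k - i) = \<mu> (a \<otimes> b)" by (simp add: mu_mult)
        then show ?thesis using \<open>a \<in> carrier A\<close> \<open>b \<in> carrier A\<close> by blast
      qed
      let ?f = "\<lambda>i. F i \<otimes>\<^bsub>E\<^esub> G (k - i)" and ?X = "{i. F i \<noteq> \<zero>\<^bsub>D\<^esub>}"
      have "\<mu> ` carrier A \<subseteq> carrier D" by auto
      then have imD: "?f \<in> ?X \<rightarrow> carrier D" using im by blast
      have "(F \<otimes>\<^bsub>B1\<^esub> G) k = finsum D ?f ?X"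
        using B.rees_mult[OF F fin subset_refl, of k] by simp
      also have "\<dots> = finsum E ?f ?X" by (rule D_finsum[OF imD])
      also have "\<dots> \<in> \<mu> ` carrier A" by (rule mu_image_finsum) (use im in blast)
      finally show "(F \<otimes>\<^bsub>B1\<^esub> G) k \<in> \<mu> ` carrier A" .
    qed (use FG in simp)
  qed auto
  then show ?thesis unfolding scal_def by (rule qh.img_is_subring)
qed

lemma scal_decompose:
  assumes "X \<in> scal"
  shows "\<exists>T a. finite T \<and> (\<forall>i\<in>T. a i \<in> carrier A \<and> \<mu> (a i) \<in> Dp i) \<and> X = (\<Oplus>\<^bsub>SS\<^esub>i\<in>T. cls i (\<mu> (a i)))"
proof -
  obtain F where F: "F \<in> carrier B1" "X = q F" "\<And>i. F i \<in> \<mu> ` carrier A" using assms by (auto simp: scal_def)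
  then have "\<forall>i. \<exists>a. a \<in> carrier A \<and> F i = \<mu> a" by blast
  then obtain a where a: "\<And>i. a i \<in> carrier A" "\<And>i. F i = \<mu> (a i)" by metis
  let ?T = "{i. F i \<noteq> \<zero>\<^bsub>D\<^esub>}"
  interpret qh: ring_hom_ring B1 SS q
    by (rule ring_hom_ringI2[OF B.S.ring_axioms SS.ring_axioms q_hom])
  have sgF: "(\<lambda>i. B.sg i (F i)) \<in> ?T \<rightarrow> carrier B1" using B1_part[OF F(1)] by simp
  have "X = q (\<Oplus>\<^bsub>B1\<^esub>i\<in>?T. B.sg i (F i))" unfolding F(2) using B.rees_decompose[OF F(1)] by (rule arg_cong)
  also have "\<dots> = (\<Oplus>\<^bsub>SS\<^esub>i\<in>?T. cls i (\<mu> (a i)))"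
    using qh.hom_finsum[OF sgF] by (simp add: comp_def cls_q a(2))
  finally have "X = (\<Oplus>\<^bsub>SS\<^esub>i\<in>?T. cls i (\<mu> (a i)))" .
  moreover have "finite ?T" using F(1) B.rees_mem by blast
  moreover have "\<mu> (a i) \<in> Dp i" for i using B1_part[OF F(1), of i] a(2) by simp
  ultimately show ?thesis using a(1) by blast
qed

text \<open>Homogeneous elements of \<open>scal\<close> are multiplications equipped with a degree;
  multiplications commute and degrees add. Finite sums inherit this.\<close>

lemma scal_comm: "X \<in> scal \<Longrightarrow> Z \<in> scal \<Longrightarrow> X \<otimes>\<^bsub>SS\<^esub> Z = Z \<otimes>\<^bsub>SS\<^esub> X"
proof -
  assume X: "X \<in> scal" and Z: "Z \<in> scal"
  obtain T a where T: "finite T" "\<And>i. i \<in> T \<Longrightarrow> a i \<in> carrier A \<and> \<mu> (a i) \<in> Dp i" "X = (\<Oplus>\<^bsub>SS\<^esub>i\<in>T. cls i (\<mu> (a i)))"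
    using scal_decompose[OF X] by blast
  obtain T' b where T': "finite T'" "\<And>i. i \<in> T' \<Longrightarrow> b i \<in> carrier A \<and> \<mu> (b i) \<in> Dp i" "Z = (\<Oplus>\<^bsub>SS\<^esub>i\<in>T'. cls i (\<mu> (b i)))"
    using scal_decompose[OF Z] by blast
  have YS: "Z \<in> carrier SS" using Z subringE(1)[OF scal_subring] by blast
  have "cls i (\<mu> (a i)) \<otimes>\<^bsub>SS\<^esub> Z = Z \<otimes>\<^bsub>SS\<^esub> cls i (\<mu> (a i))" if i: "i \<in> T" for i
  proof (rule sym, unfold T'(3), rule SS.finsum_commute)
    fix j assume "j \<in> T'"
    then show "cls j (\<mu> (b j)) \<otimes>\<^bsub>SS\<^esub> cls i (\<mu> (a i)) = cls i (\<mu> (a i)) \<otimes>\<^bsub>SS\<^esub> cls j (\<mu> (b j))"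
      using T(2)[OF i] T'(2) by (simp add: cls_mult mu_comm add.commute)
  qed (use T(2)[OF i] T' in auto)
  then show ?thesis unfolding T(3) using T YS by (intro SS.finsum_commute) auto
qed

abbreviation SC where "SC \<equiv> SS\<lparr>carrier := scal\<rparr>"

lemma SC_cring: "cring SC"
proof -
  have "subcring scal SS" using scal_subring scal_comm by (rule SS.subcringI)
  then show ?thesis using SS.subcring_iff subringE(1)[OF scal_subring] by blast
qed

lemma cls_scal: "a \<in> carrier A \<Longrightarrow> \<mu> a \<in> Dp i \<Longrightarrow> cls i (\<mu> a) \<in> scal"
proof -
  assume a: "a \<in> carrier A" "\<mu> a \<in> Dp i"
  have "\<zero>\<^bsub>E\<^esub> \<in> \<mu> ` carrier A" using mu_zero by (metis image_eqI zero_closed)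
  then have "B.sg i (\<mu> a) \<in> {F \<in> carrier B1. \<forall>i. F i \<in> \<mu> ` carrier A}"
    using a by (auto simp: B.sg_def intro: B.sg_closed[OF a(2), unfolded B.sg_def])
  then show ?thesis unfolding scal_def cls_q by blast
qed

lemma fS_scal: "fS \<in> scal" and vS_scal: "vS \<in> scal"
  using cls_scal[of \<one> 1] cls_scal[of "[p] \<cdot> \<one>" "-1"] one_part1 p_part
  by (simp_all add: fS_def vS_def mu_one mu_add_pow)

lemma h_scal: "r \<in> carrier Rb \<Longrightarrow> h r \<in> scal"
  by (auto simp: carrier_reduction h_red intro!: cls_scal mu_part0)

definition ev1 where "ev1 = eval Rb SS h fS"
definition ev where "ev = eval (UP Rb) SS ev1 vS"

text \<open>The universal property of \<open>UP\<close> is applied twice, for f and for v, with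
  target \<open>SC\<close>; \<open>eval_subring_eq\<close> identifies the results with evaluations
  in \<open>SS\<close>.\<close>

lemma ev_hom: "ev1 \<in> ring_hom (UP Rb) SC" "ev \<in> ring_hom (UP (UP Rb)) SC"
proof -
  have h: "h \<in> ring_hom Rb SC"
    using h_hom h_scal unfolding ring_hom_def by auto
  interpret e1: UP_pre_univ_prop Rb SC h "UP Rb"
    by (rule UP_pre_univ_propI[OF Rb.is_cring SC_cring h]) 
  have eq1: "eval Rb SC h fS = ev1"
    unfolding ev1_def by (rule eval_subring_eq[OF SS.ring_axioms scal_subring h_scal fS_scal Rb.ring_axioms])
  show ev1: "ev1 \<in> ring_hom (UP Rb) SC"
    using e1.eval_ring_hom[of fS] fS_scal unfolding eq1 by simp
  interpret e2: UP_pre_univ_prop "UP Rb" SC ev1 "UP (UP Rb)"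
    by (rule UP_pre_univ_propI[OF fv.U.UP_cring SC_cring ev1]) 
  have "ev1 r \<in> scal" if "r \<in> carrier (UP Rb)" for r
    using ring_hom_closed[OF ev1 that] by simp
  then have eq2: "eval (UP Rb) SC ev1 vS = ev"
    unfolding ev_def by (intro eval_subring_eq[OF SS.ring_axioms scal_subring _ vS_scal fv.U.UP_ring])
  show "ev \<in> ring_hom (UP (UP Rb)) SC"
    using e2.eval_ring_hom[of vS] vS_scal unfolding eq2 by simp
qed

lemma ev_scal: "Pl \<in> carrier (UP (UP Rb)) \<Longrightarrow> ev Pl \<in> scal"
  using ring_hom_closed[OF ev_hom(2)] by simp

lemma scal_SS: "X \<in> scal \<Longrightarrow> X \<in> carrier SS"
  using subringE(1)[OF scal_subring] by blast

lemma ev_hom_SS: "ev \<in> ring_hom (UP (UP Rb)) SS"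
  using ev_hom(2) scal_SS unfolding ring_hom_def by auto

abbreviation cf where "cf Pl j i \<equiv> coeff (UP Rb) (coeff (UP (UP Rb)) Pl j) i"

definition trm :: "'a set \<Rightarrow> nat \<Rightarrow> nat \<Rightarrow> (int \<Rightarrow> 'a \<Rightarrow> 'a) set" where
  "trm r i j = h r \<otimes>\<^bsub>SS\<^esub> fS [^]\<^bsub>SS\<^esub> i \<otimes>\<^bsub>SS\<^esub> vS [^]\<^bsub>SS\<^esub> j"

lemma trm_eq:
  assumes a: "a \<in> carrier A"
  shows "trm (red a) i j = cls (int i - int j) (\<mu> ([(p ^ j)] \<cdot> a))" "\<mu> ([(p ^ j)] \<cdot> a) \<in> Dp (int i - int j)"
proof -
  have 1: "\<mu> a \<in> Dp (int i)" using part_mult[OF mu_part0[OF a] fS_pow(2)[of i]] a by simp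
  have 2: "\<mu> a \<otimes>\<^bsub>E\<^esub> [(p ^ j)] \<cdot>\<^bsub>E\<^esub> \<one>\<^bsub>E\<^esub> = \<mu> ([(p ^ j)] \<cdot> a)"
    using a by (simp add: E.add_pow_rdistr mu_add_pow)
  show "trm (red a) i j = cls (int i - int j) (\<mu> ([(p ^ j)] \<cdot> a))"
    unfolding trm_def h_red[OF a] fS_pow(1) vS_pow(1)
    using cls_mult[OF mu_part0[OF a] fS_pow(2)[of i]] cls_mult[OF 1 vS_pow(2)[of j]] a 2 by simp
  show "\<mu> ([(p ^ j)] \<cdot> a) \<in> Dp (int i - int j)"
    using part_mult[OF 1 vS_pow(2)[of j]] 2 by simp
qed

lemma trm_closed: "r \<in> carrier Rb \<Longrightarrow> trm r i j \<in> carrier SS"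
  by (auto simp: carrier_reduction trm_eq)

lemma ev_eq:
  assumes Pl: "Pl \<in> carrier (UP (UP Rb))"
  shows "ev Pl = (\<Oplus>\<^bsub>SS\<^esub>j\<in>{..deg (UP Rb) Pl}. \<Oplus>\<^bsub>SS\<^esub>i\<in>{..deg Rb (coeff (UP (UP Rb)) Pl j)}. trm (cf Pl j i) i j)"
proof -
  have cP: "coeff (UP (UP Rb)) Pl j \<in> carrier (UP Rb)" for j using Pl by (rule fv.V.coeff_closed)
  have c: "cf Pl j i \<in> carrier Rb" for j i using cP by (rule fv.U.coeff_closed)
  have hc: "h r \<in> carrier SS" if "r \<in> carrier Rb" for r using h_scal[OF that] scal_SS by blast
  have "ev Pl = (\<Oplus>\<^bsub>SS\<^esub>j\<in>{..deg (UP Rb) Pl}. ev1 (coeff (UP (UP Rb)) Pl j) \<otimes>\<^bsub>SS\<^esub> vS [^]\<^bsub>SS\<^esub> j)"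
    using Pl by (simp add: ev_def eval_def)
  also have "\<dots> = (\<Oplus>\<^bsub>SS\<^esub>j\<in>{..deg (UP Rb) Pl}. \<Oplus>\<^bsub>SS\<^esub>i\<in>{..deg Rb (coeff (UP (UP Rb)) Pl j)}. trm (cf Pl j i) i j)"
  proof (rule SS.finsum_cong')
    fix j
    have "ev1 (coeff (UP (UP Rb)) Pl j) =
      (\<Oplus>\<^bsub>SS\<^esub>i\<in>{..deg Rb (coeff (UP (UP Rb)) Pl j)}. h (cf Pl j i) \<otimes>\<^bsub>SS\<^esub> fS [^]\<^bsub>SS\<^esub> i)"
      using cP[of j] by (simp add: ev1_def eval_def)
    then show "ev1 (coeff (UP (UP Rb)) Pl j) \<otimes>\<^bsub>SS\<^esub> vS [^]\<^bsub>SS\<^esub> j =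
      (\<Oplus>\<^bsub>SS\<^esub>i\<in>{..deg Rb (coeff (UP (UP Rb)) Pl j)}. trm (cf Pl j i) i j)"
      unfolding trm_def using c hc fS_closed vS_closed by (simp add: SS.finsum_ldistr)
  qed (use trm_closed c in \<open>auto intro!: SS.finsum_closed\<close>)
  finally show ?thesis .
qed

text \<open>In degree \<open>?d\<close> the basis element with index \<open>K\<close> carries
  p^max(0, j - i), while \<open>trm\<close> brings \<open>p ^ j\<close>. The surplus p^min(i, j)
  survives modulo \<open>p\<close> only if one of the exponents is 0; this is fv = 0 seen on
  operators.\<close>

lemma lam_trm:
  assumes r: "r \<in> carrier Rb" and K: "K \<in> M"
  shows "lam (trm r i j \<otimes>\<^bsub>SS\<^esub> cls (int (wt K)) (eb K)) (L, m) =
    (if L = K \<and> m = int (wt K) + int i - int j \<and> (i = 0 \<or> j = 0) then r else \<zero>\<^bsub>Rb\<^esub>)"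
proof -
  obtain a where a: "a \<in> carrier A" "r = red a" using r by (auto simp: carrier_reduction)
  let ?d = "int (wt K) + int i - int j"
  let ?b = "[(p ^ min i j)] \<cdot> a"
  have hi: "j = hi ?d K + min i j" by (auto simp: hi_def min_def)
  have pj: "[(p ^ j)] \<cdot> a = [(p ^ hi ?d K)] \<cdot> ?b"
    unfolding add_pow_mult[OF a(1)] power_add[symmetric] hi[symmetric] ..
  have "trm r i j \<otimes>\<^bsub>SS\<^esub> cls (int (wt K)) (eb K) = cls ?d (\<mu> ([(p ^ hi ?d K)] \<cdot> ?b) \<otimes>\<^bsub>E\<^esub> eb K)"
    unfolding a(2) trm_eq(1)[OF a(1)] pj[symmetric] cls_mult[OF trm_eq(2)[OF a(1), of j i] eb_part[OF K]]
    by (simp add: algebra_simps)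
  also have "lam \<dots> (L, m) = (if (L, m) = (K, ?d) then red ?b else \<zero>\<^bsub>Rb\<^esub>)"
    by (rule lam_cls[OF K]) (use a in simp)
  also have "red ?b = (if i = 0 \<or> j = 0 then r else \<zero>\<^bsub>Rb\<^esub>)"
  proof (cases "i = 0 \<or> j = 0")
    case True
    then have "min i j = 0" by auto
    then show ?thesis using True a by simp
  next
    case False
    have "cg (min i j) ?b \<zero>" by (rule cg_zero_add_pow[OF a(1)])
    then have "cg 1 ?b \<zero>" by (rule cg_mono) (use False in auto)
    then have "red ?b = red \<zero>" using red_eq_iff[of ?b \<zero>] a(1) by simp
    then show ?thesis using False by (simp add: red_zero)
  qed
  finally show ?thesis by auto
qed

text \<open>By \<open>lam_trm\<close> mixed monomials vanish, and each degree receives one pure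
  monomial. Multiplying a basis element by \<open>ev Pl\<close> therefore exhibits the pure
  coefficients of \<open>Pl\<close>, shifted by \<open>wt K\<close>.\<close>

lemma lam_ev:
  assumes Pl: "Pl \<in> carrier (UP (UP Rb))" and K: "K \<in> M"
  shows "lam (ev Pl \<otimes>\<^bsub>SS\<^esub> cls (int (wt K)) (eb K)) (L, m) =
    (if L = K then fv.pc Pl (m - int (wt K)) else \<zero>\<^bsub>Rb\<^esub>)"
proof -
  let ?b = "cls (int (wt K)) (eb K)" and ?d = "m - int (wt K)"
  let ?J = "{..deg (UP Rb) Pl}" and ?I = "\<lambda>j. {..deg Rb (coeff (UP (UP Rb)) Pl j)}"
  have b: "?b \<in> carrier SS" using eb_part[OF K] by simp
  have cP: "coeff (UP (UP Rb)) Pl j \<in> carrier (UP Rb)" for j using Pl by (rule fv.V.coeff_closed)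
  have c: "cf Pl j i \<in> carrier Rb" for j i using cP by (rule fv.U.coeff_closed)
  have t: "trm (cf Pl j i) i j \<in> carrier SS" for i j by (rule trm_closed[OF c])
  have "lam (ev Pl \<otimes>\<^bsub>SS\<^esub> ?b) (L, m) = lam (\<Oplus>\<^bsub>SS\<^esub>j\<in>?J. \<Oplus>\<^bsub>SS\<^esub>i\<in>?I j. trm (cf Pl j i) i j \<otimes>\<^bsub>SS\<^esub> ?b) (L, m)"
    unfolding ev_eq[OF Pl] using b t by (simp add: SS.finsum_ldistr)
  also have "\<dots> = (\<Oplus>\<^bsub>Rb\<^esub>j\<in>?J. \<Oplus>\<^bsub>Rb\<^esub>i\<in>?I j. lam (trm (cf Pl j i) i j \<otimes>\<^bsub>SS\<^esub> ?b) (L, m))"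
    using b t by (subst lam_finsum) (auto simp: lam_finsum intro!: Rb.finsum_cong' Rb.finsum_closed SS.finsum_closed lam_closed)
  also have "\<dots> = (\<Oplus>\<^bsub>Rb\<^esub>j\<in>?J. \<Oplus>\<^bsub>Rb\<^esub>i\<in>?I j. if L = K \<and> j = nat (- ?d) \<and> i = nat ?d then cf Pl j i else \<zero>\<^bsub>Rb\<^esub>)"
  proof (intro Rb.finsum_cong' refl)
    fix j i
    \<comment> \<open>Among the pairs with difference \<open>?d\<close>, the one with a zero entry
      consists of the positive and the negative part of \<open>?d\<close>.\<close>
    have "(L = K \<and> m = int (wt K) + int i - int j \<and> (i = 0 \<or> j = 0)) \<longleftrightarrow> (L = K \<and> j = nat (- ?d) \<and> i = nat ?d)"
      by auto
    then show "lam (trm (cf Pl j i) i j \<otimes>\<^bsub>SS\<^esub> ?b) (L, m) =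
        (if L = K \<and> j = nat (- ?d) \<and> i = nat ?d then cf Pl j i else \<zero>\<^bsub>Rb\<^esub>)"
      unfolding lam_trm[OF c K] by simp
  qed (use c in \<open>auto intro!: Rb.finsum_closed\<close>)
  also have "\<dots> = (\<Oplus>\<^bsub>Rb\<^esub>j\<in>?J. if L = K \<and> j = nat (- ?d) then cf Pl j (nat ?d) else \<zero>\<^bsub>Rb\<^esub>)"
  proof (rule Rb.finsum_cong')
    fix j
    show "(\<Oplus>\<^bsub>Rb\<^esub>i\<in>?I j. if L = K \<and> j = nat (- ?d) \<and> i = nat ?d then cf Pl j i else \<zero>\<^bsub>Rb\<^esub>) =
       (if L = K \<and> j = nat (- ?d) then cf Pl j (nat ?d) else \<zero>\<^bsub>Rb\<^esub>)"
    proof (cases "L = K \<and> j = nat (- ?d) \<and> nat ?d \<in> ?I j")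
      case True
      then show ?thesis using c by (subst Rb.finsum_single[of _ "nat ?d"]) auto
    next
      case False
      then have "L = K \<and> j = nat (- ?d) \<Longrightarrow> cf Pl j (nat ?d) = \<zero>\<^bsub>Rb\<^esub>"
        using fv.U.deg_aboveD[OF _ cP[of j], of "nat ?d"] by auto
      then show ?thesis using False by (subst Rb.finsum_neutral) auto
    qed
  qed (use c in auto)
  also have "\<dots> = (if L = K then fv.pc Pl ?d else \<zero>\<^bsub>Rb\<^esub>)"
  proof (cases "L = K \<and> nat (- ?d) \<in> ?J")
    case True
    then show ?thesis using c by (subst Rb.finsum_single[of _ "nat (- ?d)"]) (auto simp: fv.pc_def)
  next
    case False
    then have "L = K \<Longrightarrow> fv.pc Pl ?d = \<zero>\<^bsub>Rb\<^esub>"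
      using fv.V.deg_aboveD[OF _ Pl, of "nat (- ?d)"] by (auto simp: fv.pc_def)
    then show ?thesis using False by (subst Rb.finsum_neutral) auto
  qed
  finally show ?thesis .
qed

section \<open>The graded module over D(A/p) and its freeness\<close>

abbreviation DRb where "DRb \<equiv> D_ring p Rb"
abbreviation str where "str \<equiv> D01_structure_map p W \<iota> A"

text \<open>Applied to \<open>K0\<close>, whose \<open>eb\<close> is the identity,
  \<open>lam_ev\<close> computes all coordinates of \<open>ev Z\<close> from the pure coefficients
  of \<open>Z\<close>. These agree on a class, so \<open>the_elem\<close> is applied to a
  singleton.\<close>

lemma str_cl:
  assumes Pl: "Pl \<in> carrier (UP (UP Rb))"
  shows "str (fv.cl Pl) = ev Pl"
proof -
  have "str (fv.cl Pl) = the_elem (ev ` fv.cl Pl)"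
    unfolding D01_structure_map_def Let_def ev_def ev1_def fS_def vS_def ..
  also have "\<dots> = ev Pl"
  proof (rule the_elem_image_unique)
    interpret I: ideal "fv_ideal p Rb" "UP (UP Rb)" by (rule fv.I_ideal)
    show "fv.cl Pl \<noteq> {}" using I.a_rcos_self[OF Pl] by blast
    fix Z assume Z: "Z \<in> fv.cl Pl"
    have ZV: "Z \<in> carrier (UP (UP Rb))"
      using Z fv.V.P.a_r_coset_subset_G[OF I.a_subset Pl] by blast
    have "fv.cl Z = fv.cl Pl" using I.a_repr_independence'[OF Z Pl] by simp
    then have pc: "fv.pc Z d = fv.pc Pl d" for d using fv.cl_eq_iff[OF ZV Pl] by blast
    have one: "cls (int (wt K0)) (eb K0) = \<one>\<^bsub>SS\<^esub>" using K0 cls_one by simp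
    show "ev Z = ev Pl"
    proof (rule lam_inj)
      show "ev Z \<in> carrier SS" "ev Pl \<in> carrier SS" using ev_scal scal_SS ZV Pl by blast+
      fix t :: "idx \<times> int"
      obtain L m where t: "t = (L, m)" by (cases t)
      show "lam (ev Z) t = lam (ev Pl) t"
        using lam_ev[OF ZV K0(1), of L m] lam_ev[OF Pl K0(1), of L m] \<open>ev Z \<in> carrier SS\<close> \<open>ev Pl \<in> carrier SS\<close>
        by (simp add: one pc t)
    qed
  qed
  finally show ?thesis .
qed

lemma str_hom: "str \<in> ring_hom DRb SS"
proof (rule ring_hom_memI)
  fix X Z assume "X \<in> carrier DRb" "Z \<in> carrier DRb"
  then obtain Pl Q where PQ: "Pl \<in> carrier (UP (UP Rb))" "X = fv.cl Pl" "Q \<in> carrier (UP (UP Rb))" "Z = fv.cl Q"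
    by (auto simp: fv.carrier_DR)
  show "str X \<in> carrier SS" using PQ by (simp add: str_cl ring_hom_closed[OF ev_hom_SS])
  show "str (X \<otimes>\<^bsub>DRb\<^esub> Z) = str X \<otimes>\<^bsub>SS\<^esub> str Z" "str (X \<oplus>\<^bsub>DRb\<^esub> Z) = str X \<oplus>\<^bsub>SS\<^esub> str Z"
    using PQ by (simp_all add: ring_hom_mult[OF fv.cl_hom, symmetric] ring_hom_add[OF fv.cl_hom, symmetric]
      str_cl ring_hom_mult[OF ev_hom_SS] ring_hom_add[OF ev_hom_SS] del: fv.V.coeff_mult)
next
  show "str \<one>\<^bsub>DRb\<^esub> = \<one>\<^bsub>SS\<^esub>"
    by (simp add: ring_hom_one[OF fv.cl_hom, symmetric] str_cl ring_hom_one[OF ev_hom_SS])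
qed

lemma NN_module: "module DRb NN"
  by (rule moduleI)
    (auto simp: fv.DR_cring NN.abelian_group_axioms ring_hom_closed[OF str_hom] ring_hom_add[OF str_hom]
      ring_hom_mult[OF str_hom] ring_hom_one[OF str_hom] SS.l_distr SS.r_distr SS.m_assoc)

lemma SP_lam: "X \<in> SP i \<Longrightarrow> snd t \<noteq> i \<Longrightarrow> lam X t = \<zero>\<^bsub>Rb\<^esub>"
  unfolding SP_eq by blast

lemma SP_finsum: "f \<in> F \<rightarrow> SP i \<Longrightarrow> finsum SS f F \<in> SP i"
proof -
  assume f: "f \<in> F \<rightarrow> SP i"
  then have fS: "f \<in> F \<rightarrow> carrier SS" by (auto simp: SP_eq)
  have "lam (finsum SS f F) t = \<zero>\<^bsub>Rb\<^esub>" if "snd t \<noteq> i" for t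
    unfolding lam_finsum[OF fS] using f that SP_lam by (intro Rb.finsum_neutral) blast
  then show ?thesis using fS by (auto simp: SP_eq)
qed

lemma SP_mult: "X \<in> SP i \<Longrightarrow> Z \<in> SP j \<Longrightarrow> X \<otimes>\<^bsub>SS\<^esub> Z \<in> SP (i + j)"
  by (auto simp: D01_mod_part_def cls_mult part_mult)

lemma ev_homog:
  assumes "Pl \<in> fv.homog d"
  shows "ev Pl \<in> SP d"
proof -
  have Pl: "Pl \<in> carrier (UP (UP Rb))" using assms by (simp add: fv.homog_def)
  have c: "cf Pl j i \<in> carrier Rb" for j i by (rule fv.U.coeff_closed[OF fv.V.coeff_closed[OF Pl]])
  have "trm (cf Pl j i) i j \<in> SP d" for i j
  proof (cases "cf Pl j i = \<zero>\<^bsub>Rb\<^esub>")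
    \<comment> \<open>A zero coefficient may stand at any position, so homogeneity does not fix its
      degree; its term is zero and lies in every piece.\<close>
    case True
    have "trm \<zero>\<^bsub>Rb\<^esub> i j = cls d \<zero>\<^bsub>E\<^esub>"
      unfolding red_zero[symmetric] trm_eq(1)[OF zero_closed] by (simp add: mu_zero cls_zero)
    moreover have "\<zero>\<^bsub>E\<^esub> \<in> Dp d" using B.H_zero[of d] by simp
    ultimately show ?thesis unfolding True by (auto simp: D01_mod_part_def)
  next
    case False
    then have d: "int i - int j = d" using assms unfolding fv.homog_def by blast
    obtain a where a: "a \<in> carrier A" "cf Pl j i = red a" using c[of j i] unfolding carrier_reduction by blast
    show ?thesis
      unfolding a(2) trm_eq(1)[OF a(1)] d D01_mod_part_def using trm_eq(2)[OF a(1), of j i] unfolding d by blast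
  qed
  then show ?thesis unfolding ev_eq[OF Pl] by (intro SP_finsum Pi_I)
qed

lemma NN_graded: "graded_module DRb (D_ring_part p Rb) NN SP"
  unfolding graded_module_def
proof (intro conjI allI ballI fv.DR_graded NN_module NN_grading)
  fix i j X Z assume "X \<in> D_ring_part p Rb i" "Z \<in> SP j"
  then obtain Pl where Pl: "Pl \<in> fv.homog i" "X = fv.cl Pl" by (auto simp: fv.DR_part)
  then have "Pl \<in> carrier (UP (UP Rb))" by (simp add: fv.homog_def)
  then show "X \<odot>\<^bsub>NN\<^esub> Z \<in> SP (i + j)"
    using SP_mult[OF ev_homog[OF Pl(1)] \<open>Z \<in> SP j\<close>] Pl(2) by (simp add: str_cl)
qed

lemma lam_smult:
  assumes "X \<in> carrier DRb" "K \<in> M"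
  shows "lam (X \<odot>\<^bsub>NN\<^esub> cls (int (wt K)) (eb K)) (L, m) =
    (if L = K then fv.kap X (m - int (wt K)) else \<zero>\<^bsub>Rb\<^esub>)"
proof -
  obtain Pl where "Pl \<in> carrier (UP (UP Rb))" "X = fv.cl Pl" using assms(1) by (auto simp: fv.carrier_DR)
  then show ?thesis using assms(2) by (simp add: str_cl lam_ev fv.kap_cl)
qed

text \<open>Coordinate \<open>(K, m)\<close> of a combination depends on the coefficient of
  \<open>b K\<close> alone and is its component of degree \<open>m - int (wt K)\<close>. So the
  coordinates determine the coefficients, and \<open>kap_surj\<close> provides coefficients with the
  required components.\<close>

lemma NN_free:
  assumes b: "\<And>K. K \<in> M \<Longrightarrow> b K = cls (int (wt K)) (eb K)"
  shows "free_basis DRb NN M b"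
proof -
  have bN: "b K \<in> carrier SS" if "K \<in> M" for K using b eb_part that by simp
  have smult_closed: "X \<odot>\<^bsub>NN\<^esub> b K \<in> carrier SS" if "X \<in> carrier DRb" "K \<in> M" for X K
    using that bN ring_hom_closed[OF str_hom] by simp
  have lam_sum: "lam (\<Oplus>\<^bsub>NN\<^esub>K\<in>{K\<in>M. c K \<noteq> \<zero>\<^bsub>DRb\<^esub>}. c K \<odot>\<^bsub>NN\<^esub> b K) (L, m) =
      (if L \<in> M then fv.kap (c L) (m - int (wt L)) else \<zero>\<^bsub>Rb\<^esub>)"
    if c: "c \<in> M \<rightarrow>\<^sub>E carrier DRb" "finite {K\<in>M. c K \<noteq> \<zero>\<^bsub>DRb\<^esub>}" for c L m
  proof -
    let ?F = "{K\<in>M. c K \<noteq> \<zero>\<^bsub>DRb\<^esub>}"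
    have cD: "c K \<in> carrier DRb" if "K \<in> M" for K using c(1) that by auto
    have "lam (\<Oplus>\<^bsub>NN\<^esub>K\<in>?F. c K \<odot>\<^bsub>NN\<^esub> b K) (L, m) = (\<Oplus>\<^bsub>Rb\<^esub>K\<in>?F. lam (c K \<odot>\<^bsub>NN\<^esub> b K) (L, m))"
      unfolding NN_finsum by (rule lam_finsum) (use smult_closed cD in blast)
    also have "\<dots> = (\<Oplus>\<^bsub>Rb\<^esub>K\<in>?F. if L = K then fv.kap (c K) (m - int (wt K)) else \<zero>\<^bsub>Rb\<^esub>)"
      by (rule Rb.finsum_cong') (use cD lam_smult b fv.kap_closed in \<open>auto simp del: NN_simps\<close>)
    also have "\<dots> = (if L \<in> M then fv.kap (c L) (m - int (wt L)) else \<zero>\<^bsub>Rb\<^esub>)"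
    proof (cases "L \<in> ?F")
      case True
      then show ?thesis using c(2) cD fv.kap_closed by (subst Rb.finsum_single[of _ L]) auto
    next
      case False
      then have "L \<in> M \<Longrightarrow> fv.kap (c L) (m - int (wt L)) = \<zero>\<^bsub>Rb\<^esub>" by (simp add: fv.kap_zero)
      then show ?thesis using False by (subst Rb.finsum_neutral) auto
    qed
    finally show ?thesis .
  qed
  have sum_closed: "(\<Oplus>\<^bsub>NN\<^esub>K\<in>{K\<in>M. c K \<noteq> \<zero>\<^bsub>DRb\<^esub>}. c K \<odot>\<^bsub>NN\<^esub> b K) \<in> carrier SS"
    if "c \<in> M \<rightarrow>\<^sub>E carrier DRb" for c
    unfolding NN_finsum by (rule SS.finsum_closed) (use smult_closed that in blast)
  have "\<exists>!c. c \<in> M \<rightarrow>\<^sub>E carrier DRb \<and> finite {K\<in>M. c K \<noteq> \<zero>\<^bsub>DRb\<^esub>} \<and>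
      X = (\<Oplus>\<^bsub>NN\<^esub>K\<in>{K\<in>M. c K \<noteq> \<zero>\<^bsub>DRb\<^esub>}. c K \<odot>\<^bsub>NN\<^esub> b K)" if X: "X \<in> carrier SS" for X
  proof -
    \<comment> \<open>The component of degree \<open>d\<close> of a coefficient carries
      \<open>b K\<close>, of degree \<open>wt K\<close>, into degree
      \<open>d + int (wt K)\<close>.\<close>
    have "\<exists>Z\<in>carrier DRb. fv.kap Z = (\<lambda>d. lam X (K, d + int (wt K)))" for K
    proof (rule fv.kap_surj)
      have "{d. lam X (K, d + int (wt K)) \<noteq> \<zero>\<^bsub>Rb\<^esub>} \<subseteq> (\<lambda>t. snd t - int (wt K)) ` {t. lam X t \<noteq> \<zero>\<^bsub>Rb\<^esub>}"
      proof
        fix d assume "d \<in> {d. lam X (K, d + int (wt K)) \<noteq> \<zero>\<^bsub>Rb\<^esub>}"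
        then show "d \<in> (\<lambda>t. snd t - int (wt K)) ` {t. lam X t \<noteq> \<zero>\<^bsub>Rb\<^esub>}"
          by (intro rev_image_eqI[of "(K, d + int (wt K))"]) auto
      qed
      then show "finite {d. lam X (K, d + int (wt K)) \<noteq> \<zero>\<^bsub>Rb\<^esub>}"
        by (rule finite_subset) (intro finite_imageI lam_finite[OF X])
    qed (rule lam_closed[OF X])
    then obtain c' where c': "\<And>K. c' K \<in> carrier DRb" "\<And>K. fv.kap (c' K) = (\<lambda>d. lam X (K, d + int (wt K)))"
      by metis
    define c where "c = restrict c' M"
    have cE: "c \<in> M \<rightarrow>\<^sub>E carrier DRb" using c' by (auto simp: c_def)
    have "{K\<in>M. c K \<noteq> \<zero>\<^bsub>DRb\<^esub>} \<subseteq> fst ` {t. lam X t \<noteq> \<zero>\<^bsub>Rb\<^esub>}"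
    proof
      fix K assume K: "K \<in> {K\<in>M. c K \<noteq> \<zero>\<^bsub>DRb\<^esub>}"
      then have "K \<in> M" "c K \<noteq> \<zero>\<^bsub>DRb\<^esub>" by blast+
      then have "c' K \<noteq> \<zero>\<^bsub>DRb\<^esub>" by (simp add: c_def)
      then obtain d where "fv.kap (c' K) d \<noteq> \<zero>\<^bsub>Rb\<^esub>"
        using fv.kap_inj[OF c'(1)[of K] fv.DR.zero_closed] fv.kap_zero by metis
      then show "K \<in> fst ` {t. lam X t \<noteq> \<zero>\<^bsub>Rb\<^esub>}"
        unfolding c'(2) by (intro rev_image_eqI[of "(K, d + int (wt K))"]) auto
    qed
    then have fin: "finite {K\<in>M. c K \<noteq> \<zero>\<^bsub>DRb\<^esub>}"
      by (rule finite_subset) (intro finite_imageI lam_finite[OF X])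
    have "X = (\<Oplus>\<^bsub>NN\<^esub>K\<in>{K\<in>M. c K \<noteq> \<zero>\<^bsub>DRb\<^esub>}. c K \<odot>\<^bsub>NN\<^esub> b K)"
    proof (rule lam_inj[OF X sum_closed[OF cE]])
      fix t :: "idx \<times> int"
      obtain L m where t: "t = (L, m)" by (cases t)
      show "lam X t = lam (\<Oplus>\<^bsub>NN\<^esub>K\<in>{K\<in>M. c K \<noteq> \<zero>\<^bsub>DRb\<^esub>}. c K \<odot>\<^bsub>NN\<^esub> b K) t"
        unfolding t lam_sum[OF cE fin] using lam_outside[OF X] c'(2)[of L] by (simp add: c_def)
    qed
    note exists = conjI[OF cE conjI[OF fin this]]
    have unique: "e = c" if e: "e \<in> M \<rightarrow>\<^sub>E carrier DRb" "finite {K\<in>M. e K \<noteq> \<zero>\<^bsub>DRb\<^esub>}"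
      "X = (\<Oplus>\<^bsub>NN\<^esub>K\<in>{K\<in>M. e K \<noteq> \<zero>\<^bsub>DRb\<^esub>}. e K \<odot>\<^bsub>NN\<^esub> b K)" for e
    proof (rule PiE_ext[OF e(1) cE])
      fix K assume K: "K \<in> M"
      show "e K = c K"
      proof (rule fv.kap_inj)
        show "e K \<in> carrier DRb" "c K \<in> carrier DRb" using e(1) cE K by auto
        fix d
        have "fv.kap (e K) d = lam X (K, d + int (wt K))"
          unfolding e(3) lam_sum[OF e(1,2)] using K by simp
        then show "fv.kap (e K) d = fv.kap (c K) d" using K c'(2)[of K] by (simp add: c_def)
      qed
    qed
    show ?thesis by (rule ex1I[of _ c], rule exists) (use unique in blast)
  qed
  then show ?thesis unfolding free_basis_def NN_simps(1) using bN by blast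
qed

section \<open>The monomials of the theorem as classes of operators\<close>

lemma list_power_cls:
  assumes "\<And>j. j \<in> set js \<Longrightarrow> \<Phi> j \<in> Dp k" "distinct js"
  shows "SS.list_power (\<lambda>j. cls k (\<Phi> j)) I js = cls (k * int (\<Sum>j\<in>set js. I j)) (E.list_power \<Phi> I js) \<and>
    E.list_power \<Phi> I js \<in> Dp (k * int (\<Sum>j\<in>set js. I j))"
  using assms
proof (induction js)
  case (Cons j js)
  let ?e = "k * int (\<Sum>j\<in>set js. I j)"
  have IH: "SS.list_power (\<lambda>j. cls k (\<Phi> j)) I js = cls ?e (E.list_power \<Phi> I js)" "E.list_power \<Phi> I js \<in> Dp ?e"
    using Cons by auto
  have j: "\<Phi> j \<in> Dp k" using Cons.prems by simp
  have e: "int (I j) * k + ?e = k * int (\<Sum>j\<in>set (j # js). I j)"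
    using Cons.prems by (simp add: algebra_simps)
  show ?case
    using cls_mult[OF conjunct2[OF cls_pow[OF j]] IH(2), of "I j"] part_mult[OF conjunct2[OF cls_pow[OF j]] IH(2), of "I j"]
      cls_pow[OF j, of "I j"] IH(1) unfolding e by simp
qed (simp add: cls_one part_one)

lemma delta_part: "j < n \<Longrightarrow> \<delta> j \<in> Dp 0"
proof -
  assume j: "j < n"
  have "ord_lt (Suc (p ^ k)) (\<delta> j)" for k
    using ord_mono[OF _ _ ord_Der[OF delta_Der[OF j]], of "Suc (p ^ k)"] j p_gt_1 by (simp del: ord_lt.simps)
  then have "\<delta> j \<in> D_level p W \<iota> A k" for k using mem_D_level j by simp
  then have "\<delta> j \<in> P" "\<delta> j \<in> Q" using D_level_zero D_level_one by blast+
  moreover have "int 0 - int 0 = 0" by simp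
  note part_iff[OF this]
  ultimately show ?thesis by blast
qed

lemma dp_part: "j < n \<Longrightarrow> dp j \<in> Dp 1"
proof -
  assume j: "j < n"
  \<comment> \<open>\<open>dp j\<close> is itself a basis monomial of weight 1, with a single entry
    raised from the index of the identity.\<close>
  let ?K = "(fst K0, (snd K0)(j := Suc (snd K0 j)))"
  have "?K \<in> M" using j by (auto simp: M_def K0_def PiE_iff extensional_def)
  moreover have "dp j = eb ?K" using dp_eb[OF j, of K0] K0 j by simp
  moreover have "wt ?K = 1"
    using sum_upd[OF j, of "snd K0" "Suc (snd K0 j)"] K0(3) by (simp add: wt_def)
  ultimately show ?thesis using eb_part[of ?K] by simp
qed

text \<open>Degrees add along the products: a plain derivation contributes 0 and a divided power 1,
  which makes \<open>wt\<close> in total.\<close>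

lemma monomial_eq: "(I, J) \<in> M \<Longrightarrow> D01_monomial p W \<iota> A n \<delta> I J = cls (int (wt (I, J))) (eb (I, J))"
proof -
  have s: "set [0..<n] = {..<n}" by auto
  have 1: "SS.list_power (\<lambda>j. cls 0 (\<delta> j)) I [0..<n] = cls 0 (mpow \<delta> I)" "mpow \<delta> I \<in> Dp 0"
    using list_power_cls[of "[0..<n]" \<delta> 0 I] delta_part by auto
  have 2: "SS.list_power (\<lambda>j. cls 1 (dp j)) J [0..<n] = cls (int (wt (I, J))) (mpow dp J)" "mpow dp J \<in> Dp (int (wt (I, J)))"
    using list_power_cls[of "[0..<n]" dp 1 J] dp_part unfolding s by (auto simp: wt_def)
  show ?thesis
    unfolding D01_monomial_def Let_def multi_power_eq dp_def[symmetric] 1 2 cls_mult[OF 1(2) 2(2)]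
    by (simp add: eb_def)
qed

theorem monomials_free_graded_basis:
  "free_graded_module DRb (D_ring_part p Rb) NN SP M
    (\<lambda>(I, J). D01_monomial p W \<iota> A n \<delta> I J) (\<lambda>(I, J). int (\<Sum>j<n. J j))"
  unfolding free_graded_module_def
proof (intro conjI NN_graded NN_free ballI)
  fix K assume K: "K \<in> M"
  obtain I J where IJ: "K = (I, J)" by (cases K)
  show eq: "(case K of (I, J) \<Rightarrow> D01_monomial p W \<iota> A n \<delta> I J) = cls (int (wt K)) (eb K)"
    using monomial_eq K by (simp add: IJ)
  show "(case K of (I, J) \<Rightarrow> D01_monomial p W \<iota> A n \<delta> I J) \<in> SP (case K of (I, J) \<Rightarrow> int (\<Sum>j<n. J j))"
    unfolding eq using eb_part[OF K] by (auto simp: D01_mod_part_def IJ wt_def)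
qed

end

theorem corollary3p10:
  fixes p n :: nat
    and k :: "('k, 's) ring_scheme"
    and \<A> :: "('a, 't) ring_scheme"
    and \<iota> :: "(nat \<Rightarrow> 'k) \<Rightarrow> 'a"
    and x :: "nat \<Rightarrow> 'a"
    and \<delta> :: "nat \<Rightarrow> 'a \<Rightarrow> 'a"
  assumes "perfect_field p k"
    and "affine_smooth_formal p (witt_ring p k) \<iota> \<A>"
    and "local_coordinates p (witt_ring p k) \<iota> \<A> n x \<delta>"
  shows "free_graded_module
    (D_ring p (reduction p \<A>)) (D_ring_part p (reduction p \<A>))
    (D01_mod p (witt_ring p k) \<iota> \<A>) (D01_mod_part p (witt_ring p k) \<iota> \<A>)
    (({..<n} \<rightarrow>\<^sub>E {0..p - 1}) \<times> ({..<n} \<rightarrow>\<^sub>E (UNIV :: nat set)))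
    (\<lambda>(I, J). D01_monomial p (witt_ring p k) \<iota> \<A> n \<delta> I J)
    (\<lambda>(I, J). int (\<Sum>j<n. J j))"
proof -
  have "formal_coords \<A> p (witt_ring p k) \<iota> n x \<delta>"
    unfolding formal_coords_def formal_coords_axioms_def formal_scheme_def formal_scheme_axioms_def
      operators_def operators_axioms_def
    using assms by (auto simp: perfect_field_def affine_smooth_formal_def)
  then interpret formal_coords \<A> p "witt_ring p k" \<iota> n x \<delta> .
  show ?thesis using monomials_free_graded_basis unfolding M_def .
qed

end
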